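(* Let $s\in(0,1]$ and $0\le\gamma\le s$. Let $(X,d,\mu)$ be a metric space endowed with a doubling measure $\mu$ with doubling dimension $n_\mu$, and let $1\le p\le q\le\frac{n_\mu p}{n_\mu-(s-\gamma)p}$, where $(s-\gamma)p<n_\mu$. Let $\Omega\subset X$ be a bounded John domain, and let $\phi$ be a positive increasing function on $(0,\infty)$ with $\phi(2t)\le C\phi(t)$ for all $t>0$ and some constant $C$, such that $w_\phi\in L^1_{\mathrm{loc}}(\Omega)$. Put $\Phi(t)=\phi(t)^{p/q}$. Let $w$ be a doubling weight with $w\in A_\infty(\mu)$, and let $v$ be a weight. Let $\tau\in(0,1)$. If $f\in W^{s,p}_\tau(\Omega,d\mu)$ and $(w,v)\in A^{s-\gamma,r}_{q,p}(\Omega,\mu)$ for some $r>1$, then $$\inf_{c\in\mathbb{R}}\|f-c\|_{L^q(\Omega,\,w_\phi w\,d\mu)}\lesssim [f]_{W^{s,p}_\tau(\Omega,\,w_{\Phi,\gamma p}v\,d\mu)},$$ where the implicit constant is independent of $f$. Moreover, when $s<1$, the right-hand side can be replaced by $[f]_{W^{s,p}_\tau(\Omega,\,v_{\Phi,\gamma p}v\,d\mu)}$.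
   Context: Notation: $B(x,\rho)=\{y\in X: d(x,y)<\rho\}$; $r(B)$ is the radius of a ball $B$, $\lambda B$ the concentric ball of radius $\lambda r(B)$; $-\!\!\!\!\!\int_B g\,d\mu=\frac1{\mu(B)}\int_B g\,d\mu$, $f_B=-\!\!\!\!\!\int_B f\,d\mu$; $d_\Omega(x)=\inf_{y\in\partial\Omega}d(x,y)$ is the distance to the boundary; $p'=p/(p-1)$. The measure $\mu$ is doubling if $\mu(2B)\le C\mu(B)$ for all balls; doubling dimension $n_\mu$ means $\mu(B(x,R))\le C(R/\rho)^{n_\mu}\mu(B(x,\rho))$ for all $x\in X$, $0<\rho\le R$. A weight is a nonnegative locally $\mu$-integrable function; it is doubling if $\int_{2B}w\,d\mu\le C\int_B w\,d\mu$ for all balls. $A_\infty(\mu)$ is the union over $t\ge1$ of the Muckenhoupt classes $A_t(\mu)$ (defined with balls and $\mu$). Improving weights: $w_\phi(x)=\phi(d_\Omega(x))$, $\;w_{\Phi,\gamma p}(x)=d_\Omega(x)^{\gamma p}\,\Phi(d_\Omega(x))$, $\;v_{\Phi,\gamma p}(x,y)=\min_{z\in\{x,y\}}d_\Omega(z)^{\gamma p}\,\Phi(d_\Omega(z))$. Seminorms: for $0<s<1$ and a weight $u$, $$[f]_{W^{s,p}_\tau(\Omega,u\,d\mu)}=\left(\int_\Omega\int_{\Omega\cap B(y,\tau d_\Omega(y))}\frac{|f(x)-f(y)|^p}{\mu[B(y,d(x,y))]\,d(x,y)^{sp}}\,u(y)\,d\mu(x)\,d\mu(y)\right)^{1/p},$$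 and $[f]_{W^{s,p}_\tau(\Omega,v_{\Phi,\gamma p}v\,d\mu)}$ is the same with $u(y)$ replaced by $v_{\Phi,\gamma p}(x,y)v(y)$. For $s=1$, $[f]_{W^{1,p}_\tau(\Omega,u\,d\mu)}=\left(\int_\Omega g^p u\,d\mu\right)^{1/p}$, where $g\ge0$ is a fixed "gradient" of $f$, meaning: $f\in L^1_{\mathrm{loc}}(X)$, $g\in L^1(X)$, and there are fixed $\lambda\ge1$, $C>0$ such that the $(1,1)$-Poincaré inequality $$-\!\!\!\!\!\!\int_B|f-f_B|\,d\mu\le C\,r(B)\,-\!\!\!\!\!\!\int_{\lambda B}g\,d\mu$$ holds for every ball $B$ with $\lambda B\subset\Omega$, and the pair $(f,g)$ has the truncation property: for all $b\in\mathbb{R}$, $0<t_1<t_2<\infty$ and $\varepsilon\in\{-1,1\}$, writing $h=\varepsilon(f-b)$, the pair $\left(\min\{\max\{0,h-t_1\},t_2-t_1\},\ g\,\chi_{\{t_1<h\le t_2\}}\right)$ satisfies the same type of $(1,1)$-Poincaré inequality with fixed constants (independent of $b,t_1,t_2,\varepsilon$). $W^{s,p}_\tau(\Omega,d\mu)$ is the space of functions $f\in L^p(\Omega,d\mu)$ for which the unweighted seminorm ($u\equiv1$) is finite. Weight class: $(w,v)\in A^{\alpha,r}_{q,p}(\Omega,\mu)$ means $$\sup_B r(B)^{\alpha}\mu(B)^{\frac1q-\frac1p}\left(-\!\!\!\!\!\!\int_B w^r\,d\mu\right)^{\frac1{qr}}\left(-\!\!\!\!\!\!\int_B v^{1-p'}\,d\mu\right)^{\frac1{p'}}<\infty,$$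 the supremum being over all balls $B\subset\Omega$; when $p=1$ the last factor is read as $\operatorname{ess\,sup}_B v^{-1}$. John domain: $\Omega$ is a bounded John domain if it is a bounded domain and there are $x_0\in\Omega$ and $C\ge1$ such that every $x\in\Omega$ can be joined to $x_0$ by a rectifiable curve $\kappa:[0,l]\to\Omega$ parametrized by arc length, $\kappa(0)=x$, $\kappa(l)=x_0$, with $d_\Omega(\kappa(t))\ge t/C$ for all $t$.
   Formalization: Two conditions on Ω are added: its boundary is non-empty (otherwise d_Ω is undefined), and for some c>0 every ball B(x, c·d_Ω(x)) with x in Ω lies in Ω; without the latter the inequality can fail in a general metric space. *)

theory Defs
  imports "HOL-Analysis.Analysis" "HOL-Probability.Essential_Supremum"
begin

text \<open>Real powers with the conventions \<open>0\<^sup>a = \<infinity>\<close> and \<open>\<infinity>\<^sup>a = 0\<close> for \<open>a < 0\<close>. The library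
  has \<open>0 powr a = 0\<close> also for \<open>a < 0\<close>, which would be wrong for \<open>v\<^sup>1\<^sup>-\<^sup>p\<^sup>'\<close> where \<open>v = 0\<close>.\<close>

definition ennreal_powr :: "ennreal \<Rightarrow> real \<Rightarrow> ennreal" where
  "ennreal_powr x a =
     (if a = 0 then 1
      else if x = 0 then (if a > 0 then 0 else \<infinity>)
      else if x = \<infinity> then (if a > 0 then \<infinity> else 0)
      else ennreal (enn2real x powr a))"


subsection \<open>Doubling measures\<close>

definition doubling_measure :: "'a::metric_space measure \<Rightarrow> bool" where
  "doubling_measure M \<longleftrightarrow>
     sets M = sets borel \<and>
     (\<forall>x r. r > 0 \<longrightarrow> 0 < emeasure M (ball x r) \<and> emeasure M (ball x r) < \<infinity>) \<and>
     (\<exists>C::real. \<forall>x r. r > 0 \<longrightarrow> emeasure M (ball x (2 * r)) \<le> ennreal C * emeasure M (ball x r))"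

definition doubling_dimension :: "'a::metric_space measure \<Rightarrow> real \<Rightarrow> bool" where
  "doubling_dimension M n \<longleftrightarrow>
     (\<exists>C::real. \<forall>x \<rho> R. 0 < \<rho> \<and> \<rho> \<le> R \<longrightarrow>
        emeasure M (ball x R) \<le> ennreal (C * (R / \<rho>) powr n) * emeasure M (ball x \<rho>))"

definition avg :: "'a measure \<Rightarrow> 'a set \<Rightarrow> ('a \<Rightarrow> real) \<Rightarrow> real" where
  "avg M B f = (LINT x:B|M. f x) / measure M B"

definition nn_avg :: "'a measure \<Rightarrow> 'a set \<Rightarrow> ('a \<Rightarrow> ennreal) \<Rightarrow> ennreal" where
  "nn_avg M B f = (\<integral>\<^sup>+x\<in>B. f x \<partial>M) / emeasure M B"

definition locally_integrable :: "'a::metric_space measure \<Rightarrow> 'a set \<Rightarrow> ('a \<Rightarrow> real) \<Rightarrow> bool" where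
  "locally_integrable M U f \<longleftrightarrow> (\<forall>x\<in>U. \<exists>r>0. set_integrable M (ball x r \<inter> U) f)"


subsection \<open>Weights\<close>

definition weight :: "'a::metric_space measure \<Rightarrow> ('a \<Rightarrow> real) \<Rightarrow> bool" where
  "weight M w \<longleftrightarrow> w \<in> borel_measurable M \<and> (\<forall>x. 0 \<le> w x) \<and> locally_integrable M UNIV w"

definition doubling_weight :: "'a::metric_space measure \<Rightarrow> ('a \<Rightarrow> real) \<Rightarrow> bool" where
  "doubling_weight M w \<longleftrightarrow> weight M w \<and>
     (\<exists>C::real. \<forall>x r. r > 0 \<longrightarrow>
        (\<integral>\<^sup>+y\<in>ball x (2 * r). ennreal (w y) \<partial>M) \<le> ennreal C * (\<integral>\<^sup>+y\<in>ball x r. ennreal (w y) \<partial>M))"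

definition muckenhoupt :: "'a::metric_space measure \<Rightarrow> real \<Rightarrow> ('a \<Rightarrow> real) \<Rightarrow> bool" where
  "muckenhoupt M t w \<longleftrightarrow> weight M w \<and>
     (SUP (x, r) \<in> UNIV \<times> {0<..}.
        nn_avg M (ball x r) (\<lambda>y. ennreal (w y)) *
        (if t = 1 then esssup (restrict_space M (ball x r)) (\<lambda>y. inverse (ennreal (w y)))
         else ennreal_powr
                (nn_avg M (ball x r) (\<lambda>y. ennreal_powr (ennreal (w y)) (1 - t / (t - 1)))) (t - 1))) < \<infinity>"

definition muckenhoupt_infinity :: "'a::metric_space measure \<Rightarrow> ('a \<Rightarrow> real) \<Rightarrow> bool" where
  "muckenhoupt_infinity M w \<longleftrightarrow> (\<exists>t\<ge>1. muckenhoupt M t w)"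

text \<open>The class of pairs \<open>(w, v) \<in> A\<^sup>\<alpha>\<^sup>,\<^sup>r\<^sub>q\<^sub>,\<^sub>p(\<Omega>, \<mu>)\<close>; here \<open>p' = p / (p - 1)\<close>, so \<open>1 / p' = (p - 1) / p\<close>.\<close>

definition weight_pair_class ::
  "'a::metric_space measure \<Rightarrow> 'a set \<Rightarrow> real \<Rightarrow> real \<Rightarrow> real \<Rightarrow> real \<Rightarrow> ('a \<Rightarrow> real) \<Rightarrow> ('a \<Rightarrow> real) \<Rightarrow> bool" where
  "weight_pair_class M \<Omega> \<alpha> r q p w v \<longleftrightarrow>
     (SUP (x, \<rho>) \<in> {(x, \<rho>). 0 < \<rho> \<and> ball x \<rho> \<subseteq> \<Omega>}.
        ennreal (\<rho> powr \<alpha>) *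
        ennreal (measure M (ball x \<rho>) powr (1 / q - 1 / p)) *
        ennreal_powr (nn_avg M (ball x \<rho>) (\<lambda>y. ennreal (w y powr r))) (1 / (q * r)) *
        (if p = 1 then esssup (restrict_space M (ball x \<rho>)) (\<lambda>y. inverse (ennreal (v y)))
         else ennreal_powr
                (nn_avg M (ball x \<rho>) (\<lambda>y. ennreal_powr (ennreal (v y)) (1 - p / (p - 1))))
                ((p - 1) / p))) < \<infinity>"


subsection \<open>John domains\<close>

definition bdist :: "'a::metric_space set \<Rightarrow> 'a \<Rightarrow> real" where
  "bdist \<Omega> x = infdist x (frontier \<Omega>)"

definition curve_length :: "(real \<Rightarrow> 'a::metric_space) \<Rightarrow> real \<Rightarrow> real \<Rightarrow> ennreal" where
  "curve_length \<kappa> a b =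
     (SUP ts \<in> {ts. sorted ts \<and> set ts \<subseteq> {a..b}}.
        \<Sum>i<length ts - 1. ennreal (dist (\<kappa> (ts ! i)) (\<kappa> (ts ! Suc i))))"

definition arc_length_curve :: "(real \<Rightarrow> 'a::metric_space) \<Rightarrow> real \<Rightarrow> bool" where
  "arc_length_curve \<kappa> l \<longleftrightarrow> 0 \<le> l \<and> continuous_on {0..l} \<kappa> \<and>
     (\<forall>a b. 0 \<le> a \<and> a \<le> b \<and> b \<le> l \<longrightarrow> curve_length \<kappa> a b = ennreal (b - a))"

definition bounded_john_domain :: "'a::metric_space set \<Rightarrow> bool" where
  "bounded_john_domain \<Omega> \<longleftrightarrow> open \<Omega> \<and> connected \<Omega> \<and> bounded \<Omega> \<and>
     (\<exists>x0\<in>\<Omega>. \<exists>C\<ge>1. \<forall>x\<in>\<Omega>. \<exists>\<kappa> l. arc_length_curve \<kappa> l \<and> \<kappa> ` {0..l} \<subseteq> \<Omega> \<and>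
        \<kappa> 0 = x \<and> \<kappa> l = x0 \<and> (\<forall>t\<in>{0..l}. bdist \<Omega> (\<kappa> t) \<ge> t / C))"


subsection \<open>Improving weights\<close>

definition w_phi :: "'a::metric_space set \<Rightarrow> (real \<Rightarrow> real) \<Rightarrow> 'a \<Rightarrow> real" where
  "w_phi \<Omega> \<phi> x = \<phi> (bdist \<Omega> x)"

definition w_Phi :: "'a::metric_space set \<Rightarrow> (real \<Rightarrow> real) \<Rightarrow> real \<Rightarrow> 'a \<Rightarrow> real" where
  "w_Phi \<Omega> \<Phi> a x = bdist \<Omega> x powr a * \<Phi> (bdist \<Omega> x)"

definition v_Phi :: "'a::metric_space set \<Rightarrow> (real \<Rightarrow> real) \<Rightarrow> real \<Rightarrow> 'a \<Rightarrow> 'a \<Rightarrow> real" where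
  "v_Phi \<Omega> \<Phi> a x y = min (w_Phi \<Omega> \<Phi> a x) (w_Phi \<Omega> \<Phi> a y)"


subsection \<open>Norms and seminorms\<close>

definition weighted_Lnorm ::
  "'a measure \<Rightarrow> 'a set \<Rightarrow> ('a \<Rightarrow> real) \<Rightarrow> real \<Rightarrow> ('a \<Rightarrow> real) \<Rightarrow> ennreal" where
  "weighted_Lnorm M \<Omega> u q h = ennreal_powr (\<integral>\<^sup>+x\<in>\<Omega>. ennreal (\<bar>h x\<bar> powr q * u x) \<partial>M) (1 / q)"

text \<open>The kernel \<open>U x y\<close> is \<open>u y\<close> or \<open>v_Phi \<Omega> \<Phi> a x y * v y\<close>. On the diagonal the integrand is
  \<open>0 / 0 = 0\<close>.\<close>

definition frac_seminorm ::
  "'a::metric_space measure \<Rightarrow> real \<Rightarrow> real \<Rightarrow> real \<Rightarrow> 'a set \<Rightarrow> ('a \<Rightarrow> 'a \<Rightarrow> real) \<Rightarrow> ('a \<Rightarrow> real) \<Rightarrow> ennreal" where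
  "frac_seminorm M s p \<tau> \<Omega> U f =
     ennreal_powr
       (\<integral>\<^sup>+y\<in>\<Omega>. (\<integral>\<^sup>+x\<in>\<Omega> \<inter> ball y (\<tau> * bdist \<Omega> y).
            ennreal (\<bar>f x - f y\<bar> powr p / (measure M (ball y (dist x y)) * dist x y powr (s * p)) * U x y)
          \<partial>M) \<partial>M)
       (1 / p)"

text \<open>For \<open>s = 1\<close> the seminorm is that of the fixed gradient \<open>g\<close> of \<open>f\<close>; for \<open>s < 1\<close> the argument
  \<open>g\<close> plays no role.\<close>

definition sobolev_seminorm ::
  "'a::metric_space measure \<Rightarrow> real \<Rightarrow> real \<Rightarrow> real \<Rightarrow> 'a set \<Rightarrow> ('a \<Rightarrow> real) \<Rightarrow>
     ('a \<Rightarrow> real) \<Rightarrow> ('a \<Rightarrow> real) \<Rightarrow> ennreal" where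
  "sobolev_seminorm M s p \<tau> \<Omega> u f g =
     (if s = 1 then weighted_Lnorm M \<Omega> u p g else frac_seminorm M s p \<tau> \<Omega> (\<lambda>x y. u y) f)"

definition poincare_pair ::
  "'a::metric_space measure \<Rightarrow> 'a set \<Rightarrow> real \<Rightarrow> real \<Rightarrow> ('a \<Rightarrow> real) \<Rightarrow> ('a \<Rightarrow> real) \<Rightarrow> bool" where
  "poincare_pair M \<Omega> lam C f g \<longleftrightarrow>
     (\<forall>x r. r > 0 \<and> ball x (lam * r) \<subseteq> \<Omega> \<longrightarrow>
        nn_avg M (ball x r) (\<lambda>y. ennreal \<bar>f y - avg M (ball x r) f\<bar>)
          \<le> ennreal (C * r) * nn_avg M (ball x (lam * r)) (\<lambda>y. ennreal (g y)))"

definition truncation_property ::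
  "'a::metric_space measure \<Rightarrow> 'a set \<Rightarrow> real \<Rightarrow> real \<Rightarrow> ('a \<Rightarrow> real) \<Rightarrow> ('a \<Rightarrow> real) \<Rightarrow> bool" where
  "truncation_property M \<Omega> lam C f g \<longleftrightarrow>
     (\<forall>b t1 t2 \<epsilon>. 0 < t1 \<and> t1 < t2 \<and> \<epsilon> \<in> {-1, 1} \<longrightarrow>
        (let h = (\<lambda>x. \<epsilon> * (f x - b)) in
           poincare_pair M \<Omega> lam C
             (\<lambda>x. min (max 0 (h x - t1)) (t2 - t1))
             (\<lambda>x. g x * indicator {x. t1 < h x \<and> h x \<le> t2} x)))"

text \<open>The constants of the Poincare inequality are \<open>lam, C\<close>, those of the truncation property
  \<open>lam', C'\<close>.\<close>

definition is_gradient ::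
  "'a::metric_space measure \<Rightarrow> 'a set \<Rightarrow> real \<Rightarrow> real \<Rightarrow> real \<Rightarrow> real \<Rightarrow> ('a \<Rightarrow> real) \<Rightarrow> ('a \<Rightarrow> real) \<Rightarrow> bool" where
  "is_gradient M \<Omega> lam C lam' C' f g \<longleftrightarrow>
     locally_integrable M UNIV f \<and> integrable M g \<and> (\<forall>x. 0 \<le> g x) \<and>
     poincare_pair M \<Omega> lam C f g \<and> truncation_property M \<Omega> lam' C' f g"

definition sobolev_space ::
  "'a::metric_space measure \<Rightarrow> real \<Rightarrow> real \<Rightarrow> real \<Rightarrow> 'a set \<Rightarrow> ('a \<Rightarrow> real) \<Rightarrow> ('a \<Rightarrow> real) \<Rightarrow> bool" where
  "sobolev_space M s p \<tau> \<Omega> f g \<longleftrightarrow>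
     f \<in> borel_measurable (restrict_space M \<Omega>) \<and>
     weighted_Lnorm M \<Omega> (\<lambda>_. 1) p f < \<infinity> \<and>
     sobolev_seminorm M s p \<tau> \<Omega> (\<lambda>_. 1) f g < \<infinity>"

end

(* Let nu be the measure phi(d_Omega) w dmu on Omega. Subtract a median of f over a central ball
   and let psi be a truncation of h = f - median (or of its negative) between the levels t and 2t,
   rescaled to [0, 1], so that psi vanishes on half of the central ball. From a point where psi = 1,
   follow the balls along a John curve towards the centre and stop at the first one on which the
   mean of psi is at least 1/4. If psi oscillates little on all Whitney-type balls, this mean is
   still well below 1, so psi = 1 only on a small part of the stopping ball; the A_infinity property
   of w together with the decay of w in thin boundary layers and a covering argument then gives the
   good-lambda bound  nu {psi = 1} <= nu (bad set) + theta nu {psi > 0}  with theta small, where the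
   bad set is the union of the dilated Whitney-type balls on which psi oscillates. The Vitali
   covering lemma, the two-weight condition and Hoelder's inequality bound nu (bad set) by a
   constant times the q/p-th power of the energy of psi. Since q >= p, these powers add up over
   the levels t = 2^k t_0, and the energies of the truncations sum up to at most that of f. *)
theory Submission
  imports Defs
begin

text \<open>The good-lambda bound compares two level sets of one bounded function, without a maximal
  function. The obstacle is that a point \<open>y\<close> with \<open>\<psi> y = 1\<close> does not
  keep its stopping ball: the Vitali selection replaces it by a ball that may be much larger. The
  exceptional set must therefore belong to the selected ball and not depend on \<open>y\<close>. It
  has two pieces, both tied to fixed fractions of the radius: the points of {\<psi> = 1} at which
  this set has small density at one scale, and a thin boundary layer. Off the layer the ball around
  \<open>y\<close> at that scale is itself of Whitney type, so \<psi> oscillates little on it, and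
  the chain of \<open>y\<close> keeps its mean below 1; hence \<open>y\<close> falls into the first
  piece. For the absorption, {h > 2t} is a superlevel set of the next dyadic level, so a \<theta>
  below \<open>1 / 2 powr q\<close> closes the summation, with an error proportional to
  \<open>t0 powr q\<close>. Two facts shape the statements: countable subfamilies are obtained from
  the finite measure of balls, and integrals of energy densities, which may be nonmeasurable, are
  used only through monotonicity and superadditivity.\<close>

subsection \<open>Covering by balls\<close>

text \<open>One predicate serves both the given measure and the weighted measure \<open>W\<close>.
  Positivity of balls is left out on purpose: a doubling weight may vanish identically, and
  \<open>W\<close> still qualifies then. For \<open>M\<close> positivity is carried along separately
  as \<open>pos\<close>. Finiteness on balls allows the real-valued \<open>measure\<close> in most
  estimates.\<close>

definition ball_doubling :: "'a::metric_space measure \<Rightarrow> real \<Rightarrow> bool" where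
  "ball_doubling N D \<longleftrightarrow> sets N = sets borel \<and> 1 \<le> D \<and> (\<forall>x r. emeasure N (ball x r) < \<infinity>) \<and>
     (\<forall>x r. 0 < r \<longrightarrow> emeasure N (ball x (2 * r)) \<le> ennreal D * emeasure N (ball x r))"

lemma ball_doublingD:
  assumes "ball_doubling N D"
  shows "sets N = sets borel" "space N = UNIV" "1 \<le> D" "emeasure N (ball x r) < \<infinity>"
    "ball x r \<in> fmeasurable N"
    "0 < r \<Longrightarrow> emeasure N (ball x (2 * r)) \<le> ennreal D * emeasure N (ball x r)"
    "0 < r \<Longrightarrow> measure N (ball x (2 * r)) \<le> D * measure N (ball x r)"
proof -
  show s: "sets N = sets borel" and D: "1 \<le> D" and f: "emeasure N (ball x r) < \<infinity>" for x r
    using assms by (auto simp: ball_doubling_def)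
  show "space N = UNIV" using sets_eq_imp_space_eq[OF s] by simp
  show "ball x r \<in> fmeasurable N" using f s by (auto intro!: fmeasurableI)
  show e: "0 < r \<Longrightarrow> emeasure N (ball x (2 * r)) \<le> ennreal D * emeasure N (ball x r)"
    using assms by (auto simp: ball_doubling_def)
  have m: "emeasure N (ball x r) = ennreal (measure N (ball x r))" for x r
    using f[of x r] by (intro emeasure_eq_ennreal_measure) auto
  show "0 < r \<Longrightarrow> measure N (ball x (2 * r)) \<le> D * measure N (ball x r)"
    using e D by (simp add: m ennreal_mult'[symmetric] ennreal_le_iff)
qed

lemma ball_doubling_pow:
  assumes "ball_doubling N D" "0 < r"
  shows "measure N (ball x (2 ^ k * r)) \<le> D ^ k * measure N (ball x r)"
proof (induction k)
  case (Suc k)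
  have "measure N (ball x (2 * (2 ^ k * r))) \<le> D * measure N (ball x (2 ^ k * r))"
    using ball_doublingD(7)[OF assms(1), of "2 ^ k * r" x] assms(2) by simp
  also have "\<dots> \<le> D * (D ^ k * measure N (ball x r))"
    using Suc ball_doublingD(3)[OF assms(1)] by (intro mult_left_mono) auto
  finally show ?case by (simp add: mult.assoc)
qed simp

text \<open>\<open>ball y R\<close> lies in \<open>ball x (2 ^ k * r)\<close> once
  \<open>2 ^ k\<close> exceeds \<open>K\<close>, so \<open>L\<close> depends only on
  \<open>K\<close> and the doubling constant. Later comparisons of balls of comparable size at
  comparable distance take this form.\<close>

lemma ball_compare:
  assumes "ball_doubling N D"
  obtains L where "1 \<le> L"
    "\<And>x y r R. 0 < r \<Longrightarrow> dist x y + R \<le> K * r \<Longrightarrow> measure N (ball y R) \<le> L * measure N (ball x r)"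
proof -
  obtain k where k: "K < 2 ^ k"
    using real_arch_pow[of 2 K] by auto
  show thesis
  proof (rule that)
    show "1 \<le> D ^ k" using ball_doublingD(3)[OF assms] by simp
    fix x y :: 'a and r R :: real assume r: "0 < r" and le: "dist x y + R \<le> K * r"
    have "K * r \<le> 2 ^ k * r" using k r by (intro mult_right_mono) auto
    then have "dist x y + R \<le> 2 ^ k * r" using le by linarith
    then have "ball y R \<subseteq> ball x (2 ^ k * r)"
      by (auto simp: mem_ball) (smt (verit) dist_triangle)
    then have "measure N (ball y R) \<le> measure N (ball x (2 ^ k * r))"
      using ball_doublingD[OF assms] by (intro measure_mono_fmeasurable) auto
    also have "\<dots> \<le> D ^ k * measure N (ball x r)" by (rule ball_doubling_pow[OF assms r])
    finally show "measure N (ball y R) \<le> D ^ k * measure N (ball x r)" .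
  qed
qed

text \<open>Selection of disjoint balls, each at least half as large as the balls it blocks. Indices
  are pairs of centre and radius, because in a metric space a ball as a set does not determine
  them.\<close>

lemma vitali_covering:
  fixes I :: "('a::metric_space \<times> real) set"
  assumes I: "\<And>z \<rho>. (z, \<rho>) \<in> I \<Longrightarrow> 0 < \<rho> \<and> \<rho> \<le> R"
  obtains G where "G \<subseteq> I" "disjoint_family_on (\<lambda>(z, \<rho>). ball z \<rho>) G"
    "\<And>z \<rho>. (z, \<rho>) \<in> I \<Longrightarrow> \<exists>z' \<rho>'. (z', \<rho>') \<in> G \<and> \<rho> \<le> 2 * \<rho>' \<and> ball z \<rho> \<subseteq> ball z' (5 * \<rho>')"
proof -
  define bl where "bl = (\<lambda>(z::'a, \<rho>::real). ball z \<rho>)"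
  define meet where "meet = (\<lambda>b g. bl b \<inter> bl g \<noteq> {})"
  \<comment> \<open>Admissible families: disjoint, and a ball of \<open>I\<close> that meets the
    family meets a member of at least half its radius. The last clause is conditional, so it holds
    for the empty family and survives unions of chains; maximality then removes the
    condition.\<close>
  define \<A> where "\<A> = {G. G \<subseteq> I \<and> disjoint_family_on bl G \<and>
    (\<forall>b\<in>I. (\<exists>g\<in>G. meet b g) \<longrightarrow> (\<exists>g\<in>G. meet b g \<and> snd b \<le> 2 * snd g))}"
  have "\<exists>G\<in>\<A>. \<forall>X\<in>\<A>. G \<subseteq> X \<longrightarrow> X = G"
  proof (rule subset_Zorn')
    fix \<C> assume c: "subset.chain \<A> \<C>"
    then have sub: "\<C> \<subseteq> \<A>" and tot: "\<And>X Y. X \<in> \<C> \<Longrightarrow> Y \<in> \<C> \<Longrightarrow> X \<subseteq> Y \<or> Y \<subseteq> X"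
      by (auto simp: subset.chain_def)
    have "disjoint_family_on bl (\<Union>\<C>)"
      unfolding disjoint_family_on_def
    proof (intro ballI impI)
      fix m n assume "m \<in> \<Union>\<C>" "n \<in> \<Union>\<C>" and ne: "m \<noteq> n"
      then obtain X Y where "X \<in> \<C>" "m \<in> X" "Y \<in> \<C>" "n \<in> Y" by auto
      with tot obtain Z where "Z \<in> \<C>" "m \<in> Z" "n \<in> Z" by blast
      with sub ne show "bl m \<inter> bl n = {}"
        by (auto simp: \<A>_def disjoint_family_on_def)
    qed
    moreover have "\<exists>g\<in>\<Union>\<C>. meet b g \<and> snd b \<le> 2 * snd g" if h: "b \<in> I" "g \<in> \<Union>\<C>" "meet b g" for b g
    proof -
      obtain X where "X \<in> \<C>" "g \<in> X" using h by auto
      with sub h have "\<exists>g\<in>X. meet b g \<and> snd b \<le> 2 * snd g" by (auto simp: \<A>_def subset_iff)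
      with \<open>X \<in> \<C>\<close> show ?thesis by blast
    qed
    moreover have "\<Union>\<C> \<subseteq> I" using sub by (auto simp: \<A>_def)
    ultimately show "\<Union>\<C> \<in> \<A>" unfolding \<A>_def by blast
  qed
  then obtain G where G: "G \<in> \<A>" and mx: "\<And>X. X \<in> \<A> \<Longrightarrow> G \<subseteq> X \<Longrightarrow> X = G" by blast
  have all: "\<exists>g\<in>G. meet b g" if b: "b \<in> I" for b
  proof (rule ccontr)
    assume nb: "\<not> ?thesis"
    define N where "N = {b\<in>I. \<forall>g\<in>G. \<not> meet b g}"
    have bN: "b \<in> N" using b nb by (auto simp: N_def)
    have bdd: "bdd_above (snd ` N)" using I by (auto simp: N_def bdd_above_def intro!: exI[of _ R])
    have "0 < snd b" using I b by (cases b) auto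
    then have sp: "0 < (SUP b\<in>N. snd b)"
      using cSUP_upper[OF bN bdd] by linarith
    then have "(SUP b\<in>N. snd b) / 2 < (SUP b\<in>N. snd b)" by simp
    \<comment> \<open>A ball of more than half the supremal radius among those missed by
      \<open>G\<close>. Adding it keeps the family admissible: a ball that is newly met was missed
      by \<open>G\<close>, so its radius is at most twice that of \<open>b0\<close>.\<close>
    then obtain b0 where b0: "b0 \<in> N" "(SUP b\<in>N. snd b) / 2 < snd b0"
      using less_cSUP_iff[OF _ bdd] bN by blast
    have le: "snd c \<le> 2 * snd b0" if "c \<in> N" for c
      using cSUP_upper[OF that bdd] b0(2) by simp
    have "insert b0 G \<in> \<A>"
    proof -
      have "disjoint_family_on bl (insert b0 G)"
        using G b0 by (auto simp: \<A>_def disjoint_family_on_def N_def meet_def)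
      moreover have "\<exists>g\<in>insert b0 G. meet c g \<and> snd c \<le> 2 * snd g"
        if "c \<in> I" "g \<in> insert b0 G" "meet c g" for c g
      proof (cases "\<exists>g\<in>G. meet c g")
        case True
        then show ?thesis using G that(1) by (auto simp: \<A>_def)
      next
        case False
        then have "c \<in> N" "g = b0" using that by (auto simp: N_def)
        then show ?thesis using le that by auto
      qed
      moreover have "insert b0 G \<subseteq> I" using G b0 by (auto simp: \<A>_def N_def)
      ultimately show ?thesis unfolding \<A>_def by blast
    qed
    then have "b0 \<in> G" using mx[of "insert b0 G"] by auto
    moreover have "meet b0 b0"
      using b0(1) I[of "fst b0" "snd b0"] by (auto simp: meet_def bl_def N_def split: prod.splits)
    ultimately show False using b0 by (auto simp: N_def)
  qed
  show thesis
  proof (rule that)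
    show "G \<subseteq> I" "disjoint_family_on (\<lambda>(z, \<rho>). ball z \<rho>) G"
      using G by (auto simp: \<A>_def bl_def)
    fix z \<rho> assume z: "(z, \<rho>) \<in> I"
    with all G obtain g where g: "g \<in> G" "meet (z, \<rho>) g" "\<rho> \<le> 2 * snd g"
      by (fastforce simp: \<A>_def)
    obtain z' \<rho>' where gg: "g = (z', \<rho>')" by (cases g)
    obtain u where u: "dist z u < \<rho>" "dist z' u < \<rho>'"
      using g(2) by (auto simp: meet_def bl_def gg)
    have "ball z \<rho> \<subseteq> ball z' (5 * \<rho>')"
    proof
      fix x assume "x \<in> ball z \<rho>"
      then have "dist z x < \<rho>" by simp
      moreover have "dist z' x \<le> dist z' u + dist z u + dist z x"
        using dist_triangle[of z' x u] dist_triangle[of u x z] by (simp add: dist_commute)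
      ultimately show "x \<in> ball z' (5 * \<rho>')" using u g(3) by (simp add: gg)
    qed
    then show "\<exists>z' \<rho>'. (z', \<rho>') \<in> G \<and> \<rho> \<le> 2 * \<rho>' \<and> ball z \<rho> \<subseteq> ball z' (5 * \<rho>')"
      using g by (auto simp: gg)
  qed
qed

text \<open>Continuity from below along an enumeration of \<open>G\<close> reduces the bound to
  finite unions, so that only finite sums have to be estimated in applications.\<close>

lemma emeasure_countable_UN_le:
  assumes "countable G" "\<And>i. i \<in> G \<Longrightarrow> T i \<in> sets N"
    and "\<And>F. finite F \<Longrightarrow> F \<subseteq> G \<Longrightarrow> (\<Sum>i\<in>F. emeasure N (T i)) \<le> Q"
  shows "emeasure N (\<Union>i\<in>G. T i) \<le> Q"
proof (cases "G = {}")
  case False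
  define U where "U n = (\<Union>i\<in>from_nat_into G ` {..n}. T i)" for n :: nat
  have fin: "from_nat_into G ` {..n} \<subseteq> G" for n
    using from_nat_into[OF False] by auto
  have "(\<Union>i\<in>G. T i) \<subseteq> (\<Union>n. U n)"
  proof
    fix x assume "x \<in> (\<Union>i\<in>G. T i)"
    then obtain i where i: "i \<in> G" "x \<in> T i" by blast
    obtain n where "from_nat_into G n = i" using from_nat_into_surj[OF assms(1) i(1)] by blast
    then have "x \<in> U n" using i(2) unfolding U_def by blast
    then show "x \<in> (\<Union>n. U n)" by blast
  qed
  moreover have Us: "U n \<in> sets N" for n
    unfolding U_def using fin[of n] assms(2) by (intro sets.finite_UN) auto
  ultimately have "emeasure N (\<Union>i\<in>G. T i) \<le> emeasure N (\<Union>n. U n)"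
    by (intro emeasure_mono) auto
  also have "\<dots> = (SUP n. emeasure N (U n))"
    using Us by (intro SUP_emeasure_incseq[symmetric]) (auto simp: U_def incseq_def, meson atMost_iff order.trans)
  also have "\<dots> \<le> Q"
  proof (rule SUP_least)
    fix n
    have "emeasure N (U n) \<le> (\<Sum>i\<in>from_nat_into G ` {..n}. emeasure N (T i))"
      unfolding U_def using fin[of n] assms(2) by (intro emeasure_subadditive_finite) auto
    also have "\<dots> \<le> Q" using fin[of n] by (intro assms(3)) auto
    finally show "emeasure N (U n) \<le> Q" .
  qed
  finally show ?thesis .
qed simp

text \<open>The set \<open>T i\<close> attached to a ball is arbitrary, and the bound
  \<open>Q\<close> is only asked for on finite disjoint subfamilies; this leaves room for bounds
  that are not additive in the balls, such as sums of powers. Countability of the selection comes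
  from \<open>M\<close>: disjoint balls of positive measure lie in one ball of finite
  measure.\<close>

lemma covering_lemma:
  fixes M N :: "'a::metric_space measure" and I :: "('a \<times> real) set" and x0 :: 'a
  assumes M: "ball_doubling M D" and pos: "\<And>x r. 0 < r \<Longrightarrow> 0 < measure M (ball x r)"
    and I: "\<And>z \<rho>. (z, \<rho>) \<in> I \<Longrightarrow> 0 < \<rho> \<and> \<rho> \<le> R \<and> dist x0 z \<le> R"
    and T: "\<And>z \<rho>. (z, \<rho>) \<in> I \<Longrightarrow> T (z, \<rho>) \<in> sets N"
    and sum: "\<And>F. finite F \<Longrightarrow> F \<subseteq> I \<Longrightarrow> disjoint_family_on (\<lambda>(z, \<rho>). ball z \<rho>) F \<Longrightarrow>
        (\<Sum>i\<in>F. emeasure N (T i)) \<le> Q"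
  obtains G where "G \<subseteq> I" "countable G"
    "\<And>z \<rho>. (z, \<rho>) \<in> I \<Longrightarrow> \<exists>z' \<rho>'. (z', \<rho>') \<in> G \<and> \<rho> \<le> 2 * \<rho>' \<and> ball z \<rho> \<subseteq> ball z' (5 * \<rho>')"
    "(\<Union>i\<in>G. T i) \<in> sets N" "emeasure N (\<Union>i\<in>G. T i) \<le> Q"
proof -
  obtain G where G: "G \<subseteq> I" "disjoint_family_on (\<lambda>(z, \<rho>). ball z \<rho>) G"
    "\<And>z \<rho>. (z, \<rho>) \<in> I \<Longrightarrow> \<exists>z' \<rho>'. (z', \<rho>') \<in> G \<and> \<rho> \<le> 2 * \<rho>' \<and> ball z \<rho> \<subseteq> ball z' (5 * \<rho>')"
    by (rule vitali_covering[of I R]) (use I in auto)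
  define m where "m = (\<lambda>i. measure M (case i of (z, \<rho>) \<Rightarrow> ball z \<rho>))"
  have sum_m: "sum m F \<le> measure M (ball x0 (2 * R + 1))" if F: "finite F" "F \<subseteq> G" for F
  proof -
    have dj: "disjoint_family_on (\<lambda>(z, \<rho>). ball z \<rho>) F"
      using G(2) F(2) by (rule disjoint_family_on_mono[rotated])
    have "sum m F = measure M (\<Union>i\<in>F. case i of (z, \<rho>) \<Rightarrow> ball z \<rho>)"
      unfolding m_def
    proof (rule measure_finite_Union[OF F(1) _ dj, symmetric])
      show "emeasure M (case i of (z, \<rho>) \<Rightarrow> ball z \<rho>) \<noteq> \<infinity>" for i :: "'a \<times> real"
        using ball_doublingD(4)[OF M, of "fst i" "snd i"] by (simp add: case_prod_beta less_top)
      show "(\<lambda>i. case i of (z, \<rho>) \<Rightarrow> ball z \<rho>) ` F \<subseteq> sets M"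
        using ball_doublingD(1)[OF M] by (simp add: case_prod_beta image_subset_iff)
    qed
    also have "\<dots> \<le> measure M (ball x0 (2 * R + 1))"
    proof (rule measure_mono_fmeasurable)
      show "(\<Union>i\<in>F. case i of (z, \<rho>) \<Rightarrow> ball z \<rho>) \<subseteq> ball x0 (2 * R + 1)"
      proof
        fix x assume "x \<in> (\<Union>i\<in>F. case i of (z, \<rho>) \<Rightarrow> ball z \<rho>)"
        then obtain z \<rho> where "(z, \<rho>) \<in> F" "dist z x < \<rho>" by auto
        moreover have "dist x0 x \<le> dist x0 z + dist z x" by (rule dist_triangle)
        moreover have "(z, \<rho>) \<in> I" using \<open>(z, \<rho>) \<in> F\<close> F(2) G(1) by blast
        ultimately show "x \<in> ball x0 (2 * R + 1)" using I[of z \<rho>] by simp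
      qed
      show "(\<Union>i\<in>F. case i of (z, \<rho>) \<Rightarrow> ball z \<rho>) \<in> sets M"
        using F(1) ball_doublingD(1)[OF M] by (intro sets.finite_UN) (simp_all add: case_prod_beta)
    qed (rule ball_doublingD(5)[OF M])
    finally show ?thesis .
  qed
  have "m summable_on G"
    by (rule nonneg_bounded_partial_sums_imp_summable_on[where C = "measure M (ball x0 (2 * R + 1))"])
      (auto simp: m_def[abs_def] eventually_finite_subsets_at_top intro!: exI[of _ "{}"] sum_m[unfolded m_def])
  then have "countable {i\<in>G. m i \<noteq> 0}" by (rule summable_countable_real)
  moreover have "m i \<noteq> 0" if "i \<in> G" for i
  proof -
    obtain z \<rho> where i: "i = (z, \<rho>)" by (cases i)
    then have "0 < \<rho>" using that G(1) I[of z \<rho>] by blast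
    then have "0 < m i" using pos by (simp add: m_def i)
    then show ?thesis by simp
  qed
  then have "{i\<in>G. m i \<noteq> 0} = G" by blast
  ultimately have cnt: "countable G" by simp
  have Ts: "T i \<in> sets N" if "i \<in> G" for i
    using T[of "fst i" "snd i"] G(1) that by auto
  show thesis
  proof (rule that[OF G(1) cnt G(3)])
    show "(\<Union>i\<in>G. T i) \<in> sets N" using cnt Ts by (intro sets.countable_UN') auto
    show "emeasure N (\<Union>i\<in>G. T i) \<le> Q"
    proof (rule emeasure_countable_UN_le[OF cnt Ts])
      fix F assume F: "finite F" "F \<subseteq> G"
      have "disjoint_family_on (\<lambda>(z, \<rho>). ball z \<rho>) F"
        using G(2) F(2) by (rule disjoint_family_on_mono[rotated])
      then show "(\<Sum>i\<in>F. emeasure N (T i)) \<le> Q"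
        using F G(1) by (intro sum) blast+
    qed
  qed
qed

text \<open>The additive case of the covering argument: each \<open>T\<close> is charged to the part
  of \<open>A\<close> in its own ball, and by disjointness no part of \<open>A\<close> pays twice.
  The charged measure \<open>N'\<close> may differ from \<open>N\<close>.\<close>

lemma covering_charge:
  fixes M N N' :: "'a::metric_space measure" and I :: "('a \<times> real) set" and x0 :: 'a
  assumes M: "ball_doubling M D" and pos: "\<And>x r. 0 < r \<Longrightarrow> 0 < measure M (ball x r)"
    and I: "\<And>z \<rho>. (z, \<rho>) \<in> I \<Longrightarrow> 0 < \<rho> \<and> \<rho> \<le> R \<and> dist x0 z \<le> R"
    and T: "\<And>z \<rho>. (z, \<rho>) \<in> I \<Longrightarrow> T (z, \<rho>) \<in> sets N"
    and N': "sets N' = sets borel" and A: "A \<in> sets borel"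
    and le: "\<And>z \<rho>. (z, \<rho>) \<in> I \<Longrightarrow> emeasure N (T (z, \<rho>)) \<le> c * emeasure N' (A \<inter> ball z \<rho>)"
  obtains G where "G \<subseteq> I" "countable G"
    "\<And>z \<rho>. (z, \<rho>) \<in> I \<Longrightarrow> \<exists>z' \<rho>'. (z', \<rho>') \<in> G \<and> \<rho> \<le> 2 * \<rho>' \<and> ball z \<rho> \<subseteq> ball z' (5 * \<rho>')"
    "(\<Union>i\<in>G. T i) \<in> sets N" "emeasure N (\<Union>i\<in>G. T i) \<le> c * emeasure N' A"
proof -
  have sum: "(\<Sum>i\<in>F. emeasure N (T i)) \<le> c * emeasure N' A"
    if F: "finite F" "F \<subseteq> I" "disjoint_family_on (\<lambda>(z, \<rho>). ball z \<rho>) F" for F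
  proof -
    let ?b = "\<lambda>i. A \<inter> (case i of (z, \<rho>) \<Rightarrow> ball z \<rho>)"
    have "(\<Sum>i\<in>F. emeasure N (T i)) \<le> (\<Sum>i\<in>F. c * emeasure N' (?b i))"
      using F(2) le by (intro sum_mono) (auto split: prod.splits)
    also have "\<dots> = c * (\<Sum>i\<in>F. emeasure N' (?b i))"
      by (simp add: sum_distrib_left)
    also have "(\<Sum>i\<in>F. emeasure N' (?b i)) = emeasure N' (\<Union>i\<in>F. ?b i)"
    proof (rule sum_emeasure)
      show "disjoint_family_on ?b F"
        using F(3) unfolding disjoint_family_on_def by blast
    qed (use F(1) A N' in \<open>simp_all add: case_prod_beta image_subset_iff\<close>)
    also have "c * emeasure N' (\<Union>i\<in>F. ?b i) \<le> c * emeasure N' A"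
      using A N' by (intro mult_left_mono emeasure_mono) auto
    finally show ?thesis .
  qed
  show thesis
    by (rule covering_lemma[where M = M and D = D and R = R and ?x0.0 = x0 and I = I and T = T and N = N
      and Q = "c * emeasure N' A", OF M pos I T sum]; (assumption | (rule that; assumption)))
qed

lemma ball_doubling_fmeasurable:
  assumes "ball_doubling N D" "A \<in> sets borel" "A \<subseteq> ball x R"
  shows "A \<in> fmeasurable N" "emeasure N A = ennreal (measure N A)" "emeasure N A < \<infinity>"
proof -
  have "emeasure N A \<le> emeasure N (ball x R)"
    using assms ball_doublingD(1)[OF assms(1)] by (intro emeasure_mono) auto
  also have "\<dots> < \<infinity>" using ball_doublingD(4)[OF assms(1)] .
  finally show *: "emeasure N A < \<infinity>" .
  then show "A \<in> fmeasurable N"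
    using assms(2) ball_doublingD(1)[OF assms(1)] by (intro fmeasurableI) auto
  show "emeasure N A = ennreal (measure N A)"
    using * by (intro emeasure_eq_ennreal_measure) auto
qed

lemma ball_doubling_mono:
  assumes "ball_doubling N D" "A \<in> sets borel" "B \<in> sets borel" "A \<subseteq> B" "B \<subseteq> ball x R"
  shows "measure N A \<le> measure N B"
  using assms ball_doubling_fmeasurable(1)[OF assms(1,3,5)] ball_doublingD(1)[OF assms(1)]
  by (intro measure_mono_fmeasurable) auto

lemma covering_measure:
  fixes M N N' :: "'a::metric_space measure" and I :: "('a \<times> real) set" and x0 :: 'a
  assumes M: "ball_doubling M D" and pos: "\<And>x r. 0 < r \<Longrightarrow> 0 < measure M (ball x r)"
    and I: "\<And>z \<rho>. (z, \<rho>) \<in> I \<Longrightarrow> 0 < \<rho> \<and> \<rho> \<le> R \<and> dist x0 z \<le> R"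
    and T: "\<And>z \<rho>. (z, \<rho>) \<in> I \<Longrightarrow> T (z, \<rho>) \<in> sets N" "\<And>z \<rho>. (z, \<rho>) \<in> I \<Longrightarrow> emeasure N (T (z, \<rho>)) < \<infinity>"
    and N': "sets N' = sets borel" and A: "A \<in> sets borel" "emeasure N' A < \<infinity>"
    and le: "\<And>z \<rho>. (z, \<rho>) \<in> I \<Longrightarrow> measure N (T (z, \<rho>)) \<le> c * measure N' (A \<inter> ball z \<rho>)"
    and c: "0 \<le> c"
  obtains G where "G \<subseteq> I" "countable G"
    "\<And>z \<rho>. (z, \<rho>) \<in> I \<Longrightarrow> \<exists>z' \<rho>'. (z', \<rho>') \<in> G \<and> \<rho> \<le> 2 * \<rho>' \<and> ball z \<rho> \<subseteq> ball z' (5 * \<rho>')"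
    "(\<Union>i\<in>G. T i) \<in> sets N" "emeasure N (\<Union>i\<in>G. T i) < \<infinity>"
    "measure N (\<Union>i\<in>G. T i) \<le> c * measure N' A"
proof -
  have A_eq: "emeasure N' A = ennreal (measure N' A)"
    using A(2) by (intro emeasure_eq_ennreal_measure) auto
  have le': "emeasure N (T (z, \<rho>)) \<le> ennreal c * emeasure N' (A \<inter> ball z \<rho>)" if i: "(z, \<rho>) \<in> I" for z \<rho>
  proof -
    have "emeasure N' (A \<inter> ball z \<rho>) \<le> emeasure N' A"
      using A(1) N' by (intro emeasure_mono) auto
    then have "emeasure N' (A \<inter> ball z \<rho>) = ennreal (measure N' (A \<inter> ball z \<rho>))"
      using A(2) by (intro emeasure_eq_ennreal_measure) (auto simp: less_top top_unique)
    moreover have "emeasure N (T (z, \<rho>)) = ennreal (measure N (T (z, \<rho>)))"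
      using T(2)[OF i] by (intro emeasure_eq_ennreal_measure) auto
    ultimately show ?thesis using le[OF i] c by (simp add: ennreal_mult'[symmetric] ennreal_le_iff)
  qed
  show thesis
  proof (rule covering_charge[where M = M and D = D and R = R and ?x0.0 = x0 and I = I and T = T and N = N
        and N' = N' and A = A and c = "ennreal c", OF M pos I T(1) N' A(1) le'])
    fix G assume G: "G \<subseteq> I" "countable G"
      "\<And>z \<rho>. (z, \<rho>) \<in> I \<Longrightarrow> \<exists>z' \<rho>'. (z', \<rho>') \<in> G \<and> \<rho> \<le> 2 * \<rho>' \<and> ball z \<rho> \<subseteq> ball z' (5 * \<rho>')"
      "(\<Union>i\<in>G. T i) \<in> sets N" and b: "emeasure N (\<Union>i\<in>G. T i) \<le> ennreal c * emeasure N' A"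
    have b': "emeasure N (\<Union>i\<in>G. T i) \<le> ennreal (c * measure N' A)"
      using b c by (simp add: A_eq ennreal_mult')
    then have "emeasure N (\<Union>i\<in>G. T i) < \<infinity>" using ennreal_less_top le_less_trans by fastforce
    moreover have "measure N (\<Union>i\<in>G. T i) \<le> c * measure N' A"
      using b' c unfolding measure_def[of N] by (intro enn2real_leI) auto
    ultimately show thesis using that[OF G] by blast
  qed assumption+
qed

subsection \<open>Regularity and density points\<close>

text \<open>Borel induction on a property symmetric under complements. The basic case uses that a
  closed set in a metric space is the intersection of its open neighbourhoods, whose finite measures
  decrease to that of the set.\<close>

lemma closed_open_approx_finite:
  fixes N :: "'a::metric_space measure"
  assumes N: "finite_measure N" "sets N = sets borel" and E: "E \<in> sets borel" and e: "0 < e"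
  shows "\<exists>F U. closed F \<and> open U \<and> F \<subseteq> E \<and> E \<subseteq> U \<and> measure N (U - F) < e"
proof -
  interpret finite_measure N by fact
  have meas[measurable]: "closed A \<Longrightarrow> A \<in> sets N" "open A \<Longrightarrow> A \<in> sets N" for A
    using N(2) by auto
  have "E \<in> sigma_sets UNIV (Collect closed)"
    using E by (simp add: borel_eq_closed)
  then have "\<forall>e>0. \<exists>F U. closed F \<and> open U \<and> F \<subseteq> E \<and> E \<subseteq> U \<and> measure N (U - F) < e"
  proof (induction rule: sigma_sets.induct)
    case (Basic A)
    then have cl: "closed A" by simp
    show ?case
    proof (intro allI impI)
      fix e :: real assume e: "0 < e"
      show "\<exists>F U. closed F \<and> open U \<and> F \<subseteq> A \<and> A \<subseteq> U \<and> measure N (U - F) < e"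
      \<comment> \<open>\<open>infdist x {}\<close> is 0, so for \<open>A = {}\<close> the
        neighbourhoods used below would be the whole space.\<close>
      proof (cases "A = {}")
        case True
        then show ?thesis using e by (intro exI[of _ "{}"]) auto
      next
        case False
        define U where "U n = {x. infdist x A < 1 / real (Suc n)}" for n
        have op: "open (U n)" for n
          unfolding U_def by (intro open_Collect_less continuous_intros)
        have "(\<Inter>n. U n) = A"
        proof safe
          fix x assume x: "x \<in> (\<Inter>n. U n)"
          have "infdist x A \<le> 0"
          proof (rule ccontr)
            assume "\<not> infdist x A \<le> 0"
            then obtain n where "1 / real (Suc n) < infdist x A" using nat_approx_posE[of "infdist x A"] by auto
            moreover have "infdist x A < 1 / real (Suc n)" using x unfolding U_def by blast
            ultimately show False by simp
          qed
          then have "infdist x A = 0" using infdist_nonneg[of x A] by linarith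
          then show "x \<in> A" using in_closed_iff_infdist_zero[OF cl False] by simp
        qed (simp add: U_def)
        moreover have "(\<lambda>n. measure N (U n)) \<longlonglongrightarrow> measure N (\<Inter>n. U n)"
        proof (rule finite_Lim_measure_decseq)
          show "decseq U"
            unfolding decseq_def
          proof (intro allI impI subsetI)
            fix m n x assume "m \<le> n" "x \<in> U n"
            then have "infdist x A < 1 / real (Suc n)" "1 / real (Suc n) \<le> 1 / real (Suc m)"
              by (auto simp: U_def intro!: frac_le)
            then show "x \<in> U m" unfolding U_def by (blast intro: less_le_trans)
          qed
        qed (use op in auto)
        ultimately have "(\<lambda>n. measure N (U n)) \<longlonglongrightarrow> measure N A" by simp
        then have "eventually (\<lambda>n. measure N (U n) < measure N A + e) sequentially"
          using e by (intro order_tendstoD) auto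
        then obtain n where n: "measure N (U n) < measure N A + e"
          unfolding eventually_sequentially by blast
        have AU: "A \<subseteq> U n" by (auto simp: U_def)
        then have "measure N (U n - A) = measure N (U n) - measure N A"
          using cl op by (intro finite_measure_Diff) auto
        then have "measure N (U n - A) < e" using n by simp
        then show ?thesis using cl op AU by blast
      qed
    qed
  next
    case Empty
    show ?case by (auto intro!: exI[of _ "{}"])
  next
    case (Compl A)
    show ?case
    proof (intro allI impI)
      fix e :: real assume e: "0 < e"
      obtain F U where *: "closed F" "open U" "F \<subseteq> A" "A \<subseteq> U" "measure N (U - F) < e"
        using Compl.IH[rule_format, OF e] by (elim exE conjE)
      have eq: "(UNIV - F) - (UNIV - U) = U - F" by auto
      show "\<exists>F U. closed F \<and> open U \<and> F \<subseteq> UNIV - A \<and> UNIV - A \<subseteq> U \<and> measure N (U - F) < e"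
        using * eq by (intro exI[of _ "UNIV - U"] exI[of _ "UNIV - F"]) (simp add: open_Diff closed_Diff Diff_mono)
    qed
  next
    case (Union A)
    show ?case
    proof (intro allI impI)
      fix e :: real assume e: "0 < e"
      have "\<forall>i. \<exists>F U. closed F \<and> open U \<and> F \<subseteq> A i \<and> A i \<subseteq> U \<and> measure N (U - F) < e / 2 * (1/2) ^ Suc i"
      proof
        fix i
        have "0 < e / 2 * (1/2) ^ Suc i" using e by simp
        then show "\<exists>F U. closed F \<and> open U \<and> F \<subseteq> A i \<and> A i \<subseteq> U \<and> measure N (U - F) < e / 2 * (1/2) ^ Suc i"
          using Union.IH[of i] by blast
      qed
      then obtain F U where FU: "\<And>i. closed (F i)" "\<And>i. open (U i)" "\<And>i. F i \<subseteq> A i" "\<And>i. A i \<subseteq> U i"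
        "\<And>i. measure N (U i - F i) < e / 2 * (1/2) ^ Suc i"
        unfolding choice_iff by (elim exE) blast
      \<comment> \<open>The union of all \<open>F i\<close> need not be closed. A finite part of it
        is, and it exhausts the union up to \<open>e / 2\<close> in measure.\<close>
      define G where "G n = (\<Union>i\<le>n. F i)" for n
      have clG: "closed (G n)" for n unfolding G_def using FU(1) by (intro closed_UN) auto
      have "(\<lambda>n. measure N (G n)) \<longlonglongrightarrow> measure N (\<Union>n. G n)"
      proof (intro finite_Lim_measure_incseq)
        show "incseq G" unfolding incseq_def G_def by (intro allI impI UN_mono) auto
      qed (use clG in auto)
      then have "eventually (\<lambda>n. measure N (\<Union>n. G n) - e / 2 < measure N (G n)) sequentially"
        using e by (intro order_tendstoD) auto
      then obtain n where n: "measure N (\<Union>n. G n) - e / 2 < measure N (G n)"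
        unfolding eventually_sequentially by blast
      have GF: "(\<Union>n. G n) = (\<Union>i. F i)" unfolding G_def by auto
      have Fs: "(\<Union>i. F i) \<in> sets N" "(\<Union>i. U i) \<in> sets N" using FU by auto
      have sums: "(\<lambda>i. e / 2 * (1/2) ^ Suc i) sums (e / 2)"
        using sums_mult[OF power_half_series, of "e/2"] by simp
      have s1: "summable (\<lambda>i. measure N (U i - F i))"
        using FU(5) by (intro summable_comparison_test'[OF sums_summable[OF sums], of 0]) (auto intro: less_imp_le)
      have "measure N (\<Union>i. U i - F i) \<le> (\<Sum>i. measure N (U i - F i))"
        using FU s1 by (intro finite_measure_subadditive_countably) auto
      also have "\<dots> \<le> e / 2"
        using suminf_le[OF less_imp_le[OF FU(5)] s1 sums_summable[OF sums]] sums_unique[OF sums] by linarith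
      finally have u1: "measure N (\<Union>i. U i - F i) \<le> e / 2" .
      have "measure N ((\<Union>i. U i) - G n) \<le> measure N ((\<Union>i. U i - F i) \<union> ((\<Union>i. F i) - G n))"
        using FU clG Fs by (intro finite_measure_mono) auto
      also have "\<dots> \<le> measure N (\<Union>i. U i - F i) + measure N ((\<Union>i. F i) - G n)"
        using FU clG Fs by (intro measure_Un_le) auto
      also have "measure N ((\<Union>i. F i) - G n) = measure N (\<Union>i. F i) - measure N (G n)"
        using Fs clG by (intro finite_measure_Diff) (auto simp: G_def)
      finally have "measure N ((\<Union>i. U i) - G n) < e" using u1 n GF by simp
      moreover have "G n \<subseteq> \<Union> (range A)" "\<Union> (range A) \<subseteq> (\<Union>i. U i)"
        using FU(3,4) by (auto simp: G_def) blast+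
      ultimately show "\<exists>F U. closed F \<and> open U \<and> F \<subseteq> \<Union> (range A) \<and> \<Union> (range A) \<subseteq> U \<and> measure N (U - F) < e"
        using clG FU(2) by (intro exI[of _ "G n"] exI[of _ "\<Union>i. U i"]) auto
    qed
  qed
  then show ?thesis using e by blast
qed

text \<open>Regularity is applied to the restriction of \<open>M\<close> to the ball, which is
  finite even when \<open>M\<close> is not.\<close>

lemma open_approx:
  assumes M: "ball_doubling M D" and E: "E \<in> sets borel" "E \<subseteq> ball x R" and e: "0 < e"
  obtains U where "open U" "E \<subseteq> U" "U \<subseteq> ball x R" "measure M (U - E) < e"
proof -
  define N where "N = density M (indicator (ball x R))"
  have sN: "sets N = sets borel" using ball_doublingD(1)[OF M] by (simp add: N_def)
  have emN: "emeasure N A = emeasure M (A \<inter> ball x R)" if "A \<in> sets borel" for A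
    using that ball_doublingD(1)[OF M]
    by (simp add: N_def emeasure_restricted Int_commute)
  have "finite_measure N"
    using emN[of UNIV] ball_doublingD(4)[OF M, of x R] sN
    by (intro finite_measureI) (auto simp: sets_eq_imp_space_eq[OF sN])
  from closed_open_approx_finite[OF this sN E(1) e] obtain F U where
    FU: "closed F" "open U" "F \<subseteq> E" "E \<subseteq> U" "measure N (U - F) < e" by blast
  interpret finite_measure N by fact
  have "measure M ((U \<inter> ball x R) - E) = measure N ((U \<inter> ball x R) - E)"
    unfolding measure_def using FU E by (subst emN) (auto intro!: arg_cong[where f = "\<lambda>A. enn2real (emeasure M A)"])
  also have "\<dots> \<le> measure N (U - F)"
    using FU E sN by (intro finite_measure_mono) auto
  finally show thesis using FU E by (intro that[of "U \<inter> ball x R"]) auto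
qed

text \<open>Lebesgue density for a doubling measure by a weak-type bound. For open \<open>U\<close>
  containing \<open>E\<close> with \<open>U - E\<close> small, the points of \<open>E\<close> having
  a ball of radius at most 1 in which \<open>U - E\<close> has density above \<kappa> lie in a set
  of measure at most \<open>L / \<kappa>\<close> times a bound for \<open>U - E\<close>. For a point
  of \<open>E\<close> outside it small balls lie in \<open>U\<close>, and there \<open>U - E\<close>
  is the same as the complement of \<open>E\<close>. The null set is the intersection of these sets
  over a sequence of \<open>U\<close>.\<close>

lemma density_points:
  fixes M :: "'a::metric_space measure"
  assumes M: "ball_doubling M D" and pos: "\<And>x r. 0 < r \<Longrightarrow> 0 < measure M (ball x r)"
    and E: "E \<in> sets borel" "E \<subseteq> ball x0 R" and k: "0 < \<kappa>"
  obtains Z where "Z \<in> null_sets M"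
    "\<And>y. y \<in> E - Z \<Longrightarrow> \<exists>\<delta>>0. \<forall>r. 0 < r \<and> r < \<delta> \<longrightarrow> measure M (ball y r - E) \<le> \<kappa> * measure M (ball y r)"
proof -
  have sM: "sets M = sets borel" by (rule ball_doublingD[OF M])
  obtain L where L: "1 \<le> L"
    "\<And>x y r R. 0 < r \<Longrightarrow> dist x y + R \<le> 5 * r \<Longrightarrow> measure M (ball y R) \<le> L * measure M (ball x r)"
    using ball_compare[OF M, of 5] by metis
  have "\<exists>U V. open U \<and> E \<subseteq> U \<and> U \<subseteq> ball x0 R \<and> V \<in> sets M \<and> emeasure M V < \<infinity> \<and> measure M V \<le> L / \<kappa> * (1 / real (Suc n)) \<and>
      (\<forall>y r. y \<in> E \<and> 0 < r \<and> r \<le> 1 \<and> \<kappa> * measure M (ball y r) < measure M ((U - E) \<inter> ball y r) \<longrightarrow> y \<in> V)" for n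
  proof -
    obtain U where U: "open U" "E \<subseteq> U" "U \<subseteq> ball x0 R" "measure M (U - E) < 1 / real (Suc n)"
      using open_approx[OF M E, of "1 / real (Suc n)"] by auto
    \<comment> \<open>Radii are capped by 1 because the covering argument needs a bounded family;
      density only concerns small radii.\<close>
    define I where "I = {(y, r). y \<in> E \<and> 0 < r \<and> r \<le> 1 \<and> \<kappa> * measure M (ball y r) < measure M ((U - E) \<inter> ball y r)}"
    define T where "T = (\<lambda>(z::'a, \<rho>::real). ball z (5 * \<rho>))"
    have UE: "U - E \<in> sets borel" "U - E \<subseteq> ball x0 R" using U E by auto
    have i: "0 < \<rho> \<and> \<rho> \<le> max 1 R \<and> dist x0 z \<le> max 1 R" if "(z, \<rho>) \<in> I" for z \<rho>
    proof -
      have "z \<in> ball x0 R" "0 < \<rho>" "\<rho> \<le> 1" using that E(2) by (auto simp: I_def)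
      then show ?thesis by (auto simp: max_def)
    qed
    have t: "T (z, \<rho>) \<in> sets M" "emeasure M (T (z, \<rho>)) < \<infinity>" for z \<rho>
      using ball_doublingD[OF M] by (auto simp: T_def)
    have le: "measure M (T (z, \<rho>)) \<le> L / \<kappa> * measure M ((U - E) \<inter> ball z \<rho>)" if "(z, \<rho>) \<in> I" for z \<rho>
    proof -
      have "measure M (T (z, \<rho>)) \<le> L * measure M (ball z \<rho>)"
        unfolding T_def using that L(2)[of \<rho> z z "5 * \<rho>"] by (auto simp: I_def)
      also have "\<dots> = L / \<kappa> * (\<kappa> * measure M (ball z \<rho>))" using k by simp
      also have "\<dots> \<le> L / \<kappa> * measure M ((U - E) \<inter> ball z \<rho>)"
        using that k L(1) by (intro mult_left_mono) (auto simp: I_def)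
      finally show ?thesis .
    qed
    obtain G where G: "G \<subseteq> I" "countable G"
      "\<And>z \<rho>. (z, \<rho>) \<in> I \<Longrightarrow> \<exists>z' \<rho>'. (z', \<rho>') \<in> G \<and> \<rho> \<le> 2 * \<rho>' \<and> ball z \<rho> \<subseteq> ball z' (5 * \<rho>')"
      "(\<Union>i\<in>G. T i) \<in> sets M" "emeasure M (\<Union>i\<in>G. T i) < \<infinity>"
      "measure M (\<Union>i\<in>G. T i) \<le> L / \<kappa> * measure M (U - E)"
      by (rule covering_measure[where N = M and N' = M and M = M and I = I and T = T and A = "U - E" and c = "L / \<kappa>",
            OF M pos i t sM UE(1) ball_doubling_fmeasurable(3)[OF M UE] le]) (use L k in auto)
    have "L / \<kappa> * measure M (U - E) \<le> L / \<kappa> * (1 / real (Suc n))"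
      using U(4) L(1) k by (intro mult_left_mono) auto
    moreover have "y \<in> (\<Union>i\<in>G. T i)"
      if "y \<in> E" "0 < r" "r \<le> 1" "\<kappa> * measure M (ball y r) < measure M ((U - E) \<inter> ball y r)" for y r
    proof -
      have "(y, r) \<in> I" using that by (auto simp: I_def)
      then obtain z' \<rho>' where *: "(z', \<rho>') \<in> G" "ball y r \<subseteq> ball z' (5 * \<rho>')" using G(3) by blast
      have "y \<in> ball y r" using \<open>0 < r\<close> by simp
      with *(2) have "y \<in> T (z', \<rho>')" unfolding T_def by (simp add: subset_iff)
      with * show ?thesis by blast
    qed
    ultimately show ?thesis
      using G U by (intro exI[of _ U] exI[of _ "\<Union>i\<in>G. T i"]) auto
  qed
  then obtain U V where UV: "\<And>n. open (U n)" "\<And>n. E \<subseteq> U n" "\<And>n. V n \<in> sets M" "\<And>n. emeasure M (V n) < \<infinity>"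
    "\<And>n. measure M (V n) \<le> L / \<kappa> * (1 / real (Suc n))"
    "\<And>n y r. y \<in> E \<Longrightarrow> 0 < r \<Longrightarrow> r \<le> 1 \<Longrightarrow> \<kappa> * measure M (ball y r) < measure M ((U n - E) \<inter> ball y r) \<Longrightarrow> y \<in> V n"
    by metis
  show thesis
  proof (rule that)
    have "emeasure M (\<Inter>n. V n) \<le> ennreal e" if e: "0 < e" for e
    proof -
      obtain n where n: "L / \<kappa> / e < real (Suc n)"
        using reals_Archimedean2 less_Suc_eq by (metis less_trans of_nat_less_iff lessI)
      then have "L / \<kappa> < real (Suc n) * e"
        using e by (simp only: pos_divide_less_eq)
      then have "L / \<kappa> / real (Suc n) \<le> e"
        using mult_imp_div_pos_le[of "real (Suc n)" "L / \<kappa>" e] by (simp only: mult.commute of_nat_0_less_iff zero_less_Suc less_imp_le)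
      then have "L / \<kappa> * (1 / real (Suc n)) \<le> e" by simp
      moreover have "emeasure M (V n) = ennreal (measure M (V n))"
        using UV(4)[of n] by (intro emeasure_eq_ennreal_measure) auto
      moreover have "emeasure M (\<Inter>n. V n) \<le> emeasure M (V n)"
        using UV(3) by (intro emeasure_mono) auto
      ultimately show ?thesis using UV(5)[of n] e by (metis ennreal_leI order.trans)
    qed
    then have "emeasure M (\<Inter>n. V n) \<le> 0 + ennreal e" if "0 < e" for e
      using that by (simp only: add_0)
    then have "emeasure M (\<Inter>n. V n) \<le> 0"
      by (rule ennreal_le_epsilon)
    then show "(\<Inter>n. V n) \<in> null_sets M"
      using UV(3) by (intro null_setsI sets.countable_INT) auto
  next
    fix y assume y: "y \<in> E - (\<Inter>n. V n)"
    then obtain n where n: "y \<notin> V n" by blast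
    have "y \<in> U n" using y UV(2) by blast
    then obtain d where d: "0 < d" "ball y d \<subseteq> U n"
      using UV(1)[of n] openE by blast
    have "measure M (ball y r - E) \<le> \<kappa> * measure M (ball y r)" if r: "0 < r" "r < min 1 d" for r
    proof -
      have "ball y r \<subseteq> U n" using d(2) r by auto
      then have eq: "(U n - E) \<inter> ball y r = ball y r - E" by auto
      then show ?thesis using UV(6)[of y r n] y n r by (auto simp: not_less[symmetric])
    qed
    then show "\<exists>\<delta>>0. \<forall>r. 0 < r \<and> r < \<delta> \<longrightarrow> measure M (ball y r - E) \<le> \<kappa> * measure M (ball y r)"
      using d by (intro exI[of _ "min 1 d"]) auto
  qed
qed

subsection \<open>Muckenhoupt weights\<close>

lemma ball_doubling_split:
  assumes N: "ball_doubling N D" and "A \<in> sets borel" "B \<in> sets borel" "A \<subseteq> ball x R"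
  shows "measure N A = measure N (A \<inter> B) + measure N (A - B)"
proof -
  have "measure N ((A \<inter> B) \<union> (A - B)) = measure N (A \<inter> B) + measure N (A - B)"
    using assms ball_doublingD(1)[OF N] ball_doubling_fmeasurable(3)[OF N, of "A \<inter> B" x R]
      ball_doubling_fmeasurable(3)[OF N, of "A - B" x R]
    by (intro measure_Union) (auto simp: less_top[symmetric])
  then show ?thesis by (simp add: Un_Diff_Int Int_Diff_Un)
qed

text \<open>An \<open>E\<close> of small density everywhere at scale \<open>\<rho>\<close> is enlarged by balls in which its density
  is about one half; such balls carry a fixed proportion of \<open>W\<close> outside \<open>E\<close>.\<close>

lemma a_infinity_step:
  fixes M W :: "'a::metric_space measure"
  assumes M: "ball_doubling M D" and pos: "\<And>x r. 0 < r \<Longrightarrow> 0 < measure M (ball x r)"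
    and W: "ball_doubling W D'" and null: "null_sets M \<subseteq> null_sets W"
    and c: "0 < c" and half: "\<And>x r F. F \<in> sets borel \<Longrightarrow> F \<subseteq> ball x r \<Longrightarrow> 0 < r \<Longrightarrow>
          measure M (ball x r) \<le> 2 * measure M F \<Longrightarrow> c * measure W (ball x r) \<le> measure W F"
  obtains K \<beta> where "1 \<le> K" "1 < \<beta>"
    "\<And>E x0 R \<rho>. E \<in> sets borel \<Longrightarrow> E \<subseteq> ball x0 R \<Longrightarrow> 0 < \<rho> \<Longrightarrow>
       (\<And>y. y \<in> E \<Longrightarrow> 2 * measure M E < measure M (ball y \<rho>)) \<Longrightarrow>
       \<exists>E'. E' \<in> sets borel \<and> E' \<subseteq> ball x0 (R + \<rho>) \<and> measure M E' \<le> K * measure M E \<and>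
            \<beta> * measure W E \<le> measure W E'"
proof -
  have sM: "sets M = sets borel" and sW: "sets W = sets borel"
    using ball_doublingD(1) M W by auto
  obtain L where L: "1 \<le> L"
    "\<And>x y r R. 0 < r \<Longrightarrow> dist x y + R \<le> 5 * r \<Longrightarrow> measure M (ball y R) \<le> L * measure M (ball x r)"
    using ball_compare[OF M, of 5] by metis
  obtain L' where L': "1 \<le> L'"
    "\<And>x y r R. 0 < r \<Longrightarrow> dist x y + R \<le> 5 * r \<Longrightarrow> measure W (ball y R) \<le> L' * measure W (ball x r)"
    using ball_compare[OF W, of 5] by metis
  have D: "1 \<le> D" by (rule ball_doublingD[OF M])
  show thesis
  proof (rule that)
    have "1 * 1 \<le> 2 * D * L" using D L(1) by (intro mult_mono) auto
    then show "1 \<le> 2 * D * L" by simp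
    show "1 < 1 + c / L'" using c L'(1) by simp
    fix E :: "'a set" and x0 :: 'a and R \<rho> :: real
    assume E: "E \<in> sets borel" "E \<subseteq> ball x0 R" and \<rho>: "0 < \<rho>"
      and small: "\<And>y. y \<in> E \<Longrightarrow> 2 * measure M E < measure M (ball y \<rho>)"
    obtain Z where Z: "Z \<in> null_sets M"
      "\<And>y. y \<in> E - Z \<Longrightarrow> \<exists>\<delta>>0. \<forall>r. 0 < r \<and> r < \<delta> \<longrightarrow> measure M (ball y r - E) \<le> 1/2 * measure M (ball y r)"
      by (rule density_points[OF M pos E, of "1/2"]) auto
    \<comment> \<open>Balls centred in \<open>E\<close> in which \<open>E\<close> has density
      between \<open>1 / (2 * D)\<close> and 1/2. The lower bound controls the enlarged set in
      \<open>M\<close>, the upper bound leaves half of the ball outside \<open>E\<close>.\<close>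
    define I where "I = {(y, r). y \<in> E \<and> 0 < r \<and> r \<le> \<rho> \<and> 2 * measure M (E \<inter> ball y r) \<le> measure M (ball y r)
        \<and> measure M (ball y r) \<le> 2 * D * measure M (E \<inter> ball y r)}"
    define E' where "E' = (\<Union>(y, r)\<in>I. ball y r)"
    define T where "T = (\<lambda>(z::'a, \<rho>::real). ball z (5 * \<rho>))"
    have op: "open E'" unfolding E'_def by (auto intro!: open_UN)
    have E'sub: "E' \<subseteq> ball x0 (R + \<rho>)"
    proof
      fix x assume "x \<in> E'"
      then obtain y r where "y \<in> E" "r \<le> \<rho>" "dist y x < r" by (auto simp: E'_def I_def)
      moreover have "dist x0 x \<le> dist x0 y + dist y x" by (rule dist_triangle)
      ultimately show "x \<in> ball x0 (R + \<rho>)" using E(2) by fastforce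
    qed
    have cover: "E - Z \<subseteq> E'"
    proof
      fix y assume y: "y \<in> E - Z"
      \<comment> \<open>\<open>P i\<close> says that \<open>E\<close> has density at least 1/2 at
        scale \<open>\<rho> / 2 ^ i\<close>. It fails at \<open>i = 0\<close> by smallness and holds
        for some \<open>i\<close> at a density point. At the last scale before the first success the
        density is below 1/2, and doubling keeps it above \<open>1 / (2 * D)\<close>.\<close>
      define P where "P i \<longleftrightarrow> measure M (ball y (\<rho> / 2 ^ i)) \<le> 2 * measure M (E \<inter> ball y (\<rho> / 2 ^ i))" for i :: nat
      obtain d where d: "0 < d" "\<And>r. 0 < r \<Longrightarrow> r < d \<Longrightarrow> measure M (ball y r - E) \<le> 1/2 * measure M (ball y r)"
        using Z(2)[OF y] by blast
      have split: "measure M (ball y r) = measure M (E \<inter> ball y r) + measure M (ball y r - E)" for r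
        using ball_doubling_split[OF M _ E(1), of "ball y r" y r] by (simp add: Int_commute)
      obtain i where i: "\<rho> / d < 2 ^ i" using real_arch_pow[of 2 "\<rho> / d"] by auto
      then have "\<rho> / 2 ^ i < d" using d(1) by (simp add: field_simps)
      then have "P i" using d(2)[of "\<rho> / 2 ^ i"] \<rho> split[of "\<rho> / 2 ^ i"] by (simp add: P_def)
      define j where "j = (LEAST i. P i)"
      have Pj: "P j" and before: "\<And>i. i < j \<Longrightarrow> \<not> P i"
        unfolding j_def using LeastI[of P, OF \<open>P i\<close>] not_less_Least by blast+
      have "measure M (E \<inter> ball y \<rho>) \<le> measure M E"
        using E by (intro ball_doubling_mono[OF M _ _ _ E(2)]) auto
      then have "\<not> P 0" using small[of y] y by (simp add: P_def)
      then obtain k where k: "j = Suc k" using Pj by (cases j) auto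
      define r where "r = \<rho> / 2 ^ k"
      have r: "0 < r" "r \<le> \<rho>" using \<rho> by (auto simp: r_def field_simps)
      have "measure M (ball y r) \<le> D * measure M (ball y (r / 2))"
        using ball_doublingD(7)[OF M, of "r/2" y] r by simp
      also have "\<dots> \<le> D * (2 * measure M (E \<inter> ball y (r / 2)))"
        using Pj D by (intro mult_left_mono) (auto simp: P_def k r_def mult.commute)
      also have "\<dots> \<le> D * (2 * measure M (E \<inter> ball y r))"
        using E(1) D r by (intro mult_left_mono ball_doubling_mono[OF M, of _ _ y r]) auto
      finally have "measure M (ball y r) \<le> 2 * D * measure M (E \<inter> ball y r)" by simp
      moreover have "2 * measure M (E \<inter> ball y r) \<le> measure M (ball y r)"
        using before[of k] k by (simp add: P_def r_def)
      ultimately have "(y, r) \<in> I" using y r by (auto simp: I_def)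
      then show "y \<in> E'" using r unfolding E'_def by force
    qed
    have i: "0 < r \<and> r \<le> max \<rho> R \<and> dist x0 y \<le> max \<rho> R" if "(y, r) \<in> I" for y r
    proof -
      have "y \<in> ball x0 R" "0 < r" "r \<le> \<rho>" using that E(2) by (auto simp: I_def)
      then show ?thesis by (auto simp: max_def)
    qed
    have TM: "T (z, r) \<in> sets M" "emeasure M (T (z, r)) < \<infinity>"
      and TW: "T (z, r) \<in> sets W" "emeasure W (T (z, r)) < \<infinity>" for z r
      using ball_doublingD[OF M] ball_doublingD[OF W] by (auto simp: T_def)
    have E'b: "E' \<in> sets borel" using op by simp
    have E'T: "E' \<subseteq> (\<Union>i\<in>G. T i)"
      if G: "\<And>z \<rho>. (z, \<rho>) \<in> I \<Longrightarrow> \<exists>z' \<rho>'. (z', \<rho>') \<in> G \<and> \<rho> \<le> 2 * \<rho>' \<and> ball z \<rho> \<subseteq> ball z' (5 * \<rho>')" for G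
    proof
      fix x assume "x \<in> E'"
      then obtain y r where "(y, r) \<in> I" "x \<in> ball y r" by (auto simp: E'_def)
      with G[of y r] obtain z' \<rho>' where "(z', \<rho>') \<in> G" "x \<in> ball z' (5 * \<rho>')" by blast
      then show "x \<in> (\<Union>i\<in>G. T i)" unfolding T_def by blast
    qed
    have leM: "measure M (T (y, r)) \<le> (2 * D * L) * measure M (E \<inter> ball y r)" if "(y, r) \<in> I" for y r
    proof -
      have "measure M (T (y, r)) \<le> L * measure M (ball y r)"
        unfolding T_def using that L(2)[of r y y "5 * r"] by (auto simp: I_def)
      also have "\<dots> \<le> L * (2 * D * measure M (E \<inter> ball y r))"
        using that L(1) by (intro mult_left_mono) (auto simp: I_def)
      finally show ?thesis by (simp add: mult_ac)
    qed
    have KM: "measure M E' \<le> 2 * D * L * measure M E"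
    proof (rule covering_measure[where N = M and N' = M and M = M and I = I and T = T and A = E and c = "2 * D * L",
            OF M pos i TM sM E(1) ball_doubling_fmeasurable(3)[OF M E] leM])
      fix G assume G: "\<And>z \<rho>. (z, \<rho>) \<in> I \<Longrightarrow> \<exists>z' \<rho>'. (z', \<rho>') \<in> G \<and> \<rho> \<le> 2 * \<rho>' \<and> ball z \<rho> \<subseteq> ball z' (5 * \<rho>')"
        "(\<Union>i\<in>G. T i) \<in> sets M" "emeasure M (\<Union>i\<in>G. T i) < \<infinity>"
        "measure M (\<Union>i\<in>G. T i) \<le> 2 * D * L * measure M E"
      have "measure M E' \<le> measure M (\<Union>i\<in>G. T i)"
        using E'T[OF G(1)] G(2,3) E'b sM by (intro measure_mono_fmeasurable) (auto intro: fmeasurableI)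
      with G(4) show ?thesis by simp
    qed (use D L in auto)
    \<comment> \<open>At least half of \<open>ball y r\<close> lies outside \<open>E\<close>, and
      \<open>half\<close> gives that part the proportion \<open>c\<close> of \<open>W\<close>; the
      dilation by 5 costs \<open>L'\<close>.\<close>
    have leW: "measure W (T (y, r)) \<le> (L' / c) * measure W ((E' - E) \<inter> ball y r)" if yr: "(y, r) \<in> I" for y r
    proof -
      have r: "0 < r" using yr by (auto simp: I_def)
      have sub: "ball y r \<subseteq> E'" using yr unfolding E'_def by force
      have "measure M (ball y r) = measure M (E \<inter> ball y r) + measure M (ball y r - E)"
        using ball_doubling_split[OF M _ E(1), of "ball y r" y r] by (simp add: Int_commute)
      then have "measure M (ball y r) \<le> 2 * measure M (ball y r - E)" using yr by (auto simp: I_def)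
      then have "c * measure W (ball y r) \<le> measure W (ball y r - E)"
        using E(1) r by (intro half) auto
      moreover have "(E' - E) \<inter> ball y r = ball y r - E" using sub by auto
      moreover have "measure W (T (y, r)) \<le> L' * measure W (ball y r)"
        unfolding T_def using L'(2)[of r y y "5 * r"] r by auto
      moreover have "L' * measure W (ball y r) = (L' / c) * (c * measure W (ball y r))" using c by simp
      moreover have "(L' / c) * (c * measure W (ball y r)) \<le> (L' / c) * measure W (ball y r - E)"
        if "c * measure W (ball y r) \<le> measure W (ball y r - E)"
        using that c L'(1) by (intro mult_left_mono) auto
      ultimately show ?thesis by simp
    qed
    have E'E: "E' - E \<in> sets borel" "E' - E \<subseteq> ball x0 (R + \<rho>)" using E'b E(1) E'sub by auto
    have KW: "measure W E' \<le> L' / c * measure W (E' - E)"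
    proof (rule covering_measure[where N = W and N' = W and M = M and I = I and T = T and A = "E' - E" and c = "L' / c",
            OF M pos i TW sW E'E(1) ball_doubling_fmeasurable(3)[OF W E'E] leW])
      fix G assume G: "\<And>z \<rho>. (z, \<rho>) \<in> I \<Longrightarrow> \<exists>z' \<rho>'. (z', \<rho>') \<in> G \<and> \<rho> \<le> 2 * \<rho>' \<and> ball z \<rho> \<subseteq> ball z' (5 * \<rho>')"
        "(\<Union>i\<in>G. T i) \<in> sets W" "emeasure W (\<Union>i\<in>G. T i) < \<infinity>"
        "measure W (\<Union>i\<in>G. T i) \<le> L' / c * measure W (E' - E)"
      have "measure W E' \<le> measure W (\<Union>i\<in>G. T i)"
        using E'T[OF G(1)] G(2,3) E'b sW by (intro measure_mono_fmeasurable) (auto intro: fmeasurableI)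
      with G(4) show ?thesis by simp
    qed (use c L' in auto)
    have dec: "measure W E' = measure W (E \<inter> E') + measure W (E' - E)"
      using ball_doubling_split[OF W E'b E(1) E'sub] by (simp add: Int_commute)
    have "measure W E \<le> measure W ((E \<inter> E') \<union> Z)"
    proof (rule measure_mono_fmeasurable)
      have "Z \<in> null_sets W" using Z null by auto
      then have "Z \<in> fmeasurable W" by (intro fmeasurableI) auto
      moreover have "E \<inter> E' \<in> fmeasurable W"
        using E E'b by (intro ball_doubling_fmeasurable(1)[OF W, of _ x0 R]) auto
      ultimately show "(E \<inter> E') \<union> Z \<in> fmeasurable W" by (intro fmeasurable.Un)
    qed (use cover E sW in auto)
    also have "\<dots> = measure W (E \<inter> E')"
      using Z(1) null E(1) E'b sW by (intro measure_Un_null_set) auto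
    finally have WE: "measure W E \<le> measure W (E \<inter> E')" .
    \<comment> \<open>The gain \<open>W (E' - E)\<close> is at least \<open>c / L'\<close> times
      \<open>W E'\<close>, hence at least \<open>c / L'\<close> times \<open>W E\<close>; this is
      the growth factor \<open>1 + c / L'\<close>.\<close>
    have "measure W E \<le> measure W E'"
      using WE dec measure_nonneg[of W "E' - E"] by linarith
    then have "c / L' * measure W E \<le> c / L' * measure W E'"
      using c L'(1) by (intro mult_left_mono) auto
    also have "\<dots> \<le> c / L' * (L' / c * measure W (E' - E))"
      using KW c L'(1) by (intro mult_left_mono) auto
    also have "\<dots> = measure W (E' - E)" using c L'(1) by simp
    finally have "(1 + c / L') * measure W E \<le> measure W E'"
      using WE dec measure_nonneg[of W "E' - E"] by (simp add: algebra_simps)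
    then show "\<exists>E'. E' \<in> sets borel \<and> E' \<subseteq> ball x0 (R + \<rho>) \<and> measure M E' \<le> 2 * D * L * measure M E \<and>
            (1 + c / L') * measure W E \<le> measure W E'"
      using E'b E'sub KM by (intro exI[of _ E']) auto
  qed
qed

text \<open>Passage from the fixed threshold one half to arbitrarily small proportions. If
  \<open>F\<close> is very small in \<open>M\<close>, the enlargement can be repeated
  \<open>m\<close> times inside the doubled ball. The \<open>W\<close>-measure grows by \<beta> each
  time but stays below that of the doubled ball, which forces \<open>W F\<close> to be
  small.\<close>

lemma a_infinity_small:
  fixes M W :: "'a::metric_space measure"
  assumes M: "ball_doubling M D" and pos: "\<And>x r. 0 < r \<Longrightarrow> 0 < measure M (ball x r)"
    and W: "ball_doubling W D'" and null: "null_sets M \<subseteq> null_sets W"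
    and c: "0 < c" and half: "\<And>x r F. F \<in> sets borel \<Longrightarrow> F \<subseteq> ball x r \<Longrightarrow> 0 < r \<Longrightarrow>
          measure M (ball x r) \<le> 2 * measure M F \<Longrightarrow> c * measure W (ball x r) \<le> measure W F"
    and \<delta>: "0 < \<delta>"
  obtains \<epsilon> where "0 < \<epsilon>"
    "\<And>x r F. F \<in> sets borel \<Longrightarrow> F \<subseteq> ball x r \<Longrightarrow> 0 < r \<Longrightarrow>
       measure M F \<le> \<epsilon> * measure M (ball x r) \<Longrightarrow> measure W F \<le> \<delta> * measure W (ball x r)"
proof (rule a_infinity_step[where M = M and W = W and D = D and D' = D' and c = c, OF M pos W null c half])
  fix K \<beta> assume K: "1 \<le> K" and \<beta>: "1 < \<beta>" and step:
    "\<And>E x0 R \<rho>. E \<in> sets borel \<Longrightarrow> E \<subseteq> ball x0 R \<Longrightarrow> 0 < \<rho> \<Longrightarrow>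
       (\<And>y. y \<in> E \<Longrightarrow> 2 * measure M E < measure M (ball y \<rho>)) \<Longrightarrow>
       \<exists>E'. E' \<in> sets borel \<and> E' \<subseteq> ball x0 (R + \<rho>) \<and> measure M E' \<le> K * measure M E \<and>
            \<beta> * measure W E \<le> measure W E'"
  have D': "1 \<le> D'" by (rule ball_doublingD[OF W])
  \<comment> \<open>After \<open>m\<close> steps the growth outweighs the doubling constant of
    \<open>W\<close> and the wanted proportion \<delta> together.\<close>
  obtain m where m: "D' / \<delta> < \<beta> ^ m" using real_arch_pow[OF \<beta>] by blast
  obtain L where L: "1 \<le> L"
    "\<And>x y r R. 0 < r \<Longrightarrow> dist x y + R \<le> (3 * real (Suc m)) * r \<Longrightarrow> measure M (ball y R) \<le> L * measure M (ball x r)"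
    using ball_compare[OF M, of "3 * real (Suc m)"] by metis
  \<comment> \<open>Even after growing by \<open>K ^ m\<close>, a set that starts with this
    proportion fills at most \<open>1 / (4 * L)\<close> of \<open>ball x r\<close>, hence at most a
    quarter of the measure of each \<open>ball y \<rho>\<close> around its points. This is the
    smallness that every enlargement demands.\<close>
  define \<epsilon> where "\<epsilon> = 1 / (4 * K ^ m * L)"
  have \<epsilon>: "0 < \<epsilon>" using K L by (simp add: \<epsilon>_def)
  show thesis
  proof (rule that[OF \<epsilon>])
    fix x :: 'a and r :: real and F :: "'a set"
    assume F: "F \<in> sets borel" "F \<subseteq> ball x r" and r: "0 < r" and small: "measure M F \<le> \<epsilon> * measure M (ball x r)"
    \<comment> \<open>\<open>m\<close> enlargements by \<rho> increase the radius by less than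
      \<open>r\<close>.\<close>
    define \<rho> where "\<rho> = r / real (Suc m)"
    have \<rho>: "0 < \<rho>" using r by (simp add: \<rho>_def)
    have iter: "\<exists>E. E \<in> sets borel \<and> E \<subseteq> ball x (r + real i * \<rho>) \<and> measure M E \<le> K ^ i * measure M F \<and>
        \<beta> ^ i * measure W F \<le> measure W E" if "i \<le> m" for i
      using that
    proof (induction i)
      case 0
      show ?case using F by (intro exI[of _ F]) auto
    next
      case (Suc i)
      then obtain E where E: "E \<in> sets borel" "E \<subseteq> ball x (r + real i * \<rho>)" "measure M E \<le> K ^ i * measure M F"
        "\<beta> ^ i * measure W F \<le> measure W E" by auto
      have "real i * \<rho> \<le> real (Suc m) * \<rho>" using Suc.prems \<rho> by (intro mult_right_mono) auto
      then have i: "real i * \<rho> \<le> r" by (simp add: \<rho>_def)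
      have dens: "2 * measure M E < measure M (ball y \<rho>)" if y: "y \<in> E" for y
      proof -
        have "dist y x < 2 * r" using E(2) y i by (fastforce simp: dist_commute)
        moreover have "3 * real (Suc m) * \<rho> = 3 * r" by (simp add: \<rho>_def field_simps)
        ultimately have "measure M (ball x r) \<le> L * measure M (ball y \<rho>)"
          using L(2)[OF \<rho>, of y x r] by linarith
        moreover have "K ^ i * measure M F \<le> K ^ m * (\<epsilon> * measure M (ball x r))"
          using Suc.prems K small by (intro mult_mono power_increasing) auto
        moreover have "K ^ m * \<epsilon> = 1 / (4 * L)" using K by (simp add: \<epsilon>_def)
        ultimately have "measure M E \<le> 1 / (4 * L) * measure M (ball x r)"
          using E(3) by (metis mult.assoc order.trans)
        also have "\<dots> \<le> 1 / (4 * L) * (L * measure M (ball y \<rho>))"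
          using \<open>measure M (ball x r) \<le> L * measure M (ball y \<rho>)\<close> L(1) by (intro mult_left_mono) auto
        also have "\<dots> = measure M (ball y \<rho>) / 4" using L(1) by simp
        finally show ?thesis using pos[OF \<rho>, of y] by linarith
      qed
      obtain E' where E': "E' \<in> sets borel" "E' \<subseteq> ball x (r + real i * \<rho> + \<rho>)" "measure M E' \<le> K * measure M E"
        "\<beta> * measure W E \<le> measure W E'"
        using step[OF E(1,2) \<rho> dens] by auto
      have "measure M E' \<le> K ^ Suc i * measure M F"
        using order.trans[OF E'(3) mult_left_mono[OF E(3), of K]] K by (simp add: mult.assoc)
      moreover have "\<beta> ^ Suc i * measure W F \<le> measure W E'"
        using order.trans[OF mult_left_mono[OF E(4), of \<beta>] E'(4)] \<beta> by (simp add: mult.assoc)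
      ultimately show ?case using E'(1,2) by (intro exI[of _ E']) (auto simp: algebra_simps)
    qed
    obtain E where E: "E \<in> sets borel" "E \<subseteq> ball x (r + real m * \<rho>)" "\<beta> ^ m * measure W F \<le> measure W E"
      using iter[of m] by auto
    have "real m * \<rho> \<le> real (Suc m) * \<rho>" using \<rho> by (intro mult_right_mono) auto
    then have "real m * \<rho> \<le> r" by (simp add: \<rho>_def)
    then have "E \<subseteq> ball x (2 * r)" using E(2) subset_ball[of "r + real m * \<rho>" "2 * r" x] by auto
    then have "measure W E \<le> measure W (ball x (2 * r))"
      using E(1) by (intro ball_doubling_mono[OF W, of _ _ x "2 * r"]) auto
    also have "\<dots> \<le> D' * measure W (ball x r)" by (rule ball_doublingD(7)[OF W r])
    also have "\<dots> \<le> (\<delta> * \<beta> ^ m) * measure W (ball x r)"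
      using m \<delta> by (intro mult_right_mono) (auto simp: field_simps)
    finally have "\<beta> ^ m * measure W F \<le> \<beta> ^ m * (\<delta> * measure W (ball x r))"
      using E(3) by (simp add: mult_ac)
    then show "measure W F \<le> \<delta> * measure W (ball x r)" using \<beta> by simp
  qed
qed assumption+

section \<open>Extended real powers, doubling weights and the Muckenhoupt condition\<close>

lemma ennreal_powr_real:
  assumes "0 \<le> x" "0 < x \<or> 0 < a"
  shows "ennreal_powr (ennreal x) a = ennreal (x powr a)"
  using assms by (cases "x = 0") (auto simp: ennreal_powr_def)

lemma ennreal_powr_measurable [measurable]:
  assumes [measurable]: "f \<in> borel_measurable M"
  shows "(\<lambda>x. ennreal_powr (f x) a) \<in> borel_measurable M"
  unfolding ennreal_powr_def by measurable

lemma ennreal_powr_mono: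
  assumes "x \<le> y" "0 \<le> a"
  shows "ennreal_powr x a \<le> ennreal_powr y a"
proof (cases "y = \<infinity> \<or> a = 0 \<or> x = 0")
  case True
  then show ?thesis using assms by (auto simp: ennreal_powr_def)
next
  case False
  then obtain x' y' where "x = ennreal x'" "0 \<le> x'" "y = ennreal y'" "0 \<le> y'"
    using assms(1) by (cases x; cases y) (auto simp: top_unique)
  then show ?thesis
    using assms False by (auto simp: ennreal_powr_real ennreal_le_iff intro!: powr_mono2)
qed

lemma doubling_measureD:
  assumes "doubling_measure M"
  shows "\<exists>D. ball_doubling M D" "0 < r \<Longrightarrow> 0 < measure M (ball x r)"
proof -
  obtain C where C: "\<And>x r. 0 < r \<Longrightarrow> emeasure M (ball x (2 * r)) \<le> ennreal C * emeasure M (ball x r)"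
    using assms by (auto simp: doubling_measure_def)
  have fin: "emeasure M (ball x r) < \<infinity>" for x r
    using assms by (cases "0 < r") (auto simp: doubling_measure_def ball_empty)
  have "emeasure M (ball x (2 * r)) \<le> ennreal (max 1 C) * emeasure M (ball x r)" if "0 < r" for x r
    using C[OF that, of x] by (rule order.trans) (intro mult_right_mono ennreal_leI, auto)
  then have "ball_doubling M (max 1 C)"
    using assms fin by (auto simp: ball_doubling_def doubling_measure_def)
  then show "\<exists>D. ball_doubling M D" by blast
  show "0 < r \<Longrightarrow> 0 < measure M (ball x r)"
    using assms unfolding measure_def doubling_measure_def enn2real_positive_iff by (auto simp: less_top)
qed

text \<open>Local integrability gives a finite integral only on some small ball around each point;
  doubling carries the finiteness to all radii.\<close>

lemma doubling_weightD:
  assumes M: "doubling_measure M" and w: "doubling_weight M w"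
  shows "\<exists>D. ball_doubling (density M (\<lambda>x. ennreal (w x))) D"
proof -
  let ?W = "density M (\<lambda>x. ennreal (w x))"
  have sM: "sets M = sets borel" using M by (simp add: doubling_measure_def)
  have wm [measurable]: "w \<in> borel_measurable M" and w0: "\<And>x. 0 \<le> w x"
    and loc: "locally_integrable M UNIV w"
    using w by (auto simp: doubling_weight_def weight_def)
  have em: "emeasure ?W (ball x r) = (\<integral>\<^sup>+y\<in>ball x r. ennreal (w y) \<partial>M)" for x r
    using sM by (intro emeasure_density) auto
  obtain C where C: "\<And>x r. 0 < r \<Longrightarrow> emeasure ?W (ball x (2 * r)) \<le> ennreal C * emeasure ?W (ball x r)"
    using w unfolding doubling_weight_def em by auto
  have fin: "emeasure ?W (ball x R) < \<infinity>" for x R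
  proof -
    obtain r where r: "0 < r" "set_integrable M (ball x r) w"
      using loc by (auto simp: locally_integrable_def)
    have "(\<integral>\<^sup>+y\<in>ball x r. ennreal (w y) \<partial>M) = (\<integral>\<^sup>+y. ennreal (norm (indicator (ball x r) y *\<^sub>R w y)) \<partial>M)"
      using w0 by (intro nn_integral_cong) (auto split: split_indicator)
    also have "\<dots> < \<infinity>"
      using r(2) by (auto simp: set_integrable_def integrable_iff_bounded)
    finally have f0: "emeasure ?W (ball x r) < \<infinity>" by (simp add: em)
    have f: "emeasure ?W (ball x (2 ^ k * r)) < \<infinity>" for k
    proof (induction k)
      case (Suc k)
      have "emeasure ?W (ball x (2 * (2 ^ k * r))) \<le> ennreal C * emeasure ?W (ball x (2 ^ k * r))"
        using r(1) by (intro C) simp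
      also have "\<dots> < \<infinity>" using Suc by (simp add: ennreal_mult_less_top)
      finally show ?case by (simp add: mult.assoc)
    qed (use f0 in simp)
    obtain k where "R / r < 2 ^ k" using real_arch_pow[of 2 "R / r"] by auto
    then have "R \<le> 2 ^ k * r" using r(1) by (simp add: field_simps)
    then have "emeasure ?W (ball x R) \<le> emeasure ?W (ball x (2 ^ k * r))"
      using sM by (intro emeasure_mono subset_ball) auto
    then show ?thesis using f[of k] by (rule le_less_trans)
  qed
  have "emeasure ?W (ball x (2 * r)) \<le> ennreal (max 1 C) * emeasure ?W (ball x r)" if "0 < r" for x r
    using C[OF that, of x] by (rule order.trans) (intro mult_right_mono ennreal_leI, auto)
  then have "ball_doubling ?W (max 1 C)"
    using fin sM by (auto simp: ball_doubling_def)
  then show ?thesis by blast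
qed

text \<open>Outside a quarter of the ball the weight is at least a constant multiple of its mean: by
  the essential bound on the reciprocal for \<open>t = 1\<close>, by Chebyshev for the dual power
  with exponent \<open>- 1 / (t - 1)\<close> otherwise. A set filling half of the ball still has a
  quarter of the ball on which this lower bound is valid.\<close>

lemma muckenhoupt_half:
  assumes M: "doubling_measure M" and w: "doubling_weight M w" and A: "muckenhoupt M t w" "1 \<le> t"
  obtains c where "0 < c"
    "\<And>x r F. F \<in> sets borel \<Longrightarrow> F \<subseteq> ball x r \<Longrightarrow> 0 < r \<Longrightarrow> measure M (ball x r) \<le> 2 * measure M F \<Longrightarrow>
       c * measure (density M (\<lambda>x. ennreal (w x))) (ball x r) \<le> measure (density M (\<lambda>x. ennreal (w x))) F"
proof -
  define W where "W = density M (\<lambda>x. ennreal (w x))"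
  obtain D where D: "ball_doubling M D" using doubling_measureD(1)[OF M] by blast
  note pos = doubling_measureD(2)[OF M]
  obtain D' where D': "ball_doubling W D'" unfolding W_def using doubling_weightD[OF M w] by blast
  have sM: "sets M = sets borel" and sW: "sets W = sets borel" using ball_doublingD(1) D D' by auto
  have wm [measurable]: "w \<in> borel_measurable M" and w0: "\<And>x. 0 \<le> w x"
    using w by (auto simp: doubling_weight_def weight_def)
  have em: "emeasure W F = (\<integral>\<^sup>+y\<in>F. ennreal (w y) \<partial>M)" if "F \<in> sets borel" for F
    unfolding W_def using sM that by (intro emeasure_density) auto
  define Q where "Q x r = (if t = 1 then esssup (restrict_space M (ball x r)) (\<lambda>y. inverse (ennreal (w y)))
         else ennreal_powr
                (nn_avg M (ball x r) (\<lambda>y. ennreal_powr (ennreal (w y)) (1 - t / (t - 1)))) (t - 1))" for x r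
  define S where "S = (SUP (x, r) \<in> UNIV \<times> {0<..}. nn_avg M (ball x r) (\<lambda>y. ennreal (w y)) * Q x r)"
  have "S < \<infinity>" using A(1) unfolding muckenhoupt_def S_def Q_def by simp
  then obtain S' where S': "S = ennreal S'" "0 \<le> S'" by (cases S) auto
  define A' where "A' = max 1 S'"
  have A': "1 \<le> A'" by (simp add: A'_def)
  have avgW: "nn_avg M (ball x r) (\<lambda>y. ennreal (w y)) = ennreal (measure W (ball x r) / measure M (ball x r))"
    if "0 < r" for x r
  proof -
    have "nn_avg M (ball x r) (\<lambda>y. ennreal (w y)) = emeasure W (ball x r) / emeasure M (ball x r)"
      by (simp add: nn_avg_def em)
    also have "\<dots> = ennreal (measure W (ball x r)) / ennreal (measure M (ball x r))"
      using ball_doubling_fmeasurable(2)[OF D, of "ball x r" x r] ball_doubling_fmeasurable(2)[OF D', of "ball x r" x r]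
      by simp
    also have "\<dots> = ennreal (measure W (ball x r) / measure M (ball x r))"
      using pos[OF that, of x] by (simp add: divide_ennreal)
    finally show ?thesis .
  qed
  have SQ: "ennreal (measure W (ball x r) / measure M (ball x r)) * Q x r \<le> ennreal A'" if r: "0 < r" for x r
  proof -
    have "nn_avg M (ball x r) (\<lambda>y. ennreal (w y)) * Q x r \<le> S"
      unfolding S_def by (rule SUP_upper2[of "(x, r)"]) (use r in auto)
    also have "\<dots> \<le> ennreal A'" unfolding S' A'_def by (intro ennreal_leI) simp
    finally show ?thesis using avgW[OF r] by simp
  qed
  \<comment> \<open>\<open>A'\<close> bounds the Muckenhoupt products; \<open>4 powr (1 - t)\<close>
    is the loss from applying Chebyshev at four times the bound on the mean.\<close>
  define \<theta> where "\<theta> = 4 powr (1 - t) / A'"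
  have \<theta>: "0 < \<theta>" using A' by (simp add: \<theta>_def)
  have good: "\<exists>G. G \<in> sets M \<and> measure M G \<le> measure M (ball x r) / 4 \<and> emeasure M G < \<infinity> \<and>
      (\<forall>y\<in>ball x r - G. \<theta> * (measure W (ball x r) / measure M (ball x r)) \<le> w y)"
    if r: "0 < r" and p: "0 < measure W (ball x r)" for x r
  proof -
    define a where "a = measure W (ball x r) / measure M (ball x r)"
    have a: "0 < a" using p pos[OF r] by (simp add: a_def)
    have aQ: "ennreal a * Q x r \<le> ennreal A'" using SQ[OF r] by (simp add: a_def)
    \<comment> \<open>Positivity of the mean of \<open>w\<close> is essential here: for
      \<open>w = 0\<close> almost everywhere on the ball the dual factor is infinite while the
      product is 0.\<close>
    have "Q x r \<noteq> top"
    proof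
      assume "Q x r = top"
      then have "ennreal a * Q x r = top" using a by (simp add: ennreal_mult_eq_top_iff)
      with aQ show False by (simp add: top_unique)
    qed
    then obtain q where q: "Q x r = ennreal q" "0 \<le> q" by (cases "Q x r") auto
    have qa: "q \<le> A' / a" using aQ a q A' by (simp add: q ennreal_mult'[symmetric] ennreal_le_iff field_simps)
    have B: "ball x r \<in> sets M" using sM by auto
    show ?thesis
    proof (cases "t = 1")
      case True
      have "AE y in restrict_space M (ball x r). inverse (ennreal (w y)) \<le> Q x r"
        unfolding Q_def using True by (simp add: esssup_AE)
      then have "AE y in M. y \<in> ball x r \<longrightarrow> inverse (ennreal (w y)) \<le> Q x r"
        using B by (subst (asm) AE_restrict_space_iff) auto
      then obtain N where N: "{y\<in>space M. \<not> (y \<in> ball x r \<longrightarrow> inverse (ennreal (w y)) \<le> Q x r)} \<subseteq> N"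
        "emeasure M N = 0" "N \<in> sets M" by (rule AE_E)
      have "\<theta> * a \<le> w y" if y: "y \<in> ball x r - N" for y
      proof -
        have le: "inverse (ennreal (w y)) \<le> ennreal q" using N(1) y q ball_doublingD(2)[OF D] by auto
        have wy: "0 < w y"
        proof (rule ccontr)
          assume "\<not> 0 < w y"
          then have "w y = 0" using w0[of y] by simp
          then show False using le by (simp add: top_unique)
        qed
        then have "1 / w y \<le> q" using le q(2) by (simp add: inverse_ennreal ennreal_le_iff divide_inverse)
        then have "1 / w y \<le> A' / a" using qa by simp
        then have "a / A' \<le> w y" using wy a A' by (simp add: field_simps)
        then show ?thesis using True by (simp add: \<theta>_def)
      qed
      then show ?thesis using N pos[OF r, of x] by (intro exI[of _ N]) (auto simp: a_def measure_def)
    next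
      case False
      then have t: "1 < t" using A(2) by simp
      define u where "u y = ennreal_powr (ennreal (w y)) (1 - t / (t - 1))" for y
      have um [measurable]: "u \<in> borel_measurable M" unfolding u_def by measurable
      define U where "U = nn_avg M (ball x r) u"
      have Qu: "ennreal_powr U (t - 1) = ennreal q"
        using q(1) False unfolding Q_def U_def u_def by simp
      \<comment> \<open>Upper bound for the mean \<open>U\<close> of the dual power, solved from
        \<open>a * U powr (t - 1) \<le> A'\<close>.\<close>
      define lm where "lm = (A' / a) powr (1 / (t - 1))"
      have l: "0 < lm" using A' a by (simp add: lm_def)
      have "U \<noteq> \<infinity>" using Qu t by (auto simp: ennreal_powr_def)
      then obtain U' where U': "U = ennreal U'" "0 \<le> U'" by (cases U) auto
      have "U' powr (t - 1) = q" using Qu U' t q(2) by (simp add: ennreal_powr_real)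
      then have "(U' powr (t - 1)) powr (1 / (t - 1)) \<le> lm"
        unfolding lm_def using qa t q(2) by (intro powr_mono2) auto
      then have U'l: "U' \<le> lm" using t U'(2) by (simp add: powr_powr)
      define m where "m = measure M (ball x r)"
      have m: "0 < m" using pos[OF r] by (simp add: m_def)
      have mB: "emeasure M (ball x r) = ennreal m"
        unfolding m_def by (rule ball_doubling_fmeasurable(2)[OF D, of _ x r]) auto
      have "set_nn_integral M (ball x r) u = U * ennreal m"
        unfolding U_def nn_avg_def mB using m
        by (simp add: divide_ennreal_def mult.assoc inverse_ennreal ennreal_mult'[symmetric])
      then have int: "set_nn_integral M (ball x r) u \<le> ennreal (lm * m)"
        using U' U'l m l by (simp add: ennreal_mult'[symmetric] mult_right_mono)
      \<comment> \<open>The set where the dual power reaches four times the bound on its mean;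
        Chebyshev leaves it at most a quarter of the ball.\<close>
      define G where "G = {y\<in>ball x r. 1 \<le> ennreal (1 / (4 * lm)) * u y}"
      have "emeasure M G \<le> ennreal (1 / (4 * lm)) * set_nn_integral M (ball x r) u"
        unfolding G_def using B um by (intro nn_integral_Markov_inequality borel_measurable_times borel_measurable_indicator) auto
      also have "\<dots> \<le> ennreal (1 / (4 * lm)) * ennreal (lm * m)" using int by (rule mult_left_mono) simp
      also have "\<dots> = ennreal (m / 4)" using l m by (simp add: ennreal_mult'[symmetric])
      finally have G4: "emeasure M G \<le> ennreal (m / 4)" .
      have "{y\<in>space M. 1 \<le> ennreal (1 / (4 * lm)) * u y} \<in> sets M" by measurable
      moreover have "G = ball x r \<inter> {y\<in>space M. 1 \<le> ennreal (1 / (4 * lm)) * u y}"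
        using ball_doublingD(2)[OF D] by (auto simp: G_def)
      ultimately have Gs: "G \<in> sets M" using B by auto
      have "\<theta> * a \<le> w y" if y: "y \<in> ball x r - G" for y
      proof -
        have nle: "ennreal (1 / (4 * lm)) * u y < 1" using y by (auto simp: G_def not_le)
        have e: "1 - t / (t - 1) = - (1 / (t - 1))" using t by (simp add: field_simps)
        \<comment> \<open>The convention of \<open>ennreal_powr\<close> makes the dual power
          infinite where \<open>w\<close> vanishes, so zeros of \<open>w\<close> in the ball belong
          to \<open>G\<close>.\<close>
        have wy: "0 < w y"
        proof (rule ccontr)
          assume "\<not> 0 < w y"
          then have "u y = \<infinity>" using w0[of y] t unfolding u_def e by (auto simp: ennreal_powr_def)
          then have "ennreal (1 / (4 * lm)) * u y = top" using l by (simp add: ennreal_mult_eq_top_iff)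
          then show False using nle by simp
        qed
        then have "u y = ennreal (w y powr (- (1 / (t - 1))))"
          unfolding u_def e by (intro ennreal_powr_real) auto
        then have "ennreal (1 / (4 * lm) * w y powr (- (1 / (t - 1)))) < ennreal 1"
          using nle l by (simp add: ennreal_mult'[symmetric])
        then have "1 / (4 * lm) * w y powr (- (1 / (t - 1))) < 1"
          using l by (subst (asm) ennreal_less_iff) auto
        then have "w y powr (- (1 / (t - 1))) \<le> 4 * lm"
          using l by (simp add: field_simps)
        then have "(4 * lm) powr (- (t - 1)) \<le> (w y powr (- (1 / (t - 1)))) powr (- (t - 1))"
          using t wy by (intro powr_mono2') auto
        also have "\<dots> = w y powr ((- (1 / (t - 1))) * (- (t - 1)))" by (rule powr_powr)
        also have "(- (1 / (t - 1))) * (- (t - 1)) = 1"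
          using t nonzero_eq_divide_eq[of "t - 1" "1 / (t - 1)" 1] by (simp only: minus_mult_minus) simp
        also have "w y powr 1 = w y" using wy by simp
        also have "(4 * lm) powr (- (t - 1)) = 4 powr (1 - t) * lm powr (- (t - 1))"
          using l by (simp add: powr_mult)
        also have "lm powr (- (t - 1)) = a / A'"
        proof -
          have "lm powr (- (t - 1)) = (A' / a) powr ((1 / (t - 1)) * (- (t - 1)))"
            unfolding lm_def by (rule powr_powr)
          also have "(1 / (t - 1)) * (- (t - 1)) = - 1"
            using t nonzero_eq_divide_eq[of "t - 1" "1 / (t - 1)" 1] by (simp only: mult_minus_right) simp
          also have "(A' / a) powr (- 1) = a / A'" using a A' by (simp add: powr_minus_divide)
          finally show ?thesis .
        qed
        finally show ?thesis by (simp add: \<theta>_def)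
      qed
      moreover have "emeasure M G < \<infinity>" using G4 by (rule le_less_trans) simp
      moreover have "measure M G \<le> m / 4"
        unfolding measure_def using G4 m by (intro enn2real_leI) auto
      ultimately show ?thesis using Gs by (intro exI[of _ G]) (auto simp: a_def m_def)
    qed
  qed
  show thesis
  proof (rule that[of "\<theta> / 4"])
    show "0 < \<theta> / 4" using \<theta> by simp
    fix x r F assume F: "F \<in> sets borel" "F \<subseteq> ball x r" and r: "0 < r" and h: "measure M (ball x r) \<le> 2 * measure M F"
    have "\<theta> / 4 * measure W (ball x r) \<le> measure W F"
    proof (cases "measure W (ball x r) = 0")
      case False
      define m where "m = measure M (ball x r)"
      define a where "a = measure W (ball x r) / m"
      have "0 < measure W (ball x r)" using False measure_nonneg[of W] by (simp add: less_le)
      from good[OF r this] obtain G where G: "G \<in> sets M" "measure M G \<le> m / 4" "emeasure M G < \<infinity>"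
        "\<And>y. y \<in> ball x r - G \<Longrightarrow> \<theta> * a \<le> w y" by (auto simp: m_def a_def)
      have m: "0 < m" using pos[OF r] by (simp add: m_def)
      have a: "0 \<le> a" using m by (simp add: a_def)
      have Gb: "G \<in> sets borel" using G(1) sM by simp
      have FG: "F - G \<in> sets borel" "F - G \<subseteq> ball x r" "F \<inter> G \<in> sets borel" using F Gb by auto
      have "measure M F = measure M (F \<inter> G) + measure M (F - G)"
        by (rule ball_doubling_split[OF D F(1) Gb F(2)])
      moreover have "measure M (F \<inter> G) \<le> measure M G"
        using G FG(3) sM by (intro measure_mono_fmeasurable) (auto intro: fmeasurableI)
      ultimately have FG4: "m / 4 \<le> measure M (F - G)" using h G(2) by (simp add: m_def)
      have "ennreal (\<theta> * a) * emeasure M (F - G) = (\<integral>\<^sup>+y\<in>F - G. ennreal (\<theta> * a) \<partial>M)"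
        using FG(1) sM by (intro nn_integral_cmult_indicator[symmetric]) simp
      also have "\<dots> \<le> (\<integral>\<^sup>+y\<in>F - G. ennreal (w y) \<partial>M)"
        using G(4) F(2) by (intro nn_integral_mono) (auto intro!: ennreal_leI split: split_indicator)
      also have "\<dots> = emeasure W (F - G)" by (rule em[OF FG(1), symmetric])
      finally have "\<theta> * a * measure M (F - G) \<le> measure W (F - G)"
        using ball_doubling_fmeasurable(2)[OF D FG(1,2)] ball_doubling_fmeasurable(2)[OF D' FG(1,2)] \<theta> a
        by (simp add: ennreal_mult'[symmetric] ennreal_le_iff)
      moreover have "\<theta> * a * (m / 4) \<le> \<theta> * a * measure M (F - G)"
        using FG4 \<theta> a by (intro mult_left_mono) auto
      moreover have "measure W (F - G) \<le> measure W F"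
        using F FG by (intro ball_doubling_mono[OF D' _ _ _ F(2)]) auto
      moreover have "\<theta> * a * (m / 4) = \<theta> / 4 * measure W (ball x r)" using m by (simp add: a_def)
      ultimately show ?thesis by linarith
    qed simp
    then show "\<theta> / 4 * measure (density M (\<lambda>x. ennreal (w x))) (ball x r) \<le> measure (density M (\<lambda>x. ennreal (w x))) F"
      by (simp add: W_def)
  qed
qed

subsection \<open>John domains\<close>

text \<open>What the argument retains of the hypotheses on \<open>M\<close>, \<open>w\<close>,
  \<Omega> and \<phi>. Of the Muckenhoupt condition only \<open>half\<close> is left. The curves are
  1-Lipschitz on a common interval of length \<open>CJ * bdist \<Omega> x0\<close>. The constant
  \<open>c0\<close> is there because balls of a metric space may be disconnected: a ball can leave
  \<Omega> without meeting the frontier, so \<open>bdist\<close> alone does not tell which balls lie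
  in \<Omega>. With a nonempty frontier \<open>bdist\<close> is positive on the open set
  \<Omega>.\<close>

locale john_setting =
  fixes M W :: "'a::metric_space measure" and \<Omega> :: "'a set" and x0 :: 'a
    and D D' c CJ c0 D\<phi> :: real and \<phi> :: "real \<Rightarrow> real"
  assumes M: "ball_doubling M D" and pos: "\<And>x r. 0 < r \<Longrightarrow> 0 < measure M (ball x r)"
    and W: "ball_doubling W D'" and null: "null_sets M \<subseteq> null_sets W"
    and c: "0 < c" and half: "\<And>x r F. F \<in> sets borel \<Longrightarrow> F \<subseteq> ball x r \<Longrightarrow> 0 < r \<Longrightarrow>
          measure M (ball x r) \<le> 2 * measure M F \<Longrightarrow> c * measure W (ball x r) \<le> measure W F"
    and \<Omega>: "open \<Omega>" "bounded \<Omega>" "frontier \<Omega> \<noteq> {}"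
    and x0: "x0 \<in> \<Omega>" and CJ: "1 \<le> CJ"
    and john_curve: "\<And>y. y \<in> \<Omega> \<Longrightarrow> \<exists>\<kappa>. \<kappa> 0 = y \<and> \<kappa> (CJ * bdist \<Omega> x0) = x0 \<and>
          (\<forall>t. 0 \<le> t \<and> t \<le> CJ * bdist \<Omega> x0 \<longrightarrow> \<kappa> t \<in> \<Omega> \<and> t / CJ \<le> bdist \<Omega> (\<kappa> t)) \<and>
          (\<forall>s t. 0 \<le> s \<and> s \<le> t \<and> t \<le> CJ * bdist \<Omega> x0 \<longrightarrow> dist (\<kappa> s) (\<kappa> t) \<le> t - s)"
    and c0: "0 < c0" "\<And>x. x \<in> \<Omega> \<Longrightarrow> ball x (c0 * bdist \<Omega> x) \<subseteq> \<Omega>"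
    and \<phi>: "\<And>t. 0 < t \<Longrightarrow> 0 < \<phi> t" "mono_on {0<..} \<phi>" "\<And>t. 0 < t \<Longrightarrow> \<phi> (2 * t) \<le> D\<phi> * \<phi> t"
begin

definition "R0 = CJ * bdist \<Omega> x0"

lemma bdist_pos: "x \<in> \<Omega> \<Longrightarrow> 0 < bdist \<Omega> x"
  using \<Omega> infdist_nonneg[of x "frontier \<Omega>"] in_closed_iff_infdist_zero[OF frontier_closed \<Omega>(3), of x]
  by (auto simp: bdist_def frontier_def interior_open less_le)

lemma bdist_lipschitz: "bdist \<Omega> x \<le> bdist \<Omega> y + dist x y"
  unfolding bdist_def by (rule infdist_triangle)

lemma bdist_continuous: "continuous_on S (bdist \<Omega>)"
  unfolding bdist_def by (intro continuous_intros)

lemma R0_pos: "0 < R0"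
  using bdist_pos[OF x0] CJ by (simp add: R0_def)

lemma sets_M: "sets M = sets borel" and sets_W: "sets W = sets borel"
  using ball_doublingD(1) M W by auto

text \<open>The width \<tau> also enlarges the radius, so that a curve starting in the layer and
  followed for a time comparable to \<tau> stays in a wider layer with the same \<open>z\<close> and
  \<open>Q\<close>.\<close>

definition layer :: "'a \<Rightarrow> real \<Rightarrow> real \<Rightarrow> 'a set" where
  "layer z Q \<tau> = {y\<in>\<Omega>. dist z y < Q + \<tau> \<and> bdist \<Omega> y < \<tau>}"

lemma layer_open: "open (layer z Q \<tau>)"
proof -
  have "layer z Q \<tau> = \<Omega> \<inter> ({y. dist z y < Q + \<tau>} \<inter> {y. bdist \<Omega> y < \<tau>})" by (auto simp: layer_def)
  moreover have "open {y. bdist \<Omega> y < \<tau>}"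
    by (intro open_Collect_less bdist_continuous continuous_intros)
  moreover have "open {y. dist z y < Q + \<tau>}"
    by (intro open_Collect_less continuous_intros)
  ultimately show ?thesis using \<Omega>(1) by auto
qed

lemma layer_sub: "layer z Q \<tau> \<subseteq> ball z (Q + \<tau>)"
  by (auto simp: layer_def)

text \<open>From a point of the layer the John curve leads, at comparable distance, to a ball
  inside the larger layer but outside the given one.\<close>

lemma layer_step:
  obtains \<beta> where "1 < \<beta>"
    "\<And>z Q \<tau>. 0 < \<tau> \<Longrightarrow> 0 \<le> Q \<Longrightarrow> 2 * CJ * \<tau> \<le> R0 \<Longrightarrow>
       \<beta> * measure W (layer z Q \<tau>) \<le> measure W (layer z Q ((2 * CJ + 2) * \<tau>))"
proof -
  define c' where "c' = min (1/2) c0"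
  have c': "0 < c'" "c' \<le> 1/2" "c' \<le> c0" using c0(1) by (auto simp: c'_def)
  \<comment> \<open>At time \<open>2 * CJ * \<tau>\<close> the curve has depth at least
    \<open>2 * \<tau>\<close>. The offset \<tau> of the starting point, this time and a ball of
    radius \<open>\<tau> / 2\<close> add up to less than \<open>N * \<tau>\<close>, while every
    point of that ball has depth at least \<tau> and so avoids the given layer.\<close>
  define N where "N = 2 * CJ + 2"
  obtain L where L: "1 \<le> L"
    "\<And>x y r R. 0 < r \<Longrightarrow> dist x y + R \<le> ((2 * CJ + 5 * (2 * CJ + 1)) / c') * r \<Longrightarrow> measure W (ball y R) \<le> L * measure W (ball x r)"
    using ball_compare[OF W, of "(2 * CJ + 5 * (2 * CJ + 1)) / c'"] by metis
  show thesis
  proof (rule that)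
    show "1 < 1 + 1 / L" using L(1) by simp
    fix z and Q \<tau> :: real assume \<tau>: "0 < \<tau>" and Q: "0 \<le> Q" and R: "2 * CJ * \<tau> \<le> R0"
    define A where "A = layer z Q (N * \<tau>) - layer z Q \<tau>"
    have A: "A \<in> sets borel" "A \<subseteq> ball z (Q + N * \<tau>)"
      using layer_open layer_sub[of z Q "N * \<tau>"] by (auto simp: A_def)
    define I where "I = {(y, r). y \<in> layer z Q \<tau> \<and> r = (2 * CJ + 1) * \<tau>}"
    define T where "T = (\<lambda>(y::'a, r::real). ball y (5 * r))"
    have i: "0 < r \<and> r \<le> (2 * CJ + 1) * \<tau> + Q + \<tau> \<and> dist z y \<le> (2 * CJ + 1) * \<tau> + Q + \<tau>" if "(y, r) \<in> I" for y r
    proof -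
      have r: "r = (2 * CJ + 1) * \<tau>" and y: "dist z y < Q + \<tau>" using that by (auto simp: I_def layer_def)
      have "0 < (2 * CJ + 1) * \<tau>" using CJ \<tau> by (intro mult_pos_pos) auto
      then show ?thesis using r y Q \<tau> by simp
    qed
    have TW: "T (y, r) \<in> sets W" "emeasure W (T (y, r)) < \<infinity>" for y r
      using ball_doublingD[OF W] by (auto simp: T_def)
    have le: "measure W (T (y, r)) \<le> L * measure W (A \<inter> ball y r)" if yr: "(y, r) \<in> I" for y r
    proof -
      have r: "r = (2 * CJ + 1) * \<tau>" and y: "y \<in> layer z Q \<tau>" using yr by (auto simp: I_def)
      then have y': "y \<in> \<Omega>" "dist z y < Q + \<tau>" "bdist \<Omega> y < \<tau>" by (auto simp: layer_def)
      obtain \<kappa> where \<kappa>: "\<kappa> 0 = y"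
        "\<And>t. 0 \<le> t \<Longrightarrow> t \<le> R0 \<Longrightarrow> \<kappa> t \<in> \<Omega> \<and> t / CJ \<le> bdist \<Omega> (\<kappa> t)"
        "\<And>s t. 0 \<le> s \<Longrightarrow> s \<le> t \<Longrightarrow> t \<le> R0 \<Longrightarrow> dist (\<kappa> s) (\<kappa> t) \<le> t - s"
        using john_curve[OF y'(1)] unfolding R0_def by blast
      define u where "u = \<kappa> (2 * CJ * \<tau>)"
      have t0: "0 \<le> 2 * CJ * \<tau>" using CJ \<tau> by simp
      have u: "u \<in> \<Omega>" "2 * \<tau> \<le> bdist \<Omega> u" "dist y u \<le> 2 * CJ * \<tau>"
        using \<kappa>(2)[OF t0 R] \<kappa>(3)[OF order.refl t0 R] \<kappa>(1) CJ by (auto simp: u_def)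
      have "c' * \<tau> \<le> c0 * bdist \<Omega> u"
        using c' \<tau> u(2) by (intro mult_mono) auto
      then have "ball u (c' * \<tau>) \<subseteq> \<Omega>" using c0(2)[OF u(1)] subset_ball by blast
      moreover have "x \<in> ball u (c' * \<tau>) \<Longrightarrow> dist z x < Q + N * \<tau> \<and> bdist \<Omega> x < N * \<tau> \<and> \<tau> \<le> bdist \<Omega> x \<and> dist y x < r" for x
      proof -
        assume "x \<in> ball u (c' * \<tau>)"
        moreover have "c' * \<tau> \<le> \<tau> / 2" using c'(2) \<tau> by simp
        ultimately have x: "dist u x < \<tau> / 2" by simp
        have "dist y x \<le> dist y u + dist u x" "dist z x \<le> dist z y + dist y x" by (rule dist_triangle)+
        moreover have "bdist \<Omega> x \<le> bdist \<Omega> y + dist x y" "bdist \<Omega> u \<le> bdist \<Omega> x + dist u x"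
          by (rule bdist_lipschitz)+
        ultimately show ?thesis
          using x u(2,3) y'(2,3) \<tau> by (simp add: N_def r algebra_simps dist_commute)
      qed
      ultimately have sub: "ball u (c' * \<tau>) \<subseteq> A \<inter> ball y r"
        by (force simp: A_def layer_def simp del: mem_ball simp: mem_ball[of _ y])
      have "measure W (T (y, r)) \<le> L * measure W (ball u (c' * \<tau>))"
        unfolding T_def prod.case
      proof (rule L(2))
        have "(2 * CJ + 5 * (2 * CJ + 1)) / c' * (c' * \<tau>) = 2 * CJ * \<tau> + 5 * r"
        proof -
          have "(2 * CJ + 5 * (2 * CJ + 1)) / c' * (c' * \<tau>) = (2 * CJ + 5 * (2 * CJ + 1)) * \<tau>"
            using c'(1) by simp
          then show ?thesis by (simp add: r algebra_simps)
        qed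
        then show "dist u y + 5 * r \<le> (2 * CJ + 5 * (2 * CJ + 1)) / c' * (c' * \<tau>)"
          using u(3) by (simp add: dist_commute)
      qed (use c' \<tau> in auto)
      also have "\<dots> \<le> L * measure W (A \<inter> ball y r)"
        using sub L(1) A by (intro mult_left_mono ball_doubling_mono[OF W, of _ _ y r]) auto
      finally show ?thesis .
    qed
    have "measure W (layer z Q \<tau>) \<le> L * measure W A"
    proof (rule covering_measure[where N = W and N' = W and M = M and I = I and T = T and A = A and c = L,
            OF M pos i TW sets_W A(1) ball_doubling_fmeasurable(3)[OF W A] le])
      fix G assume G: "\<And>z \<rho>. (z, \<rho>) \<in> I \<Longrightarrow> \<exists>z' \<rho>'. (z', \<rho>') \<in> G \<and> \<rho> \<le> 2 * \<rho>' \<and> ball z \<rho> \<subseteq> ball z' (5 * \<rho>')"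
        "(\<Union>i\<in>G. T i) \<in> sets W" "emeasure W (\<Union>i\<in>G. T i) < \<infinity>"
        "measure W (\<Union>i\<in>G. T i) \<le> L * measure W A"
      have "layer z Q \<tau> \<subseteq> (\<Union>i\<in>G. T i)"
      proof
        fix y assume "y \<in> layer z Q \<tau>"
        then have yI: "(y, (2 * CJ + 1) * \<tau>) \<in> I" by (simp add: I_def)
        with G(1) obtain z' \<rho>' where *: "(z', \<rho>') \<in> G" "ball y ((2 * CJ + 1) * \<tau>) \<subseteq> ball z' (5 * \<rho>')" by blast
        have "y \<in> ball y ((2 * CJ + 1) * \<tau>)" using i[OF yI] by simp
        with * have "y \<in> T (z', \<rho>')" unfolding T_def by blast
        with * show "y \<in> (\<Union>i\<in>G. T i)" by blast
      qed
      then have "measure W (layer z Q \<tau>) \<le> measure W (\<Union>i\<in>G. T i)"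
        using G(2,3) layer_open[of z Q \<tau>] sets_W by (intro measure_mono_fmeasurable) (auto intro: fmeasurableI)
      with G(4) show ?thesis by simp
    qed (use L in auto)
    moreover have "layer z Q \<tau> \<subseteq> layer z Q (N * \<tau>)"
    proof -
      have "1 * \<tau> \<le> N * \<tau>" using CJ \<tau> by (intro mult_right_mono) (auto simp: N_def)
      then show ?thesis by (auto simp: layer_def)
    qed
    then have "layer z Q (N * \<tau>) \<inter> layer z Q \<tau> = layer z Q \<tau>" by auto
    then have "measure W (layer z Q (N * \<tau>)) = measure W (layer z Q \<tau>) + measure W A"
      unfolding A_def using layer_open
      by (subst ball_doubling_split[OF W _ _ layer_sub, where B = "layer z Q \<tau>"]) auto
    moreover have "(1 / L) * measure W (layer z Q \<tau>) \<le> measure W A"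
      if "measure W (layer z Q \<tau>) \<le> L * measure W A"
      using that L(1) by (simp add: field_simps)
    ultimately show "(1 + 1 / L) * measure W (layer z Q \<tau>) \<le> measure W (layer z Q ((2 * CJ + 2) * \<tau>))"
      by (simp add: N_def[symmetric] distrib_right)
  qed
qed

text \<open>Nested layers with widths growing by the factor \<open>N\<close>: each step multiplies
  the \<open>W\<close>-measure by at least \<beta>, and the largest layer lies in
  \<open>ball z (Q + \<rho>)\<close>. So the innermost one, of width \<open>\<eta> * \<rho>\<close>,
  carries at most the fraction \<open>1 / \<beta> ^ m\<close>. The restriction
  \<open>\<rho> \<le> R0\<close> keeps the curves long enough at every step.\<close>

lemma layer_small:
  assumes \<delta>: "0 < \<delta>"
  obtains \<eta> where "0 < \<eta>"
    "\<And>z Q \<rho>. 0 \<le> Q \<Longrightarrow> 0 < \<rho> \<Longrightarrow> \<rho> \<le> R0 \<Longrightarrow>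
       measure W {y\<in>\<Omega>. dist z y < Q \<and> bdist \<Omega> y < \<eta> * \<rho>} \<le> \<delta> * measure W (ball z (Q + \<rho>))"
proof (rule layer_step)
  fix \<beta> :: real assume \<beta>: "1 < \<beta>" and step: "\<And>z Q \<tau>. 0 < \<tau> \<Longrightarrow> 0 \<le> Q \<Longrightarrow> 2 * CJ * \<tau> \<le> R0 \<Longrightarrow>
       \<beta> * measure W (layer z Q \<tau>) \<le> measure W (layer z Q ((2 * CJ + 2) * \<tau>))"
  define N where "N = 2 * CJ + 2"
  have N: "1 < N" using CJ by (simp add: N_def)
  obtain m where m: "1 / \<delta> < \<beta> ^ m" using real_arch_pow[OF \<beta>] by blast
  define \<eta> where "\<eta> = 1 / (2 * CJ * N ^ m)"
  have \<eta>: "0 < \<eta>" using CJ N by (simp add: \<eta>_def)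
  show thesis
  proof (rule that[OF \<eta>])
    fix z and Q \<rho> :: real assume Q: "0 \<le> Q" and \<rho>: "0 < \<rho>" "\<rho> \<le> R0"
    define \<tau> where "\<tau> i = \<rho> / (2 * CJ * N ^ i)" for i
    have \<tau>: "0 < \<tau> i" "2 * CJ * \<tau> i \<le> R0" "\<tau> i = N * \<tau> (Suc i)" for i
    proof -
      show "0 < \<tau> i" using \<rho> CJ N by (simp add: \<tau>_def)
      have "1 \<le> N ^ i" using N by simp
      then have "\<rho> * 1 \<le> R0 * N ^ i" using \<rho> R0_pos by (intro mult_mono) auto
      then show "2 * CJ * \<tau> i \<le> R0" using CJ N by (simp add: \<tau>_def field_simps)
      show "\<tau> i = N * \<tau> (Suc i)" using N by (simp add: \<tau>_def)
    qed
    have iter: "\<beta> ^ i * measure W (layer z Q (\<tau> i)) \<le> measure W (layer z Q (\<tau> 0))" for i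
    proof (induction i)
      case (Suc i)
      have "\<beta> ^ Suc i * measure W (layer z Q (\<tau> (Suc i))) = \<beta> ^ i * (\<beta> * measure W (layer z Q (\<tau> (Suc i))))"
        by (simp add: mult_ac)
      also have "\<dots> \<le> \<beta> ^ i * measure W (layer z Q (\<tau> i))"
        using step[OF \<tau>(1)[of "Suc i"] Q \<tau>(2)[of "Suc i"], of z] \<beta> \<tau>(3)[of i] by (intro mult_left_mono) (auto simp: N_def)
      finally show ?case using Suc by simp
    qed simp
    have sub0: "layer z Q (\<tau> 0) \<subseteq> ball z (Q + \<rho>)"
    proof -
      have "\<rho> * 1 \<le> \<rho> * (2 * CJ)" using \<rho> CJ by (intro mult_left_mono) auto
      then have "\<tau> 0 \<le> \<rho>" using CJ by (simp add: \<tau>_def field_simps)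
      then show ?thesis using layer_sub[of z Q "\<tau> 0"] subset_ball[of "Q + \<tau> 0" "Q + \<rho>" z] by auto
    qed
    have "\<eta> * \<rho> = \<tau> m" by (simp add: \<eta>_def \<tau>_def)
    then have "measure W {y\<in>\<Omega>. dist z y < Q \<and> bdist \<Omega> y < \<eta> * \<rho>} \<le> measure W (layer z Q (\<tau> m))"
    proof (intro ball_doubling_mono[OF W _ _ _ layer_sub])
      have "{y\<in>\<Omega>. dist z y < Q \<and> bdist \<Omega> y < \<eta> * \<rho>} = \<Omega> \<inter> ({y. dist z y < Q} \<inter> {y. bdist \<Omega> y < \<eta> * \<rho>})" by auto
      moreover have "open {y. dist z y < Q}" "open {y. bdist \<Omega> y < \<eta> * \<rho>}"
        by (intro open_Collect_less bdist_continuous continuous_intros)+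
      ultimately show "{y\<in>\<Omega>. dist z y < Q \<and> bdist \<Omega> y < \<eta> * \<rho>} \<in> sets borel" using \<Omega>(1) by auto
      show "layer z Q (\<tau> m) \<in> sets borel" using layer_open by auto
      show "{y\<in>\<Omega>. dist z y < Q \<and> bdist \<Omega> y < \<eta> * \<rho>} \<subseteq> layer z Q (\<tau> m)"
        if "\<eta> * \<rho> = \<tau> m" unfolding layer_def that using \<tau>(1)[of m] by auto
    qed
    also have "\<dots> \<le> \<delta> * (\<beta> ^ m * measure W (layer z Q (\<tau> m)))"
    proof -
      have "1 * measure W (layer z Q (\<tau> m)) \<le> (\<delta> * \<beta> ^ m) * measure W (layer z Q (\<tau> m))"
        using m \<delta> by (intro mult_right_mono) (auto simp: field_simps)
      then show ?thesis by (simp add: mult_ac)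
    qed
    also have "\<dots> \<le> \<delta> * measure W (ball z (Q + \<rho>))"
    proof (intro mult_left_mono order.trans[OF iter])
      show "measure W (layer z Q (\<tau> 0)) \<le> measure W (ball z (Q + \<rho>))"
        using sub0 layer_open[of z Q "\<tau> 0"] by (intro ball_doubling_mono[OF W, of _ _ z "Q + \<rho>"]) auto
    qed (use \<delta> in auto)
    finally show "measure W {y\<in>\<Omega>. dist z y < Q \<and> bdist \<Omega> y < \<eta> * \<rho>} \<le> \<delta> * measure W (ball z (Q + \<rho>))" .
  qed
qed

end

text \<open>Normalization of the given curves. The John condition at the end point bounds the length
  by \<open>CJ * bdist \<Omega> x0\<close>, so every curve can be prolonged by the constant
  \<open>x0\<close> to this common length. The two-point partition turns arc length into the
  Lipschitz bound.\<close>

lemma john_curve_exists: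
  assumes "bounded_john_domain \<Omega>"
  obtains x0 CJ where "x0 \<in> \<Omega>" "1 \<le> CJ"
    "\<And>y. y \<in> \<Omega> \<Longrightarrow> \<exists>\<kappa>. \<kappa> 0 = y \<and> \<kappa> (CJ * bdist \<Omega> x0) = x0 \<and>
          (\<forall>t. 0 \<le> t \<and> t \<le> CJ * bdist \<Omega> x0 \<longrightarrow> \<kappa> t \<in> \<Omega> \<and> t / CJ \<le> bdist \<Omega> (\<kappa> t)) \<and>
          (\<forall>s t. 0 \<le> s \<and> s \<le> t \<and> t \<le> CJ * bdist \<Omega> x0 \<longrightarrow> dist (\<kappa> s) (\<kappa> t) \<le> t - s)"
proof -
  obtain x0 C where x0: "x0 \<in> \<Omega>" and C: "1 \<le> C" and cur: "\<forall>x\<in>\<Omega>. \<exists>\<kappa> l. arc_length_curve \<kappa> l \<and> \<kappa> ` {0..l} \<subseteq> \<Omega> \<and>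
        \<kappa> 0 = x \<and> \<kappa> l = x0 \<and> (\<forall>t\<in>{0..l}. bdist \<Omega> (\<kappa> t) \<ge> t / C)"
    using assms unfolding bounded_john_domain_def by (elim conjE bexE exE) (rule that)
  show thesis
  proof (rule that[OF x0 C])
    fix y assume "y \<in> \<Omega>"
    from cur[rule_format, OF this] obtain \<kappa> l where \<kappa>: "arc_length_curve \<kappa> l" "\<kappa> ` {0..l} \<subseteq> \<Omega>" "\<kappa> 0 = y" "\<kappa> l = x0"
      "\<forall>t\<in>{0..l}. bdist \<Omega> (\<kappa> t) \<ge> t / C" by (elim conjE exE) (rule that)
    have l: "0 \<le> l" using \<kappa>(1) by (simp add: arc_length_curve_def)
    have lC: "l \<le> C * bdist \<Omega> x0" using \<kappa>(5)[rule_format, of l] \<kappa>(4) l C by (simp add: field_simps)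
    have lip: "dist (\<kappa> s) (\<kappa> t) \<le> t - s" if "0 \<le> s" "s \<le> t" "t \<le> l" for s t
    proof -
      have "ennreal (dist (\<kappa> s) (\<kappa> t)) \<le> curve_length \<kappa> s t"
        unfolding curve_length_def by (rule SUP_upper2[of "[s, t]"]) (use that in auto)
      also have "\<dots> = ennreal (t - s)" using \<kappa>(1) that by (auto simp: arc_length_curve_def)
      finally show ?thesis using that by (simp add: ennreal_le_iff)
    qed
    show "\<exists>\<kappa>. \<kappa> 0 = y \<and> \<kappa> (C * bdist \<Omega> x0) = x0 \<and>
          (\<forall>t. 0 \<le> t \<and> t \<le> C * bdist \<Omega> x0 \<longrightarrow> \<kappa> t \<in> \<Omega> \<and> t / C \<le> bdist \<Omega> (\<kappa> t)) \<and>
          (\<forall>s t. 0 \<le> s \<and> s \<le> t \<and> t \<le> C * bdist \<Omega> x0 \<longrightarrow> dist (\<kappa> s) (\<kappa> t) \<le> t - s)"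
    proof (intro exI[of _ "\<lambda>t. \<kappa> (min t l)"] conjI allI impI; (elim conjE)?)
      show "\<kappa> (min 0 l) = y" "\<kappa> (min (C * bdist \<Omega> x0) l) = x0" using \<kappa>(3,4) l lC by (auto simp: min_def)
      fix t assume t: "0 \<le> t" "t \<le> C * bdist \<Omega> x0"
      show "\<kappa> (min t l) \<in> \<Omega>" using \<kappa>(2) t l by auto
      show "t / C \<le> bdist \<Omega> (\<kappa> (min t l))"
        using \<kappa>(4) \<kappa>(5)[rule_format, of t] t C by (cases "t \<le> l") (auto simp: min_def field_simps)
    next
      fix s t assume t: "0 \<le> s" "s \<le> t" "t \<le> C * bdist \<Omega> x0"
      show "dist (\<kappa> (min s l)) (\<kappa> (min t l)) \<le> t - s"
        using lip[of "min s l" "min t l"] t l by (auto simp: min_def split: if_splits)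
    qed
  qed
qed

subsection \<open>Mean oscillation\<close>

definition osc :: "'a::metric_space measure \<Rightarrow> ('a \<Rightarrow> real) \<Rightarrow> 'a set \<Rightarrow> real" where
  "osc M \<psi> B = avg M B (\<lambda>y. \<bar>\<psi> y - avg M B \<psi>\<bar>)"

lemma bounded_set_integrable:
  fixes f :: "'a \<Rightarrow> real"
  assumes "f \<in> borel_measurable M" "\<And>x. \<bar>f x\<bar> \<le> k" "B \<in> fmeasurable M"
  shows "set_integrable M B f"
proof -
  have B: "B \<in> sets M" "emeasure M B < \<infinity>" using assms(3) by (auto simp: fmeasurable_def)
  show ?thesis
    unfolding set_integrable_def
    by (rule integrableI_bounded_set[where A = B and B = k])
      (use assms B in \<open>auto split: split_indicator\<close>)
qed

lemma abs_avg_le: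
  fixes \<psi> :: "'a::metric_space \<Rightarrow> real"
  assumes "\<psi> \<in> borel_measurable M" "\<And>x. 0 \<le> \<psi> x \<and> \<psi> x \<le> k" "B \<in> fmeasurable M" "0 < measure M B"
  shows "0 \<le> avg M B \<psi>" "avg M B \<psi> \<le> k"
proof -
  have k: "0 \<le> k" using assms(2)[of undefined] by linarith
  have i: "set_integrable M B \<psi>" using assms(1-3) k by (intro bounded_set_integrable[where k = k]) auto
  have "0 \<le> (LINT x:B|M. \<psi> x)"
    unfolding set_lebesgue_integral_def using assms(2) by (intro integral_nonneg_AE) auto
  then show "0 \<le> avg M B \<psi>" using assms(4) by (simp add: avg_def)
  have "(LINT x:B|M. \<psi> x) \<le> (LINT x:B|M. k)"
    using assms i by (intro set_integral_mono bounded_set_integrable[where k = k]) (auto simp: k)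
  also have "\<dots> = measure M B * k" using assms(3) by (simp add: set_lebesgue_integral_def fmeasurable_def)
  finally show "avg M B \<psi> \<le> k" using assms(4) by (simp add: avg_def field_simps)
qed

context
  fixes M :: "'a::metric_space measure" and \<psi> :: "'a \<Rightarrow> real" and k :: real and B :: "'a set"
  assumes meas: "\<psi> \<in> borel_measurable M" and bd: "\<And>x. 0 \<le> \<psi> x \<and> \<psi> x \<le> k"
    and B: "B \<in> fmeasurable M" and Bpos: "0 < measure M B"
begin

lemma osc_integrable: "set_integrable M B' (\<lambda>y. \<bar>\<psi> y - m\<bar>)" if "B' \<in> fmeasurable M"
proof (rule bounded_set_integrable[OF _ _ that])
  show "(\<lambda>y. \<bar>\<psi> y - m\<bar>) \<in> borel_measurable M" using meas by measurable
  show "\<bar>\<bar>\<psi> x - m\<bar>\<bar> \<le> k + \<bar>m\<bar>" for x using bd[of x] by linarith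
qed

lemma osc_eq: "osc M \<psi> B * measure M B = (LINT y:B|M. \<bar>\<psi> y - avg M B \<psi>\<bar>)"
  using Bpos by (simp add: osc_def avg_def[of M B "\<lambda>y. \<bar>\<psi> y - avg M B \<psi>\<bar>"])

text \<open>The deviation integrated over \<open>B'\<close> is at most its integral over
  \<open>B\<close>; the factor \<open>K\<close> pays for dividing by the smaller measure.\<close>

lemma avg_diff_le_osc:
  assumes B': "B' \<in> sets M" "B' \<subseteq> B" "0 < measure M B'" and K: "measure M B \<le> K * measure M B'"
  shows "\<bar>avg M B' \<psi> - avg M B \<psi>\<bar> \<le> K * osc M \<psi> B"
proof -
  define m where "m = avg M B \<psi>"
  have fB': "B' \<in> fmeasurable M" using fmeasurableI2[OF B B'(2,1)] .
  have k: "0 \<le> k" using bd[of undefined] by linarith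
  have i: "set_integrable M B' \<psi>" using bd k by (intro bounded_set_integrable[OF meas _ fB', of k]) auto
  have ic: "set_integrable M B' (\<lambda>_. m)" by (intro bounded_set_integrable[OF _ _ fB', of _ "\<bar>m\<bar>"]) auto
  have "(avg M B' \<psi> - m) * measure M B' = (LINT y:B'|M. \<psi> y) - measure M B' * m"
    using B'(3) by (simp add: avg_def algebra_simps)
  also have "measure M B' * m = (LINT y:B'|M. m)" using fB' by (simp add: set_lebesgue_integral_def fmeasurable_def)
  also have "(LINT y:B'|M. \<psi> y) - (LINT y:B'|M. m) = (LINT y:B'|M. \<psi> y - m)"
    using i ic by (rule set_integral_diff(2)[symmetric])
  finally have "\<bar>avg M B' \<psi> - m\<bar> * measure M B' = \<bar>LINT y:B'|M. \<psi> y - m\<bar>"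
    using B'(3) by (metis abs_mult abs_of_pos)
  also have "\<dots> \<le> (LINT y:B'|M. \<bar>\<psi> y - m\<bar>)"
    unfolding set_lebesgue_integral_def
    by (rule order.trans[OF integral_abs_bound]) (simp add: abs_mult)
  also have "\<dots> \<le> (LINT y:B|M. \<bar>\<psi> y - m\<bar>)"
    using osc_integrable[OF fB', of m] osc_integrable[OF B, of m] B'(2)
    unfolding set_lebesgue_integral_def set_integrable_def
    by (intro integral_mono) (auto split: split_indicator)
  also have "\<dots> = osc M \<psi> B * measure M B" by (simp add: osc_eq m_def)
  also have "\<dots> \<le> osc M \<psi> B * (K * measure M B')"
  proof (rule mult_left_mono[OF K])
    have "0 \<le> osc M \<psi> B * measure M B"
      unfolding osc_eq set_lebesgue_integral_def by (intro integral_nonneg_AE) auto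
    then show "0 \<le> osc M \<psi> B" using Bpos by (simp add: zero_le_mult_iff)
  qed
  finally have "\<bar>avg M B' \<psi> - m\<bar> * measure M B' \<le> (K * osc M \<psi> B) * measure M B'" by (simp add: mult_ac)
  then show ?thesis using B'(3) by (simp add: m_def)
qed

text \<open>Chebyshev's inequality for the deviation from the mean.\<close>

lemma osc_markov:
  assumes F: "F \<in> sets M" "F \<subseteq> B" and g: "\<And>y. y \<in> F \<Longrightarrow> g \<le> \<bar>\<psi> y - avg M B \<psi>\<bar>"
  shows "g * measure M F \<le> osc M \<psi> B * measure M B"
proof -
  have fF: "F \<in> fmeasurable M" using fmeasurableI2[OF B F(2,1)] .
  have "g * measure M F = (LINT y:F|M. g)" using fF by (simp add: set_lebesgue_integral_def fmeasurable_def)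
  also have "\<dots> \<le> (LINT y:B|M. \<bar>\<psi> y - avg M B \<psi>\<bar>)"
    using osc_integrable[OF B, of "avg M B \<psi>"] bounded_set_integrable[OF _ _ fF, of "\<lambda>_. g" "\<bar>g\<bar>"] g F(2)
    unfolding set_lebesgue_integral_def set_integrable_def
    by (intro integral_mono) (auto split: split_indicator)
  also have "\<dots> = osc M \<psi> B * measure M B" by (simp add: osc_eq)
  finally show ?thesis .
qed

end

section \<open>The measure \<nu> and the bad set\<close>

context john_setting
begin

text \<open>\<phi> is controlled only on positive arguments, while \<open>bdist\<close> vanishes on
  the frontier. The value 0 elsewhere makes the function monotone on the whole line, hence
  Borel.\<close>

definition "\<phi>p t = (if 0 < t then \<phi> t else 0)"

definition "\<nu> = density W (\<lambda>x. indicator \<Omega> x * ennreal (\<phi>p (bdist \<Omega> x)))"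

lemma D\<phi>_ge: "1 \<le> D\<phi>"
proof -
  have "\<phi> 1 \<le> \<phi> (2 * 1)" using \<phi>(2) by (auto simp: mono_on_def)
  also have "\<dots> \<le> D\<phi> * \<phi> 1" by (rule \<phi>(3)) simp
  finally show ?thesis using \<phi>(1)[of 1] by simp
qed

lemma \<phi>_pow: "0 < t \<Longrightarrow> \<phi> (2 ^ l * t) \<le> D\<phi> ^ l * \<phi> t"
proof (induction l)
  case (Suc l)
  have "\<phi> (2 * (2 ^ l * t)) \<le> D\<phi> * \<phi> (2 ^ l * t)" using Suc.prems by (intro \<phi>(3)) simp
  also have "\<dots> \<le> D\<phi> * (D\<phi> ^ l * \<phi> t)" using Suc D\<phi>_ge by (intro mult_left_mono) auto
  finally show ?case by (simp add: mult.assoc)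
qed simp

lemma \<phi>_mono: "0 < s \<Longrightarrow> s \<le> t \<Longrightarrow> \<phi> s \<le> \<phi> t"
  using \<phi>(2) by (auto simp: mono_on_def)

lemma \<phi>p_measurable: "(\<lambda>x. \<phi>p (bdist \<Omega> x)) \<in> borel_measurable borel"
proof -
  have "mono \<phi>p" unfolding mono_def \<phi>p_def using \<phi>_mono \<phi>(1) by (auto simp: less_imp_le)
  then have "\<phi>p \<in> borel_measurable borel" by (rule borel_measurable_mono)
  moreover have "bdist \<Omega> \<in> borel_measurable borel"
    using bdist_continuous by (rule borel_measurable_continuous_onI)
  ultimately show ?thesis by (rule measurable_compose[rotated])
qed

lemma sets_\<nu>: "sets \<nu> = sets borel"
  using sets_W by (simp add: \<nu>_def)

lemma emeasure_\<nu>: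
  assumes "F \<in> sets borel"
  shows "emeasure \<nu> F = (\<integral>\<^sup>+x\<in>F \<inter> \<Omega>. ennreal (\<phi>p (bdist \<Omega> x)) \<partial>W)"
proof -
  have [measurable]: "\<Omega> \<in> sets W" "F \<in> sets W" using \<Omega>(1) assms sets_W by auto
  have [measurable]: "(\<lambda>x. \<phi>p (bdist \<Omega> x)) \<in> borel_measurable W"
    using \<phi>p_measurable sets_W measurable_cong_sets by blast
  have "emeasure \<nu> F = (\<integral>\<^sup>+x. indicator \<Omega> x * ennreal (\<phi>p (bdist \<Omega> x)) * indicator F x \<partial>W)"
    unfolding \<nu>_def by (rule emeasure_density) measurable
  also have "\<dots> = (\<integral>\<^sup>+x\<in>F \<inter> \<Omega>. ennreal (\<phi>p (bdist \<Omega> x)) \<partial>W)"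
    by (intro nn_integral_cong) (auto split: split_indicator)
  finally show ?thesis .
qed

lemma \<Omega>_ball: obtains R where "0 < R" "\<Omega> \<subseteq> ball x0 R" "\<And>x. x \<in> \<Omega> \<Longrightarrow> bdist \<Omega> x \<le> R"
proof -
  obtain R where "\<forall>y\<in>\<Omega>. dist x0 y \<le> R" using \<Omega>(2) bounded_any_center[of \<Omega> x0] by blast
  then have R: "\<Omega> \<subseteq> cball x0 R" by auto
  show thesis
  proof (rule that[of "\<bar>R\<bar> + 1 + bdist \<Omega> x0"])
    have d: "0 < bdist \<Omega> x0" by (rule bdist_pos[OF x0])
    then show "0 < \<bar>R\<bar> + 1 + bdist \<Omega> x0" by linarith
    show "\<Omega> \<subseteq> ball x0 (\<bar>R\<bar> + 1 + bdist \<Omega> x0)" using R d by fastforce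
    show "bdist \<Omega> x \<le> \<bar>R\<bar> + 1 + bdist \<Omega> x0" if "x \<in> \<Omega>" for x
    proof -
      have "dist x0 x \<le> R" using R that by auto
      then show ?thesis using bdist_lipschitz[of x x0] by (simp add: dist_commute)
    qed
  qed
qed

lemma emeasure_\<nu>_le:
  assumes F: "F \<in> sets borel" "F \<subseteq> \<Omega>" "F \<subseteq> ball x R" and t: "0 < t" and le: "\<And>y. y \<in> F \<Longrightarrow> bdist \<Omega> y \<le> t"
  shows "emeasure \<nu> F \<le> ennreal (\<phi> t * measure W F)"
proof -
  have "F \<inter> \<Omega> = F" using F(2) by auto
  then have "emeasure \<nu> F = (\<integral>\<^sup>+x\<in>F. ennreal (\<phi>p (bdist \<Omega> x)) \<partial>W)"
    using emeasure_\<nu>[OF F(1)] by simp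
  also have "\<dots> \<le> (\<integral>\<^sup>+x\<in>F. ennreal (\<phi> t) \<partial>W)"
  proof (intro nn_integral_mono)
    fix y
    have "\<phi>p (bdist \<Omega> y) \<le> \<phi> t" if "y \<in> F"
      using le[OF that] F(2) that bdist_pos \<phi>_mono[of "bdist \<Omega> y" t] by (auto simp: \<phi>p_def)
    then show "ennreal (\<phi>p (bdist \<Omega> y)) * indicator F y \<le> ennreal (\<phi> t) * indicator F y"
      by (auto split: split_indicator intro: ennreal_leI)
  qed
  also have "\<dots> = ennreal (\<phi> t) * emeasure W F"
    using F(1) sets_W by (intro nn_integral_cmult_indicator) simp
  also have "\<dots> = ennreal (\<phi> t * measure W F)"
    using \<phi>(1)[OF t] ball_doubling_fmeasurable(2)[OF W F(1,3)] by (simp add: ennreal_mult' less_imp_le)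
  finally show ?thesis .
qed

text \<open>Depth is bounded on \<Omega> and \<phi> is increasing, so the improving weight is
  bounded and \<nu> inherits finiteness from \<open>W\<close> on balls.\<close>

lemma finite_\<nu>: "finite_measure \<nu>"
proof -
  obtain R where R: "0 < R" "\<Omega> \<subseteq> ball x0 R" "\<And>x. x \<in> \<Omega> \<Longrightarrow> bdist \<Omega> x \<le> R" using \<Omega>_ball by blast
  have "emeasure \<nu> UNIV = emeasure \<nu> \<Omega>"
    using emeasure_\<nu>[of UNIV] emeasure_\<nu>[of \<Omega>] \<Omega>(1) by simp
  also have "emeasure \<nu> \<Omega> \<le> ennreal (\<phi> R * measure W \<Omega>)"
    using \<Omega>(1) by (intro emeasure_\<nu>_le[OF _ _ R(2,1,3)]) auto
  finally have "emeasure \<nu> UNIV \<le> ennreal (\<phi> R * measure W \<Omega>)" .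
  then have "emeasure \<nu> UNIV < \<infinity>" by (rule le_less_trans) simp
  then show ?thesis
    by (intro finite_measureI) (simp add: sets_eq_imp_space_eq[OF sets_\<nu>] less_top)
qed

sublocale \<nu>: finite_measure \<nu> by (rule finite_\<nu>)

lemma \<nu>_le:
  assumes "F \<in> sets borel" "F \<subseteq> \<Omega>" "F \<subseteq> ball x R" "0 < t" "\<And>y. y \<in> F \<Longrightarrow> bdist \<Omega> y \<le> t"
  shows "measure \<nu> F \<le> \<phi> t * measure W F"
  using emeasure_\<nu>_le[OF assms] \<phi>(1)[OF assms(4)]
  by (simp add: \<nu>.emeasure_eq_measure ennreal_le_iff less_imp_le)

lemma \<nu>_ge:
  assumes F: "F \<in> sets borel" "F \<subseteq> \<Omega>" "F \<subseteq> ball x R" and t: "0 < t" and le: "\<And>y. y \<in> F \<Longrightarrow> t \<le> bdist \<Omega> y"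
  shows "\<phi> t * measure W F \<le> measure \<nu> F"
proof -
  have "ennreal (\<phi> t * measure W F) = ennreal (\<phi> t) * emeasure W F"
    using \<phi>(1)[OF t] ball_doubling_fmeasurable(2)[OF W F(1,3)] by (simp add: ennreal_mult' less_imp_le)
  also have "\<dots> = (\<integral>\<^sup>+x\<in>F. ennreal (\<phi> t) \<partial>W)"
    using F(1) sets_W by (intro nn_integral_cmult_indicator[symmetric]) simp
  also have "\<dots> \<le> (\<integral>\<^sup>+x\<in>F \<inter> \<Omega>. ennreal (\<phi>p (bdist \<Omega> x)) \<partial>W)"
  proof (intro nn_integral_mono)
    fix y
    have "\<phi> t \<le> \<phi>p (bdist \<Omega> y)" if "y \<in> F"
      using le[OF that] t \<phi>_mono[of t "bdist \<Omega> y"] by (auto simp: \<phi>p_def)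
    then show "ennreal (\<phi> t) * indicator F y \<le> ennreal (\<phi>p (bdist \<Omega> y)) * indicator (F \<inter> \<Omega>) y"
      using F(2) by (auto split: split_indicator intro: ennreal_leI)
  qed
  also have "\<dots> = emeasure \<nu> F" by (rule emeasure_\<nu>[OF F(1), symmetric])
  finally show ?thesis by (simp add: \<nu>.emeasure_eq_measure ennreal_le_iff)
qed

lemma null_\<nu>: "Z \<in> null_sets M \<Longrightarrow> measure \<nu> Z = 0"
proof -
  assume "Z \<in> null_sets M"
  then have Z: "Z \<in> null_sets W" using null by auto
  have "AE x in W. x \<notin> Z" using Z by (rule AE_not_in)
  have "emeasure \<nu> Z = (\<integral>\<^sup>+x\<in>Z \<inter> \<Omega>. ennreal (\<phi>p (bdist \<Omega> x)) \<partial>W)"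
    using null_setsD2[OF Z] sets_W by (intro emeasure_\<nu>) simp
  also have "\<dots> = (\<integral>\<^sup>+x. 0 \<partial>W)"
    using \<open>AE x in W. x \<notin> Z\<close> by (intro nn_integral_cong_AE) (auto split: split_indicator)
  finally have "emeasure \<nu> Z = 0" by simp
  then show ?thesis by (simp add: measure_def)
qed

lemma compare_M: obtains L where "1 \<le> L"
    "\<And>x y r R. 0 < r \<Longrightarrow> dist x y + R \<le> K * r \<Longrightarrow> measure M (ball y R) \<le> L * measure M (ball x r)"
  using ball_compare[OF M, of K] by metis

lemma compare_W: obtains L where "1 \<le> L"
    "\<And>x y r R. 0 < r \<Longrightarrow> dist x y + R \<le> K * r \<Longrightarrow> measure W (ball y R) \<le> L * measure W (ball x r)"
  using ball_compare[OF W, of K] by metis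

lemma ball_fm: "ball x r \<in> fmeasurable M"
  by (rule ball_doublingD[OF M])

text \<open>The parameter \<open>a\<close> decides which balls count as Whitney-type. The dilation
  by \<Lambda> is there so that a point whose chain passes through a strongly oscillating ball
  belongs to the set, although it may be far from that ball.\<close>

definition bad :: "real \<Rightarrow> real \<Rightarrow> ('a \<Rightarrow> real) \<Rightarrow> real \<Rightarrow> 'a set" where
  "bad a \<Lambda> \<psi> \<epsilon> = (\<Union>(z, r)\<in>{(z, r). z \<in> \<Omega> \<and> 0 < r \<and> r \<le> a * bdist \<Omega> z \<and> \<epsilon> < osc M \<psi> (ball z r)}. ball z (\<Lambda> * r))"

lemma bad_open: "open (bad a \<Lambda> \<psi> \<epsilon>)"
  unfolding bad_def by (auto intro!: open_UN)

lemma not_badD: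
  assumes "y \<notin> bad a \<Lambda> \<psi> \<epsilon>" "z \<in> \<Omega>" "0 < r" "r \<le> a * bdist \<Omega> z" "dist z y < \<Lambda> * r"
  shows "osc M \<psi> (ball z r) \<le> \<epsilon>"
  using assms unfolding bad_def by (force simp: not_less[symmetric])

end

section \<open>Chains of balls along John curves\<close>

text \<open>\<open>a \<le> c0\<close> keeps Whitney-type balls inside \<Omega>, and
  \<open>a \<le> 1/2\<close> keeps the depth on them comparable to that of the centre. A chain ball
  of radius \<open>2 * b * \<rho> i\<close> with \<open>b = a / (2 * CJ)\<close> serves points at
  distance up to \<open>\<rho> i\<close> from its centre; the bound on \<Lambda> says that the
  dilated chain ball contains them.\<close>

locale john_chain = john_setting +
  fixes a \<Lambda> :: real
  assumes a: "0 < a" "a \<le> c0" "a \<le> 1/2" and \<Lambda>: "2 * CJ / a \<le> \<Lambda>"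
begin

text \<open>The chain balls have radius \<open>2 b \<rho>\<^sub>i\<close> and are centred at the points \<open>\<rho>\<^sub>i\<close> of a John curve. The
  ratio of the \<open>\<rho>\<^sub>i\<close> makes consecutive centres at most \<open>b \<rho>\<^sub>i\<close> apart.\<close>

definition "b = a / (2 * CJ)"
definition "sg = 1 - b"
definition "\<rho> i = R0 * sg ^ i"

lemma b: "0 < b" "b \<le> 1/4" "1 \<le> \<Lambda> * b" "2 * b = a / CJ"
proof -
  show "0 < b" using a CJ by (simp add: b_def)
  have "2 * a \<le> CJ" using a CJ by linarith
  then show "b \<le> 1/4" using CJ by (simp add: b_def field_simps)
  have "2 * CJ / a * b = 1" using a CJ by (simp add: b_def)
  then show "1 \<le> \<Lambda> * b" using mult_right_mono[OF \<Lambda>, of b] \<open>0 < b\<close> by simp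
  show "2 * b = a / CJ" by (simp add: b_def)
qed

lemma sg: "0 < sg" "sg < 1" "3/4 \<le> sg"
  using b by (auto simp: sg_def)

lemma \<rho>: "0 < \<rho> i" "\<rho> (Suc i) = sg * \<rho> i" "\<rho> i - \<rho> (Suc i) = b * \<rho> i" "\<rho> i \<le> R0" "\<rho> (i + j) = sg ^ j * \<rho> i"
proof -
  show p: "0 < \<rho> i" using R0_pos sg by (simp add: \<rho>_def)
  show s: "\<rho> (Suc i) = sg * \<rho> i" by (simp add: \<rho>_def)
  show "\<rho> i - \<rho> (Suc i) = b * \<rho> i" by (simp add: s sg_def algebra_simps)
  show "\<rho> i \<le> R0" using R0_pos sg power_le_one[of sg i] by (simp add: \<rho>_def mult_left_le)
  show "\<rho> (i + j) = sg ^ j * \<rho> i" by (simp add: \<rho>_def power_add)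
qed

lemma \<rho>_tendsto: "0 < e \<Longrightarrow> \<exists>N. \<forall>i\<ge>N. \<rho> i < e"
proof -
  assume e: "0 < e"
  have "(\<lambda>i. R0 * sg ^ i) \<longlonglongrightarrow> R0 * 0"
    using sg by (intro tendsto_mult tendsto_const LIMSEQ_realpow_zero) auto
  then have "(\<lambda>i. \<rho> i) \<longlonglongrightarrow> 0" by (simp add: \<rho>_def)
  then have "eventually (\<lambda>i. \<rho> i < e) sequentially" using e by (rule order_tendstoD)
  then show ?thesis by (simp add: eventually_sequentially)
qed

lemma john_points:
  assumes y: "y \<in> \<Omega>"
  obtains z where "z 0 = x0" "\<And>i. z i \<in> \<Omega>" "\<And>i. \<rho> i / CJ \<le> bdist \<Omega> (z i)" "\<And>i. dist (z i) y \<le> \<rho> i"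
    "\<And>i. dist (z (Suc i)) (z i) \<le> b * \<rho> i"
proof -
  obtain \<kappa> where \<kappa>: "\<kappa> 0 = y" "\<kappa> R0 = x0"
        "\<And>t. 0 \<le> t \<Longrightarrow> t \<le> R0 \<Longrightarrow> \<kappa> t \<in> \<Omega> \<and> t / CJ \<le> bdist \<Omega> (\<kappa> t)"
        "\<And>s t. 0 \<le> s \<Longrightarrow> s \<le> t \<Longrightarrow> t \<le> R0 \<Longrightarrow> dist (\<kappa> s) (\<kappa> t) \<le> t - s"
    using john_curve[OF y] unfolding R0_def by blast
  show thesis
  proof (rule that[of "\<lambda>i. \<kappa> (\<rho> i)"])
    show "\<kappa> (\<rho> 0) = x0" using \<kappa>(2) by (simp add: \<rho>_def)
    fix i
    have p: "0 \<le> \<rho> i" using \<rho>(1)[of i] by simp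
    show "\<kappa> (\<rho> i) \<in> \<Omega>" "\<rho> i / CJ \<le> bdist \<Omega> (\<kappa> (\<rho> i))" using \<kappa>(3)[OF p \<rho>(4)] by auto
    show "dist (\<kappa> (\<rho> i)) y \<le> \<rho> i" using \<kappa>(4)[OF order.refl p \<rho>(4)] \<kappa>(1) by (simp add: dist_commute)
    have "0 \<le> b * \<rho> i" using b(1) p by simp
    then have "\<rho> (Suc i) \<le> \<rho> i" using \<rho>(3)[of i] by linarith
    then show "dist (\<kappa> (\<rho> (Suc i))) (\<kappa> (\<rho> i)) \<le> b * \<rho> i"
      using \<kappa>(4)[OF _ _ \<rho>(4), of "\<rho> (Suc i)" i] \<rho>(1)[of "Suc i"] \<rho>(3)[of i] by simp
  qed
qed

text \<open>Concentric with the first chain ball of every point and of half its radius, so that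
  values of \<psi> on \<open>B0\<close> control the first mean of each chain.\<close>

abbreviation "B0 \<equiv> ball x0 (b * R0)"

text \<open>The functions to which the good-lambda bound applies: normalized truncations above a
  median over \<open>B0\<close>.\<close>

definition test :: "('a \<Rightarrow> real) \<Rightarrow> bool" where
  "test \<psi> \<longleftrightarrow> \<psi> \<in> borel_measurable borel \<and> (\<forall>x. 0 \<le> \<psi> x \<and> \<psi> x \<le> 1) \<and>
     measure M B0 \<le> 2 * measure M {y\<in>B0. \<psi> y = 0}"

lemma testD:
  assumes "test \<psi>"
  shows "\<psi> \<in> borel_measurable M" "\<And>x. 0 \<le> \<psi> x \<and> \<psi> x \<le> 1" "\<psi> \<in> borel_measurable borel"
  using assms sets_M measurable_cong_sets[OF sets_M refl, of borel] by (auto simp: test_def)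

lemma chain_ball:
  assumes "z \<in> \<Omega>" "\<rho> i / CJ \<le> bdist \<Omega> z"
  shows "0 < 2 * b * \<rho> i" "2 * b * \<rho> i \<le> a * bdist \<Omega> z"
proof -
  show "0 < 2 * b * \<rho> i" using b(1) \<rho>(1)[of i] by simp
  have "2 * b * \<rho> i = a * (\<rho> i / CJ)" using b(4) by simp
  also have "\<dots> \<le> a * bdist \<Omega> z" using assms(2) a by (intro mult_left_mono) auto
  finally show "2 * b * \<rho> i \<le> a * bdist \<Omega> z" .
qed

text \<open>Outside the bad set every chain ball of \<open>y\<close> has oscillation at most
  \<epsilon>, because its dilate contains \<open>y\<close>. Consecutive means are compared through a
  common ball of half the radius of the later one. The first mean is small because \<psi> vanishes
  on half of \<open>B0\<close>.\<close>

lemma chain_avg: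
  obtains K where "1 \<le> K"
    "\<And>\<psi> \<epsilon> y. test \<psi> \<Longrightarrow> y \<in> \<Omega> - bad a \<Lambda> \<psi> \<epsilon> \<Longrightarrow>
      \<exists>z. (\<forall>i. z i \<in> \<Omega> \<and> \<rho> i / CJ \<le> bdist \<Omega> (z i) \<and> dist (z i) y \<le> \<rho> i \<and>
            osc M \<psi> (ball (z i) (2 * b * \<rho> i)) \<le> \<epsilon> \<and>
            \<bar>avg M (ball (z (Suc i)) (2 * b * \<rho> (Suc i))) \<psi> - avg M (ball (z i) (2 * b * \<rho> i)) \<psi>\<bar> \<le> 2 * K * \<epsilon>) \<and>
          avg M (ball (z 0) (2 * b * \<rho> 0)) \<psi> \<le> 2 * K * \<epsilon>"
proof -
  obtain K where K: "1 \<le> K"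
    "\<And>x y r R. 0 < r \<Longrightarrow> dist x y + R \<le> 4 * r \<Longrightarrow> measure M (ball y R) \<le> K * measure M (ball x r)"
    using compare_M[of 4] by metis
  show thesis
  proof (rule that[OF K(1)])
    fix \<psi> and \<epsilon> :: real and y assume t: "test \<psi>" and y: "y \<in> \<Omega> - bad a \<Lambda> \<psi> \<epsilon>"
    obtain z where z: "z 0 = x0" "\<And>i. z i \<in> \<Omega>" "\<And>i. \<rho> i / CJ \<le> bdist \<Omega> (z i)" "\<And>i. dist (z i) y \<le> \<rho> i"
      "\<And>i. dist (z (Suc i)) (z i) \<le> b * \<rho> i"
      using john_points[of y] y by blast
    define B where "B i = ball (z i) (2 * b * \<rho> i)" for i
    note cb = chain_ball[OF z(2,3)]
    have fm: "B i \<in> fmeasurable M" and Bp: "0 < measure M (B i)" for i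
      using cb(1)[of i] pos ball_fm by (auto simp: B_def)
    have osc: "osc M \<psi> (B i) \<le> \<epsilon>" for i
      unfolding B_def
    proof (rule not_badD[OF _ z(2) cb])
      show "y \<notin> bad a \<Lambda> \<psi> \<epsilon>" using y by simp
      have "1 * \<rho> i \<le> (\<Lambda> * b) * \<rho> i" using b(3) \<rho>(1)[of i] by (intro mult_right_mono) auto
      moreover have "\<Lambda> * (2 * b * \<rho> i) = 2 * ((\<Lambda> * b) * \<rho> i)" by simp
      ultimately show "dist (z i) y < \<Lambda> * (2 * b * \<rho> i)" using z(4)[of i] \<rho>(1)[of i] by linarith
    qed
    have step: "\<bar>avg M (B (Suc i)) \<psi> - avg M (B i) \<psi>\<bar> \<le> 2 * K * \<epsilon>" for i
    proof -
      define B' where "B' = ball (z (Suc i)) (b * \<rho> (Suc i))"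
      have r: "0 < b * \<rho> (Suc i)" using b(1) \<rho>(1) by simp
      have rle: "b * \<rho> (Suc i) \<le> b * \<rho> i"
        using b(1) \<rho>(1)[of i] \<rho>(2)[of i] sg by (intro mult_left_mono) auto
      \<comment> \<open>As \<open>sg\<close> is at least 3/4, the common ball has radius at least
        \<open>3/4 * (b * \<rho> i)\<close>; hence the sum of centre distance and radius, at most
        \<open>3 * b * \<rho> i\<close>, is within the factor 4 for which \<open>K\<close> was
        chosen.\<close>
      have rge: "3 / 4 * (b * \<rho> i) \<le> b * \<rho> (Suc i)"
        using b(1) \<rho>(1)[of i] sg(3) mult_right_mono[of "3/4" sg "b * \<rho> i"] by (simp add: \<rho>(2) mult_ac)
      have sub1: "B' \<subseteq> B (Suc i)" unfolding B'_def B_def using r by (intro subset_ball) simp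
      have sub2: "B' \<subseteq> B i"
      proof
        fix x assume "x \<in> B'"
        then have "dist (z (Suc i)) x < b * \<rho> (Suc i)" by (simp add: B'_def)
        moreover have "dist (z i) x \<le> dist (z (Suc i)) (z i) + dist (z (Suc i)) x"
          using dist_triangle[of "z i" x "z (Suc i)"] by (simp add: dist_commute)
        ultimately show "x \<in> B i" using z(5)[of i] rle by (simp add: B_def)
      qed
      have p: "0 < measure M B'" and s: "B' \<in> sets M" unfolding B'_def using pos[OF r] sets_M by auto
      have K1: "measure M (B (Suc i)) \<le> K * measure M B'"
        unfolding B_def B'_def using r by (intro K(2)) auto
      have K2: "measure M (B i) \<le> K * measure M B'"
        unfolding B_def B'_def
      proof (intro K(2) r)
        show "dist (z (Suc i)) (z i) + 2 * b * \<rho> i \<le> 4 * (b * \<rho> (Suc i))"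
          using z(5)[of i] rge by simp
      qed
      have 1: "\<bar>avg M B' \<psi> - avg M (B (Suc i)) \<psi>\<bar> \<le> K * osc M \<psi> (B (Suc i))"
        by (rule avg_diff_le_osc[OF testD(1,2)[OF t] fm Bp s sub1 p K1])
      have 2: "\<bar>avg M B' \<psi> - avg M (B i) \<psi>\<bar> \<le> K * osc M \<psi> (B i)"
        by (rule avg_diff_le_osc[OF testD(1,2)[OF t] fm Bp s sub2 p K2])
      have "K * osc M \<psi> (B (Suc i)) \<le> K * \<epsilon>" "K * osc M \<psi> (B i) \<le> K * \<epsilon>"
        using osc K(1) by (auto intro!: mult_left_mono)
      with 1 2 show ?thesis by linarith
    qed
    have "avg M (B 0) \<psi> \<le> 2 * K * \<epsilon>"
    proof -
      define m where "m = avg M (B 0) \<psi>"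
      have m0: "0 \<le> m" unfolding m_def by (rule abs_avg_le[OF testD(1,2)[OF t] fm Bp])
      define F where "F = {y\<in>B0. \<psi> y = 0}"
      have [measurable]: "\<psi> \<in> borel_measurable M" by (rule testD[OF t])
      have R: "\<rho> 0 = R0" by (simp add: \<rho>_def)
      have Fs: "F \<in> sets M"
      proof -
        have "F = B0 \<inter> {y\<in>space M. \<psi> y = 0}" using ball_doublingD(2)[OF M] by (auto simp: F_def)
        moreover have "{y\<in>space M. \<psi> y = 0} \<in> sets M" by measurable
        ultimately show ?thesis using sets_M by auto
      qed
      have FB: "F \<subseteq> B 0"
      proof -
        have "0 < b * R0" using b(1) R0_pos by simp
        then have "B0 \<subseteq> B 0" unfolding B_def z(1) R by (intro subset_ball) simp
        then show ?thesis by (auto simp: F_def)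
      qed
      \<comment> \<open>On \<open>F\<close> the function vanishes, so its deviation from the mean
        \<open>m\<close> is \<open>m\<close> itself.\<close>
      have "m * measure M F \<le> osc M \<psi> (B 0) * measure M (B 0)"
        by (rule osc_markov[OF testD(1,2)[OF t] fm Bp Fs FB]) (auto simp: F_def m_def)
      also have "\<dots> \<le> \<epsilon> * measure M (B 0)" using osc Bp by (intro mult_right_mono) (auto simp: less_imp_le)
      finally have 1: "m * measure M F \<le> \<epsilon> * measure M (B 0)" .
      have "measure M (B 0) \<le> K * measure M B0"
        unfolding B_def z(1) R using b(1) R0_pos by (intro K(2)) auto
      also have "\<dots> \<le> K * (2 * measure M F)"
        using t K(1) by (intro mult_left_mono) (auto simp: test_def F_def)
      finally have 2: "measure M (B 0) \<le> 2 * K * measure M F" by simp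
      have Fp: "0 < measure M F"
      proof (rule ccontr)
        assume "\<not> ?thesis"
        then have "measure M F = 0" using measure_nonneg[of M F] by linarith
        then show False using 2 Bp[of 0] by simp
      qed
      have "0 \<le> m * measure M F" using m0 Fp by simp
      then have "0 \<le> \<epsilon> * measure M (B 0)" using 1 by linarith
      then have e0: "0 \<le> \<epsilon>" using Bp[of 0] by (simp add: zero_le_mult_iff)
      have "m * measure M F \<le> (2 * K * \<epsilon>) * measure M F"
        using 1 mult_left_mono[OF 2 e0] by (simp add: mult_ac)
      then show ?thesis using Fp by (simp add: m_def)
    qed
    then show "\<exists>z. (\<forall>i. z i \<in> \<Omega> \<and> \<rho> i / CJ \<le> bdist \<Omega> (z i) \<and> dist (z i) y \<le> \<rho> i \<and>
            osc M \<psi> (ball (z i) (2 * b * \<rho> i)) \<le> \<epsilon> \<and>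
            \<bar>avg M (ball (z (Suc i)) (2 * b * \<rho> (Suc i))) \<psi> - avg M (ball (z i) (2 * b * \<rho> i)) \<psi>\<bar> \<le> 2 * K * \<epsilon>) \<and>
          avg M (ball (z 0) (2 * b * \<rho> 0)) \<psi> \<le> 2 * K * \<epsilon>"
      using z(2-4) osc step unfolding B_def by (intro exI[of _ z]) blast
  qed
qed

text \<open>The chain balls shrink to \<open>y\<close> but are not centred there. Each lies in
  \<open>ball y (2 * \<rho> i)\<close> and fills at least the fraction \<open>1 / K\<close> of it,
  so if the complement of {\<psi> = 1} has density at most \<open>1 / (2 * K)\<close> around
  \<open>y\<close>, it fills at most half of the chain ball.\<close>

lemma chain_limit:
  assumes t: "test \<psi>"
  obtains Z where "Z \<in> null_sets M"
    "\<And>y z. y \<in> \<Omega> - Z \<Longrightarrow> \<psi> y = 1 \<Longrightarrow> \<forall>i. dist (z i) y \<le> \<rho> i \<Longrightarrow>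
       \<exists>i. 1/4 \<le> avg M (ball (z i) (2 * b * \<rho> i)) \<psi>"
proof -
  have [measurable]: "\<psi> \<in> borel_measurable borel" by (rule testD[OF t])
  define E where "E = \<Omega> \<inter> {y\<in>space borel. \<psi> y = 1}"
  have E: "E \<in> sets borel" unfolding E_def using \<Omega>(1) by (intro sets.Int) measurable
  obtain R where R: "\<Omega> \<subseteq> ball x0 R" by (rule \<Omega>_ball) (rule that)
  obtain K where K: "1 \<le> K"
    "\<And>x y r R. 0 < r \<Longrightarrow> dist x y + R \<le> (3 / (2 * b)) * r \<Longrightarrow> measure M (ball y R) \<le> K * measure M (ball x r)"
    using compare_M[of "3 / (2 * b)"] by metis
  show thesis
  proof (rule density_points[OF M pos E, of x0 R "1 / (2 * K)"])
    show "E \<subseteq> ball x0 R" using R by (auto simp: E_def)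
    show "0 < 1 / (2 * K)" using K by simp
    fix Z assume Z: "Z \<in> null_sets M"
      "\<And>y. y \<in> E - Z \<Longrightarrow> \<exists>\<delta>>0. \<forall>r. 0 < r \<and> r < \<delta> \<longrightarrow> measure M (ball y r - E) \<le> 1 / (2 * K) * measure M (ball y r)"
    show thesis
    proof (rule that[OF Z(1)])
      fix y z assume y: "y \<in> \<Omega> - Z" "\<psi> y = 1" and z: "\<forall>i. dist (z i) y \<le> \<rho> i"
      have "y \<in> E - Z" using y by (auto simp: E_def)
      from Z(2)[OF this] obtain \<delta> where \<delta>: "0 < \<delta>"
        "\<And>r. 0 < r \<Longrightarrow> r < \<delta> \<Longrightarrow> measure M (ball y r - E) \<le> 1 / (2 * K) * measure M (ball y r)" by auto
      obtain i where i: "\<rho> i < \<delta> / 2" using \<rho>_tendsto[of "\<delta> / 2"] \<delta>(1) by auto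
      define B where "B = ball (z i) (2 * b * \<rho> i)"
      have r: "0 < 2 * b * \<rho> i" using b(1) \<rho>(1) by simp
      have Bp: "0 < measure M B" unfolding B_def by (rule pos[OF r])
      have fm: "B \<in> fmeasurable M" unfolding B_def by (rule ball_fm)
      have sub: "B \<subseteq> ball y (2 * \<rho> i)"
      proof
        fix x assume "x \<in> B"
        then have "dist (z i) x < 2 * b * \<rho> i" by (simp add: B_def)
        also have "\<dots> \<le> 1 * \<rho> i" using b(2) \<rho>(1)[of i] by (intro mult_right_mono) auto
        finally show "x \<in> ball y (2 * \<rho> i)"
          using z[rule_format, of i] dist_triangle[of y x "z i"] by (simp add: dist_commute)
      qed
      have "measure M (B - E) \<le> measure M (ball y (2 * \<rho> i) - E)"
        using sub E by (intro ball_doubling_mono[OF M, of _ _ y "2 * \<rho> i"]) (auto simp: B_def)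
      also have "\<dots> \<le> 1 / (2 * K) * measure M (ball y (2 * \<rho> i))"
      proof (rule \<delta>(2))
        show "0 < 2 * \<rho> i" "2 * \<rho> i < \<delta>" using \<rho>(1)[of i] i by linarith+
      qed
      also have "\<dots> \<le> 1 / (2 * K) * (K * measure M B)"
      proof (intro mult_left_mono)
        have "(3 / (2 * b)) * (2 * b * \<rho> i) = 3 * \<rho> i" using b(1) by simp
        then show "measure M (ball y (2 * \<rho> i)) \<le> K * measure M B"
          unfolding B_def using z[rule_format, of i] by (intro K(2) r) linarith
      qed (use K in auto)
      also have "\<dots> = measure M B / 2" using K by simp
      finally have BE: "measure M (B - E) \<le> measure M B / 2" .
      have Bs: "B \<in> sets borel" by (simp add: B_def)
      have sp: "measure M B = measure M (B \<inter> E) + measure M (B - E)"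
        by (rule ball_doubling_split[OF M Bs E, of "z i" "2 * b * \<rho> i"]) (simp add: B_def)
      have "measure M (B \<inter> E) = (LINT x:B|M. indicator E x)"
        using E sets_M fm by (simp add: set_lebesgue_integral_def indicator_inter_arith[symmetric] Int_commute fmeasurable_def
            ball_doublingD(2)[OF M])
      also have "\<dots> \<le> (LINT x:B|M. \<psi> x)"
        using testD[OF t] E sets_M
        by (intro set_integral_mono bounded_set_integrable[OF _ _ fm, of _ 1])
          (auto simp: E_def split: split_indicator)
      finally have "measure M B / 2 \<le> (LINT x:B|M. \<psi> x)" using sp BE by linarith
      then have "1/4 \<le> avg M B \<psi>" using Bp by (simp add: avg_def field_simps)
      then show "\<exists>i. 1/4 \<le> avg M (ball (z i) (2 * b * \<rho> i)) \<psi>" unfolding B_def by blast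
    qed
  qed
qed

section \<open>Exceptional sets and the good-lambda inequality\<close>

text \<open>Smallness for \<open>W\<close> of the points of \<open>E\<close> at which
  \<open>E\<close> has small density at the scale \<open>5 * s\<close>. Balls of radius
  \<open>s\<close> around them have a disjoint selection whose 5-dilates cover; in each dilate
  \<open>E\<close> is small for \<open>M\<close>, hence for \<open>W\<close>, and the undilated
  balls share \<open>ball z (Q + h)\<close>. A single common radius is what makes the density
  hypothesis available on exactly the dilates that the covering produces.\<close>

lemma inner_cover:
  assumes small: "\<And>x r F. F \<in> sets borel \<Longrightarrow> F \<subseteq> ball x r \<Longrightarrow> 0 < r \<Longrightarrow>
       measure M F \<le> \<epsilon> * measure M (ball x r) \<Longrightarrow> measure W F \<le> \<delta> * measure W (ball x r)"
    and L: "\<And>x r. 0 < r \<Longrightarrow> measure W (ball x (5 * r)) \<le> L * measure W (ball x r)"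
    and d: "0 \<le> \<delta>" "0 \<le> L" and E: "E \<in> sets borel" and s: "0 < s" "5 * s \<le> h" and Q: "0 \<le> Q"
  shows "\<exists>T. T \<in> sets borel \<and> T \<subseteq> \<Omega> \<inter> ball z Q \<and> measure W T \<le> \<delta> * L * measure W (ball z (Q + h)) \<and>
      {y\<in>\<Omega> \<inter> ball z Q \<inter> E. measure M (ball y (5 * s) \<inter> E) \<le> \<epsilon> * measure M (ball y (5 * s))} \<subseteq> T"
proof -
  define I where "I = {(y, r). y \<in> \<Omega> \<inter> ball z Q \<inter> E \<and> r = s \<and> measure M (ball y (5 * s) \<inter> E) \<le> \<epsilon> * measure M (ball y (5 * s))}"
  define T where "T = (\<lambda>(y::'a, r::real). ball y (5 * r) \<inter> E)"
  define A where "A = ball z (Q + h)"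
  have i: "0 < r \<and> r \<le> s + Q \<and> dist z y \<le> s + Q" if "(y, r) \<in> I" for y r
    using that s Q by (auto simp: I_def)
  have TW: "T (y, r) \<in> sets W" "emeasure W (T (y, r)) < \<infinity>" for y r
    using E sets_W ball_doubling_fmeasurable(3)[OF W, of "ball y (5 * r) \<inter> E" y "5 * r"] by (auto simp: T_def)
  have A: "A \<in> sets borel" "emeasure W A < \<infinity>" using ball_doublingD(4)[OF W] by (auto simp: A_def)
  have le: "measure W (T (y, r)) \<le> (\<delta> * L) * measure W (A \<inter> ball y r)" if yr: "(y, r) \<in> I" for y r
  proof -
    have r: "r = s" and y: "dist z y < Q" using yr by (auto simp: I_def)
    have sub: "ball y r \<subseteq> A"
    proof
      fix x assume "x \<in> ball y r"
      then show "x \<in> A" using r y s dist_triangle[of z x y] by (simp add: A_def)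
    qed
    have "measure W (T (y, r)) \<le> \<delta> * measure W (ball y (5 * s))"
      unfolding T_def prod.case r using yr E s by (intro small) (auto simp: I_def)
    also have "\<dots> \<le> \<delta> * (L * measure W (ball y s))"
      using L[OF s(1)] d by (intro mult_left_mono) auto
    also have "ball y s = A \<inter> ball y r" using sub r by auto
    finally show ?thesis by (simp add: mult.assoc)
  qed
  show ?thesis
  proof (rule covering_measure[where N = W and N' = W and M = M and I = I and T = T and A = A and c = "\<delta> * L",
          OF M pos i TW sets_W A le])
    fix G assume G: "\<And>z \<rho>. (z, \<rho>) \<in> I \<Longrightarrow> \<exists>z' \<rho>'. (z', \<rho>') \<in> G \<and> \<rho> \<le> 2 * \<rho>' \<and> ball z \<rho> \<subseteq> ball z' (5 * \<rho>')"
      "(\<Union>i\<in>G. T i) \<in> sets W" "emeasure W (\<Union>i\<in>G. T i) < \<infinity>"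
      "measure W (\<Union>i\<in>G. T i) \<le> \<delta> * L * measure W A"
    define U where "U = (\<Union>i\<in>G. T i) \<inter> (\<Omega> \<inter> ball z Q)"
    have U: "U \<in> sets borel" using G(2) sets_W \<Omega>(1) by (auto simp: U_def)
    have "measure W U \<le> measure W (\<Union>i\<in>G. T i)"
      using U G(2,3) sets_W by (intro measure_mono_fmeasurable) (auto simp: U_def intro: fmeasurableI)
    with G(4) have "measure W U \<le> \<delta> * L * measure W (ball z (Q + h))" by (simp add: A_def)
    moreover have "{y\<in>\<Omega> \<inter> ball z Q \<inter> E. measure M (ball y (5 * s) \<inter> E) \<le> \<epsilon> * measure M (ball y (5 * s))} \<subseteq> U"
    proof
      fix y assume y: "y \<in> {y\<in>\<Omega> \<inter> ball z Q \<inter> E. measure M (ball y (5 * s) \<inter> E) \<le> \<epsilon> * measure M (ball y (5 * s))}"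
      then have "(y, s) \<in> I" by (simp add: I_def)
      with G(1) obtain z' r' where *: "(z', r') \<in> G" "ball y s \<subseteq> ball z' (5 * r')" by blast
      have "y \<in> ball y s" using s by simp
      with *(2) have "y \<in> ball z' (5 * r')" by blast
      then have "y \<in> T (z', r')" using y by (simp add: T_def)
      then show "y \<in> U" using * y unfolding U_def by blast
    qed
    ultimately show ?thesis using U by (intro exI[of _ U]) (auto simp: U_def)
  qed (use d in auto)
qed

lemma small_sets:
  assumes \<delta>: "0 < \<delta>"
  obtains \<epsilon> where "0 < \<epsilon>"
    "\<And>x r F. F \<in> sets borel \<Longrightarrow> F \<subseteq> ball x r \<Longrightarrow> 0 < r \<Longrightarrow>
       measure M F \<le> \<epsilon> * measure M (ball x r) \<Longrightarrow> measure W F \<le> \<delta> * measure W (ball x r)"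
proof (rule a_infinity_small[OF M pos W null c half \<delta>])
  fix \<epsilon> :: real assume "0 < \<epsilon>"
    "\<And>x r F. F \<in> sets borel \<Longrightarrow> F \<subseteq> ball x r \<Longrightarrow> 0 < r \<Longrightarrow>
       measure M F \<le> \<epsilon> * measure M (ball x r) \<Longrightarrow> measure W F \<le> \<delta> * measure W (ball x r)"
  then show thesis by (rule that)
qed assumption+

text \<open>Every candidate stopping ball receives an exceptional set of \<nu>-measure at most
  \<theta> times that of {\<psi> > 0} in the ball; a disjoint selection sums these to the last term.
  A point of {\<psi> = 1} off the bad set and off a null set must lie in a selected exceptional set:
  otherwise its distance from the boundary would allow a ball around it in which {\<psi> = 1} turns
  out to have small density.\<close>

lemma good_lambda:
  assumes \<theta>: "0 < \<theta>"
  obtains \<epsilon> where "0 < \<epsilon>"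
    "\<And>\<psi>. test \<psi> \<Longrightarrow> measure \<nu> {y\<in>\<Omega>. \<psi> y = 1} \<le> measure \<nu> (bad a \<Lambda> \<psi> \<epsilon>) + \<theta> * measure \<nu> {y\<in>\<Omega>. 0 < \<psi> y}"
proof -
  obtain K where K: "1 \<le> K" and chain:
    "\<And>\<psi> \<epsilon> y. test \<psi> \<Longrightarrow> y \<in> \<Omega> - bad a \<Lambda> \<psi> \<epsilon> \<Longrightarrow>
      \<exists>z. (\<forall>i. z i \<in> \<Omega> \<and> \<rho> i / CJ \<le> bdist \<Omega> (z i) \<and> dist (z i) y \<le> \<rho> i \<and>
            osc M \<psi> (ball (z i) (2 * b * \<rho> i)) \<le> \<epsilon> \<and>
            \<bar>avg M (ball (z (Suc i)) (2 * b * \<rho> (Suc i))) \<psi> - avg M (ball (z i) (2 * b * \<rho> i)) \<psi>\<bar> \<le> 2 * K * \<epsilon>) \<and>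
          avg M (ball (z 0) (2 * b * \<rho> 0)) \<psi> \<le> 2 * K * \<epsilon>"
    using chain_avg by metis
  \<comment> \<open>For comparing \<open>ball y (3 * \<rho> i)\<close> with a chain ball of
    \<open>y\<close> of radius \<open>2 * b * \<rho> i\<close>: centre distance and radius add up to
    at most \<open>4 * \<rho> i\<close>.\<close>
  obtain KV where KV: "1 \<le> KV"
    "\<And>x y r R. 0 < r \<Longrightarrow> dist x y + R \<le> (2 / b) * r \<Longrightarrow> measure M (ball y R) \<le> KV * measure M (ball x r)"
    using compare_M[of "2 / b"] by metis
  obtain L where L: "1 \<le> L" "\<And>x r. 0 < r \<Longrightarrow> measure W (ball x (5 * r)) \<le> L * measure W (ball x r)"
    using compare_W[of 5] by (metis add_0 dist_self order.refl)
  obtain L2 where L2: "1 \<le> L2" "\<And>x r. 0 < r \<Longrightarrow> measure W (ball x (11 / (2 * b) * r)) \<le> L2 * measure W (ball x r)"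
    using compare_W[of "11 / (2 * b)"] by (metis add_0 dist_self order.refl)
  \<comment> \<open>Points within \<open>10 * \<rho> i\<close> of a chain centre of depth
    \<open>d\<close> have depth at most \<open>(1 + 10 * CJ) * d\<close>, so \<open>l\<close>
    doublings bound \<phi> there.\<close>
  obtain l where l: "1 + 10 * CJ < 2 ^ l" using real_arch_pow[of 2 "1 + 10 * CJ"] by auto
  \<comment> \<open>Pays for \<open>l\<close> doublings of \<phi> on the dilated ball and one more
    on the chain ball, for the volume ratio \<open>L2\<close>, for the proportion \<open>c\<close>
    from \<open>half\<close>, and with the 2 for the two pieces of the exceptional set.\<close>
  define \<delta> where "\<delta> = \<theta> * c / (2 * (D\<phi> ^ Suc l * L2))"
  have DP: "0 < D\<phi> ^ Suc l * L2" using D\<phi>_ge L2(1) by (intro mult_pos_pos zero_less_power) auto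
  have \<delta>: "0 < \<delta>" using DP \<theta> c by (simp add: \<delta>_def)
  obtain \<eta> where \<eta>: "0 < \<eta>" "\<And>z Q \<rho>. 0 \<le> Q \<Longrightarrow> 0 < \<rho> \<Longrightarrow> \<rho> \<le> R0 \<Longrightarrow>
       measure W {y\<in>\<Omega>. dist z y < Q \<and> bdist \<Omega> y < \<eta> * \<rho>} \<le> \<delta> * measure W (ball z (Q + \<rho>))"
    by (rule layer_small[OF \<delta>]) (rule that)
  have \<delta>L: "0 < \<delta> / L" using \<delta> L(1) by simp
  obtain \<epsilon>A where \<epsilon>A: "0 < \<epsilon>A" and small:
    "\<And>x r F. F \<in> sets borel \<Longrightarrow> F \<subseteq> ball x r \<Longrightarrow> 0 < r \<Longrightarrow>
       measure M F \<le> \<epsilon>A * measure M (ball x r) \<Longrightarrow> measure W F \<le> \<delta> / L * measure W (ball x r)"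
    by (rule small_sets[OF \<delta>L]) (rule that)
  \<comment> \<open>For a selected ball of index \<open>j\<close>, the radius
    \<open>3 * \<rho> (j + m)\<close> is at most \<open>a * \<eta> * \<rho> j\<close>; so a ball of
    that radius around a point of depth at least \<open>\<eta> * \<rho> j\<close> is Whitney-type.
    The bound 1/3 keeps this radius below \<open>\<rho> j\<close>.\<close>
  obtain m where m: "sg ^ m < min (a * \<eta> / 3) (1/3)"
    using real_arch_pow_inv[of "min (a * \<eta> / 3) (1/3)" sg] a(1) \<eta>(1) sg by auto
  \<comment> \<open>\<open>m0\<close> steps more than halve the radii; this limits how far along the
    chain the factor 2 of the Vitali selection can move the index.\<close>
  obtain m0 where m0: "sg ^ m0 < 1/2" using real_arch_pow_inv[of "1/2" sg] sg by auto
  define n where "n = m0 + m"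
  \<comment> \<open>In order, the four bounds serve the positivity of \<psi> on half of a stopping
    ball, the small density of \<open>E\<close> in \<open>V\<close>, the comparison of the mean over
    \<open>V\<close> with a chain mean, and the drift of the chain means from the stopping index to
    at most \<open>n\<close> indices later.\<close>
  define \<epsilon> where "\<epsilon> = min (min (1/8) (\<epsilon>A / 4)) (min (1 / (4 * KV)) (1 / (8 * K * real (n + 2))))"
  have \<epsilon>: "0 < \<epsilon>" "\<epsilon> \<le> 1/8" "4 * \<epsilon> \<le> \<epsilon>A" "KV * \<epsilon> \<le> 1/4" "2 * K * \<epsilon> * real (n + 2) \<le> 1/4"
  proof -
    show "0 < \<epsilon>" using \<epsilon>A KV(1) K by (simp add: \<epsilon>_def)
    have "\<epsilon> \<le> \<epsilon>A / 4" "\<epsilon> \<le> 1 / (4 * KV)" "\<epsilon> \<le> 1 / (8 * K * real (n + 2))" by (simp_all add: \<epsilon>_def)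
    note e = this
    show "4 * \<epsilon> \<le> \<epsilon>A" "KV * \<epsilon> \<le> 1/4"
      using e(1,2) KV(1) by (simp_all add: field_simps)
    have "0 < 8 * K * real (n + 2)" using K by (intro mult_pos_pos) auto
    then have "\<epsilon> * (8 * K * real (n + 2)) \<le> 1" using e(3) by (simp only: pos_le_divide_eq)
    moreover have "2 * K * \<epsilon> * real (n + 2) = \<epsilon> * (8 * K * real (n + 2)) / 4" by simp
    ultimately show "2 * K * \<epsilon> * real (n + 2) \<le> 1/4" by linarith
    show "\<epsilon> \<le> 1/8" by (simp add: \<epsilon>_def)
  qed
  show thesis
  proof (rule that[OF \<epsilon>(1)])
    fix \<psi> assume t: "test \<psi>"
    have [measurable]: "\<psi> \<in> borel_measurable borel" by (rule testD[OF t])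
    have bd: "0 \<le> \<psi> x" "\<psi> x \<le> 1" for x using testD(2)[OF t] by auto
    have lev: "{y. \<psi> y = k} \<in> sets borel" "{y. k < \<psi> y} \<in> sets borel" for k
    proof -
      have "{y\<in>space borel. \<psi> y = k} \<in> sets borel" "{y\<in>space borel. k < \<psi> y} \<in> sets borel" by measurable
      then show "{y. \<psi> y = k} \<in> sets borel" "{y. k < \<psi> y} \<in> sets borel" by simp_all
    qed
    define E where "E = {y. \<psi> y = 1}"
    define P where "P = \<Omega> \<inter> {y. 0 < \<psi> y}"
    have E: "E \<in> sets borel" and P: "P \<in> sets borel" using lev \<Omega>(1) by (auto simp: E_def P_def)
    obtain Z where Z: "Z \<in> null_sets M" and lim:
      "\<And>y z. y \<in> \<Omega> - Z \<Longrightarrow> \<psi> y = 1 \<Longrightarrow> \<forall>i. dist (z i) y \<le> \<rho> i \<Longrightarrow> \<exists>i. 1/4 \<le> avg M (ball (z i) (2 * b * \<rho> i)) \<psi>"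
      by (rule chain_limit[OF t]) (rule that)
    define av where "av z i = avg M (ball z (2 * b * \<rho> i)) \<psi>" for z i
    \<comment> \<open>Candidate stopping balls, without reference to a point. The radius is
      \<open>2 * \<rho> i\<close> instead of that of the chain ball, so that a point whose chain
      stops here lies in the ball.\<close>
    define I where "I = {(z, r). \<exists>i. r = 2 * \<rho> i \<and> z \<in> \<Omega> \<and> \<rho> i / CJ \<le> bdist \<Omega> z \<and>
        osc M \<psi> (ball z (2 * b * \<rho> i)) \<le> \<epsilon> \<and> 1/4 \<le> av z i}"
    \<comment> \<open>The exceptional set in the 5-dilate contains the points of depth below
      \<open>\<eta> * \<rho> i\<close> and the points of \<open>E\<close> at which \<open>E\<close>
      has density at most \<open>\<epsilon>A\<close> at scale \<open>3 * \<rho> (i + m)\<close>.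
      Both conditions refer to the radius of the ball only.\<close>
    have ex_T: "\<exists>T. T \<in> sets borel \<and> T \<subseteq> \<Omega> \<inter> ball z (5 * r) \<and> measure \<nu> T \<le> \<theta> * measure \<nu> (P \<inter> ball z r) \<and>
        (\<forall>y\<in>\<Omega> \<inter> ball z (5 * r). bdist \<Omega> y < \<eta> * (r / 2) \<longrightarrow> y \<in> T) \<and>
        (\<forall>y\<in>\<Omega> \<inter> ball z (5 * r) \<inter> E. measure M (ball y (3 * (sg ^ m * (r / 2))) \<inter> E) \<le> \<epsilon>A * measure M (ball y (3 * (sg ^ m * (r / 2)))) \<longrightarrow> y \<in> T)"
      if zr: "(z, r) \<in> I" for z r
    proof -
      obtain i where i: "r = 2 * \<rho> i" "z \<in> \<Omega>" "\<rho> i / CJ \<le> bdist \<Omega> z" "osc M \<psi> (ball z (2 * b * \<rho> i)) \<le> \<epsilon>" "1/4 \<le> av z i"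
        using zr by (auto simp: I_def)
      define s where "s = 3 * (sg ^ m * \<rho> i) / 5"
      note cb = chain_ball[OF i(2,3)]
      have p: "0 < \<rho> i" by (rule \<rho>)
      have "sg ^ m * \<rho> i \<le> 1/3 * \<rho> i" using m p by (intro mult_right_mono) auto
      then have s: "0 < s" "5 * s \<le> \<rho> i" using sg p by (auto simp: s_def)
      have "\<exists>T. T \<in> sets borel \<and> T \<subseteq> \<Omega> \<inter> ball z (10 * \<rho> i) \<and>
        measure W T \<le> \<delta> / L * L * measure W (ball z (10 * \<rho> i + \<rho> i)) \<and>
        {y\<in>\<Omega> \<inter> ball z (10 * \<rho> i) \<inter> E. measure M (ball y (5 * s) \<inter> E) \<le> \<epsilon>A * measure M (ball y (5 * s))} \<subseteq> T"
      proof (rule inner_cover[OF _ L(2) _ _ E s])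
        fix x r F assume "F \<in> sets borel" "F \<subseteq> ball x r" "0 < r" "measure M F \<le> \<epsilon>A * measure M (ball x r)"
        then show "measure W F \<le> \<delta> / L * measure W (ball x r)" by (rule small)
      qed (use \<delta>L L(1) p in auto)
      then obtain T1 where T1: "T1 \<in> sets borel" "T1 \<subseteq> \<Omega> \<inter> ball z (10 * \<rho> i)"
        "measure W T1 \<le> \<delta> / L * L * measure W (ball z (10 * \<rho> i + \<rho> i))"
        "{y\<in>\<Omega> \<inter> ball z (10 * \<rho> i) \<inter> E. measure M (ball y (5 * s) \<inter> E) \<le> \<epsilon>A * measure M (ball y (5 * s))} \<subseteq> T1"
        by (elim exE conjE) (rule that)
      define T2 where "T2 = {y\<in>\<Omega>. dist z y < 10 * \<rho> i \<and> bdist \<Omega> y < \<eta> * \<rho> i}"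
      have T2b: "T2 \<in> sets borel"
      proof -
        have "T2 = \<Omega> \<inter> ({y. dist z y < 10 * \<rho> i} \<inter> {y. bdist \<Omega> y < \<eta> * \<rho> i})" by (auto simp: T2_def)
        moreover have "open {y. dist z y < 10 * \<rho> i}" "open {y. bdist \<Omega> y < \<eta> * \<rho> i}"
          by (intro open_Collect_less bdist_continuous continuous_intros)+
        ultimately show ?thesis using \<Omega>(1) by auto
      qed
      have T2W: "measure W T2 \<le> \<delta> * measure W (ball z (10 * \<rho> i + \<rho> i))"
        unfolding T2_def using p \<rho>(4) by (intro \<eta>(2)) auto
      define T where "T = T1 \<union> T2"
      have T: "T \<in> sets borel" "T \<subseteq> \<Omega>" "T \<subseteq> ball z (10 * \<rho> i)" using T1 T2b by (auto simp: T_def T2_def)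
      define w where "w = measure W (ball z (2 * b * \<rho> i))"
      have "measure W (ball z (10 * \<rho> i + \<rho> i)) \<le> L2 * w"
      proof -
        have "11 / (2 * b) * (2 * b * \<rho> i) = 10 * \<rho> i + \<rho> i" using b(1) by simp
        then show ?thesis using L2(2)[OF cb(1), of z] by (simp add: w_def)
      qed
      then have dW: "\<delta> * measure W (ball z (10 * \<rho> i + \<rho> i)) \<le> \<delta> * (L2 * w)"
        using \<delta> by (intro mult_left_mono) auto
      have "measure W T \<le> measure W T1 + measure W T2"
        unfolding T_def using T1(1) T2b sets_W by (intro measure_Un_le) auto
      also have "\<dots> \<le> 2 * (\<delta> * (L2 * w))" using T1(3) T2W dW L(1) by simp
      finally have TW: "measure W T \<le> 2 * (\<delta> * (L2 * w))" .
      define d where "d = bdist \<Omega> z"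
      have d: "0 < d" unfolding d_def by (rule bdist_pos[OF i(2)])
      have \<phi>d: "0 < \<phi> d" by (rule \<phi>(1)[OF d])
      have "measure \<nu> T \<le> \<phi> (2 ^ l * d) * measure W T"
      proof (rule \<nu>_le[OF T])
        fix y assume "y \<in> T"
        then have "dist z y < 10 * \<rho> i" using T(3) by auto
        moreover have "\<rho> i \<le> CJ * d" using i(3) CJ by (simp add: d_def field_simps)
        ultimately have "bdist \<Omega> y \<le> (1 + 10 * CJ) * d"
          using bdist_lipschitz[of y z] by (simp add: d_def dist_commute algebra_simps)
        also have "\<dots> \<le> 2 ^ l * d" using l d by (intro mult_right_mono) auto
        finally show "bdist \<Omega> y \<le> 2 ^ l * d" .
      qed (use d in simp)
      also have "\<dots> \<le> (D\<phi> ^ l * \<phi> d) * (2 * (\<delta> * (L2 * w)))"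
        using TW \<phi>_pow[OF d] D\<phi>_ge \<phi>d by (intro mult_mono) (auto simp: less_imp_le)
      finally have \<nu>T: "measure \<nu> T \<le> (D\<phi> ^ l * \<phi> d) * (2 * (\<delta> * (L2 * w)))" .
      define B where "B = ball z (2 * b * \<rho> i)"
      have fm: "B \<in> fmeasurable M" and Bp: "0 < measure M B" using ball_fm pos[OF cb(1)] by (auto simp: B_def)
      have Bb: "B \<in> sets borel" "B \<subseteq> ball z (2 * b * \<rho> i)" by (auto simp: B_def)
      have "\<bar>a\<bar> * d \<le> 1/2 * d" using a d by (intro mult_right_mono) auto
      then have ad: "2 * b * \<rho> i \<le> d / 2" using cb(2) a(1) by (simp add: d_def)
      have Bd: "d / 2 \<le> bdist \<Omega> y" if "y \<in> B" for y
        using that ad bdist_lipschitz[of z y] by (simp add: B_def d_def)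
      have B\<Omega>: "B \<subseteq> \<Omega>"
      proof -
        have "a * d \<le> c0 * d" using a d by (intro mult_right_mono) auto
        then have "B \<subseteq> ball z (c0 * d)" unfolding B_def using cb(2) by (intro subset_ball) (simp add: d_def)
        then show ?thesis using c0(2)[OF i(2)] by (auto simp: d_def)
      qed
      define F where "F = B \<inter> {y. 0 < \<psi> y}"
      have F: "F \<in> sets borel" "F \<subseteq> \<Omega>" "F \<subseteq> ball z (2 * b * \<rho> i)" using Bb B\<Omega> lev by (auto simp: F_def)
      \<comment> \<open>Where \<psi> vanishes, the deviation from the mean is at least 1/4.
        Oscillation at most 1/8 then leaves at least half of \<open>B\<close> to {\<psi> >
        0}.\<close>
      have "1/4 * measure M (B - F) \<le> osc M \<psi> B * measure M B"
      proof (rule osc_markov[OF testD(1,2)[OF t] fm Bp])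
        show "B - F \<in> sets M" using F Bb sets_M by auto
        fix y assume "y \<in> B - F"
        then have "\<psi> y = 0" using bd[of y] by (auto simp: F_def)
        then show "1/4 \<le> \<bar>\<psi> y - avg M B \<psi>\<bar>" using i(5) by (simp add: av_def B_def)
      qed auto
      also have "\<dots> \<le> 1/8 * measure M B"
        using i(4) \<epsilon>(2) Bp by (intro mult_right_mono) (auto simp: B_def less_imp_le)
      finally have "measure M (B - F) \<le> measure M B / 2" by simp
      moreover have "measure M B = measure M (B \<inter> F) + measure M (B - F)"
        by (rule ball_doubling_split[OF M Bb(1) F(1) Bb(2)])
      moreover have "B \<inter> F = F" by (auto simp: F_def)
      ultimately have "measure M B \<le> 2 * measure M F" by simp
      then have "c * w \<le> measure W F"
        unfolding w_def using F cb(1) by (intro half) (auto simp: B_def)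
      then have "\<phi> (d / 2) * (c * w) \<le> \<phi> (d / 2) * measure W F"
        using \<phi>(1)[of "d / 2"] d by (intro mult_left_mono) auto
      also have "\<dots> \<le> measure \<nu> F"
      proof (rule \<nu>_ge[OF F])
        show "d / 2 \<le> bdist \<Omega> y" if "y \<in> F" for y using that Bd by (simp add: F_def)
      qed (use d in simp)
      also have "\<dots> \<le> measure \<nu> (P \<inter> ball z r)"
      proof (rule \<nu>.finite_measure_mono)
        have "2 * b * \<rho> i \<le> 1 * r" using b(2) p unfolding i(1) mult.assoc[symmetric] by (intro mult_right_mono) auto
        then have "B \<subseteq> ball z r" unfolding B_def by (intro subset_ball) simp
        then show "F \<subseteq> P \<inter> ball z r" using F(2) by (auto simp: F_def P_def)
        show "P \<inter> ball z r \<in> sets \<nu>" using P sets_\<nu> by auto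
      qed
      finally have low: "\<phi> (d / 2) * (c * w) \<le> measure \<nu> (P \<inter> ball z r)" .
      have "\<phi> (2 * (d / 2)) \<le> D\<phi> * \<phi> (d / 2)" using d by (intro \<phi>(3)) simp
      then have "\<phi> d * (c * w) \<le> D\<phi> * \<phi> (d / 2) * (c * w)"
        using c by (intro mult_right_mono) (auto simp: w_def)
      also have "\<dots> = D\<phi> * (\<phi> (d / 2) * (c * w))" by (simp add: mult_ac)
      also have "\<dots> \<le> D\<phi> * measure \<nu> (P \<inter> ball z r)"
        using low D\<phi>_ge by (intro mult_left_mono) auto
      finally have low': "\<phi> d * (c * w) \<le> D\<phi> * measure \<nu> (P \<inter> ball z r)" .
      have "(D\<phi> ^ l * \<phi> d) * (2 * (\<delta> * (L2 * w))) = (\<theta> / D\<phi>) * (\<phi> d * (c * w))"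
        using DP D\<phi>_ge L2(1) by (simp add: \<delta>_def field_simps)
      also have "\<dots> \<le> (\<theta> / D\<phi>) * (D\<phi> * measure \<nu> (P \<inter> ball z r))"
        using low' \<theta> D\<phi>_ge by (intro mult_left_mono) auto
      also have "\<dots> = \<theta> * measure \<nu> (P \<inter> ball z r)" using D\<phi>_ge by simp
      finally have "measure \<nu> T \<le> \<theta> * measure \<nu> (P \<inter> ball z r)" using \<nu>T by linarith
      moreover have "5 * r = 10 * \<rho> i" "r / 2 = \<rho> i" using i(1) by auto
      moreover have "\<forall>y\<in>\<Omega> \<inter> ball z (10 * \<rho> i). bdist \<Omega> y < \<eta> * \<rho> i \<longrightarrow> y \<in> T"
        by (auto simp: T_def T2_def)
      moreover have "3 * (sg ^ m * \<rho> i) = 5 * s" by (simp add: s_def)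
      ultimately show ?thesis using T T1(4) by (intro exI[of _ T]) (auto simp: T_def)
    qed
    obtain T where T: "\<And>z r. (z, r) \<in> I \<Longrightarrow> T (z, r) \<in> sets borel \<and> T (z, r) \<subseteq> \<Omega> \<inter> ball z (5 * r) \<and>
        measure \<nu> (T (z, r)) \<le> \<theta> * measure \<nu> (P \<inter> ball z r) \<and>
        (\<forall>y\<in>\<Omega> \<inter> ball z (5 * r). bdist \<Omega> y < \<eta> * (r / 2) \<longrightarrow> y \<in> T (z, r)) \<and>
        (\<forall>y\<in>\<Omega> \<inter> ball z (5 * r) \<inter> E. measure M (ball y (3 * (sg ^ m * (r / 2))) \<inter> E) \<le> \<epsilon>A * measure M (ball y (3 * (sg ^ m * (r / 2)))) \<longrightarrow> y \<in> T (z, r))"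
    proof -
      have "\<exists>T. \<forall>i\<in>I. (\<lambda>(z, r) T. T \<in> sets borel \<and> T \<subseteq> \<Omega> \<inter> ball z (5 * r) \<and> measure \<nu> T \<le> \<theta> * measure \<nu> (P \<inter> ball z r) \<and>
        (\<forall>y\<in>\<Omega> \<inter> ball z (5 * r). bdist \<Omega> y < \<eta> * (r / 2) \<longrightarrow> y \<in> T) \<and>
        (\<forall>y\<in>\<Omega> \<inter> ball z (5 * r) \<inter> E. measure M (ball y (3 * (sg ^ m * (r / 2))) \<inter> E) \<le> \<epsilon>A * measure M (ball y (3 * (sg ^ m * (r / 2)))) \<longrightarrow> y \<in> T)) i (T i)"
        by (rule bchoice) (use ex_T in \<open>auto simp only: split_paired_all prod.case\<close>)
      then show thesis by (elim exE) (rule that, drule bspec, assumption, simp only: prod.case)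
    qed
    obtain R where R: "0 < R" "\<Omega> \<subseteq> ball x0 R" by (rule \<Omega>_ball) (rule that)
    have Ib: "0 < r \<and> r \<le> 2 * R0 + R \<and> dist x0 z \<le> 2 * R0 + R" if "(z, r) \<in> I" for z r
    proof -
      obtain i where "r = 2 * \<rho> i" "z \<in> \<Omega>" using \<open>(z, r) \<in> I\<close> by (auto simp: I_def)
      moreover have "dist x0 z < R" using R(2) \<open>z \<in> \<Omega>\<close> by auto
      ultimately show ?thesis using \<rho>(1,4)[of i] R(1) R0_pos by simp
    qed
    have TN: "T (z, r) \<in> sets \<nu>" "emeasure \<nu> (T (z, r)) < \<infinity>" if "(z, r) \<in> I" for z r
    proof -
      show "T (z, r) \<in> sets \<nu>" using T[OF that] sets_\<nu> by simp
      show "emeasure \<nu> (T (z, r)) < \<infinity>"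
        using \<nu>.emeasure_finite[of "T (z, r)"] unfolding infinity_ennreal_def less_top .
    qed
    have Pf: "emeasure \<nu> P < \<infinity>" using \<nu>.emeasure_finite[of P] unfolding infinity_ennreal_def less_top .
    have Tle: "measure \<nu> (T (z, r)) \<le> \<theta> * measure \<nu> (P \<inter> ball z r)" if "(z, r) \<in> I" for z r
      using T[OF that] by blast
    have main: "measure \<nu> (\<Omega> \<inter> E) \<le> measure \<nu> (bad a \<Lambda> \<psi> \<epsilon>) + \<theta> * measure \<nu> P"
    proof (rule covering_measure[where N = \<nu> and N' = \<nu> and M = M and I = I and T = T and A = P and c = \<theta>,
            OF M pos Ib TN sets_\<nu> P Pf Tle])
      fix G assume GI: "G \<subseteq> I" and G: "\<And>z \<rho>. (z, \<rho>) \<in> I \<Longrightarrow> \<exists>z' \<rho>'. (z', \<rho>') \<in> G \<and> \<rho> \<le> 2 * \<rho>' \<and> ball z \<rho> \<subseteq> ball z' (5 * \<rho>')"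
        "(\<Union>i\<in>G. T i) \<in> sets \<nu>" "measure \<nu> (\<Union>i\<in>G. T i) \<le> \<theta> * measure \<nu> P"
      have sub: "\<Omega> \<inter> E \<subseteq> (bad a \<Lambda> \<psi> \<epsilon> \<union> Z) \<union> (\<Union>i\<in>G. T i)"
      proof
        fix y assume yE: "y \<in> \<Omega> \<inter> E"
        show "y \<in> (bad a \<Lambda> \<psi> \<epsilon> \<union> Z) \<union> (\<Union>i\<in>G. T i)"
        proof (rule ccontr)
          assume no: "y \<notin> (bad a \<Lambda> \<psi> \<epsilon> \<union> Z) \<union> (\<Union>i\<in>G. T i)"
          then have y: "y \<in> \<Omega> - bad a \<Lambda> \<psi> \<epsilon>" "y \<in> \<Omega> - Z" "\<psi> y = 1" using yE by (auto simp: E_def)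
          obtain z where z: "\<And>i. z i \<in> \<Omega>" "\<And>i. \<rho> i / CJ \<le> bdist \<Omega> (z i)" "\<And>i. dist (z i) y \<le> \<rho> i"
            "\<And>i. osc M \<psi> (ball (z i) (2 * b * \<rho> i)) \<le> \<epsilon>"
            "\<And>i. \<bar>av (z (Suc i)) (Suc i) - av (z i) i\<bar> \<le> 2 * K * \<epsilon>" "av (z 0) 0 \<le> 2 * K * \<epsilon>"
            using chain[OF t y(1)] unfolding av_def by blast
          have "\<exists>i. 1/4 \<le> av (z i) i" unfolding av_def by (rule lim[OF y(2,3)]) (use z(3) in blast)
          \<comment> \<open>The first chain ball of \<open>y\<close> with mean at least 1/4. Being
            the first, its mean exceeds the threshold by at most one step
            \<open>2 * K * \<epsilon>\<close>.\<close>
          define i1 where "i1 = (LEAST i. 1/4 \<le> av (z i) i)"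
          have i1: "1/4 \<le> av (z i1) i1" "\<And>i. i < i1 \<Longrightarrow> av (z i) i < 1/4"
            unfolding i1_def using LeastI_ex[OF \<open>\<exists>i. 1/4 \<le> av (z i) i\<close>] not_less_Least by (blast, fastforce)
          have e0: "0 \<le> 2 * K * \<epsilon>" using K \<epsilon>(1) by simp
          have top: "av (z i1) i1 \<le> 1/4 + 2 * K * \<epsilon>"
          proof (cases i1)
            case 0
            then show ?thesis using z(6) by simp
          next
            case (Suc i)
            then show ?thesis using z(5)[of i] i1(2)[of i] by simp
          qed
          have later: "av (z (i1 + k)) (i1 + k) \<le> 1/4 + 2 * K * \<epsilon> * real (k + 1)" for k
          proof (induction k)
            case (Suc k)
            have "av (z (i1 + Suc k)) (i1 + Suc k) \<le> av (z (i1 + k)) (i1 + k) + 2 * K * \<epsilon>"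
              using z(5)[of "i1 + k"] by simp
            with Suc show ?case by (simp add: algebra_simps)
          qed (use top in simp)
          have in_I: "(z i1, 2 * \<rho> i1) \<in> I" unfolding I_def using z(1,2,4) i1(1) by blast
          \<comment> \<open>The selected ball that replaces the stopping ball of \<open>y\<close>.
            It can be far larger, but its radius is at least half that of the stopping ball.\<close>
          obtain z' r' where zr': "(z', r') \<in> G" "2 * \<rho> i1 \<le> 2 * r'" "ball (z i1) (2 * \<rho> i1) \<subseteq> ball z' (5 * r')"
            using G(1)[OF in_I] by blast
          have "(z', r') \<in> I" using zr'(1) GI by blast
          then obtain j where j: "r' = 2 * \<rho> j" by (auto simp: I_def)
          have "dist (z i1) y < 2 * \<rho> i1" using z(3)[of i1] \<rho>(1)[of i1] by linarith
          then have yb: "y \<in> ball z' (5 * r')" using zr'(3) by auto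
          note TT = T[OF \<open>(z', r') \<in> I\<close>, THEN conjunct2, THEN conjunct2, THEN conjunct2]
          have y\<Omega>: "y \<in> \<Omega> \<inter> ball z' (5 * r')" using yE yb by blast
          note TT1 = TT[THEN conjunct1, THEN bspec, OF y\<Omega>]
          have nT: "y \<notin> T (z', r')" using no zr'(1) by blast
          then have far: "\<eta> * \<rho> j \<le> bdist \<Omega> y" using TT1 nT by (auto simp: j)
          \<comment> \<open>A scale fixed by the selected ball, used as an index on the chain of
            \<open>y\<close>. If it precedes \<open>i1\<close>, the mean is below 1/4 by minimality;
            otherwise it comes at most \<open>n\<close> steps after \<open>i1\<close>, and the drift
            keeps the mean below 1/2.\<close>
          define i' where "i' = j + m"
          have \<rho>i': "\<rho> i' = sg ^ m * \<rho> j" unfolding i'_def by (rule \<rho>)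
          have adm: "3 * \<rho> i' \<le> a * bdist \<Omega> y"
          proof -
            have "sg ^ m * \<rho> j \<le> (a * \<eta> / 3) * \<rho> j" using m \<rho>(1)[of j] by (intro mult_right_mono) auto
            moreover have "a * (\<eta> * \<rho> j) \<le> a * bdist \<Omega> y" using far a by (intro mult_left_mono) auto
            ultimately show ?thesis by (simp add: \<rho>i')
          qed
          have "j \<le> i1 + m0"
          proof (rule ccontr)
            assume "\<not> j \<le> i1 + m0"
            then obtain k where k: "j = i1 + (m0 + k)" using le_Suc_ex[of "i1 + m0" j] by (auto simp: add.assoc)
            have "sg ^ (m0 + k) \<le> sg ^ m0" using sg by (intro power_decreasing) auto
            then have "sg ^ (m0 + k) * \<rho> i1 < 1/2 * \<rho> i1" using m0 \<rho>(1) by (intro mult_strict_right_mono) auto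
            moreover have "\<rho> j = sg ^ (m0 + k) * \<rho> i1" using \<rho>(5)[of i1 "m0 + k"] k by simp
            moreover have "\<rho> i1 \<le> 2 * \<rho> j" using zr'(2) j by simp
            ultimately show False by linarith
          qed
          then have i'n: "i' \<le> i1 + n" by (simp add: i'_def n_def)
          have avi': "av (z i') i' \<le> 1/2"
          proof (cases "i' < i1")
            case True
            then show ?thesis using i1(2)[of i'] by simp
          next
            case False
            then obtain k where k: "i' = i1 + k" using le_Suc_ex[of i1 i'] by auto
            have "2 * K * \<epsilon> * real (k + 1) \<le> 2 * K * \<epsilon> * real (n + 2)"
              using i'n k e0 by (intro mult_left_mono) auto
            then show ?thesis using later[of k] \<epsilon>(5) k by simp
          qed
          \<comment> \<open>Centred at \<open>y\<close>, large enough to contain the chain ball of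
            index \<open>i'\<close>, and exactly the ball in which the exceptional set of the
            selected ball tests the density of \<open>E\<close>.\<close>
          define V where "V = ball y (3 * \<rho> i')"
          define B where "B = ball (z i') (2 * b * \<rho> i')"
          have p: "0 < \<rho> i'" by (rule \<rho>)
          have r1: "0 < 2 * b * \<rho> i'" using b(1) p by simp
          have BV: "B \<subseteq> V"
          proof
            fix x assume "x \<in> B"
            then have "dist (z i') x < 2 * b * \<rho> i'" by (simp add: B_def)
            also have "\<dots> \<le> 1 * \<rho> i'" using b(2) p by (intro mult_right_mono) auto
            finally show "x \<in> V"
              using z(3)[of i'] dist_triangle[of y x "z i'"] p by (simp add: V_def dist_commute)
          qed
          have oscV: "osc M \<psi> V \<le> \<epsilon>"
            unfolding V_def
          proof (rule not_badD[OF _ _ _ adm])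
            have "0 < \<Lambda>" using less_le_trans[OF _ \<Lambda>, of 0] CJ a(1) by simp
            then show "dist y y < \<Lambda> * (3 * \<rho> i')" using p by simp
          qed (use y p in auto)
          have fmV: "V \<in> fmeasurable M" and Vp: "0 < measure M V" using ball_fm pos p by (auto simp: V_def)
          have "\<bar>avg M B \<psi> - avg M V \<psi>\<bar> \<le> KV * osc M \<psi> V"
          proof (rule avg_diff_le_osc[OF testD(1,2)[OF t] fmV Vp _ BV])
            show "0 < measure M B" unfolding B_def by (rule pos[OF r1])
            have "2 / b * (2 * b * \<rho> i') = 4 * \<rho> i'" using b(1) by simp
            then show "measure M V \<le> KV * measure M B"
              unfolding V_def B_def using z(3)[of i'] by (intro KV(2) r1) linarith
          qed (use sets_M in \<open>auto simp: B_def\<close>)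
          also have "\<dots> \<le> KV * \<epsilon>" using oscV KV(1) by (intro mult_left_mono) auto
          finally have avV: "avg M V \<psi> \<le> 3/4" using \<epsilon>(4) avi' by (simp add: av_def B_def)
          \<comment> \<open>The mean over \<open>V\<close> is at most 3/4 and \<psi> is 1 on
            \<open>E\<close>, so the deviation on \<open>E\<close> is at least 1/4.\<close>
          have "1/4 * measure M (V \<inter> E) \<le> osc M \<psi> V * measure M V"
          proof (rule osc_markov[OF testD(1,2)[OF t] fmV Vp])
            show "V \<inter> E \<in> sets M" using E sets_M by (auto simp: V_def)
            show "1/4 \<le> \<bar>\<psi> x - avg M V \<psi>\<bar>" if "x \<in> V \<inter> E" for x
              using that avV by (simp add: E_def)
          qed auto
          also have "\<dots> \<le> \<epsilon> * measure M V" using oscV Vp by (intro mult_right_mono) auto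
          finally have "measure M (V \<inter> E) \<le> (4 * \<epsilon>) * measure M V" by simp
          also have "\<dots> \<le> \<epsilon>A * measure M V" using \<epsilon>(3) Vp by (intro mult_right_mono) auto
          finally have "measure M (ball y (3 * (sg ^ m * (r' / 2))) \<inter> E) \<le> \<epsilon>A * measure M (ball y (3 * (sg ^ m * (r' / 2))))"
            by (simp add: V_def \<rho>i' j)
          moreover have "y \<in> \<Omega> \<inter> ball z' (5 * r') \<inter> E" using yE yb by blast
          ultimately show False using TT[THEN conjunct2, THEN bspec, of y] nT by blast
        qed
      qed
      have bs: "bad a \<Lambda> \<psi> \<epsilon> \<in> sets \<nu>" using bad_open sets_\<nu> by auto
      have Zs: "Z \<in> sets \<nu>" using Z sets_\<nu> sets_M by (auto simp: null_sets_def)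
      have "measure \<nu> (\<Omega> \<inter> E) \<le> measure \<nu> ((bad a \<Lambda> \<psi> \<epsilon> \<union> Z) \<union> (\<Union>i\<in>G. T i))"
        using sub bs Zs G(2) by (intro \<nu>.finite_measure_mono sets.Un)
      moreover have "measure \<nu> ((bad a \<Lambda> \<psi> \<epsilon> \<union> Z) \<union> (\<Union>i\<in>G. T i)) \<le> measure \<nu> (bad a \<Lambda> \<psi> \<epsilon> \<union> Z) + measure \<nu> (\<Union>i\<in>G. T i)"
        using bs Zs G(2) by (intro measure_Un_le sets.Un)
      moreover have "measure \<nu> (bad a \<Lambda> \<psi> \<epsilon> \<union> Z) \<le> measure \<nu> (bad a \<Lambda> \<psi> \<epsilon>) + measure \<nu> Z"
        using bs Zs by (intro measure_Un_le)
      ultimately show ?thesis using G(3) null_\<nu>[OF Z] by linarith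
    qed (use \<theta> in auto)
    moreover have "{y\<in>\<Omega>. \<psi> y = 1} = \<Omega> \<inter> E" "{y\<in>\<Omega>. 0 < \<psi> y} = P" by (auto simp: E_def P_def)
    ultimately show "measure \<nu> {y\<in>\<Omega>. \<psi> y = 1} \<le> measure \<nu> (bad a \<Lambda> \<psi> \<epsilon>) + \<theta> * measure \<nu> {y\<in>\<Omega>. 0 < \<psi> y}" by simp
  qed
qed

end

subsection \<open>Summation over truncation levels\<close>

text \<open>For non-measurable integrands \<open>\<integral>\<^sup>+\<close> is a lower integral, which is only superadditive.\<close>

lemma nn_integral_superadd:
  fixes f g :: "'a \<Rightarrow> ennreal"
  shows "integral\<^sup>N M f + integral\<^sup>N M g \<le> (\<integral>\<^sup>+x. f x + g x \<partial>M)"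
proof -
  let ?S = "\<lambda>f. {h. simple_function M h \<and> h \<le> f}"
  have ne: "?S f \<noteq> {}" for f :: "'a \<Rightarrow> ennreal"
    by (auto simp: le_fun_def intro!: exI[of _ "\<lambda>_. 0"])
  have "integral\<^sup>N M f + integral\<^sup>N M g = (SUP u\<in>?S f. integral\<^sup>S M u + integral\<^sup>N M g)"
    unfolding nn_integral_def[of M f] by (rule ennreal_SUP_add_left[OF ne, symmetric])
  also have "\<dots> \<le> (\<integral>\<^sup>+x. f x + g x \<partial>M)"
  proof (rule SUP_least)
    fix u assume u: "u \<in> ?S f"
    have "integral\<^sup>S M u + integral\<^sup>N M g = (SUP v\<in>?S g. integral\<^sup>S M u + integral\<^sup>S M v)"
      unfolding nn_integral_def[of M g] by (rule ennreal_SUP_add_right[OF ne])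
    also have "\<dots> \<le> (\<integral>\<^sup>+x. f x + g x \<partial>M)"
    proof (rule SUP_least)
      fix v assume v: "v \<in> ?S g"
      have "integral\<^sup>S M u + integral\<^sup>S M v = integral\<^sup>S M (\<lambda>x. u x + v x)"
        using u v by (intro simple_integral_add[symmetric]) auto
      also have "\<dots> = (\<integral>\<^sup>+x. u x + v x \<partial>M)"
        using u v by (intro nn_integral_eq_simple_integral[symmetric]) auto
      also have "\<dots> \<le> (\<integral>\<^sup>+x. f x + g x \<partial>M)"
        using u v by (intro nn_integral_mono add_mono) (auto simp: le_fun_def)
      finally show "integral\<^sup>S M u + integral\<^sup>S M v \<le> (\<integral>\<^sup>+x. f x + g x \<partial>M)" .
    qed
    finally show "integral\<^sup>S M u + integral\<^sup>N M g \<le> (\<integral>\<^sup>+x. f x + g x \<partial>M)" .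
  qed
  finally show ?thesis .
qed

lemma nn_integral_superadd_sum:
  fixes f :: "'i \<Rightarrow> 'a \<Rightarrow> ennreal"
  assumes "finite F"
  shows "(\<Sum>i\<in>F. integral\<^sup>N M (f i)) \<le> (\<integral>\<^sup>+x. (\<Sum>i\<in>F. f i x) \<partial>M)"
  using assms
proof (induction F)
  case (insert i F)
  have "(\<Sum>j\<in>insert i F. integral\<^sup>N M (f j)) \<le> integral\<^sup>N M (f i) + (\<integral>\<^sup>+x. (\<Sum>i\<in>F. f i x) \<partial>M)"
    using insert by (simp add: add_left_mono)
  also have "\<dots> \<le> (\<integral>\<^sup>+x. f i x + (\<Sum>i\<in>F. f i x) \<partial>M)" by (rule nn_integral_superadd)
  finally show ?case using insert by simp
qed simp

lemma nn_integral_superadd_disjoint: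
  fixes e :: "'a \<Rightarrow> ennreal"
  assumes "finite F" "disjoint_family_on A F" "\<And>i. i \<in> F \<Longrightarrow> A i \<subseteq> B"
  shows "(\<Sum>i\<in>F. \<integral>\<^sup>+x\<in>A i. e x \<partial>M) \<le> (\<integral>\<^sup>+x\<in>B. e x \<partial>M)"
proof -
  have "(\<Sum>i\<in>F. e x * indicator (A i) x) \<le> e x * indicator B x" for x
  proof -
    have "(\<Sum>i\<in>F. indicator (A i) x :: ennreal) = indicator (\<Union>i\<in>F. A i) x"
      by (rule indicator_UN_disjoint[OF assms(1,2), symmetric])
    also have "\<dots> \<le> indicator B x" using assms(3) by (auto split: split_indicator)
    finally show ?thesis by (simp add: sum_distrib_left[symmetric] mult_left_mono)
  qed
  then show ?thesis
    by (intro order.trans[OF nn_integral_superadd_sum[OF assms(1)]] nn_integral_mono)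
qed

lemma powr_superadd:
  fixes a b k :: real
  assumes "0 \<le> a" "0 \<le> b" "1 \<le> k"
  shows "a powr k + b powr k \<le> (a + b) powr k"
proof (cases "a + b = 0")
  case False
  have split: "x powr k = x * x powr (k - 1)" if "0 \<le> x" for x :: real
    using that powr_add[of x 1 "k - 1"] by simp
  have "a powr k + b powr k = a * a powr (k - 1) + b * b powr (k - 1)"
    using assms split by simp
  also have "\<dots> \<le> a * (a + b) powr (k - 1) + b * (a + b) powr (k - 1)"
    using assms by (intro add_mono mult_left_mono powr_mono2) auto
  also have "\<dots> = (a + b) powr k" using assms split[of "a + b"] by (simp add: distrib_right)
  finally show ?thesis .
next
  case True
  then have "a = 0" "b = 0" using assms by linarith+
  then show ?thesis by simp
qed

lemma sum_powr_le:
  fixes x :: "'i \<Rightarrow> real"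
  assumes "finite F" "\<And>i. i \<in> F \<Longrightarrow> 0 \<le> x i" "1 \<le> k"
  shows "(\<Sum>i\<in>F. x i powr k) \<le> (\<Sum>i\<in>F. x i) powr k"
  using assms(1,2)
proof (induction F)
  case (insert i F)
  then have "(\<Sum>j\<in>insert i F. x j powr k) \<le> x i powr k + (\<Sum>j\<in>F. x j) powr k" by simp
  also have "\<dots> \<le> (x i + (\<Sum>j\<in>F. x j)) powr k"
    using insert assms(3) by (intro powr_superadd sum_nonneg) auto
  finally show ?case using insert by simp
qed simp

text \<open>Normalized to [0, 1], so that the fixed thresholds of the good-lambda bound apply at
  every level; the factor \<open>t\<close> returns in the energies.\<close>

definition trunc :: "real \<Rightarrow> ('a \<Rightarrow> real) \<Rightarrow> 'a \<Rightarrow> real" where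
  "trunc t h x = min (max 0 (h x - t)) t / t"

lemma trunc_props:
  assumes "0 < t"
  shows "0 \<le> trunc t h x" "trunc t h x \<le> 1" "trunc t h x = 1 \<longleftrightarrow> 2 * t \<le> h x"
    "0 < trunc t h x \<longleftrightarrow> t < h x" "trunc t h x = 0 \<longleftrightarrow> h x \<le> t"
  using assms by (auto simp: trunc_def min_def max_def field_simps)

text \<open>The threshold \<open>t0 * 2 ^ Suc k\<close> is twice the level of the
  \<open>k\<close>-th truncation, to match the set where that truncation equals 1. In the induction
  a value above \<open>t0 * 2 ^ m\<close> with \<open>m = Suc k\<close> is paid for by the single
  term \<open>k\<close>, whose height \<open>4 * (t0 * 2 ^ k)\<close> is the new cut-off.\<close>

lemma layer_cake_dyadic:
  fixes h t0 q :: real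
  assumes "0 < t0" "0 < q"
  shows "min (max 0 h) (t0 * 2 ^ m) powr q
    \<le> (2 * t0) powr q + (\<Sum>k<m. (4 * (t0 * 2 ^ k)) powr q * (if t0 * 2 ^ Suc k < h then 1 else 0))"
proof (induction m)
  case 0
  have "min (max 0 h) t0 powr q \<le> (2 * t0) powr q" using assms by (intro powr_mono2) auto
  then show ?case by simp
next
  case (Suc m)
  let ?S = "\<lambda>m. \<Sum>k<m. (4 * (t0 * 2 ^ k)) powr q * (if t0 * 2 ^ Suc k < h then 1 else 0)"
  have nn: "0 \<le> ?S m" for m by (intro sum_nonneg) auto
  have p: "0 < t0 * 2 ^ k" for k using assms by simp
  show ?case
  proof (cases "h \<le> t0 * 2 ^ m")
    case True
    then have "min (max 0 h) (t0 * 2 ^ Suc m) = min (max 0 h) (t0 * 2 ^ m)"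
      using p[of m] by (auto simp: min_def max_def)
    then have "min (max 0 h) (t0 * 2 ^ Suc m) powr q \<le> (2 * t0) powr q + ?S m" using Suc by simp
    moreover have "?S m \<le> ?S (Suc m)" by simp
    ultimately show ?thesis by linarith
  next
    case False
    have le: "min (max 0 h) (t0 * 2 ^ Suc m) powr q \<le> (2 * (t0 * 2 ^ m)) powr q"
      using assms p by (intro powr_mono2) auto
    show ?thesis
    proof (cases m)
      case 0
      then have "(2 * (t0 * 2 ^ m)) powr q \<le> (2 * t0) powr q + ?S (Suc m)" using nn[of "Suc m"] by simp
      with le show ?thesis by linarith
    next
      case (Suc k)
      have "(2 * (t0 * 2 ^ m)) powr q = (4 * (t0 * 2 ^ k)) powr q * (if t0 * 2 ^ Suc k < h then 1 else 0)"
        using False Suc by simp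
      also have "\<dots> \<le> ?S (Suc m)"
        using Suc by (intro member_le_sum) auto
      finally have "(2 * (t0 * 2 ^ m)) powr q \<le> ?S (Suc m)" .
      moreover have "0 \<le> (2 * t0) powr q" by simp
      ultimately show ?thesis using le by linarith
    qed
  qed
qed

section \<open>From local oscillation bounds to weak and strong estimates\<close>

context john_chain
begin

text \<open>The local bound is a power of a local energy and not additive, so the general covering
  lemma applies: over disjoint balls the energies add up to at most the total, and
  \<open>\<kappa> \<ge> 1\<close> lets their powers add up as well. The selection is disjoint at
  radius \<open>\<Lambda> * r\<close>, so the energies may live on \<open>ball z (l * r)\<close> for
  any \<open>l \<le> \<Lambda>\<close>.\<close>

lemma weak_estimate:
  assumes pq: "1 \<le> \<kappa>" and q: "0 < q" and l: "l \<le> \<Lambda>" "l * a \<le> c0" and t: "0 < t" and \<epsilon>: "0 < \<epsilon>" and K1: "0 \<le> K1"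
    and fin: "(\<integral>\<^sup>+y\<in>\<Omega>. e y \<partial>M) < \<infinity>"
    and loc: "\<And>z r. z \<in> \<Omega> \<Longrightarrow> 0 < r \<Longrightarrow> r \<le> a * bdist \<Omega> z \<Longrightarrow>
      (t * osc M \<psi> (ball z r)) powr q * measure \<nu> (ball z (5 * (\<Lambda> * r)))
        \<le> K1 * enn2real (\<integral>\<^sup>+y\<in>ball z (l * r). e y \<partial>M) powr \<kappa>"
  shows "t powr q * measure \<nu> (bad a \<Lambda> \<psi> \<epsilon>) \<le> K1 / \<epsilon> powr q * enn2real (\<integral>\<^sup>+y\<in>\<Omega>. e y \<partial>M) powr \<kappa>"
proof -
  have L0: "0 < \<Lambda>" using less_le_trans[OF _ \<Lambda>, of 0] CJ a(1) by simp
  define J where "J = enn2real (\<integral>\<^sup>+y\<in>\<Omega>. e y \<partial>M)"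
  have J: "(\<integral>\<^sup>+y\<in>\<Omega>. e y \<partial>M) = ennreal J" unfolding J_def using fin by (simp add: less_top)
  define I where "I = {(z, h). \<exists>r. h = \<Lambda> * r \<and> z \<in> \<Omega> \<and> 0 < r \<and> r \<le> a * bdist \<Omega> z \<and> \<epsilon> < osc M \<psi> (ball z r)}"
  define T where "T = (\<lambda>(z::'a, h::real). ball z (5 * h))"
  define A where "A = (\<lambda>(z::'a, h::real). ball z (l * (h / \<Lambda>)))"
  define Q where "Q = K1 / (t * \<epsilon>) powr q * J powr \<kappa>"
  obtain R where R: "0 < R" "\<Omega> \<subseteq> ball x0 R" "\<And>x. x \<in> \<Omega> \<Longrightarrow> bdist \<Omega> x \<le> R" by (rule \<Omega>_ball) (rule that)
  have i: "0 < h \<and> h \<le> R + \<Lambda> * (a * R) \<and> dist x0 z \<le> R + \<Lambda> * (a * R)" if zh: "(z, h) \<in> I" for z h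
  proof -
    obtain r where r: "h = \<Lambda> * r" "z \<in> \<Omega>" "0 < r" "r \<le> a * bdist \<Omega> z" using zh by (auto simp: I_def)
    have "a * bdist \<Omega> z \<le> a * R" using R(3)[OF r(2)] a by (intro mult_left_mono) auto
    then have "\<Lambda> * r \<le> \<Lambda> * (a * R)" using r(4) L0 by (intro mult_left_mono) auto
    moreover have "0 < \<Lambda> * r" using L0 r(3) by simp
    moreover have "dist x0 z < R" using R(2) r(2) by auto
    ultimately show ?thesis using r(1) R(1) by linarith
  qed
  have TN: "T (z, h) \<in> sets \<nu>" for z h using sets_\<nu> by (simp add: T_def)
  have sum: "(\<Sum>i\<in>F. emeasure \<nu> (T i)) \<le> ennreal Q"
    if F: "finite F" "F \<subseteq> I" "disjoint_family_on (\<lambda>(z, h). ball z h) F" for F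
  proof -
    have each: "measure \<nu> (T i) \<le> K1 / (t * \<epsilon>) powr q * enn2real (\<integral>\<^sup>+y\<in>A i. e y \<partial>M) powr \<kappa> \<and> A i \<subseteq> \<Omega> \<and>
        A i \<subseteq> (\<lambda>(z, h). ball z h) i" if iF: "i \<in> F" for i
    proof -
      obtain z r where r: "i = (z, \<Lambda> * r)" "z \<in> \<Omega>" "0 < r" "r \<le> a * bdist \<Omega> z" "\<epsilon> < osc M \<psi> (ball z r)"
      proof -
        obtain z h where zh: "i = (z, h)" by (cases i)
        then have "(z, h) \<in> I" using iF F(2) by blast
        then show thesis unfolding I_def using that zh by blast
      qed
      have Ai: "A i = ball z (l * r)" using L0 by (simp add: A_def r(1))
      have "l * r \<le> c0 * bdist \<Omega> z"
      proof (cases "0 \<le> l")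
        case True
        have "l * r \<le> l * (a * bdist \<Omega> z)" using r(4) True by (intro mult_left_mono) auto
        also have "\<dots> \<le> c0 * bdist \<Omega> z"
          using mult_right_mono[OF l(2), of "bdist \<Omega> z"] bdist_pos[OF r(2)] by (simp add: mult.assoc)
        finally show ?thesis .
      next
        case False
        then have "l * r \<le> 0" using r(3) by (simp add: mult_le_0_iff)
        moreover have "0 \<le> c0 * bdist \<Omega> z" using c0(1) bdist_pos[OF r(2)] by simp
        ultimately show ?thesis by linarith
      qed
      then have "A i \<subseteq> \<Omega>" using c0(2)[OF r(2)] Ai subset_ball by blast
      moreover have "A i \<subseteq> ball z (\<Lambda> * r)"
        unfolding Ai using l(1) r(3) by (intro subset_ball mult_right_mono) auto
      moreover have "measure \<nu> (T i) \<le> K1 / (t * \<epsilon>) powr q * enn2real (\<integral>\<^sup>+y\<in>A i. e y \<partial>M) powr \<kappa>"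
      proof -
        have "(t * \<epsilon>) powr q * measure \<nu> (T i) \<le> (t * osc M \<psi> (ball z r)) powr q * measure \<nu> (T i)"
          using t \<epsilon> r(5) q by (intro mult_right_mono powr_mono2 mult_left_mono) auto
        also have "\<dots> \<le> K1 * enn2real (\<integral>\<^sup>+y\<in>A i. e y \<partial>M) powr \<kappa>"
          unfolding Ai unfolding T_def r(1) prod.case by (rule loc[OF r(2-4)])
        finally show ?thesis using t \<epsilon> by (simp add: field_simps)
      qed
      ultimately show ?thesis by (simp add: r(1))
    qed
    have dj: "disjoint_family_on A F"
      unfolding disjoint_family_on_def
    proof (intro ballI impI)
      fix i j assume ij: "i \<in> F" "j \<in> F" "i \<noteq> j"
      then have "(\<lambda>(z, h). ball z h) i \<inter> (\<lambda>(z, h). ball z h) j = {}"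
        using F(3) unfolding disjoint_family_on_def by blast
      then show "A i \<inter> A j = {}" using each[OF ij(1)] each[OF ij(2)] by blast
    qed
    have sA: "(\<Sum>i\<in>F. \<integral>\<^sup>+y\<in>A i. e y \<partial>M) \<le> ennreal J"
      unfolding J[symmetric] using each by (intro nn_integral_superadd_disjoint F(1) dj) blast
    define x where "x i = enn2real (\<integral>\<^sup>+y\<in>A i. e y \<partial>M)" for i
    have xe: "(\<integral>\<^sup>+y\<in>A i. e y \<partial>M) = ennreal (x i)" if "i \<in> F" for i
    proof -
      have "(\<integral>\<^sup>+y\<in>A i. e y \<partial>M) \<le> (\<Sum>i\<in>F. \<integral>\<^sup>+y\<in>A i. e y \<partial>M)"
        using that F(1) by (intro member_le_sum) auto
      then have "(\<integral>\<^sup>+y\<in>A i. e y \<partial>M) < top" using sA by (meson ennreal_less_top le_less_trans)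
      then show ?thesis by (simp add: x_def)
    qed
    have "(\<Sum>i\<in>F. ennreal (x i)) \<le> ennreal J" using sA xe by simp
    then have xJ: "(\<Sum>i\<in>F. x i) \<le> J"
      by (subst (asm) sum_ennreal) (auto simp: x_def ennreal_le_iff J_def)
    have "(\<Sum>i\<in>F. emeasure \<nu> (T i)) = ennreal (\<Sum>i\<in>F. measure \<nu> (T i))"
      by (simp add: \<nu>.emeasure_eq_measure)
    also have "\<dots> \<le> ennreal Q"
    proof (rule ennreal_leI)
      have "(\<Sum>i\<in>F. measure \<nu> (T i)) \<le> (\<Sum>i\<in>F. K1 / (t * \<epsilon>) powr q * x i powr \<kappa>)"
        using each by (intro sum_mono) (simp add: x_def)
      also have "\<dots> = K1 / (t * \<epsilon>) powr q * (\<Sum>i\<in>F. x i powr \<kappa>)" by (simp add: sum_distrib_left)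
      also have "\<dots> \<le> K1 / (t * \<epsilon>) powr q * ((\<Sum>i\<in>F. x i) powr \<kappa>)"
        using K1 by (intro mult_left_mono sum_powr_le F(1) pq) (auto simp: x_def)
      also have "\<dots> \<le> Q"
        unfolding Q_def using K1 xJ pq by (intro mult_left_mono powr_mono2 sum_nonneg) (auto simp: x_def)
      finally show "(\<Sum>i\<in>F. measure \<nu> (T i)) \<le> Q" .
    qed
    finally show ?thesis .
  qed
  have "measure \<nu> (bad a \<Lambda> \<psi> \<epsilon>) \<le> Q"
  proof (rule covering_lemma[where M = M and N = \<nu> and I = I and T = T and Q = "ennreal Q", OF M pos i TN sum])
    fix G assume G: "\<And>z h. (z, h) \<in> I \<Longrightarrow> \<exists>z' h'. (z', h') \<in> G \<and> h \<le> 2 * h' \<and> ball z h \<subseteq> ball z' (5 * h')"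
      "(\<Union>i\<in>G. T i) \<in> sets \<nu>" "emeasure \<nu> (\<Union>i\<in>G. T i) \<le> ennreal Q"
    have "bad a \<Lambda> \<psi> \<epsilon> \<subseteq> (\<Union>i\<in>G. T i)"
    proof
      fix y assume "y \<in> bad a \<Lambda> \<psi> \<epsilon>"
      then obtain z r where "(z, \<Lambda> * r) \<in> I" "y \<in> ball z (\<Lambda> * r)" unfolding bad_def I_def by blast
      with G(1)[of z "\<Lambda> * r"] obtain z' h' where "(z', h') \<in> G" "y \<in> ball z' (5 * h')" by blast
      then show "y \<in> (\<Union>i\<in>G. T i)" unfolding T_def by blast
    qed
    then have "emeasure \<nu> (bad a \<Lambda> \<psi> \<epsilon>) \<le> emeasure \<nu> (\<Union>i\<in>G. T i)"
      using G(2) by (intro emeasure_mono) auto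
    also note G(3)
    finally show ?thesis using K1 by (simp add: \<nu>.emeasure_eq_measure Q_def ennreal_le_iff)
  qed
  then have "t powr q * measure \<nu> (bad a \<Lambda> \<psi> \<epsilon>) \<le> t powr q * Q" by (intro mult_left_mono) auto
  also have "t powr q * Q = K1 / \<epsilon> powr q * J powr \<kappa>"
    using t \<epsilon> by (simp add: Q_def powr_mult)
  finally show ?thesis by (simp add: J_def)
qed

text \<open>The good-lambda bound at level \<open>t\<close> estimates {h > 2t} by the bad set and a
  small multiple of {h > t}. After multiplication by \<open>t powr q\<close> and summation over
  \<open>t = t0 * 2 ^ k\<close>, the last term is a shifted copy of the left side plus a boundary
  term with \<open>t0 powr q\<close>. The copy is absorbed, and the boundary term vanishes as
  \<open>t0\<close> tends to 0.\<close>

lemma weak_to_strong: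
  assumes \<kappa>: "1 \<le> \<kappa>" and q: "0 < q" and l: "l \<le> \<Lambda>" "l * a \<le> c0" and K1: "0 \<le> K1"
  obtains K where "0 < K"
    "\<And>h e Et. h \<in> borel_measurable borel \<Longrightarrow> measure M B0 \<le> 2 * measure M {y\<in>B0. h y \<le> 0} \<Longrightarrow> 0 \<le> Et \<Longrightarrow>
      \<forall>t z r. 0 < t \<and> z \<in> \<Omega> \<and> 0 < r \<and> r \<le> a * bdist \<Omega> z \<longrightarrow>
        (t * osc M (trunc t h) (ball z r)) powr q * measure \<nu> (ball z (5 * (\<Lambda> * r)))
          \<le> K1 * enn2real (\<integral>\<^sup>+y\<in>ball z (l * r). e t y \<partial>M) powr \<kappa> \<Longrightarrow>
      \<forall>t0 m. 0 < t0 \<longrightarrow> (\<Sum>k<m. \<integral>\<^sup>+y\<in>\<Omega>. e (t0 * 2 ^ k) y \<partial>M) \<le> ennreal Et \<Longrightarrow>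
      (\<integral>\<^sup>+y\<in>\<Omega>. ennreal (max 0 (h y) powr q) \<partial>\<nu>) \<le> ennreal (K * Et powr \<kappa>)"
proof -
  \<comment> \<open>The index shift in the dyadic sum costs \<open>2 powr q\<close>; this \<theta>
    turns the cost into one half.\<close>
  define \<theta> where "\<theta> = 1 / (2 * 2 powr q)"
  have \<theta>: "0 < \<theta>" by (simp add: \<theta>_def)
  obtain \<epsilon> where \<epsilon>: "0 < \<epsilon>" and gl:
    "\<And>\<psi>. test \<psi> \<Longrightarrow> measure \<nu> {y\<in>\<Omega>. \<psi> y = 1} \<le> measure \<nu> (bad a \<Lambda> \<psi> \<epsilon>) + \<theta> * measure \<nu> {y\<in>\<Omega>. 0 < \<psi> y}"
    by (rule good_lambda[OF \<theta>]) (rule that)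
  \<comment> \<open>The summand 1 makes \<open>K\<close> positive also when
    \<open>K1 = 0\<close>.\<close>
  define K where "K = 4 powr q * (2 * (K1 / \<epsilon> powr q)) + 1"
  have K: "0 < K" using K1 by (auto simp: K_def intro!: add_nonneg_pos)
  show thesis
  proof (rule that[OF K])
    fix h :: "'a \<Rightarrow> real" and e :: "real \<Rightarrow> 'a \<Rightarrow> ennreal" and Et :: real
    assume hm [measurable]: "h \<in> borel_measurable borel" and med: "measure M B0 \<le> 2 * measure M {y\<in>B0. h y \<le> 0}"
      and Et: "0 \<le> Et" and loc: "\<forall>t z r. 0 < t \<and> z \<in> \<Omega> \<and> 0 < r \<and> r \<le> a * bdist \<Omega> z \<longrightarrow>
        (t * osc M (trunc t h) (ball z r)) powr q * measure \<nu> (ball z (5 * (\<Lambda> * r)))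
          \<le> K1 * enn2real (\<integral>\<^sup>+y\<in>ball z (l * r). e t y \<partial>M) powr \<kappa>"
      and tot: "\<forall>t0 m. 0 < t0 \<longrightarrow> (\<Sum>k<m. \<integral>\<^sup>+y\<in>\<Omega>. e (t0 * 2 ^ k) y \<partial>M) \<le> ennreal Et"
    have lev: "{y\<in>B0. h y \<le> t} \<in> sets borel" "{y\<in>\<Omega>. t < h y} \<in> sets borel" for t
    proof -
      have "{y\<in>space borel. h y \<le> t} \<in> sets borel" "{y\<in>space borel. t < h y} \<in> sets borel" by measurable
      moreover have "{y\<in>B0. h y \<le> t} = B0 \<inter> {y\<in>space borel. h y \<le> t}" "{y\<in>\<Omega>. t < h y} = \<Omega> \<inter> {y\<in>space borel. t < h y}" by auto
      ultimately show "{y\<in>B0. h y \<le> t} \<in> sets borel" "{y\<in>\<Omega>. t < h y} \<in> sets borel" using \<Omega>(1) by auto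
    qed
    have test: "test (trunc t h)" if t: "0 < t" for t
      unfolding test_def
    proof (intro conjI allI)
      show "trunc t h \<in> borel_measurable borel" unfolding trunc_def[abs_def] by measurable
      show "0 \<le> trunc t h x" "trunc t h x \<le> 1" for x by (rule trunc_props[OF t])+
      have "measure M {y\<in>B0. h y \<le> 0} \<le> measure M {y\<in>B0. h y \<le> t}"
        using t lev by (intro ball_doubling_mono[OF M, of _ _ x0 "b * R0"]) auto
      then show "measure M B0 \<le> 2 * measure M {y\<in>B0. trunc t h y = 0}"
        using med by (simp add: trunc_props(5)[OF t])
    qed
    define al where "al t = measure \<nu> {y\<in>\<Omega>. t < h y}" for t
    define J where "J t = enn2real (\<integral>\<^sup>+y\<in>\<Omega>. e t y \<partial>M)" for t
    have Jfin: "(\<integral>\<^sup>+y\<in>\<Omega>. e t y \<partial>M) < \<infinity>" if t: "0 < t" for t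
    proof -
      have "(\<integral>\<^sup>+y\<in>\<Omega>. e t y \<partial>M) \<le> ennreal Et"
        using tot[rule_format, OF t, of 1] by simp
      then show ?thesis using ennreal_less_top[of Et] by (simp add: le_less_trans)
    qed
    have J: "(\<integral>\<^sup>+y\<in>\<Omega>. e t y \<partial>M) = ennreal (J t)" if "0 < t" for t
      using Jfin[OF that] unfolding J_def by simp
    have step: "t powr q * al (2 * t) \<le> K1 / \<epsilon> powr q * J t powr \<kappa> + \<theta> * (t powr q * al t)" if t: "0 < t" for t
    proof -
      have "al (2 * t) \<le> measure \<nu> {y\<in>\<Omega>. trunc t h y = 1}"
      proof -
        have "{y\<in>\<Omega>. trunc t h y = 1} = \<Omega> \<inter> {y\<in>space borel. 2 * t \<le> h y}" by (auto simp: trunc_props(3)[OF t])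
        moreover have "{y\<in>space borel. 2 * t \<le> h y} \<in> sets borel" by measurable
        ultimately have "{y\<in>\<Omega>. trunc t h y = 1} \<in> sets \<nu>" using \<Omega>(1) sets_\<nu> by auto
        then show ?thesis unfolding al_def by (intro \<nu>.finite_measure_mono) (auto simp: trunc_props(3)[OF t])
      qed
      also have "\<dots> \<le> measure \<nu> (bad a \<Lambda> (trunc t h) \<epsilon>) + \<theta> * al t"
        using gl[OF test[OF t]] by (simp add: al_def trunc_props(4)[OF t])
      finally have "t powr q * al (2 * t) \<le> t powr q * (measure \<nu> (bad a \<Lambda> (trunc t h) \<epsilon>) + \<theta> * al t)"
        by (intro mult_left_mono) auto
      moreover have "t powr q * measure \<nu> (bad a \<Lambda> (trunc t h) \<epsilon>) \<le> K1 / \<epsilon> powr q * J t powr \<kappa>"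
        unfolding J_def
      proof (rule weak_estimate[OF \<kappa> q l t \<epsilon> K1 Jfin[OF t]])
        fix z r assume "z \<in> \<Omega>" "0 < r" "r \<le> a * bdist \<Omega> z"
        then show "(t * osc M (trunc t h) (ball z r)) powr q * measure \<nu> (ball z (5 * (\<Lambda> * r)))
          \<le> K1 * enn2real (\<integral>\<^sup>+y\<in>ball z (l * r). e t y \<partial>M) powr \<kappa>" using loc t by blast
      qed
      ultimately show ?thesis by (simp add: algebra_simps)
    qed
    define V where "V = measure \<nu> \<Omega>"
    have alV: "al t \<le> V" for t
      unfolding al_def V_def using \<Omega>(1) sets_\<nu> by (intro \<nu>.finite_measure_mono) auto
    have al0: "0 \<le> al t" for t by (simp add: al_def)
    define X where "X = K1 / \<epsilon> powr q * Et powr \<kappa>"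
    have sumS: "(\<Sum>k<m. (t0 * 2 ^ k) powr q * al (t0 * 2 ^ Suc k)) \<le> 2 * X + t0 powr q * V"
      if t0: "0 < t0" for t0 m
    proof -
      have p: "0 < t0 * 2 ^ k" for k using t0 by simp
      define S where "S = (\<Sum>k<m. (t0 * 2 ^ k) powr q * al (t0 * 2 ^ Suc k))"
      have S0: "0 \<le> S" unfolding S_def using al0 by (intro sum_nonneg) auto
      have "S \<le> (\<Sum>k<m. K1 / \<epsilon> powr q * J (t0 * 2 ^ k) powr \<kappa> + \<theta> * ((t0 * 2 ^ k) powr q * al (t0 * 2 ^ k)))"
        unfolding S_def using step[OF p] by (intro sum_mono) (simp add: mult_ac)
      also have "\<dots> = K1 / \<epsilon> powr q * (\<Sum>k<m. J (t0 * 2 ^ k) powr \<kappa>) + \<theta> * (\<Sum>k<m. (t0 * 2 ^ k) powr q * al (t0 * 2 ^ k))"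
        by (simp add: sum.distrib sum_distrib_left)
      also have "K1 / \<epsilon> powr q * (\<Sum>k<m. J (t0 * 2 ^ k) powr \<kappa>) \<le> X"
      proof -
        have "(\<Sum>k<m. ennreal (J (t0 * 2 ^ k))) \<le> ennreal Et"
          using tot[rule_format, OF t0, of m] J[OF p] by simp
        then have "(\<Sum>k<m. J (t0 * 2 ^ k)) \<le> Et"
          using Et by (subst (asm) sum_ennreal) (auto simp: J_def ennreal_le_iff)
        then have "(\<Sum>k<m. J (t0 * 2 ^ k)) powr \<kappa> \<le> Et powr \<kappa>"
          using \<kappa> by (intro powr_mono2 sum_nonneg) (auto simp: J_def)
        moreover have "(\<Sum>k<m. J (t0 * 2 ^ k) powr \<kappa>) \<le> (\<Sum>k<m. J (t0 * 2 ^ k)) powr \<kappa>"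
          using \<kappa> by (intro sum_powr_le) (auto simp: J_def)
        ultimately show ?thesis unfolding X_def using K1 by (intro mult_left_mono) auto
      qed
      also have "(\<Sum>k<m. (t0 * 2 ^ k) powr q * al (t0 * 2 ^ k)) \<le> t0 powr q * V + 2 powr q * S"
      proof (cases m)
        case 0
        then show ?thesis using S0 by (simp add: V_def)
      next
        case (Suc n)
        have "(\<Sum>k<m. (t0 * 2 ^ k) powr q * al (t0 * 2 ^ k))
          = t0 powr q * al t0 + (\<Sum>k<n. (t0 * 2 ^ Suc k) powr q * al (t0 * 2 ^ Suc k))"
          unfolding Suc by (subst sum.lessThan_Suc_shift) simp
        also have "(\<Sum>k<n. (t0 * 2 ^ Suc k) powr q * al (t0 * 2 ^ Suc k)) = 2 powr q * (\<Sum>k<n. (t0 * 2 ^ k) powr q * al (t0 * 2 ^ Suc k))"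
        proof -
          have "(t0 * 2 ^ Suc k) powr q = 2 powr q * (t0 * 2 ^ k) powr q" for k
            using t0 powr_mult[of 2 "t0 * 2 ^ k" q] by (simp add: mult_ac)
          then show ?thesis by (simp add: sum_distrib_left mult.assoc)
        qed
        also have "(\<Sum>k<n. (t0 * 2 ^ k) powr q * al (t0 * 2 ^ Suc k)) \<le> S"
          unfolding S_def using Suc al0 by (intro sum_mono2) auto
        finally show ?thesis using mult_left_mono[OF alV[of t0], of "t0 powr q"] by simp
      qed
      finally have "S \<le> X + \<theta> * (t0 powr q * V + 2 powr q * S)" using \<theta> by simp
      \<comment> \<open>Subtracting \<open>S / 2\<close> is legitimate because \<open>S\<close> is a
        finite sum of finite terms, \<nu> being finite.\<close>
      also have "\<dots> = X + \<theta> * (t0 powr q * V) + S / 2" by (simp add: \<theta>_def field_simps)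
      finally have "S \<le> 2 * X + 2 * \<theta> * (t0 powr q * V)" by simp
      also have "2 * \<theta> * (t0 powr q * V) \<le> 1 * (t0 powr q * V)"
      proof (intro mult_right_mono)
        have "1 \<le> 2 powr q" using q by (intro ge_one_powr_ge_zero) auto
        then show "2 * \<theta> \<le> 1" by (simp add: \<theta>_def)
      qed (simp add: V_def)
      finally show ?thesis by (simp add: S_def)
    qed
    have bound: "(\<integral>\<^sup>+y\<in>\<Omega>. ennreal (min (max 0 (h y)) (t0 * 2 ^ m) powr q) \<partial>\<nu>)
        \<le> ennreal (4 powr q * (2 * X) + (2 powr q + 4 powr q) * V * t0 powr q)" if t0: "0 < t0" for t0 m
    proof -
      have "(\<integral>\<^sup>+y\<in>\<Omega>. ennreal (min (max 0 (h y)) (t0 * 2 ^ m) powr q) \<partial>\<nu>)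
        \<le> (\<integral>\<^sup>+y. (ennreal ((2 * t0) powr q) * indicator \<Omega> y +
              (\<Sum>k<m. ennreal ((4 * (t0 * 2 ^ k)) powr q) * indicator {y\<in>\<Omega>. t0 * 2 ^ Suc k < h y} y)) \<partial>\<nu>)"
      proof (intro nn_integral_mono)
        fix y
        have "ennreal (min (max 0 (h y)) (t0 * 2 ^ m) powr q) \<le> ennreal ((2 * t0) powr q +
          (\<Sum>k<m. (4 * (t0 * 2 ^ k)) powr q * (if t0 * 2 ^ Suc k < h y then 1 else 0)))"
          by (rule ennreal_leI[OF layer_cake_dyadic[OF t0 q]])
        also have "\<dots> = ennreal ((2 * t0) powr q) +
          (\<Sum>k<m. ennreal ((4 * (t0 * 2 ^ k)) powr q * (if t0 * 2 ^ Suc k < h y then 1 else 0)))"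
          by (subst ennreal_plus) (auto intro!: sum_nonneg simp: sum_ennreal)
        also have "(\<Sum>k<m. ennreal ((4 * (t0 * 2 ^ k)) powr q * (if t0 * 2 ^ Suc k < h y then 1 else 0)))
          = (\<Sum>k<m. ennreal ((4 * (t0 * 2 ^ k)) powr q) * (if t0 * 2 ^ Suc k < h y then 1 else 0))"
          by (intro sum.cong) auto
        finally have main: "ennreal (min (max 0 (h y)) (t0 * 2 ^ m) powr q) \<le> ennreal ((2 * t0) powr q) +
          (\<Sum>k<m. ennreal ((4 * (t0 * 2 ^ k)) powr q) * (if t0 * 2 ^ Suc k < h y then 1 else 0))" .
        have eq: "(\<Sum>k<m. ennreal ((4 * (t0 * 2 ^ k)) powr q) * indicator {y\<in>\<Omega>. t0 * 2 ^ Suc k < h y} y)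
          = (\<Sum>k<m. ennreal ((4 * (t0 * 2 ^ k)) powr q) * (if t0 * 2 ^ Suc k < h y then 1 else 0))" if "y \<in> \<Omega>"
          using that by (intro sum.cong) (auto simp: indicator_def)
        show "ennreal (min (max 0 (h y)) (t0 * 2 ^ m) powr q) * indicator \<Omega> y
          \<le> ennreal ((2 * t0) powr q) * indicator \<Omega> y +
              (\<Sum>k<m. ennreal ((4 * (t0 * 2 ^ k)) powr q) * indicator {y\<in>\<Omega>. t0 * 2 ^ Suc k < h y} y)"
        proof (cases "y \<in> \<Omega>")
          case True
          show ?thesis unfolding eq[OF True] using main True by (simp only: indicator_simps mult_1_right)
        qed simp
      qed
      also have "\<dots> = ennreal ((2 * t0) powr q) * emeasure \<nu> \<Omega> +
          (\<Sum>k<m. ennreal ((4 * (t0 * 2 ^ k)) powr q) * emeasure \<nu> {y\<in>\<Omega>. t0 * 2 ^ Suc k < h y})"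
      proof -
        have [measurable]: "\<Omega> \<in> sets \<nu>" "{y\<in>\<Omega>. t < h y} \<in> sets \<nu>" for t using \<Omega>(1) lev sets_\<nu> by auto
        show ?thesis
          by (subst nn_integral_add, measurable, subst nn_integral_sum, measurable)
            (simp add: nn_integral_cmult_indicator)
      qed
      also have "\<dots> = ennreal ((2 * t0) powr q * V + (\<Sum>k<m. (4 * (t0 * 2 ^ k)) powr q * al (t0 * 2 ^ Suc k)))"
        unfolding V_def al_def \<nu>.emeasure_eq_measure
        by (subst ennreal_plus) (auto intro!: sum_nonneg simp: sum_ennreal[symmetric] ennreal_mult')
      also have "(\<Sum>k<m. (4 * (t0 * 2 ^ k)) powr q * al (t0 * 2 ^ Suc k)) = 4 powr q * (\<Sum>k<m. (t0 * 2 ^ k) powr q * al (t0 * 2 ^ Suc k))"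
        using t0 by (simp add: powr_mult sum_distrib_left mult.assoc)
      also have "ennreal ((2 * t0) powr q * V + 4 powr q * (\<Sum>k<m. (t0 * 2 ^ k) powr q * al (t0 * 2 ^ Suc k)))
        \<le> ennreal ((2 * t0) powr q * V + 4 powr q * (2 * X + t0 powr q * V))"
        using sumS[OF t0, of m] by (intro ennreal_leI add_left_mono mult_left_mono) auto
      also have "(2 * t0) powr q * V + 4 powr q * (2 * X + t0 powr q * V) = 4 powr q * (2 * X) + (2 powr q + 4 powr q) * V * t0 powr q"
        using t0 by (simp add: powr_mult algebra_simps)
      finally show ?thesis .
    qed
    \<comment> \<open>The cut-off \<open>2 ^ N\<close> stays fixed while
      \<open>t0 = (1/2) ^ n0\<close> becomes small and the number of levels is
      \<open>N + n0\<close>. This works because the bound \<open>Et\<close> on the summed energies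
      does not depend on \<open>t0\<close> or on the number of levels.\<close>
    have cut: "(\<integral>\<^sup>+y\<in>\<Omega>. ennreal (min (max 0 (h y)) (2 ^ N) powr q) \<partial>\<nu>) \<le> ennreal (4 powr q * (2 * X))" for N :: nat
    proof (rule ennreal_le_epsilon)
      fix ep :: real assume ep: "0 < ep"
      define c1 where "c1 = (2 powr q + 4 powr q) * V"
      have c1: "0 \<le> c1" by (simp add: c1_def V_def)
      have "(\<lambda>n. c1 * ((1/2) powr q) ^ n) \<longlonglongrightarrow> c1 * 0"
      proof (intro tendsto_mult tendsto_const LIMSEQ_realpow_zero)
        have "(1/2 :: real) powr q < (1/2) powr 0" using q by (intro powr_less_mono') auto
        then show "(1/2 :: real) powr q < 1" by simp
      qed simp
      then have "eventually (\<lambda>n. c1 * ((1/2) powr q) ^ n < ep) sequentially"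
        using ep by (intro order_tendstoD) auto
      then obtain n0 where n0: "\<And>n. n \<ge> n0 \<Longrightarrow> c1 * ((1/2) powr q) ^ n < ep"
        by (auto simp: eventually_sequentially)
      have t0: "0 < (1/2 :: real) ^ n0" by simp
      have eq: "(1/2) ^ n0 * 2 ^ (N + n0) = (2 ^ N :: real)" by (simp add: power_add power_one_over)
      have pw: "((1/2 :: real) ^ n0) powr q = ((1/2) powr q) ^ n0"
        by (simp add: powr_realpow[symmetric] powr_powr mult.commute)
      have "(\<integral>\<^sup>+y\<in>\<Omega>. ennreal (min (max 0 (h y)) (2 ^ N) powr q) \<partial>\<nu>) \<le> ennreal (4 powr q * (2 * X) + c1 * ((1/2) powr q) ^ n0)"
        using bound[OF t0, of "N + n0"] unfolding eq pw c1_def .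
      also have "\<dots> \<le> ennreal (4 powr q * (2 * X) + ep)"
        using n0[of n0] by (intro ennreal_leI) simp
      also have "\<dots> = ennreal (4 powr q * (2 * X)) + ennreal ep"
        using ep K1 by (intro ennreal_plus) (auto simp: X_def)
      finally show "(\<integral>\<^sup>+y\<in>\<Omega>. ennreal (min (max 0 (h y)) (2 ^ N) powr q) \<partial>\<nu>) \<le> ennreal (4 powr q * (2 * X)) + ennreal ep" .
    qed
    have sup: "(SUP N. ennreal (min (max 0 (h y)) (2 ^ N) powr q) * indicator \<Omega> y) = ennreal (max 0 (h y) powr q) * indicator \<Omega> y" for y
    proof (rule antisym)
      show "(SUP N. ennreal (min (max 0 (h y)) (2 ^ N) powr q) * indicator \<Omega> y) \<le> ennreal (max 0 (h y) powr q) * indicator \<Omega> y"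
        using q by (intro SUP_least mult_right_mono ennreal_leI powr_mono2) auto
      obtain N where "max 0 (h y) < 2 ^ N" using real_arch_pow[of 2 "max 0 (h y)"] by auto
      then have "min (max 0 (h y)) (2 ^ N) = max 0 (h y)" by simp
      then show "ennreal (max 0 (h y) powr q) * indicator \<Omega> y \<le> (SUP N. ennreal (min (max 0 (h y)) (2 ^ N) powr q) * indicator \<Omega> y)"
        by (intro SUP_upper2[of N]) simp_all
    qed
    have [measurable]: "\<Omega> \<in> sets \<nu>" "h \<in> borel_measurable \<nu>"
      using \<Omega>(1) sets_\<nu> hm measurable_cong_sets[OF sets_\<nu> refl, of borel] by auto
    have "(\<integral>\<^sup>+y\<in>\<Omega>. ennreal (max 0 (h y) powr q) \<partial>\<nu>) = (\<integral>\<^sup>+y. (SUP N. ennreal (min (max 0 (h y)) (2 ^ N) powr q) * indicator \<Omega> y) \<partial>\<nu>)"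
      by (simp only: sup)
    also have "\<dots> = (SUP N. \<integral>\<^sup>+y\<in>\<Omega>. ennreal (min (max 0 (h y)) (2 ^ N) powr q) \<partial>\<nu>)"
    proof (rule nn_integral_monotone_convergence_SUP)
      show "incseq (\<lambda>N y. ennreal (min (max 0 (h y)) (2 ^ N) powr q) * indicator \<Omega> y)"
        unfolding incseq_def le_fun_def using q
        by (intro allI impI mult_right_mono ennreal_leI powr_mono2 min.mono) auto
    qed measurable
    also have "\<dots> \<le> ennreal (4 powr q * (2 * X))" by (intro SUP_least cut)
    also have "\<dots> \<le> ennreal (K * Et powr \<kappa>)"
    proof (rule ennreal_leI)
      have "K * Et powr \<kappa> = 4 powr q * (2 * X) + Et powr \<kappa>" by (simp add: K_def X_def algebra_simps)
      then show "4 powr q * (2 * X) \<le> K * Et powr \<kappa>" by simp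
    qed
    finally show "(\<integral>\<^sup>+y\<in>\<Omega>. ennreal (max 0 (h y) powr q) \<partial>\<nu>) \<le> ennreal (K * Et powr \<kappa>)" .
  qed
qed

end

subsection \<open>The two-weight condition\<close>

text \<open>The last factor in the condition on the pair of weights, isolated as a function of the
  set.\<close>

definition dual_factor :: "'a::metric_space measure \<Rightarrow> real \<Rightarrow> ('a \<Rightarrow> real) \<Rightarrow> 'a set \<Rightarrow> ennreal" where
  "dual_factor M p v B = (if p = 1 then esssup (restrict_space M B) (\<lambda>y. inverse (ennreal (v y)))
     else ennreal_powr (nn_avg M B (\<lambda>y. ennreal_powr (ennreal (v y)) (1 - p / (p - 1)))) ((p - 1) / p))"

text \<open>Hoelder's inequality for \<open>f * v powr (1 / p)\<close> and
  \<open>v powr (- (1 / p))\<close>, obtained from Young's inequality at each point. This form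
  tolerates zeros of \<open>v\<close>: there the dual power, and with it the right side, is
  infinite. The normalization divides by \<open>e\<close>, hence \<open>0 < e\<close>.\<close>

lemma holder_pos:
  assumes p: "1 \<le> p" and B: "B \<in> sets M" "emeasure M B = ennreal m" "0 < m"
    and f [measurable]: "f \<in> borel_measurable M" and f0: "\<And>x. 0 \<le> f x"
    and v [measurable]: "v \<in> borel_measurable M" and v0: "\<And>x. 0 \<le> v x"
    and e: "0 < e" "(\<integral>\<^sup>+x\<in>B. ennreal (f x powr p * v x) \<partial>M) \<le> ennreal e"
    and H: "0 < H" "dual_factor M p v B \<le> ennreal H"
  shows "(\<integral>\<^sup>+x\<in>B. ennreal (f x) \<partial>M) \<le> ennreal (e powr (1 / p) * H * m powr (1 - 1 / p))"
proof (cases "p = 1")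
  case True
  have "AE x in restrict_space M B. inverse (ennreal (v x)) \<le> dual_factor M p v B"
    unfolding dual_factor_def using True by (simp add: esssup_AE)
  then have ae: "AE x in M. x \<in> B \<longrightarrow> inverse (ennreal (v x)) \<le> dual_factor M p v B"
    using B(1) by (subst (asm) AE_restrict_space_iff) auto
  have "(\<integral>\<^sup>+x\<in>B. ennreal (f x) \<partial>M) \<le> (\<integral>\<^sup>+x. ennreal H * (ennreal (f x powr p * v x) * indicator B x) \<partial>M)"
  proof (rule nn_integral_mono_AE)
    show "AE x in M. ennreal (f x) * indicator B x \<le> ennreal H * (ennreal (f x powr p * v x) * indicator B x)"
      using ae
    proof eventually_elim
      case (elim x)
      show ?case
      proof (cases "x \<in> B")
        case xB: True
        then have le: "inverse (ennreal (v x)) \<le> ennreal H" using elim H(2) by (meson order.trans)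
        have vx: "0 < v x"
        proof (rule ccontr)
          assume "\<not> 0 < v x"
          then have "v x = 0" using v0[of x] by simp
          then show False using le by (simp add: top_unique)
        qed
        then have "1 / v x \<le> H" using le H(1) by (simp add: inverse_ennreal ennreal_le_iff divide_inverse)
        then have "1 \<le> H * v x" using vx by (simp add: field_simps)
        then have "1 * f x \<le> (H * v x) * f x" using f0[of x] by (intro mult_right_mono) auto
        then show ?thesis using xB True f0[of x] v0[of x] H(1)
          by (simp add: ennreal_mult'[symmetric] mult_ac ennreal_leI)
      qed simp
    qed
  qed
  also have "\<dots> = ennreal H * (\<integral>\<^sup>+x\<in>B. ennreal (f x powr p * v x) \<partial>M)"
    using B(1) f v by (intro nn_integral_cmult borel_measurable_times borel_measurable_indicator) auto
  also have "\<dots> \<le> ennreal H * ennreal e" by (intro mult_left_mono e) simp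
  also have "\<dots> = ennreal (e powr (1 / p) * H * m powr (1 - 1 / p))"
    using True e(1) H(1) B(3) by (simp add: ennreal_mult'[symmetric] mult.commute)
  finally show ?thesis .
next
  case False
  then have p1: "1 < p" using p by simp
  define \<beta> where "\<beta> = 1 - p / (p - 1)"
  define p' where "p' = p / (p - 1)"
  have p': "1 < p'" "1 / p + 1 / p' = 1" using p1 by (auto simp: p'_def divide_simps)
  have \<beta>: "\<beta> < 0" "\<beta> = - (p' / p)" using p1 by (auto simp: \<beta>_def p'_def divide_simps)
  define u where "u y = ennreal_powr (ennreal (v y)) \<beta>" for y
  have um [measurable]: "u \<in> borel_measurable M" unfolding u_def by measurable
  define g where "g = m * H powr p'"
  have g: "0 < g" using B(3) H(1) by (simp add: g_def)
  have ug: "(\<integral>\<^sup>+x\<in>B. u x \<partial>M) \<le> ennreal g"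
  proof -
    define U where "U = nn_avg M B u"
    have UH: "ennreal_powr U ((p - 1) / p) \<le> ennreal H"
    proof -
      have "u = (\<lambda>y. ennreal_powr (ennreal (v y)) (1 - p / (p - 1)))" by (simp add: u_def \<beta>_def fun_eq_iff)
      then show ?thesis using H(2) False by (simp add: dual_factor_def U_def)
    qed
    have "U \<noteq> \<infinity>"
    proof
      assume "U = \<infinity>"
      then have "ennreal_powr U ((p - 1) / p) = \<infinity>" using p1 by (simp add: ennreal_powr_def)
      then show False using UH by (simp add: top_unique)
    qed
    then obtain U' where U': "U = ennreal U'" "0 \<le> U'" by (cases U) auto
    have "U' powr ((p - 1) / p) \<le> H"
      using UH U' p1 H(1) by (simp add: ennreal_powr_real ennreal_le_iff)
    then have "(U' powr ((p - 1) / p)) powr p' \<le> H powr p'"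
      using p'(1) by (intro powr_mono2) auto
    moreover have "(p - 1) / p * p' = 1" using p1 by (simp add: p'_def)
    ultimately have "U' \<le> H powr p'" using U'(2) by (simp add: powr_powr)
    moreover have "(\<integral>\<^sup>+x\<in>B. u x \<partial>M) = U * ennreal m"
      unfolding U_def nn_avg_def B(2) using B(3)
      by (simp add: divide_ennreal_def mult.assoc inverse_ennreal ennreal_mult'[symmetric])
    ultimately show ?thesis
      using U' B(3) by (simp add: ennreal_mult'[symmetric] g_def mult.commute[of m] ennreal_leI mult_right_mono)
  qed
  \<comment> \<open>\<open>k\<close> is the Hoelder bound for the two integrals \<open>e\<close> and
    \<open>g\<close>. The coefficients \<open>c1\<close> and \<open>c2\<close> are those of Young's
    inequality after both factors are normalized, so that
    \<open>c1 * e + c2 * g = k\<close>.\<close>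
  define k where "k = e powr (1 / p) * g powr (1 / p')"
  have k: "0 < k" using e g by (simp add: k_def)
  define c1 where "c1 = k / (p * e)"
  define c2 where "c2 = k / (p' * g)"
  have c12: "0 < c1" "0 < c2" using k p1 e g p' by (auto simp: c1_def c2_def)
  have young: "ennreal (f x) \<le> ennreal c1 * ennreal (f x powr p * v x) + ennreal c2 * u x" for x
  proof (cases "v x = 0")
    case True
    then have "u x = top" using \<beta>(1) by (simp add: u_def ennreal_powr_def)
    then have "ennreal c2 * u x = top" using c12 by (simp add: ennreal_mult_eq_top_iff)
    then show ?thesis by simp
  next
    case False
    then have vx: "0 < v x" using v0[of x] by simp
    define A where "A = f x * v x powr (1 / p) / e powr (1 / p)"
    define C where "C = v x powr (- (1 / p)) / g powr (1 / p')"
    have AC: "0 \<le> A" "0 \<le> C" using f0[of x] by (auto simp: A_def C_def)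
    have "A * C \<le> A powr p / p + C powr p' / p'"
      by (rule Youngs_inequality[OF p1 p'(1) p'(2) AC])
    moreover have "A powr p = f x powr p * v x / e"
      unfolding A_def using f0[of x] vx e p1 by (simp add: powr_divide powr_mult powr_powr)
    moreover have "C powr p' = v x powr \<beta> / g"
      unfolding C_def using vx g p' p1 by (simp add: powr_divide powr_powr \<beta>(2))
    moreover have "f x = k * (A * C)"
      unfolding A_def C_def k_def using e g vx by (simp add: powr_minus field_simps)
    ultimately have "f x \<le> k * (f x powr p * v x / e / p + v x powr \<beta> / g / p')"
      using k by (metis mult_left_mono less_imp_le)
    also have "\<dots> = c1 * (f x powr p * v x) + c2 * v x powr \<beta>"
      by (simp add: c1_def c2_def field_simps)
    finally have "ennreal (f x) \<le> ennreal (c1 * (f x powr p * v x) + c2 * v x powr \<beta>)" by (rule ennreal_leI)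
    also have "\<dots> = ennreal c1 * ennreal (f x powr p * v x) + ennreal c2 * u x"
      unfolding u_def using vx c12 v0[of x] by (simp add: ennreal_powr_real ennreal_mult')
    finally show ?thesis .
  qed
  have "(\<integral>\<^sup>+x\<in>B. ennreal (f x) \<partial>M)
      \<le> (\<integral>\<^sup>+x. ennreal c1 * (ennreal (f x powr p * v x) * indicator B x) + ennreal c2 * (u x * indicator B x) \<partial>M)"
    using young by (intro nn_integral_mono) (auto split: split_indicator)
  also have "\<dots> = ennreal c1 * (\<integral>\<^sup>+x\<in>B. ennreal (f x powr p * v x) \<partial>M) + ennreal c2 * (\<integral>\<^sup>+x\<in>B. u x \<partial>M)"
  proof -
    have [measurable]: "(\<lambda>x. ennreal (f x powr p * v x) * indicator B x) \<in> borel_measurable M"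
      "(\<lambda>x. u x * indicator B x) \<in> borel_measurable M"
      using B(1) by (auto intro!: borel_measurable_times borel_measurable_indicator)
    show ?thesis by (subst nn_integral_add) (auto simp: nn_integral_cmult)
  qed
  also have "\<dots> \<le> ennreal c1 * ennreal e + ennreal c2 * ennreal g"
    by (intro add_mono mult_left_mono e ug) auto
  also have "\<dots> = ennreal (c1 * e + c2 * g)"
    using c12 e g by (simp add: ennreal_mult' ennreal_plus)
  also have "c1 * e + c2 * g = k * (1 / p + 1 / p')"
    using e g by (simp add: c1_def c2_def field_simps)
  also have "\<dots> = k" by (simp only: p'(2) mult_1_right)
  also have "k = e powr (1 / p) * H * m powr (1 - 1 / p)"
  proof -
    have "1 / p' = 1 - 1 / p" using p'(2) by simp
    moreover have "(H powr p') powr (1 / p') = H" using H(1) p'(1) by (simp add: powr_powr)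
    ultimately show ?thesis using B(3) H(1) by (simp add: k_def g_def powr_mult)
  qed
  finally show ?thesis .
qed

text \<open>Admits \<open>e = 0\<close> by letting larger bounds \<open>e'\<close> decrease to
  \<open>e\<close>; the power \<open>1 / p\<close> is continuous there.\<close>

lemma holder:
  assumes p: "1 \<le> p" and B: "B \<in> sets M" "emeasure M B = ennreal m" "0 < m"
    and f: "f \<in> borel_measurable M" and f0: "\<And>x. 0 \<le> f x"
    and v: "v \<in> borel_measurable M" and v0: "\<And>x. 0 \<le> v x"
    and e: "0 \<le> e" "(\<integral>\<^sup>+x\<in>B. ennreal (f x powr p * v x) \<partial>M) \<le> ennreal e"
    and H: "0 < H" "dual_factor M p v B \<le> ennreal H"
  shows "(\<integral>\<^sup>+x\<in>B. ennreal (f x) \<partial>M) \<le> ennreal (e powr (1 / p) * H * m powr (1 - 1 / p))"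
proof -
  define X where "X = (\<integral>\<^sup>+x\<in>B. ennreal (f x) \<partial>M)"
  have le: "X \<le> ennreal (e' powr (1 / p) * H * m powr (1 - 1 / p))" if e': "e < e'" for e'
    unfolding X_def using e' e by (intro holder_pos[OF p B f f0 v v0 _ _ H]) (auto intro: order.trans ennreal_leI)
  have "X < top" using le[of "e + 1"] by (auto intro: le_less_trans)
  then obtain x where x: "X = ennreal x" "0 \<le> x" by (cases X) auto
  have "x \<le> e powr (1 / p) * H * m powr (1 - 1 / p)"
  proof (rule tendsto_lowerbound)
    show "((\<lambda>e'. e' powr (1 / p) * H * m powr (1 - 1 / p)) \<longlongrightarrow> e powr (1 / p) * H * m powr (1 - 1 / p)) (at_right e)"
      using p e(1) by (intro tendsto_intros tendsto_powr2) (auto simp: eventually_at_right_less intro: eventually_mono[OF eventually_at_right_less])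
    show "\<forall>\<^sub>F e' in at_right e. x \<le> e' powr (1 / p) * H * m powr (1 - 1 / p)"
      using eventually_at_right_less[of e]
    proof eventually_elim
      case (elim e')
      then show ?case using le[OF elim] x H(1) by (simp add: ennreal_le_iff)
    qed
  qed simp
  then show ?thesis using x by (simp add: X_def[symmetric] ennreal_leI)
qed

lemma dual_factor_one:
  assumes p: "1 \<le> p" and B: "B \<in> sets M" "emeasure M B = ennreal m" "0 < m"
  shows "dual_factor M p (\<lambda>_. 1) B \<le> ennreal 1"
proof (cases "p = 1")
  case True
  have "inverse (1 :: ennreal) = 1" using inverse_ennreal[of 1] by simp
  then have "esssup (restrict_space M B) (\<lambda>y. inverse (ennreal 1)) \<le> 1"
    by (intro esssup_I) auto
  then show ?thesis using True by (simp add: dual_factor_def)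
next
  case False
  have "ennreal_powr 1 x = 1" for x using ennreal_powr_real[of 1 x] by (simp add: ennreal_powr_def)
  moreover have "nn_avg M B (\<lambda>y. 1) = 1"
    unfolding nn_avg_def using B by (simp add: divide_ennreal)
  ultimately show ?thesis using False by (simp add: dual_factor_def)
qed

text \<open>Hoelder against the weight 1. In place of the mean stands any \<open>F\<close> with
  \<open>F * m\<close> below the integral, which avoids integrability questions for
  \<open>f\<close>.\<close>

lemma jensen:
  fixes M :: "'a::metric_space measure"
  assumes p: "1 \<le> p" and B: "B \<in> sets M" "emeasure M B = ennreal m" "0 < m"
    and f: "f \<in> borel_measurable M" and f0: "\<And>x. 0 \<le> f x"
    and e: "0 \<le> e" "(\<integral>\<^sup>+x\<in>B. ennreal (f x powr p) \<partial>M) \<le> ennreal e"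
    and F: "0 \<le> F" "ennreal (F * m) \<le> (\<integral>\<^sup>+x\<in>B. ennreal (f x) \<partial>M)"
  shows "F powr p \<le> e / m"
proof -
  have "(\<integral>\<^sup>+x\<in>B. ennreal (f x) \<partial>M) \<le> ennreal (e powr (1 / p) * 1 * m powr (1 - 1 / p))"
    using e by (intro holder[OF p B f f0 _ _ _ _ _ dual_factor_one[OF p B]]) auto
  with F(2) have "ennreal (F * m) \<le> ennreal (e powr (1 / p) * 1 * m powr (1 - 1 / p))" by (rule order.trans)
  then have "F * m \<le> e powr (1 / p) * m powr (1 - 1 / p)" by (simp add: ennreal_le_iff)
  also have "m powr (1 - 1 / p) = m * m powr (- (1 / p))"
    using B(3) powr_add[of m 1 "- (1 / p)"] by simp
  finally have "F \<le> e powr (1 / p) * m powr (- (1 / p))" using B(3) by (simp add: mult.left_commute)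
  also have "\<dots> = (e / m) powr (1 / p)" using e(1) B(3) by (simp add: powr_divide powr_minus_divide)
  finally have "F powr p \<le> ((e / m) powr (1 / p)) powr p" using F(1) p by (intro powr_mono2) auto
  also have "\<dots> = e / m" using p e(1) B(3) by (simp add: powr_powr)
  finally show ?thesis .
qed

text \<open>The condition on the pair bounds the dual factor by \<open>A / k\<close>, where
  \<open>k\<close> collects the radius, the volume and the mean of \<open>w\<close>. Jensen with
  exponent \<open>r > 1\<close> lowers the \<open>r\<close>-mean of \<open>w\<close> to its mean. In
  the \<open>q\<close>-th power of Hoelder's bound the volume and the mean then cancel against the
  \<open>W\<close>-measure of the ball, and only the radius survives.\<close>

lemma two_weight:
  fixes M :: "'a::metric_space measure"
  assumes D: "ball_doubling M D" and pos: "\<And>x r. 0 < r \<Longrightarrow> 0 < measure M (ball x r)"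
    and W: "ball_doubling (density M (\<lambda>x. ennreal (w x))) D'"
    and w [measurable]: "w \<in> borel_measurable M" and w0: "\<And>x. 0 \<le> w x"
    and v: "v \<in> borel_measurable M" and v0: "\<And>x. 0 \<le> v x"
    and p: "1 \<le> p" and q: "0 < q" and r: "1 < r" and cls: "weight_pair_class M \<Omega> \<alpha> r q p w v"
  obtains A where "1 \<le> A"
    "\<And>z \<rho> f e F. 0 < \<rho> \<Longrightarrow> ball z \<rho> \<subseteq> \<Omega> \<Longrightarrow> f \<in> borel_measurable M \<Longrightarrow> (\<And>x. 0 \<le> f x) \<Longrightarrow> 0 \<le> e \<Longrightarrow>
       (\<integral>\<^sup>+x\<in>ball z \<rho>. ennreal (f x powr p * v x) \<partial>M) \<le> ennreal e \<Longrightarrow>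
       0 \<le> F \<Longrightarrow> ennreal (F * measure M (ball z \<rho>)) \<le> (\<integral>\<^sup>+x\<in>ball z \<rho>. ennreal (f x) \<partial>M) \<Longrightarrow>
       F powr q * measure (density M (\<lambda>x. ennreal (w x))) (ball z \<rho>) \<le> A powr q * \<rho> powr (- \<alpha> * q) * e powr (q / p)"
proof -
  define W' where "W' = density M (\<lambda>x. ennreal (w x))"
  define S where "S = (SUP (x, \<rho>) \<in> {(x, \<rho>). 0 < \<rho> \<and> ball x \<rho> \<subseteq> \<Omega>}.
        ennreal (\<rho> powr \<alpha>) * ennreal (measure M (ball x \<rho>) powr (1 / q - 1 / p)) *
        ennreal_powr (nn_avg M (ball x \<rho>) (\<lambda>y. ennreal (w y powr r))) (1 / (q * r)) * dual_factor M p v (ball x \<rho>))"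
  have "S < \<infinity>" using cls unfolding weight_pair_class_def S_def dual_factor_def .
  then obtain S' where S': "S = ennreal S'" "0 \<le> S'" by (cases S) auto
  define A where "A = max 1 S'"
  have sM: "sets M = sets borel" by (rule ball_doublingD[OF D])
  show thesis
  proof (rule that)
    show A1: "1 \<le> A" by (simp add: A_def)
    fix z :: 'a and \<rho> e F :: real and f assume \<rho>: "0 < \<rho>" and sub: "ball z \<rho> \<subseteq> \<Omega>"
      and f: "f \<in> borel_measurable M" and f0: "\<And>x. 0 \<le> f x" and e: "0 \<le> e"
        "(\<integral>\<^sup>+x\<in>ball z \<rho>. ennreal (f x powr p * v x) \<partial>M) \<le> ennreal e"
      and F: "0 \<le> F" "ennreal (F * measure M (ball z \<rho>)) \<le> (\<integral>\<^sup>+x\<in>ball z \<rho>. ennreal (f x) \<partial>M)"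
    define B where "B = ball z \<rho>"
    define m where "m = measure M B"
    have m: "0 < m" using pos[OF \<rho>] by (simp add: m_def B_def)
    have B: "B \<in> sets M" "emeasure M B = ennreal m"
      using sM ball_doubling_fmeasurable(2)[OF D, of B z \<rho>] by (auto simp: B_def m_def)
    define \<omega> where "\<omega> = measure W' B / m"
    have "F powr q * measure W' B \<le> A powr q * \<rho> powr (- \<alpha> * q) * e powr (q / p)"
    \<comment> \<open>For \<open>W\<close>-measure 0 the claim is trivial, and the divisor
      \<open>k\<close> below would be 0.\<close>
    proof (cases "measure W' B = 0")
      case False
      then have \<omega>: "0 < \<omega>" using m measure_nonneg[of W' B] by (simp add: \<omega>_def less_le)
      have intw: "(\<integral>\<^sup>+y\<in>B. ennreal (w y) \<partial>M) = ennreal (\<omega> * m)"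
      proof -
        have "(\<integral>\<^sup>+y\<in>B. ennreal (w y) \<partial>M) = emeasure W' B"
          unfolding W'_def using B(1) by (intro emeasure_density[symmetric]) auto
        also have "\<dots> = ennreal (measure W' B)"
          using ball_doubling_fmeasurable(2)[OF W, of B z \<rho>] by (simp add: B_def W'_def)
        finally show ?thesis using m by (simp add: \<omega>_def)
      qed
      define N where "N = nn_avg M B (\<lambda>y. ennreal (w y powr r))"
      have jw: "ennreal (\<omega> powr (1 / q)) \<le> ennreal_powr N (1 / (q * r))"
      proof (cases "N = \<infinity>")
        case True
        then show ?thesis using q r by (simp add: ennreal_powr_def)
      next
        case False
        then obtain n where n: "N = ennreal n" "0 \<le> n" by (cases N) auto
        have "(\<integral>\<^sup>+y\<in>B. ennreal (w y powr r) \<partial>M) = N * ennreal m"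
          unfolding N_def nn_avg_def B(2) using m
          by (simp add: divide_ennreal_def mult.assoc inverse_ennreal ennreal_mult'[symmetric])
        then have i: "(\<integral>\<^sup>+y\<in>B. ennreal (w y powr r) \<partial>M) \<le> ennreal (n * m)" using n m by (simp add: ennreal_mult')
        have "\<omega> powr r \<le> n * m / m"
          by (rule jensen[OF _ B m w w0 _ i]) (use r n m \<omega> intw in auto)
        then have "\<omega> powr r \<le> n" using m by simp
        then have "(\<omega> powr r) powr (1 / (q * r)) \<le> n powr (1 / (q * r))" using q r by (intro powr_mono2) auto
        moreover have "r * (1 / (q * r)) = 1 / q" using r by simp
        ultimately have "\<omega> powr (1 / q) \<le> n powr (1 / (q * r))" by (simp add: powr_powr)
        then show ?thesis using n q r by (simp add: ennreal_powr_real ennreal_leI)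
      qed
      define k where "k = \<rho> powr \<alpha> * m powr (1 / q - 1 / p) * \<omega> powr (1 / q)"
      have k: "0 < k" using \<rho> m \<omega> by (simp add: k_def)
      have "ennreal k * dual_factor M p v B \<le> ennreal (\<rho> powr \<alpha>) * ennreal (m powr (1 / q - 1 / p)) *
        ennreal_powr N (1 / (q * r)) * dual_factor M p v B"
        using jw by (simp add: k_def ennreal_mult' mult_left_mono mult_right_mono)
      also have "\<dots> \<le> S"
        unfolding S_def N_def m_def B_def by (rule SUP_upper2[of "(z, \<rho>)"]) (use \<rho> sub in auto)
      also have "\<dots> \<le> ennreal A" unfolding S' A_def by (intro ennreal_leI) simp
      finally have kQ: "ennreal k * dual_factor M p v B \<le> ennreal A" .
      define H where "H = A / k"
      have H: "0 < H" using k A1 by (simp add: H_def)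
      have dual: "dual_factor M p v B \<le> ennreal H"
      proof -
        have "dual_factor M p v B = ennreal (1 / k) * (ennreal k * dual_factor M p v B)"
          using k by (simp add: mult.assoc[symmetric] ennreal_mult'[symmetric])
        also have "\<dots> \<le> ennreal (1 / k) * ennreal A" using kQ by (intro mult_left_mono) auto
        also have "\<dots> = ennreal H" using k A1 by (simp add: H_def ennreal_mult'[symmetric])
        finally show ?thesis .
      qed
      have "ennreal (F * m) \<le> ennreal (e powr (1 / p) * H * m powr (1 - 1 / p))"
        using F(2) holder[OF p B m f f0 v v0 e(1) _ H dual] e(2) unfolding B_def m_def by (blast intro: order.trans)
      then have "F * m \<le> e powr (1 / p) * H * m powr (1 - 1 / p)" using H by (simp add: ennreal_le_iff)
      also have "m powr (1 - 1 / p) = m * m powr (- (1 / p))"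
        using m powr_add[of m 1 "- (1 / p)"] by simp
      finally have "F \<le> e powr (1 / p) * H * m powr (- (1 / p))" using m by (simp add: mult_ac)
      then have "F powr q \<le> (e powr (1 / p) * H * m powr (- (1 / p))) powr q" using F(1) q by (intro powr_mono2) auto
      also have "\<dots> = e powr (q / p) * H powr q * m powr (- (q / p))"
        using H m by (simp add: powr_mult powr_powr)
      also have "H powr q = A powr q * \<rho> powr (- \<alpha> * q) * m powr (q / p - 1) * \<omega> powr (- 1)"
      proof -
        have "k powr q = \<rho> powr (\<alpha> * q) * m powr (1 - q / p) * \<omega>"
          using \<rho> m \<omega> q by (simp add: k_def powr_mult powr_powr left_diff_distrib)
        then have "H powr q = A powr q / (\<rho> powr (\<alpha> * q) * m powr (1 - q / p) * \<omega>)"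
          using k A1 by (simp add: H_def powr_divide)
        moreover have "\<rho> powr (- \<alpha> * q) = 1 / \<rho> powr (\<alpha> * q)" "m powr (q / p - 1) = 1 / m powr (1 - q / p)" "\<omega> powr (- 1) = 1 / \<omega>"
          using \<omega> powr_minus_divide[of \<rho> "\<alpha> * q"] powr_minus_divide[of m "1 - q / p"] by (simp_all add: powr_minus_divide)
        ultimately show ?thesis by simp
      qed
      finally have "F powr q * measure W' B \<le> (e powr (q / p) * (A powr q * \<rho> powr (- \<alpha> * q) * m powr (q / p - 1) * \<omega> powr (- 1)) * m powr (- (q / p))) * measure W' B"
        by (intro mult_right_mono) auto
      also have "measure W' B = \<omega> * m" using m by (simp add: \<omega>_def)
      also have "(e powr (q / p) * (A powr q * \<rho> powr (- \<alpha> * q) * m powr (q / p - 1) * \<omega> powr (- 1)) * m powr (- (q / p))) * (\<omega> * m)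
        = A powr q * \<rho> powr (- \<alpha> * q) * e powr (q / p) * (\<omega> powr (- 1) * \<omega>) * (m powr (q / p - 1) * m powr (- (q / p)) * m)"
        by (simp only: mult_ac)
      also have "\<omega> powr (- 1) * \<omega> = 1" using \<omega> by (simp add: powr_minus_divide)
      also have "m powr (q / p - 1) * m powr (- (q / p)) * m = 1"
      proof -
        have "m powr (q / p - 1) * m powr (- (q / p)) = m powr (- 1)" by (simp add: powr_add[symmetric])
        then show ?thesis using m by (simp add: powr_minus_divide)
      qed
      finally show ?thesis using m by (simp add: \<omega>_def)
    qed simp
    then show "F powr q * measure (density M (\<lambda>x. ennreal (w x))) (ball z \<rho>) \<le> A powr q * \<rho> powr (- \<alpha> * q) * e powr (q / p)"
      by (simp add: W'_def B_def)
  qed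
qed

text \<open>The infimum of the levels whose sublevel set fills half of the ball: continuity from
  above keeps the half at \<open>b\<close>, continuity from below bounds the strict sublevel set by
  one half.\<close>

lemma median_exists:
  fixes M :: "'a::metric_space measure" and f :: "'a \<Rightarrow> real"
  assumes M: "ball_doubling M D" and f [measurable]: "f \<in> borel_measurable borel" and B: "0 < measure M (ball x r)"
  obtains b where "measure M (ball x r) \<le> 2 * measure M {y\<in>ball x r. f y \<le> b}"
    "measure M (ball x r) \<le> 2 * measure M {y\<in>ball x r. b \<le> f y}"
proof -
  define B where "B = ball x r"
  have sM: "sets M = sets borel" by (rule ball_doublingD[OF M])
  have lev: "{y\<in>B. f y \<le> t} \<in> sets M" "{y\<in>B. t \<le> f y} \<in> sets M" "{y\<in>B. f y < t} \<in> sets M" for t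
  proof -
    have "{y\<in>space borel. f y \<le> t} \<in> sets borel" "{y\<in>space borel. t \<le> f y} \<in> sets borel" "{y\<in>space borel. f y < t} \<in> sets borel" by measurable
    moreover have "{y\<in>B. f y \<le> t} = B \<inter> {y\<in>space borel. f y \<le> t}" "{y\<in>B. t \<le> f y} = B \<inter> {y\<in>space borel. t \<le> f y}"
      "{y\<in>B. f y < t} = B \<inter> {y\<in>space borel. f y < t}" by auto
    ultimately show "{y\<in>B. f y \<le> t} \<in> sets M" "{y\<in>B. t \<le> f y} \<in> sets M" "{y\<in>B. f y < t} \<in> sets M"
      using sM by (auto simp: B_def)
  qed
  have fin: "emeasure M A \<noteq> \<infinity>" if "A \<in> sets M" "A \<subseteq> B" for A
    using ball_doubling_fmeasurable(3)[OF M, of A x r] that sM by (auto simp: B_def)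
  define G where "G t = measure M {y\<in>B. f y \<le> t}" for t
  have mono: "G s \<le> G t" if "s \<le> t" for s t
    unfolding G_def using that lev sM by (intro ball_doubling_mono[OF M, of _ _ x r]) (auto simp: B_def)
  define S where "S = {t. measure M B \<le> 2 * G t}"
  have Bp: "0 < measure M B" using B by (simp add: B_def)
  have "S \<noteq> {}"
  proof -
    have "(\<lambda>n. measure M {y\<in>B. f y \<le> real n}) \<longlonglongrightarrow> measure M (\<Union>n. {y\<in>B. f y \<le> real n})"
    proof (rule Lim_measure_incseq)
      show "emeasure M (\<Union>n. {y\<in>B. f y \<le> real n}) \<noteq> \<infinity>" using lev by (intro fin) auto
    qed (use lev in \<open>auto simp: incseq_def\<close>)
    moreover have "(\<Union>n. {y\<in>B. f y \<le> real n}) = B" using real_arch_simple by auto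
    ultimately have "eventually (\<lambda>n. measure M B / 2 < measure M {y\<in>B. f y \<le> real n}) sequentially"
      using Bp by (intro order_tendstoD(1)[where y = "measure M B"]) auto
    then obtain n where "measure M B / 2 < measure M {y\<in>B. f y \<le> real n}" by (auto simp: eventually_sequentially)
    then have "real n \<in> S" by (simp add: S_def G_def)
    then show ?thesis by blast
  qed
  have "bdd_below S"
  proof -
    have "(\<lambda>n. measure M {y\<in>B. f y \<le> - real n}) \<longlonglongrightarrow> measure M (\<Inter>n. {y\<in>B. f y \<le> - real n})"
    proof (rule Lim_measure_decseq)
      show "emeasure M {y\<in>B. f y \<le> - real n} \<noteq> \<infinity>" for n using lev by (intro fin) auto
    qed (use lev in \<open>auto simp: decseq_def\<close>)
    moreover have "(\<Inter>n. {y\<in>B. f y \<le> - real n}) = {}"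
    proof safe
      fix y assume y: "y \<in> (\<Inter>n. {y\<in>B. f y \<le> - real n})"
      obtain n where "- f y < real n" using reals_Archimedean2 by blast
      moreover have "f y \<le> - real n" using y by blast
      ultimately show "y \<in> {}" by simp
    qed
    ultimately have "eventually (\<lambda>n. measure M {y\<in>B. f y \<le> - real n} < measure M B / 2) sequentially"
      using Bp by (intro order_tendstoD(2)[where y = 0]) auto
    then obtain n where n: "measure M {y\<in>B. f y \<le> - real n} < measure M B / 2" by (auto simp: eventually_sequentially)
    have "- real n \<le> t" if "t \<in> S" for t
    proof (rule ccontr)
      assume "\<not> - real n \<le> t"
      then have "G t \<le> G (- real n)" by (intro mono) simp
      then show False using n that by (simp add: S_def G_def)
    qed
    then show ?thesis by (auto simp: bdd_below_def)
  qed
  define b where "b = Inf S"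
  have up: "measure M B \<le> 2 * G (b + 1 / real (Suc n))" for n
  proof -
    have "Inf S < b + 1 / real (Suc n)" by (simp add: b_def)
    then obtain t where "t \<in> S" "t < b + 1 / real (Suc n)" using cInf_less_iff[OF \<open>S \<noteq> {}\<close> \<open>bdd_below S\<close>] by blast
    then show ?thesis using mono[of t "b + 1 / real (Suc n)"] by (simp add: S_def)
  qed
  have dn: "G (b - 1 / real (Suc n)) \<le> measure M B / 2" for n
  proof -
    have "b - 1 / real (Suc n) \<notin> S"
    proof
      assume "b - 1 / real (Suc n) \<in> S"
      then have "b \<le> b - 1 / real (Suc n)" unfolding b_def using \<open>bdd_below S\<close> by (rule cInf_lower)
      then show False by simp
    qed
    then show ?thesis by (simp add: S_def)
  qed
  show thesis
  proof (rule that)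
    have "(\<lambda>n. measure M {y\<in>B. f y \<le> b + 1 / real (Suc n)}) \<longlonglongrightarrow> measure M (\<Inter>n. {y\<in>B. f y \<le> b + 1 / real (Suc n)})"
    proof (rule Lim_measure_decseq)
      show "decseq (\<lambda>n. {y\<in>B. f y \<le> b + 1 / real (Suc n)})"
        unfolding decseq_def
      proof (intro allI impI subsetI)
        fix m n y assume "m \<le> n" "y \<in> {y\<in>B. f y \<le> b + 1 / real (Suc n)}"
        moreover have "1 / real (Suc n) \<le> 1 / real (Suc m)" using \<open>m \<le> n\<close> by (intro frac_le) auto
        ultimately show "y \<in> {y\<in>B. f y \<le> b + 1 / real (Suc m)}" by simp
      qed
      show "emeasure M {y\<in>B. f y \<le> b + 1 / real (Suc n)} \<noteq> \<infinity>" for n using lev by (intro fin) auto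
    qed (use lev in auto)
    moreover have "(\<Inter>n. {y\<in>B. f y \<le> b + 1 / real (Suc n)}) = {y\<in>B. f y \<le> b}"
    proof (intro set_eqI iffI)
      fix y assume y: "y \<in> (\<Inter>n. {y\<in>B. f y \<le> b + 1 / real (Suc n)})"
      have "f y \<le> b + e" if e: "0 < e" for e
      proof -
        obtain n where "1 / real (Suc n) < e" by (rule nat_approx_posE[OF e]) (rule that)
        moreover have "f y \<le> b + 1 / real (Suc n)" using y by blast
        ultimately show ?thesis by linarith
      qed
      then have "f y \<le> b" by (rule field_le_epsilon)
      then show "y \<in> {y\<in>B. f y \<le> b}" using y by blast
    next
      fix y assume y: "y \<in> {y\<in>B. f y \<le> b}"
      have "f y \<le> b + 1 / real (Suc n)" for n
      proof -
        have "0 \<le> 1 / real (Suc n)" by simp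
        moreover have "f y \<le> b" using y by simp
        ultimately show ?thesis by linarith
      qed
      then show "y \<in> (\<Inter>n. {y\<in>B. f y \<le> b + 1 / real (Suc n)})" using y by blast
    qed
    ultimately have "(\<lambda>n. G (b + 1 / real (Suc n))) \<longlonglongrightarrow> G b" by (simp add: G_def)
    moreover have "measure M B / 2 \<le> G (b + 1 / real (Suc n))" for n using up[of n] by simp
    ultimately have "measure M B / 2 \<le> G b" by (intro LIMSEQ_le_const) auto
    then show "measure M (ball x r) \<le> 2 * measure M {y\<in>ball x r. f y \<le> b}" by (simp add: G_def B_def)
    have "(\<lambda>n. measure M {y\<in>B. f y \<le> b - 1 / real (Suc n)}) \<longlonglongrightarrow> measure M (\<Union>n. {y\<in>B. f y \<le> b - 1 / real (Suc n)})"
    proof (rule Lim_measure_incseq)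
      show "incseq (\<lambda>n. {y\<in>B. f y \<le> b - 1 / real (Suc n)})"
        unfolding incseq_def
      proof (intro allI impI subsetI)
        fix m n y assume "m \<le> n" "y \<in> {y\<in>B. f y \<le> b - 1 / real (Suc m)}"
        moreover have "1 / real (Suc n) \<le> 1 / real (Suc m)" using \<open>m \<le> n\<close> by (intro frac_le) auto
        ultimately show "y \<in> {y\<in>B. f y \<le> b - 1 / real (Suc n)}" by simp
      qed
      show "emeasure M (\<Union>n. {y\<in>B. f y \<le> b - 1 / real (Suc n)}) \<noteq> \<infinity>" using lev by (intro fin) auto
    qed (use lev in auto)
    moreover have "(\<Union>n. {y\<in>B. f y \<le> b - 1 / real (Suc n)}) = {y\<in>B. f y < b}"
    proof (intro set_eqI iffI)
      fix y assume "y \<in> (\<Union>n. {y\<in>B. f y \<le> b - 1 / real (Suc n)})"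
      then obtain n where "y \<in> B" "f y \<le> b - 1 / real (Suc n)" by blast
      moreover have "0 < 1 / real (Suc n)" by simp
      ultimately have "f y < b" by linarith
      with \<open>y \<in> B\<close> show "y \<in> {y\<in>B. f y < b}" by simp
    next
      fix y assume y: "y \<in> {y\<in>B. f y < b}"
      then have "0 < b - f y" by simp
      then obtain n where "1 / real (Suc n) < b - f y" by (rule nat_approx_posE) (rule that)
      then have "f y \<le> b - 1 / real (Suc n)" by linarith
      then show "y \<in> (\<Union>n. {y\<in>B. f y \<le> b - 1 / real (Suc n)})" using y by blast
    qed
    ultimately have "(\<lambda>n. G (b - 1 / real (Suc n))) \<longlonglongrightarrow> measure M {y\<in>B. f y < b}" by (simp add: G_def)
    then have lt: "measure M {y\<in>B. f y < b} \<le> measure M B / 2" using dn by (intro LIMSEQ_le_const2) auto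
    have "measure M B = measure M (B \<inter> {y\<in>B. f y < b}) + measure M (B - {y\<in>B. f y < b})"
      using lev sM by (intro ball_doubling_split[OF M, of _ _ x r]) (auto simp: B_def)
    moreover have "B \<inter> {y\<in>B. f y < b} = {y\<in>B. f y < b}" "B - {y\<in>B. f y < b} = {y\<in>B. b \<le> f y}" by auto
    ultimately have "measure M B \<le> 2 * measure M {y\<in>B. b \<le> f y}" using lt by simp
    then show "measure M (ball x r) \<le> 2 * measure M {y\<in>ball x r. b \<le> f y}" by (simp add: B_def)
  qed
qed

section \<open>The local estimate by energies and its global consequence\<close>

context john_chain
begin

text \<open>All weights meet here. At depth \<open>d\<close> the improving weight is comparable to
  \<open>d powr (\<gamma> * p) * \<phi> d powr (p / q)\<close>; the power \<open>q / p\<close> turns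
  its reciprocal into \<open>1 / \<phi> d\<close>, which cancels the \<phi> in \<nu>, and
  \<open>d powr (- (\<gamma> * q))\<close>. Together with the powers of the radius the latter
  becomes \<open>(u / d) powr (\<gamma> * q)\<close>, at most 1. This explains the exponent in
  \<Phi> and the index \<open>s - \<gamma>\<close> of the weight class. As \<open>e\<close> may be
  nonmeasurable, constants are pulled out only on the side of \<open>f\<close>.\<close>

lemma energy_bound:
  assumes W_eq: "W = density M (\<lambda>x. ennreal (w x))"
    and w: "w \<in> borel_measurable M" "\<And>x. 0 \<le> w x" and v: "v \<in> borel_measurable M" "\<And>x. 0 \<le> v x"
    and p: "1 \<le> p" and q: "0 < q" and rr: "1 < rr" and cls: "weight_pair_class M \<Omega> (s - \<gamma>) rr q p w v"
    and \<gamma>: "0 \<le> \<gamma>" and l: "1 \<le> l" "l * a \<le> c0" and C1: "0 < C1"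
  obtains K1 where "0 \<le> K1"
    "\<And>z u f F e. z \<in> \<Omega> \<Longrightarrow> 0 < u \<Longrightarrow> u \<le> a * bdist \<Omega> z \<Longrightarrow> f \<in> borel_measurable M \<Longrightarrow> (\<And>x. 0 \<le> f x) \<Longrightarrow> 0 \<le> F \<Longrightarrow>
      ennreal (F * measure M (ball z (l * u))) \<le> (\<integral>\<^sup>+x\<in>ball z (l * u). ennreal (f x) \<partial>M) \<Longrightarrow>
      (\<And>y. y \<in> ball z (l * u) \<Longrightarrow> ennreal (f y powr p * v y * (bdist \<Omega> z powr (\<gamma> * p) * \<phi> (bdist \<Omega> z) powr (p / q)))
          \<le> ennreal (C1 * u powr (s * p)) * e y) \<Longrightarrow>
      (\<integral>\<^sup>+y\<in>ball z (l * u). e y \<partial>M) < \<infinity> \<Longrightarrow>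
      F powr q * measure \<nu> (ball z (5 * (\<Lambda> * u))) \<le> K1 * enn2real (\<integral>\<^sup>+y\<in>ball z (l * u). e y \<partial>M) powr (q / p)"
proof (rule two_weight[OF M pos W[unfolded W_eq] w v p q rr cls])
  fix A :: real assume A: "1 \<le> A" and tw: "\<And>z \<rho> f e F. 0 < \<rho> \<Longrightarrow> ball z \<rho> \<subseteq> \<Omega> \<Longrightarrow> f \<in> borel_measurable M \<Longrightarrow> (\<And>x. 0 \<le> f x) \<Longrightarrow> 0 \<le> e \<Longrightarrow>
       (\<integral>\<^sup>+x\<in>ball z \<rho>. ennreal (f x powr p * v x) \<partial>M) \<le> ennreal e \<Longrightarrow>
       0 \<le> F \<Longrightarrow> ennreal (F * measure M (ball z \<rho>)) \<le> (\<integral>\<^sup>+x\<in>ball z \<rho>. ennreal (f x) \<partial>M) \<Longrightarrow>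
       F powr q * measure (density M (\<lambda>x. ennreal (w x))) (ball z \<rho>) \<le> A powr q * \<rho> powr (- (s - \<gamma>) * q) * e powr (q / p)"
  have L0: "0 < \<Lambda>" using less_le_trans[OF _ \<Lambda>, of 0] CJ a(1) by simp
  obtain L3 where L3: "1 \<le> L3" "\<And>x y r R. 0 < r \<Longrightarrow> dist x y + R \<le> (5 * \<Lambda>) * r \<Longrightarrow> measure W (ball y R) \<le> L3 * measure W (ball x r)"
    by (rule compare_W[of "5 * \<Lambda>"]) (rule that)
  obtain n where n: "1 + 5 * \<Lambda> < 2 ^ n" using real_arch_pow[of 2 "1 + 5 * \<Lambda>"] by auto
  define K1 where "K1 = D\<phi> ^ n * L3 * (A powr q * l powr (- (s - \<gamma>) * q) * C1 powr (q / p))"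
  show thesis
  proof (rule that)
    show "0 \<le> K1" using L3(1) D\<phi>_ge by (simp add: K1_def)
    fix z :: 'a and u F :: real and f and e :: "'a \<Rightarrow> ennreal"
    assume z: "z \<in> \<Omega>" and u: "0 < u" "u \<le> a * bdist \<Omega> z" and f: "f \<in> borel_measurable M" "\<And>x. 0 \<le> f x" and F0: "0 \<le> F"
      and F: "ennreal (F * measure M (ball z (l * u))) \<le> (\<integral>\<^sup>+x\<in>ball z (l * u). ennreal (f x) \<partial>M)"
      and fe: "\<And>y. y \<in> ball z (l * u) \<Longrightarrow> ennreal (f y powr p * v y * (bdist \<Omega> z powr (\<gamma> * p) * \<phi> (bdist \<Omega> z) powr (p / q)))
          \<le> ennreal (C1 * u powr (s * p)) * e y"
      and fin: "(\<integral>\<^sup>+y\<in>ball z (l * u). e y \<partial>M) < \<infinity>"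
    define B where "B = ball z (l * u)"
    define d where "d = bdist \<Omega> z"
    have d: "0 < d" unfolding d_def by (rule bdist_pos[OF z])
    have \<phi>d: "0 < \<phi> d" by (rule \<phi>(1)[OF d])
    define x where "x = enn2real (\<integral>\<^sup>+y\<in>B. e y \<partial>M)"
    have x: "(\<integral>\<^sup>+y\<in>B. e y \<partial>M) = ennreal x" "0 \<le> x" using fin by (auto simp: x_def B_def)
    define g where "g = d powr (\<gamma> * p) * \<phi> d powr (p / q)"
    have g: "0 < g" using d \<phi>d by (simp add: g_def)
    define k where "k = C1 * u powr (s * p)"
    have k: "0 < k" using C1 u by (simp add: k_def)
    have Bs: "B \<in> sets M" using sets_M by (simp add: B_def)
    have int: "(\<integral>\<^sup>+y\<in>B. ennreal (f y powr p * v y) \<partial>M) \<le> ennreal (k / g * x)"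
    proof -
      have pt: "ennreal (g / k) * (ennreal (f y powr p * v y) * indicator B y) \<le> e y * indicator B y" for y
      proof (cases "y \<in> B")
        case True
        have "ennreal (g / k) * ennreal (f y powr p * v y) = ennreal (1 / k) * ennreal (f y powr p * v y * g)"
          using g k v(2)[of y] by (simp add: ennreal_mult'[symmetric] mult_ac)
        also have "\<dots> \<le> ennreal (1 / k) * (ennreal k * e y)"
          using fe[of y] True by (intro mult_left_mono) (simp_all add: B_def g_def k_def d_def)
        also have "\<dots> = e y" using k by (simp add: mult.assoc[symmetric] ennreal_mult'[symmetric])
        finally show ?thesis using True by simp
      qed simp
      have "ennreal (g / k) * (\<integral>\<^sup>+y\<in>B. ennreal (f y powr p * v y) \<partial>M) = (\<integral>\<^sup>+y. ennreal (g / k) * (ennreal (f y powr p * v y) * indicator B y) \<partial>M)"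
        using Bs f v by (intro nn_integral_cmult[symmetric] borel_measurable_times borel_measurable_indicator) auto
      also have "\<dots> \<le> (\<integral>\<^sup>+y\<in>B. e y \<partial>M)" using pt by (intro nn_integral_mono)
      finally have le: "ennreal (g / k) * (\<integral>\<^sup>+y\<in>B. ennreal (f y powr p * v y) \<partial>M) \<le> ennreal x" using x by simp
      have "(\<integral>\<^sup>+y\<in>B. ennreal (f y powr p * v y) \<partial>M) = ennreal (k / g) * (ennreal (g / k) * (\<integral>\<^sup>+y\<in>B. ennreal (f y powr p * v y) \<partial>M))"
        using g k by (simp add: mult.assoc[symmetric] ennreal_mult'[symmetric])
      also have "\<dots> \<le> ennreal (k / g) * ennreal x" using le by (intro mult_left_mono) auto
      finally show ?thesis using g k x(2) by (simp add: ennreal_mult'[symmetric])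
    qed
    have lu: "0 < l * u" using l u by simp
    have "l * u \<le> l * (a * d)" using u(2) l by (intro mult_left_mono) (auto simp: d_def)
    also have "\<dots> \<le> c0 * d" using l(2) d mult_right_mono[of "l * a" c0 d] by simp
    finally have sub: "B \<subseteq> \<Omega>" using c0(2)[OF z] subset_ball[of "l * u" "c0 * d" z] by (auto simp: B_def d_def)
    have "F powr q * measure W B \<le> A powr q * (l * u) powr (- (s - \<gamma>) * q) * (k / g * x) powr (q / p)"
      unfolding W_eq B_def
      by (rule tw[OF lu]) (use sub f F0 F int k g x in \<open>auto simp: B_def\<close>)
    also have "(k / g * x) powr (q / p) = C1 powr (q / p) * u powr (s * q) * d powr (- (\<gamma> * q)) * (1 / \<phi> d) * x powr (q / p)"
    proof -
      have "k powr (q / p) = C1 powr (q / p) * u powr (s * q)"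
        using C1 u p by (simp add: k_def powr_mult powr_powr)
      moreover have "g powr (q / p) = d powr (\<gamma> * q) * \<phi> d"
        using d \<phi>d p q by (simp add: g_def powr_mult powr_powr)
      ultimately show ?thesis
        using k g x d by (simp add: powr_mult powr_divide powr_minus_divide)
    qed
    also have "(l * u) powr (- (s - \<gamma>) * q) = l powr (- (s - \<gamma>) * q) * u powr (- (s - \<gamma>) * q)"
      using l u by (simp add: powr_mult)
    finally have "F powr q * measure W B \<le> (A powr q * l powr (- (s - \<gamma>) * q) * C1 powr (q / p)) * x powr (q / p) * (1 / \<phi> d)
        * (u powr (- (s - \<gamma>) * q) * u powr (s * q) * d powr (- (\<gamma> * q)))" by (simp only: mult_ac)
    also have "\<dots> \<le> (A powr q * l powr (- (s - \<gamma>) * q) * C1 powr (q / p)) * x powr (q / p) * (1 / \<phi> d) * 1"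
    proof (rule mult_left_mono)
      have "u powr (- (s - \<gamma>) * q) * u powr (s * q) = u powr (\<gamma> * q)"
        by (simp add: powr_add[symmetric] algebra_simps)
      moreover have "d powr (- (\<gamma> * q)) = 1 / d powr (\<gamma> * q)" by (rule powr_minus_divide)
      moreover have "u powr (\<gamma> * q) \<le> d powr (\<gamma> * q)"
      proof (rule powr_mono2)
        have "a * d \<le> 1 * d" using a d by (intro mult_right_mono) auto
        then show "u \<le> d" using u(2) by (simp add: d_def)
      qed (use \<gamma> q u in auto)
      ultimately show "u powr (- (s - \<gamma>) * q) * u powr (s * q) * d powr (- (\<gamma> * q)) \<le> 1"
        using d by simp
      show "0 \<le> (A powr q * l powr (- (s - \<gamma>) * q) * C1 powr (q / p)) * x powr (q / p) * (1 / \<phi> d)"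
        using \<phi>d by (intro mult_nonneg_nonneg) auto
    qed
    finally have FW: "F powr q * measure W B * \<phi> d \<le> (A powr q * l powr (- (s - \<gamma>) * q) * C1 powr (q / p)) * x powr (q / p)"
      using \<phi>d by (simp add: field_simps)
    \<comment> \<open>The dilated ball may leave \<Omega>, where \<nu> vanishes. On the part inside
      \<Omega> the depth is at most \<open>2 ^ n * d\<close>.\<close>
    define Y where "Y = ball z (5 * (\<Lambda> * u)) \<inter> \<Omega>"
    have Y: "Y \<in> sets borel" "Y \<subseteq> \<Omega>" "Y \<subseteq> ball z (5 * (\<Lambda> * u))" using \<Omega>(1) by (auto simp: Y_def)
    have "emeasure \<nu> (ball z (5 * (\<Lambda> * u))) = emeasure \<nu> Y"
      using emeasure_\<nu>[of "ball z (5 * (\<Lambda> * u))"] emeasure_\<nu>[OF Y(1)] by (simp add: Y_def Int_assoc)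
    then have "measure \<nu> (ball z (5 * (\<Lambda> * u))) = measure \<nu> Y" by (simp add: measure_def)
    also have "\<dots> \<le> \<phi> (2 ^ n * d) * measure W Y"
    proof (rule \<nu>_le[OF Y])
      fix y assume "y \<in> Y"
      then have "dist z y < 5 * (\<Lambda> * u)" using Y(3) by auto
      moreover have "\<Lambda> * u \<le> \<Lambda> * (a * d)" using u(2) L0 by (intro mult_left_mono) (auto simp: d_def)
      moreover have "\<Lambda> * (a * d) \<le> \<Lambda> * (1 * d)" using a L0 d by (intro mult_left_mono mult_right_mono) auto
      ultimately have "bdist \<Omega> y \<le> (1 + 5 * \<Lambda>) * d" using bdist_lipschitz[of y z] by (simp add: d_def dist_commute algebra_simps)
      also have "\<dots> \<le> 2 ^ n * d" using n d by (intro mult_right_mono) auto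
      finally show "bdist \<Omega> y \<le> 2 ^ n * d" .
    qed (use d in simp)
    also have "\<dots> \<le> (D\<phi> ^ n * \<phi> d) * (L3 * measure W B)"
    proof (intro mult_mono)
      show "\<phi> (2 ^ n * d) \<le> D\<phi> ^ n * \<phi> d" by (rule \<phi>_pow[OF d])
      have "measure W Y \<le> measure W (ball z (5 * (\<Lambda> * u)))"
        using Y by (intro ball_doubling_mono[OF W, of _ _ z "5 * (\<Lambda> * u)"]) auto
      also have "\<dots> \<le> L3 * measure W B"
        unfolding B_def
      proof (rule L3(2)[OF lu])
        have "(5 * \<Lambda>) * (1 * u) \<le> (5 * \<Lambda>) * (l * u)" using L0 l u by (intro mult_left_mono mult_right_mono) auto
        then show "dist z z + 5 * (\<Lambda> * u) \<le> 5 * \<Lambda> * (l * u)" by simp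
      qed
      finally show "measure W Y \<le> L3 * measure W B" .
    qed (use \<phi>d D\<phi>_ge in auto)
    finally have "F powr q * measure \<nu> (ball z (5 * (\<Lambda> * u))) \<le> F powr q * ((D\<phi> ^ n * \<phi> d) * (L3 * measure W B))"
      by (intro mult_left_mono) auto
    also have "\<dots> = (D\<phi> ^ n * L3) * (F powr q * measure W B * \<phi> d)" by (simp only: mult_ac)
    also have "\<dots> \<le> (D\<phi> ^ n * L3) * ((A powr q * l powr (- (s - \<gamma>) * q) * C1 powr (q / p)) * x powr (q / p))"
      using FW D\<phi>_ge L3(1) by (intro mult_left_mono) auto
    also have "\<dots> = K1 * x powr (q / p)" by (simp only: K1_def mult_ac)
    finally show "F powr q * measure \<nu> (ball z (5 * (\<Lambda> * u))) \<le> K1 * enn2real (\<integral>\<^sup>+y\<in>ball z (l * u). e y \<partial>M) powr (q / p)"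
      by (simp add: x_def B_def)
  qed
qed

text \<open>\<open>e h t\<close> is the energy density of \<open>h\<close> truncated between \<open>t\<close> and \<open>2t\<close>.\<close>

lemma oscillation_to_norm:
  assumes \<kappa>: "1 \<le> \<kappa>" and q: "0 < q" and l: "l \<le> \<Lambda>" "l * a \<le> c0" and K1: "0 \<le> K1"
  obtains K where "0 < K"
    "\<And>f e Et. f \<in> borel_measurable (restrict_space M \<Omega>) \<Longrightarrow> 0 \<le> Et \<Longrightarrow>
      \<forall>h \<sigma> b t z r. h = (\<lambda>x. if x \<in> \<Omega> then \<sigma> * (f x - b) else 0) \<and> \<sigma> \<in> {- 1, 1} \<and> h \<in> borel_measurable borel \<and>
          0 < t \<and> z \<in> \<Omega> \<and> 0 < r \<and> r \<le> a * bdist \<Omega> z \<and> (\<integral>\<^sup>+y\<in>\<Omega>. e h t y \<partial>M) < \<infinity> \<longrightarrow>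
        (t * osc M (trunc t h) (ball z r)) powr q * measure \<nu> (ball z (5 * (\<Lambda> * r)))
          \<le> K1 * enn2real (\<integral>\<^sup>+y\<in>ball z (l * r). e h t y \<partial>M) powr \<kappa> \<Longrightarrow>
      \<forall>h \<sigma> b t0 m. h = (\<lambda>x. if x \<in> \<Omega> then \<sigma> * (f x - b) else 0) \<and> \<sigma> \<in> {- 1, 1} \<and> 0 < t0 \<longrightarrow>
        (\<Sum>k<m. \<integral>\<^sup>+y\<in>\<Omega>. e h (t0 * 2 ^ k) y \<partial>M) \<le> ennreal Et \<Longrightarrow>
      \<exists>b. (\<integral>\<^sup>+y\<in>\<Omega>. ennreal (\<bar>f y - b\<bar> powr q) \<partial>\<nu>) \<le> ennreal (K * Et powr \<kappa>)"
proof (rule weak_to_strong[OF \<kappa> q l K1])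
  fix K :: real assume K: "0 < K" and ws: "\<And>h e Et. h \<in> borel_measurable borel \<Longrightarrow> measure M B0 \<le> 2 * measure M {y\<in>B0. h y \<le> 0} \<Longrightarrow> 0 \<le> Et \<Longrightarrow>
      \<forall>t z r. 0 < t \<and> z \<in> \<Omega> \<and> 0 < r \<and> r \<le> a * bdist \<Omega> z \<longrightarrow>
        (t * osc M (trunc t h) (ball z r)) powr q * measure \<nu> (ball z (5 * (\<Lambda> * r)))
          \<le> K1 * enn2real (\<integral>\<^sup>+y\<in>ball z (l * r). e t y \<partial>M) powr \<kappa> \<Longrightarrow>
      \<forall>t0 m. 0 < t0 \<longrightarrow> (\<Sum>k<m. \<integral>\<^sup>+y\<in>\<Omega>. e (t0 * 2 ^ k) y \<partial>M) \<le> ennreal Et \<Longrightarrow>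
      (\<integral>\<^sup>+y\<in>\<Omega>. ennreal (max 0 (h y) powr q) \<partial>\<nu>) \<le> ennreal (K * Et powr \<kappa>)"
  show thesis
  proof (rule that[of "2 * K"])
    show "0 < 2 * K" using K by simp
    fix f :: "'a \<Rightarrow> real" and e :: "('a \<Rightarrow> real) \<Rightarrow> real \<Rightarrow> 'a \<Rightarrow> ennreal" and Et :: real
    assume f: "f \<in> borel_measurable (restrict_space M \<Omega>)" and Et: "0 \<le> Et"
      and loc: "\<forall>h \<sigma> b t z r. h = (\<lambda>x. if x \<in> \<Omega> then \<sigma> * (f x - b) else 0) \<and> \<sigma> \<in> {- 1, 1} \<and> h \<in> borel_measurable borel \<and>
          0 < t \<and> z \<in> \<Omega> \<and> 0 < r \<and> r \<le> a * bdist \<Omega> z \<and> (\<integral>\<^sup>+y\<in>\<Omega>. e h t y \<partial>M) < \<infinity> \<longrightarrow>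
        (t * osc M (trunc t h) (ball z r)) powr q * measure \<nu> (ball z (5 * (\<Lambda> * r)))
          \<le> K1 * enn2real (\<integral>\<^sup>+y\<in>ball z (l * r). e h t y \<partial>M) powr \<kappa>"
      and tot: "\<forall>h \<sigma> b t0 m. h = (\<lambda>x. if x \<in> \<Omega> then \<sigma> * (f x - b) else 0) \<and> \<sigma> \<in> {- 1, 1} \<and> 0 < t0 \<longrightarrow>
        (\<Sum>k<m. \<integral>\<^sup>+y\<in>\<Omega>. e h (t0 * 2 ^ k) y \<partial>M) \<le> ennreal Et"
    \<comment> \<open>\<open>f\<close> is measurable only on \<Omega>. The median is taken for its
      extension by 0, which agrees with \<open>f\<close> on \<open>B0\<close>.\<close>
    define f' where "f' x = (if x \<in> \<Omega> then f x else 0)" for x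
    have \<Omega>M: "\<Omega> \<in> sets M" "\<Omega> \<inter> space M \<in> sets M" using \<Omega>(1) sets_M ball_doublingD(2)[OF M] by auto
    have f'M: "f' \<in> borel_measurable M"
      unfolding f'_def[abs_def] using f \<Omega>M by (subst measurable_If_restrict_space_iff[where P = "\<lambda>x. x \<in> \<Omega>"]) (auto simp: ball_doublingD(2)[OF M])
    have f'm [measurable]: "f' \<in> borel_measurable borel"
      using f'M unfolding measurable_cong_sets[OF sets_M refl] .
    have B0\<Omega>: "B0 \<subseteq> \<Omega>"
    proof -
      have "b * R0 = a * bdist \<Omega> x0 / 2" using CJ by (simp add: b_def R0_def)
      also have "\<dots> \<le> c0 * bdist \<Omega> x0" using a bdist_pos[OF x0] mult_right_mono[of a c0 "bdist \<Omega> x0"] c0(1) by simp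
      finally show ?thesis using c0(2)[OF x0] subset_ball by blast
    qed
    obtain b where md: "measure M B0 \<le> 2 * measure M {y\<in>B0. f' y \<le> b}" "measure M B0 \<le> 2 * measure M {y\<in>B0. b \<le> f' y}"
      by (rule median_exists[OF M f'm pos[OF mult_pos_pos[OF b(1) R0_pos]]]) (rule that)
    define h where "h \<sigma> x = (if x \<in> \<Omega> then \<sigma> * (f x - b) else 0)" for \<sigma> x
    have hm: "h \<sigma> \<in> borel_measurable borel" for \<sigma>
    proof -
      have [measurable]: "\<Omega> \<in> sets borel" using \<Omega>(1) by simp
      have "h \<sigma> = (\<lambda>x. indicator \<Omega> x * (\<sigma> * (f' x - b)))" by (auto simp: h_def f'_def fun_eq_iff)
      then show ?thesis by simp
    qed
    \<comment> \<open>The sign \<sigma> selects the part of \<open>f\<close> above or below the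
      median; for either sign \<open>h \<sigma>\<close> is nonpositive on half of
      \<open>B0\<close>.\<close>
    have half: "(\<integral>\<^sup>+y\<in>\<Omega>. ennreal (max 0 (h \<sigma> y) powr q) \<partial>\<nu>) \<le> ennreal (K * Et powr \<kappa>)"
      if \<sigma>: "\<sigma> \<in> {- 1, 1}" and m: "measure M B0 \<le> 2 * measure M {y\<in>B0. h \<sigma> y \<le> 0}" for \<sigma>
    proof (rule ws[OF hm m Et])
      have h_eq: "h \<sigma> = (\<lambda>x. if x \<in> \<Omega> then \<sigma> * (f x - b) else 0)" by (simp add: h_def[abs_def])
      show T: "\<forall>t0 m. 0 < t0 \<longrightarrow> (\<Sum>k<m. \<integral>\<^sup>+y\<in>\<Omega>. e (h \<sigma>) (t0 * 2 ^ k) y \<partial>M) \<le> ennreal Et"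
      proof (intro allI impI)
        fix t0 :: real and m :: nat assume "0 < t0"
        with h_eq \<sigma> show "(\<Sum>k<m. \<integral>\<^sup>+y\<in>\<Omega>. e (h \<sigma>) (t0 * 2 ^ k) y \<partial>M) \<le> ennreal Et"
          by (intro tot[rule_format, of "h \<sigma>" \<sigma> b t0 m] conjI)
      qed
      have fin: "(\<integral>\<^sup>+y\<in>\<Omega>. e (h \<sigma>) t y \<partial>M) < \<infinity>" if "0 < t" for t
      proof -
        have "(\<integral>\<^sup>+y\<in>\<Omega>. e (h \<sigma>) t y \<partial>M) \<le> ennreal Et" using T[rule_format, OF that, of 1] by simp
        then show ?thesis by (rule le_less_trans) simp
      qed
      show "\<forall>t z r. 0 < t \<and> z \<in> \<Omega> \<and> 0 < r \<and> r \<le> a * bdist \<Omega> z \<longrightarrow>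
        (t * osc M (trunc t (h \<sigma>)) (ball z r)) powr q * measure \<nu> (ball z (5 * (\<Lambda> * r)))
          \<le> K1 * enn2real (\<integral>\<^sup>+y\<in>ball z (l * r). e (h \<sigma>) t y \<partial>M) powr \<kappa>"
      proof (intro allI impI)
        fix t r :: real and z assume as: "0 < t \<and> z \<in> \<Omega> \<and> 0 < r \<and> r \<le> a * bdist \<Omega> z"
        show "(t * osc M (trunc t (h \<sigma>)) (ball z r)) powr q * measure \<nu> (ball z (5 * (\<Lambda> * r)))
          \<le> K1 * enn2real (\<integral>\<^sup>+y\<in>ball z (l * r). e (h \<sigma>) t y \<partial>M) powr \<kappa>"
          by (rule loc[rule_format, of "h \<sigma>" \<sigma> b t z r])
            (intro conjI h_eq \<sigma> hm fin, use as in simp_all)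
      qed
    qed
    have e1: "{y\<in>B0. h 1 y \<le> 0} = {y\<in>B0. f' y \<le> b}" "{y\<in>B0. h (- 1) y \<le> 0} = {y\<in>B0. b \<le> f' y}"
      using B0\<Omega> by (auto simp: h_def f'_def)
    have \<nu>m: "h \<sigma> \<in> borel_measurable \<nu>" for \<sigma>
      using hm[of \<sigma>] unfolding measurable_cong_sets[OF sets_\<nu> refl] .
    have \<Omega>\<nu>: "\<Omega> \<in> sets \<nu>" using \<Omega>(1) sets_\<nu> by simp
    have mm: "(\<lambda>y. ennreal (max 0 (h \<sigma> y) powr q) * indicator \<Omega> y) \<in> borel_measurable \<nu>" for \<sigma>
    proof -
      note [measurable] = \<nu>m \<Omega>\<nu>
      show ?thesis by measurable
    qed
    have "(\<integral>\<^sup>+y\<in>\<Omega>. ennreal (\<bar>f y - b\<bar> powr q) \<partial>\<nu>)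
        = (\<integral>\<^sup>+y. ennreal (max 0 (h 1 y) powr q) * indicator \<Omega> y + ennreal (max 0 (h (- 1) y) powr q) * indicator \<Omega> y \<partial>\<nu>)"
    proof (rule nn_integral_cong)
      fix y
      show "ennreal (\<bar>f y - b\<bar> powr q) * indicator \<Omega> y =
          ennreal (max 0 (h 1 y) powr q) * indicator \<Omega> y + ennreal (max 0 (h (- 1) y) powr q) * indicator \<Omega> y"
        by (cases "y \<in> \<Omega>"; cases "b \<le> f y") (auto simp: h_def max_def abs_if)
    qed
    also have "\<dots> = (\<integral>\<^sup>+y\<in>\<Omega>. ennreal (max 0 (h 1 y) powr q) \<partial>\<nu>) + (\<integral>\<^sup>+y\<in>\<Omega>. ennreal (max 0 (h (- 1) y) powr q) \<partial>\<nu>)"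
      by (rule nn_integral_add[OF mm mm])
    also have "\<dots> \<le> ennreal (K * Et powr \<kappa>) + ennreal (K * Et powr \<kappa>)"
      using md unfolding e1[symmetric] by (intro add_mono half) auto
    also have "\<dots> = ennreal (2 * K * Et powr \<kappa>)" using K by (simp add: ennreal_plus[symmetric] del: ennreal_plus)
    finally show "\<exists>b. (\<integral>\<^sup>+y\<in>\<Omega>. ennreal (\<bar>f y - b\<bar> powr q) \<partial>\<nu>) \<le> ennreal (2 * K * Et powr \<kappa>)" by blast
  qed
qed

end

subsection \<open>The energies of the truncations\<close>

lemma trunc_abs: "0 < t \<Longrightarrow> t * trunc t h x = min (max 0 (h x - t)) t"
  by (simp add: trunc_def)

text \<open>The slabs from \<open>t0 * 2 ^ k\<close> to \<open>t0 * 2 ^ Suc k\<close> fit together,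
  so their sum is a single truncation from \<open>t0\<close> to \<open>t0 * 2 ^ m\<close>.\<close>

lemma sum_trunc:
  assumes t0: "0 < (t0 :: real)"
  shows "(\<Sum>k<m. min (max 0 (x - t0 * 2 ^ k)) (t0 * 2 ^ k)) = min (max 0 (x - t0)) (t0 * (2 ^ m - 1))"
proof (induction m)
  case (Suc m)
  define A where "A = t0 * 2 ^ m"
  have "t0 * 1 \<le> t0 * 2 ^ m" using t0 by (intro mult_left_mono) auto
  then have A: "t0 \<le> A" by (simp add: A_def)
  have "min (max 0 (x - t0)) (A - t0) + min (max 0 (x - A)) A = min (max 0 (x - t0)) (2 * A - t0)"
    using A t0 by (auto simp: min_def max_def)
  moreover have "t0 * (2 ^ m - 1) = A - t0" "t0 * (2 ^ Suc m - 1) = 2 * A - t0"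
    by (simp_all add: A_def algebra_simps)
  ultimately show ?case using Suc by (simp only: sum.lessThan_Suc A_def)
qed simp

text \<open>Each slab is monotone in the value of \<open>h\<close>, so the increments add without
  cancellation and total at most the increment of \<open>h\<close>; for \<open>p \<ge> 1\<close> the
  powers obey the same bound. This makes the fractional energies of the truncations summable over
  the levels.\<close>

lemma sum_trunc_diff_powr:
  assumes t0: "0 < t0" and p: "1 \<le> p"
  shows "(\<Sum>k<m. \<bar>t0 * 2 ^ k * trunc (t0 * 2 ^ k) h x - t0 * 2 ^ k * trunc (t0 * 2 ^ k) h y\<bar> powr p) \<le> \<bar>h x - h y\<bar> powr p"
proof -
  define T where "T k \<alpha> = min (max 0 (\<alpha> - t0 * 2 ^ k)) (t0 * 2 ^ k)" for k \<alpha>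
  have T: "t0 * 2 ^ k * trunc (t0 * 2 ^ k) h x = T k (h x)" for k x
    using trunc_abs[of "t0 * 2 ^ k" h x] t0 by (simp add: T_def)
  have le: "(\<Sum>k<m. \<bar>T k \<alpha> - T k \<beta>\<bar>) \<le> \<alpha> - \<beta>" if "\<beta> \<le> \<alpha>" for \<alpha> \<beta>
  proof -
    have "(\<Sum>k<m. \<bar>T k \<alpha> - T k \<beta>\<bar>) = (\<Sum>k<m. T k \<alpha>) - (\<Sum>k<m. T k \<beta>)"
      unfolding sum_subtractf[symmetric] using that by (intro sum.cong) (auto simp: T_def min_def max_def)
    also have "\<dots> \<le> \<alpha> - \<beta>"
      unfolding T_def sum_trunc[OF t0] using that by (auto simp: min_def max_def)
    finally show ?thesis .
  qed
  have "(\<Sum>k<m. \<bar>T k (h x) - T k (h y)\<bar>) \<le> \<bar>h x - h y\<bar>"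
    using le[of "h y" "h x"] le[of "h x" "h y"] by (cases "h y \<le> h x") (auto simp: abs_minus_commute)
  then have "(\<Sum>k<m. \<bar>T k (h x) - T k (h y)\<bar>) powr p \<le> \<bar>h x - h y\<bar> powr p"
    using p by (intro powr_mono2 sum_nonneg) auto
  moreover have "(\<Sum>k<m. \<bar>T k (h x) - T k (h y)\<bar> powr p) \<le> (\<Sum>k<m. \<bar>T k (h x) - T k (h y)\<bar>) powr p"
    using p by (intro sum_powr_le) auto
  ultimately show ?thesis unfolding T by linarith
qed

context
  fixes M :: "'a::metric_space measure" and \<psi> :: "'a \<Rightarrow> real" and B :: "'a set"
  assumes meas: "\<psi> \<in> borel_measurable M" and bd: "\<And>x. 0 \<le> \<psi> x \<and> \<psi> x \<le> 1"
    and B: "B \<in> fmeasurable M" and Bpos: "0 < measure M B"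
begin

lemma nn_integral_bounded:
  assumes g: "g \<in> borel_measurable M" "\<And>x. 0 \<le> g x" "\<And>x. g x \<le> k"
  shows "(\<integral>\<^sup>+y\<in>B. ennreal (g y) \<partial>M) = ennreal (LINT y:B|M. g y)"
proof -
  have "\<bar>g x\<bar> \<le> k" for x using g by simp
  then have i: "set_integrable M B g" by (intro bounded_set_integrable[OF g(1) _ B])
  have "(\<integral>\<^sup>+y\<in>B. ennreal (g y) \<partial>M) = (\<integral>\<^sup>+y. ennreal (indicator B y *\<^sub>R g y) \<partial>M)"
    by (intro nn_integral_cong) (auto split: split_indicator)
  also have "\<dots> = ennreal (LINT y:B|M. g y)"
    unfolding set_lebesgue_integral_def using i g(2)
    by (intro nn_integral_eq_integral) (auto simp: set_integrable_def)
  finally show ?thesis .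
qed

lemma nn_integral_osc:
  assumes t: "0 \<le> t"
  shows "(\<integral>\<^sup>+y\<in>B. ennreal (t * \<bar>\<psi> y - avg M B \<psi>\<bar>) \<partial>M) = ennreal (t * osc M \<psi> B * measure M B)"
proof -
  have a: "0 \<le> avg M B \<psi>" "avg M B \<psi> \<le> 1" using abs_avg_le[OF meas bd B Bpos] by auto
  have "(\<integral>\<^sup>+y\<in>B. ennreal (t * \<bar>\<psi> y - avg M B \<psi>\<bar>) \<partial>M) = ennreal (LINT y:B|M. t * \<bar>\<psi> y - avg M B \<psi>\<bar>)"
  proof (rule nn_integral_bounded[where k = t])
    show "(\<lambda>y. t * \<bar>\<psi> y - avg M B \<psi>\<bar>) \<in> borel_measurable M" using meas by measurable
    fix x
    show "0 \<le> t * \<bar>\<psi> x - avg M B \<psi>\<bar>" using t by simp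
    have "\<bar>\<psi> x - avg M B \<psi>\<bar> \<le> 1" using bd[of x] a by linarith
    then show "t * \<bar>\<psi> x - avg M B \<psi>\<bar> \<le> t" using t by (simp add: mult_left_le)
  qed
  also have "(LINT y:B|M. t * \<bar>\<psi> y - avg M B \<psi>\<bar>) = t * (osc M \<psi> B * measure M B)"
    using Bpos by (simp add: osc_def avg_def[of M B "\<lambda>y. \<bar>\<psi> y - avg M B \<psi>\<bar>"])
  finally show ?thesis by (simp add: mult.assoc)
qed

text \<open>Trades the mean for the differences of values that occur in the fractional
  seminorm.\<close>

lemma deviation_le:
  assumes t: "0 \<le> t"
  shows "ennreal (t * \<bar>\<psi> y - avg M B \<psi>\<bar> * measure M B) \<le> (\<integral>\<^sup>+x\<in>B. ennreal \<bar>t * \<psi> x - t * \<psi> y\<bar> \<partial>M)"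
proof -
  have i: "set_integrable M B \<psi>" using bd by (intro bounded_set_integrable[OF meas _ B, of 1]) auto
  have ic: "set_integrable M B (\<lambda>_. \<psi> y)" by (intro bounded_set_integrable[OF _ _ B, of _ "\<bar>\<psi> y\<bar>"]) auto
  have "(avg M B \<psi> - \<psi> y) * measure M B = (LINT x:B|M. \<psi> x) - measure M B * \<psi> y"
    using Bpos by (simp add: avg_def algebra_simps)
  also have "measure M B * \<psi> y = (LINT x:B|M. \<psi> y)" using B by (simp add: set_lebesgue_integral_def fmeasurable_def)
  also have "(LINT x:B|M. \<psi> x) - (LINT x:B|M. \<psi> y) = (LINT x:B|M. \<psi> x - \<psi> y)"
    using i ic by (rule set_integral_diff(2)[symmetric])
  finally have "\<bar>avg M B \<psi> - \<psi> y\<bar> * measure M B = \<bar>LINT x:B|M. \<psi> x - \<psi> y\<bar>"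
    using Bpos by (metis abs_mult abs_of_pos)
  also have "\<dots> \<le> (LINT x:B|M. \<bar>\<psi> x - \<psi> y\<bar>)"
    unfolding set_lebesgue_integral_def
    by (rule order.trans[OF integral_abs_bound]) (simp add: abs_mult)
  finally have "t * (\<bar>\<psi> y - avg M B \<psi>\<bar> * measure M B) \<le> t * (LINT x:B|M. \<bar>\<psi> x - \<psi> y\<bar>)"
    using t by (intro mult_left_mono) (simp_all add: abs_minus_commute)
  also have "\<dots> = (LINT x:B|M. \<bar>t * \<psi> x - t * \<psi> y\<bar>)"
    using t by (simp add: right_diff_distrib[symmetric] abs_mult)
  finally have "ennreal (t * \<bar>\<psi> y - avg M B \<psi>\<bar> * measure M B) \<le> ennreal (LINT x:B|M. \<bar>t * \<psi> x - t * \<psi> y\<bar>)"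
    by (intro ennreal_leI) (simp add: mult.assoc)
  also have "\<dots> = (\<integral>\<^sup>+x\<in>B. ennreal \<bar>t * \<psi> x - t * \<psi> y\<bar> \<partial>M)"
  proof (rule nn_integral_bounded[where k = t, symmetric])
    show "(\<lambda>x. \<bar>t * \<psi> x - t * \<psi> y\<bar>) \<in> borel_measurable M" using meas by measurable
    fix x
    have "\<bar>\<psi> x - \<psi> y\<bar> \<le> 1" using bd[of x] bd[of y] by linarith
    then have "t * \<bar>\<psi> x - \<psi> y\<bar> \<le> t" using t by (simp add: mult_left_le)
    then show "\<bar>t * \<psi> x - t * \<psi> y\<bar> \<le> t" using t by (simp add: right_diff_distrib[symmetric] abs_mult)
  qed simp
  finally show ?thesis .
qed

end

section \<open>Oscillation controlled by gradient and by fractional energy\<close>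

context john_chain
begin

lemma trunc_test:
  assumes "h \<in> borel_measurable borel" "0 < t"
  shows "trunc t h \<in> borel_measurable M" "\<And>x. 0 \<le> trunc t h x \<and> trunc t h x \<le> 1"
proof -
  have "trunc t h \<in> borel_measurable borel" unfolding trunc_def[abs_def] using assms(1) by measurable
  then show "trunc t h \<in> borel_measurable M" unfolding measurable_cong_sets[OF sets_M refl] .
  show "0 \<le> trunc t h x \<and> trunc t h x \<le> 1" for x
    by (intro conjI trunc_props(1,2)[OF assms(2)])
qed

text \<open>The truncation property at the levels \<open>t\<close> and \<open>2 * t\<close>. It
  concerns \<open>\<sigma> * (f x - \<beta>)\<close> on the whole space, while \<open>h\<close> is
  cut off outside \<Omega>; both agree on \<open>ball z (lam' * r)\<close>, where the inequality
  takes place. Multiplication by the measure of this ball yields the form expected by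
  \<open>energy_bound\<close>.\<close>

lemma gradient_oscillation:
  assumes tp: "truncation_property M \<Omega> lam' C' f g" and g: "\<And>x. 0 \<le> g x" "g \<in> borel_measurable M" and C': "0 < C'" and l: "1 \<le> lam'"
    and h: "h = (\<lambda>x. if x \<in> \<Omega> then \<sigma> * (f x - \<beta>) else 0)" "\<sigma> \<in> {- 1, 1}" "h \<in> borel_measurable borel"
    and t: "0 < t" and r: "0 < r" and sub: "ball z (lam' * r) \<subseteq> \<Omega>"
  shows "ennreal (t * osc M (trunc t h) (ball z r) * measure M (ball z (lam' * r)))
    \<le> (\<integral>\<^sup>+y\<in>ball z (lam' * r). ennreal (C' * r * (g y * indicator {x. t < h x \<and> h x \<le> 2 * t} y)) \<partial>M)"
proof -
  define hh where "hh x = \<sigma> * (f x - \<beta>)" for x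
  define B where "B = ball z r"
  define B' where "B' = ball z (lam' * r)"
  have lr: "r \<le> lam' * r" using l r mult_right_mono[of 1 lam' r] by simp
  have BB: "B \<subseteq> B'" unfolding B_def B'_def by (rule subset_ball[OF lr])
  have hB: "h x = hh x" if "x \<in> B'" for x using sub that by (auto simp: h(1) hh_def B'_def)
  have fm: "B \<in> fmeasurable M" "0 < measure M B" "0 < measure M B'" using ball_fm pos r lr by (auto simp: B_def B'_def)
  note tt = trunc_test[OF h(3) t]
  have "poincare_pair M \<Omega> lam' C' (\<lambda>x. min (max 0 (hh x - t)) (2 * t - t)) (\<lambda>x. g x * indicator {x. t < hh x \<and> hh x \<le> 2 * t} x)"
    using tp[unfolded truncation_property_def, rule_format, of t "2 * t" \<sigma> \<beta>] t h(2) by (simp add: hh_def Let_def)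
  then have PP: "nn_avg M B (\<lambda>y. ennreal \<bar>min (max 0 (hh y - t)) (2 * t - t) - avg M B (\<lambda>x. min (max 0 (hh x - t)) (2 * t - t))\<bar>)
      \<le> ennreal (C' * r) * nn_avg M B' (\<lambda>y. ennreal (g y * indicator {x. t < hh x \<and> hh x \<le> 2 * t} y))"
    unfolding poincare_pair_def B_def B'_def using r sub by blast
  have ft: "min (max 0 (hh y - t)) (2 * t - t) = t * trunc t h y" if "y \<in> B" for y
    using hB[of y] that BB trunc_abs[OF t, of h y] by auto
  have "(LINT x:B|M. min (max 0 (hh x - t)) (2 * t - t)) = (LINT x:B|M. t * trunc t h x)"
    using fm(1) ft by (intro set_lebesgue_integral_cong) (auto simp: fmeasurable_def)
  then have av: "avg M B (\<lambda>x. min (max 0 (hh x - t)) (2 * t - t)) = t * avg M B (trunc t h)"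
    by (simp add: avg_def)
  have "nn_avg M B (\<lambda>y. ennreal \<bar>min (max 0 (hh y - t)) (2 * t - t) - avg M B (\<lambda>x. min (max 0 (hh x - t)) (2 * t - t))\<bar>)
      = (\<integral>\<^sup>+y\<in>B. ennreal (t * \<bar>trunc t h y - avg M B (trunc t h)\<bar>) \<partial>M) / emeasure M B"
  proof -
    have "(\<integral>\<^sup>+y\<in>B. ennreal \<bar>min (max 0 (hh y - t)) (2 * t - t) - t * avg M B (trunc t h)\<bar> \<partial>M)
        = (\<integral>\<^sup>+y\<in>B. ennreal (t * \<bar>trunc t h y - avg M B (trunc t h)\<bar>) \<partial>M)"
    proof (rule nn_integral_cong)
      fix y
      have eq: "\<bar>t * trunc t h y - t * avg M B (trunc t h)\<bar> = t * \<bar>trunc t h y - avg M B (trunc t h)\<bar>"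
        using t by (simp add: right_diff_distrib[symmetric] abs_mult)
      show "ennreal \<bar>min (max 0 (hh y - t)) (2 * t - t) - t * avg M B (trunc t h)\<bar> * indicator B y
          = ennreal (t * \<bar>trunc t h y - avg M B (trunc t h)\<bar>) * indicator B y"
      proof (cases "y \<in> B")
        case True
        show ?thesis unfolding ft[OF True] eq ..
      qed simp
    qed
    then show ?thesis unfolding nn_avg_def av by simp
  qed
  also have "\<dots> = ennreal (t * osc M (trunc t h) B)"
    using nn_integral_osc[OF tt fm(1,2), of t] t ball_doubling_fmeasurable(2)[OF M, of B z r] fm(2)
    by (simp add: B_def divide_ennreal_def inverse_ennreal ennreal_mult''[symmetric] mult.assoc)
  finally have 1: "ennreal (t * osc M (trunc t h) B) \<le> ennreal (C' * r) * nn_avg M B' (\<lambda>y. ennreal (g y * indicator {x. t < hh x \<and> hh x \<le> 2 * t} y))"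
    using PP by simp
  have em': "emeasure M B' = ennreal (measure M B')"
    by (rule ball_doubling_fmeasurable(2)[OF M, of _ z "lam' * r"]) (auto simp: B'_def)
  have "ennreal (t * osc M (trunc t h) B * measure M B') = ennreal (t * osc M (trunc t h) B) * ennreal (measure M B')"
    by (simp add: ennreal_mult'')
  also have "\<dots> \<le> (ennreal (C' * r) * nn_avg M B' (\<lambda>y. ennreal (g y * indicator {x. t < hh x \<and> hh x \<le> 2 * t} y))) * ennreal (measure M B')"
    using 1 by (rule mult_right_mono) simp
  also have "\<dots> = ennreal (C' * r) * (\<integral>\<^sup>+y\<in>B'. ennreal (g y * indicator {x. t < hh x \<and> hh x \<le> 2 * t} y) \<partial>M)"
    unfolding nn_avg_def em' using fm(3)
    by (simp add: divide_ennreal_def mult.assoc inverse_ennreal ennreal_mult'[symmetric])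
  also have "\<dots> = ennreal (C' * r) * (\<integral>\<^sup>+y\<in>B'. ennreal (g y * indicator {x. t < h x \<and> h x \<le> 2 * t} y) \<partial>M)"
  proof -
    have "ennreal (g y * indicator {x. t < hh x \<and> hh x \<le> 2 * t} y) * indicator B' y
      = ennreal (g y * indicator {x. t < h x \<and> h x \<le> 2 * t} y) * indicator B' y" for y
      using hB[of y] by (cases "y \<in> B'") (simp_all add: indicator_def)
    then show ?thesis by simp
  qed
  also have "\<dots> = (\<integral>\<^sup>+y. ennreal (C' * r) * (ennreal (g y * indicator {x. t < h x \<and> h x \<le> 2 * t} y) * indicator B' y) \<partial>M)"
  proof (rule nn_integral_cmult[symmetric])
    have hM: "h \<in> borel_measurable M" using h(3) unfolding measurable_cong_sets[OF sets_M refl] .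
    have "{x \<in> space M. t < h x \<and> h x \<le> 2 * t} \<in> sets M" using hM by measurable
    then have [measurable]: "{x. t < h x \<and> h x \<le> 2 * t} \<in> sets M" by (simp add: ball_doublingD(2)[OF M])
    have [measurable]: "B' \<in> sets M" "g \<in> borel_measurable M" using sets_M g(2) by (auto simp: B'_def)
    show "(\<lambda>y. ennreal (g y * indicator {x. t < h x \<and> h x \<le> 2 * t} y) * indicator B' y) \<in> borel_measurable M"
      by measurable
  qed
  also have "\<dots> = (\<integral>\<^sup>+y\<in>B'. ennreal (C' * r * (g y * indicator {x. t < h x \<and> h x \<le> 2 * t} y)) \<partial>M)"
  proof (rule nn_integral_cong)
    fix y
    show "ennreal (C' * r) * (ennreal (g y * indicator {x. t < h x \<and> h x \<le> 2 * t} y) * indicator B' y)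
      = ennreal (C' * r * (g y * indicator {x. t < h x \<and> h x \<le> 2 * t} y)) * indicator B' y"
      using C' r by (simp add: ennreal_mult' mult.assoc)
  qed
  finally show ?thesis by (simp add: B_def B'_def)
qed

text \<open>Within half the depth of \<open>z\<close> the depth drops by a factor of at most 2;
  monotonicity and doubling of \<phi> do the rest.\<close>

lemma improving_weight_ge:
  assumes \<gamma>: "0 \<le> \<gamma>" and p: "1 \<le> p" and q: "0 < q" and z: "z \<in> \<Omega>" and x: "x \<in> \<Omega>" "dist z x < r" "r \<le> bdist \<Omega> z / 2"
    and \<Phi>: "\<And>t. 0 < t \<Longrightarrow> \<Phi> t = \<phi> t powr (p / q)"
  shows "bdist \<Omega> z powr (\<gamma> * p) * \<phi> (bdist \<Omega> z) powr (p / q) \<le> 2 powr (\<gamma> * p) * D\<phi> powr (p / q) * w_Phi \<Omega> \<Phi> (\<gamma> * p) x"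
proof -
  define d where "d = bdist \<Omega> z"
  have d: "0 < d" and dx: "0 < bdist \<Omega> x" using bdist_pos z x(1) by (auto simp: d_def)
  have d2: "d \<le> 2 * bdist \<Omega> x" using bdist_lipschitz[of z x] x(2,3) by (simp add: d_def)
  have "d powr (\<gamma> * p) \<le> (2 * bdist \<Omega> x) powr (\<gamma> * p)"
    using d d2 \<gamma> p by (intro powr_mono2) auto
  then have 1: "d powr (\<gamma> * p) \<le> 2 powr (\<gamma> * p) * bdist \<Omega> x powr (\<gamma> * p)" using dx by (simp add: powr_mult)
  have "\<phi> d \<le> \<phi> (2 * bdist \<Omega> x)" using d d2 by (rule \<phi>_mono)
  also have "\<dots> \<le> D\<phi> * \<phi> (bdist \<Omega> x)" by (rule \<phi>(3)[OF dx])
  finally have "\<phi> d powr (p / q) \<le> (D\<phi> * \<phi> (bdist \<Omega> x)) powr (p / q)"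
    using \<phi>(1)[OF d] p q by (intro powr_mono2) auto
  then have 2: "\<phi> d powr (p / q) \<le> D\<phi> powr (p / q) * \<Phi> (bdist \<Omega> x)"
    using \<Phi>[OF dx] \<phi>(1)[OF dx] D\<phi>_ge by (simp add: powr_mult)
  have "d powr (\<gamma> * p) * \<phi> d powr (p / q) \<le> (2 powr (\<gamma> * p) * bdist \<Omega> x powr (\<gamma> * p)) * (D\<phi> powr (p / q) * \<Phi> (bdist \<Omega> x))"
    using 1 2 by (intro mult_mono) auto
  then show ?thesis by (simp add: d_def w_Phi_def mult_ac)
qed

text \<open>Jensen in the inner variable. For \<open>x\<close> and \<open>y\<close> in the ball,
  \<open>dist x y\<close> is at most \<open>2 * u\<close> and
  \<open>measure M (ball y (dist x y))\<close> is at most a multiple of the volume, which bounds the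
  kernel from below. The condition \<open>a \<le> \<tau> / 4\<close> puts the ball inside
  \<open>ball y (\<tau> * bdist \<Omega> y)\<close>. Both end points have depth at least half that
  of \<open>z\<close>, so the minimum in \<open>v_Phi\<close> is as good as either of its
  values.\<close>

lemma frac_energy_ge:
  assumes \<gamma>: "0 \<le> \<gamma>" and p: "1 \<le> p" and q: "0 < q" and s: "0 < s" and a4: "a \<le> \<tau> / 4"
    and \<Phi>: "\<And>t. 0 < t \<Longrightarrow> \<Phi> t = \<phi> t powr (p / q)" and v: "\<And>x. 0 \<le> v x"
  obtains C1 where "0 < C1"
    "\<And>z u h t y. z \<in> \<Omega> \<Longrightarrow> 0 < u \<Longrightarrow> u \<le> a * bdist \<Omega> z \<Longrightarrow> h \<in> borel_measurable borel \<Longrightarrow> 0 < t \<Longrightarrow> y \<in> ball z u \<Longrightarrow>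
      ennreal ((t * \<bar>trunc t h y - avg M (ball z u) (trunc t h)\<bar>) powr p * v y * (bdist \<Omega> z powr (\<gamma> * p) * \<phi> (bdist \<Omega> z) powr (p / q)))
      \<le> ennreal (C1 * u powr (s * p)) *
        (\<integral>\<^sup>+x\<in>\<Omega> \<inter> ball y (\<tau> * bdist \<Omega> y). ennreal (\<bar>t * trunc t h x - t * trunc t h y\<bar> powr p /
            (measure M (ball y (dist x y)) * dist x y powr (s * p)) * (v_Phi \<Omega> \<Phi> (\<gamma> * p) x y * v y)) \<partial>M)"
proof -
  obtain L where L: "1 \<le> L" "\<And>x y r R. 0 < r \<Longrightarrow> dist x y + R \<le> 3 * r \<Longrightarrow> measure M (ball y R) \<le> L * measure M (ball x r)"
    by (rule compare_M[of 3]) (rule that)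
  define C2 where "C2 = 2 powr (\<gamma> * p) * D\<phi> powr (p / q)"
  have C2: "0 < C2" using D\<phi>_ge by (simp add: C2_def)
  show thesis
  proof (rule that[of "C2 * L * 2 powr (s * p)"])
    show "0 < C2 * L * 2 powr (s * p)" using C2 L(1) by simp
    fix z y :: 'a and u t :: real and h :: "'a \<Rightarrow> real"
    assume z: "z \<in> \<Omega>" and u: "0 < u" "u \<le> a * bdist \<Omega> z" and h: "h \<in> borel_measurable borel" and t: "0 < t" and y: "y \<in> ball z u"
    define B where "B = ball z u"
    define d where "d = bdist \<Omega> z"
    have d: "0 < d" unfolding d_def by (rule bdist_pos[OF z])
    have "a * d \<le> 1/2 * d" "a * d \<le> c0 * d" "a * d \<le> \<tau> / 4 * d" using a a4 d by (auto intro!: mult_right_mono)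
    then have ud: "u \<le> d / 2" "u \<le> c0 * d" "4 * u \<le> \<tau> * d" using u(2) by (auto simp: d_def)
    have B\<Omega>: "B \<subseteq> \<Omega>" using c0(2)[OF z] subset_ball[OF ud(2), of z] by (auto simp: B_def d_def)
    have yd: "d / 2 \<le> bdist \<Omega> y" using bdist_lipschitz[of z y] y ud(1) by (simp add: d_def)
    have \<tau>: "0 < \<tau>" using a(1) a4 by simp
    have Bsub: "B \<subseteq> \<Omega> \<inter> ball y (\<tau> * bdist \<Omega> y)"
    proof
      fix x assume x: "x \<in> B"
      then have "dist y x < 2 * u" using y dist_triangle[of y x z] by (simp add: B_def dist_commute)
      also have "\<dots> \<le> \<tau> * (d / 2)" using ud(3) by simp
      also have "\<dots> \<le> \<tau> * bdist \<Omega> y" using yd \<tau> by (intro mult_left_mono) auto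
      finally show "x \<in> \<Omega> \<inter> ball y (\<tau> * bdist \<Omega> y)" using x B\<Omega> by auto
    qed
    define m where "m = measure M B"
    have m: "0 < m" using pos[OF u(1)] by (simp add: m_def B_def)
    have Bs: "B \<in> sets M" "emeasure M B = ennreal m"
      using sets_M ball_doubling_fmeasurable(2)[OF M, of B z u] by (auto simp: B_def m_def)
    have fm: "B \<in> fmeasurable M" "0 < measure M B" using ball_fm m by (auto simp: B_def m_def)
    note tt = trunc_test[OF h t]
    define \<Delta> where "\<Delta> x = \<bar>t * trunc t h x - t * trunc t h y\<bar>" for x
    define G where "G = d powr (\<gamma> * p) * \<phi> d powr (p / q)"
    have G: "0 < G" using d \<phi>(1)[OF d] by (simp add: G_def)
    define k where "k = C2 * (L * m) * (2 * u) powr (s * p)"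
    have k: "0 < k" using C2 L(1) m u by (simp add: k_def)
    define int where "int x = \<Delta> x powr p / (measure M (ball y (dist x y)) * dist x y powr (s * p)) * (v_Phi \<Omega> \<Phi> (\<gamma> * p) x y * v y)" for x
    have pt: "\<Delta> x powr p * (v y * G) \<le> k * int x" if x: "x \<in> B" for x
    \<comment> \<open>On the diagonal both sides are 0; off it the kernel has a positive
      denominator.\<close>
    proof (cases "x = y")
      case True
      then show ?thesis by (simp add: \<Delta>_def int_def)
    next
      case False
      then have dp: "0 < dist x y" by simp
      define P where "P = measure M (ball y (dist x y))"
      have P: "0 < P" unfolding P_def by (rule pos[OF dp])
      have d2: "dist x y \<le> 2 * u" using x y dist_triangle[of x y z] by (simp add: B_def dist_commute)
      have "P \<le> measure M (ball y (2 * u))" unfolding P_def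
        using d2 by (intro ball_doubling_mono[OF M, of _ _ y "2 * u"] subset_ball) auto
      also have "\<dots> \<le> L * m" unfolding m_def B_def using y u(1) by (intro L(2)) auto
      finally have PL: "P \<le> L * m" .
      have "G \<le> C2 * w_Phi \<Omega> \<Phi> (\<gamma> * p) x'" if "x' \<in> B" for x'
        unfolding G_def d_def C2_def using that B\<Omega> ud(1)
        by (intro improving_weight_ge[OF \<gamma> p q z _ _ _ \<Phi>, of _ u]) (auto simp: B_def d_def)
      then have "G \<le> C2 * w_Phi \<Omega> \<Phi> (\<gamma> * p) x" "G \<le> C2 * w_Phi \<Omega> \<Phi> (\<gamma> * p) y"
        using x y by (auto simp: B_def)
      then have GV: "G \<le> C2 * v_Phi \<Omega> \<Phi> (\<gamma> * p) x y" using C2 by (simp add: v_Phi_def min_def)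
      have V0: "0 < v_Phi \<Omega> \<Phi> (\<gamma> * p) x y" using GV G C2 by (metis less_le_trans zero_less_mult_pos)
      have "\<Delta> x powr p * (v y * G) \<le> \<Delta> x powr p * (v y * (C2 * v_Phi \<Omega> \<Phi> (\<gamma> * p) x y))"
        using GV v[of y] by (intro mult_left_mono) auto
      also have "\<dots> = (C2 * P * dist x y powr (s * p)) * int x"
        using P dp by (simp add: int_def P_def[symmetric])
      also have "\<dots> \<le> k * int x"
        unfolding k_def
      proof (intro mult_right_mono mult_mono)
        show "dist x y powr (s * p) \<le> (2 * u) powr (s * p)" using d2 s p by (intro powr_mono2) auto
        show "0 \<le> int x" using V0 v[of y] by (simp add: int_def)
      qed (use PL C2 L(1) m P in auto)
      finally show ?thesis .
    qed
    define e where "e = (\<integral>\<^sup>+x\<in>\<Omega> \<inter> ball y (\<tau> * bdist \<Omega> y). ennreal (int x) \<partial>M)"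
    have \<Delta>m: "\<Delta> \<in> borel_measurable M" unfolding \<Delta>_def[abs_def] using tt(1) by measurable
    have \<Delta>b: "0 \<le> \<Delta> x" "\<Delta> x \<le> t" for x
    proof -
      show "0 \<le> \<Delta> x" by (simp add: \<Delta>_def)
      have "\<bar>trunc t h x - trunc t h y\<bar> \<le> 1" using tt(2)[of x] tt(2)[of y] by linarith
      then have "t * \<bar>trunc t h x - trunc t h y\<bar> \<le> t" using t by (simp add: mult_left_le)
      then show "\<Delta> x \<le> t" using t by (simp add: \<Delta>_def right_diff_distrib[symmetric] abs_mult)
    qed
    define E where "E = (LINT x:B|M. \<Delta> x powr p)"
    have Ee: "(\<integral>\<^sup>+x\<in>B. ennreal (\<Delta> x powr p) \<partial>M) = ennreal E"
      unfolding E_def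
    proof (rule nn_integral_bounded[OF tt fm])
      show "(\<lambda>x. \<Delta> x powr p) \<in> borel_measurable M" using \<Delta>m by measurable
      show "\<Delta> x powr p \<le> t powr p" for x using \<Delta>b[of x] p by (intro powr_mono2) auto
    qed simp
    have E0: "0 \<le> E"
      unfolding E_def set_lebesgue_integral_def by (intro integral_nonneg_AE) auto
    define F where "F = t * \<bar>trunc t h y - avg M B (trunc t h)\<bar>"
    have "F powr p \<le> E / m"
    proof (rule jensen[OF p Bs m \<Delta>m \<Delta>b(1) E0])
      show "0 \<le> F" using t by (simp add: F_def)
      show "ennreal (F * m) \<le> (\<integral>\<^sup>+x\<in>B. ennreal (\<Delta> x) \<partial>M)"
        using deviation_le[OF tt fm, of t y] t by (simp add: F_def m_def \<Delta>_def)
    qed (simp add: Ee)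
    then have "F powr p * (v y * G) \<le> E / m * (v y * G)" using v[of y] G by (intro mult_right_mono) auto
    also have "\<dots> = (k / m) * (v y * G / k * E)" using k by simp
    finally have "ennreal (F powr p * (v y * G)) \<le> ennreal (k / m) * (ennreal (v y * G / k) * ennreal E)"
      using k m v[of y] G E0 by (simp add: ennreal_mult'[symmetric] ennreal_leI)
    also have "ennreal (v y * G / k) * ennreal E \<le> e"
    proof -
      have "ennreal (v y * G / k) * ennreal E = (\<integral>\<^sup>+x. ennreal (v y * G / k) * (ennreal (\<Delta> x powr p) * indicator B x) \<partial>M)"
        unfolding Ee[symmetric] using Bs \<Delta>m
        by (intro nn_integral_cmult[symmetric] borel_measurable_times borel_measurable_indicator) auto
      also have "\<dots> \<le> e"
        unfolding e_def
      proof (rule nn_integral_mono)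
        fix x
        show "ennreal (v y * G / k) * (ennreal (\<Delta> x powr p) * indicator B x) \<le> ennreal (int x) * indicator (\<Omega> \<inter> ball y (\<tau> * bdist \<Omega> y)) x"
        proof (cases "x \<in> B")
          case True
          have "v y * G / k * \<Delta> x powr p \<le> int x" using pt[OF True] k by (simp add: field_simps)
          then have "ennreal (v y * G / k) * ennreal (\<Delta> x powr p) \<le> ennreal (int x)"
            using v[of y] G k by (simp add: ennreal_mult'[symmetric] ennreal_leI)
          moreover have "x \<in> \<Omega> \<inter> ball y (\<tau> * bdist \<Omega> y)" using True Bsub by blast
          ultimately show ?thesis using True by (simp only: indicator_simps mult_1_right)
        qed simp
      qed
      finally show ?thesis .
    qed
    finally have "ennreal (F powr p * (v y * G)) \<le> ennreal (k / m) * e" by (simp add: mult_left_mono)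
    moreover have "k / m = C2 * L * 2 powr (s * p) * u powr (s * p)" using m u by (simp add: k_def powr_mult)
    ultimately show "ennreal ((t * \<bar>trunc t h y - avg M (ball z u) (trunc t h)\<bar>) powr p * v y * (bdist \<Omega> z powr (\<gamma> * p) * \<phi> (bdist \<Omega> z) powr (p / q)))
      \<le> ennreal (C2 * L * 2 powr (s * p) * u powr (s * p)) *
        (\<integral>\<^sup>+x\<in>\<Omega> \<inter> ball y (\<tau> * bdist \<Omega> y). ennreal (\<bar>t * trunc t h x - t * trunc t h y\<bar> powr p /
            (measure M (ball y (dist x y)) * dist x y powr (s * p)) * (v_Phi \<Omega> \<Phi> (\<gamma> * p) x y * v y)) \<partial>M)"
      by (simp add: F_def B_def G_def d_def e_def int_def \<Delta>_def mult.assoc)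
  qed
qed

section \<open>Assembly of the fractional and the gradient estimate\<close>

lemma nn_integral_\<nu>:
  assumes W_eq: "W = density M (\<lambda>x. ennreal (w x))" and w [measurable]: "w \<in> borel_measurable M" and w0: "\<And>x. 0 \<le> w x"
    and F: "F \<in> borel_measurable (restrict_space M \<Omega>)" "\<And>x. 0 \<le> F x"
  shows "(\<integral>\<^sup>+x\<in>\<Omega>. ennreal (F x) \<partial>\<nu>) = (\<integral>\<^sup>+x\<in>\<Omega>. ennreal (F x * (w_phi \<Omega> \<phi> x * w x)) \<partial>M)"
proof -
  define F' where "F' x = (if x \<in> \<Omega> then F x else 0)" for x
  have \<Omega>M [measurable]: "\<Omega> \<in> sets M" using \<Omega>(1) sets_M by simp
  have F'M [measurable]: "F' \<in> borel_measurable M"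
    unfolding F'_def[abs_def] using F(1) \<Omega>M
    by (subst measurable_If_restrict_space_iff[where P = "\<lambda>x. x \<in> \<Omega>"]) (auto simp: ball_doublingD(2)[OF M])
  have \<phi>M [measurable]: "(\<lambda>x. \<phi>p (bdist \<Omega> x)) \<in> borel_measurable M"
    using \<phi>p_measurable unfolding measurable_cong_sets[OF sets_M refl] .
  have \<nu>_eq: "\<nu> = density M (\<lambda>x. ennreal (w x) * (indicator \<Omega> x * ennreal (\<phi>p (bdist \<Omega> x))))"
  proof -
    let ?g = "\<lambda>x. indicator \<Omega> x * ennreal (\<phi>p (bdist \<Omega> x))"
    have "\<nu> = density W ?g" by (rule \<nu>_def)
    also have "\<dots> = density (density M (\<lambda>x. ennreal (w x))) ?g" by (rule arg_cong[OF W_eq])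
    also have "\<dots> = density M (\<lambda>x. ennreal (w x) * ?g x)" by (rule density_density_eq) measurable
    finally show ?thesis .
  qed
  have "(\<integral>\<^sup>+x\<in>\<Omega>. ennreal (F x) \<partial>\<nu>) = (\<integral>\<^sup>+x. ennreal (F' x) * indicator \<Omega> x \<partial>\<nu>)"
    by (intro nn_integral_cong) (auto simp: F'_def split: split_indicator)
  also have "\<dots> = (\<integral>\<^sup>+x. (ennreal (w x) * (indicator \<Omega> x * ennreal (\<phi>p (bdist \<Omega> x)))) * (ennreal (F' x) * indicator \<Omega> x) \<partial>M)"
    unfolding \<nu>_eq by (rule nn_integral_density) measurable
  also have "\<dots> = (\<integral>\<^sup>+x\<in>\<Omega>. ennreal (F x * (w_phi \<Omega> \<phi> x * w x)) \<partial>M)"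
  proof (rule nn_integral_cong)
    fix x
    show "(ennreal (w x) * (indicator \<Omega> x * ennreal (\<phi>p (bdist \<Omega> x)))) * (ennreal (F' x) * indicator \<Omega> x)
      = ennreal (F x * (w_phi \<Omega> \<phi> x * w x)) * indicator \<Omega> x"
    proof (cases "x \<in> \<Omega>")
      case True
      then have d: "0 < bdist \<Omega> x" by (rule bdist_pos)
      then show ?thesis
        using True F(2)[of x] w0[of x] \<phi>(1)[OF d]
        by (simp add: F'_def \<phi>p_def w_phi_def ennreal_mult'[symmetric] mult_ac)
    qed simp
  qed
  finally show ?thesis .
qed

lemma norm_bound:
  assumes W_eq: "W = density M (\<lambda>x. ennreal (w x))" and w: "w \<in> borel_measurable M" "\<And>x. 0 \<le> w x"
    and f: "f \<in> borel_measurable (restrict_space M \<Omega>)" and q: "0 < q" and X: "0 \<le> X"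
    and \<beta>: "(\<integral>\<^sup>+y\<in>\<Omega>. ennreal (\<bar>f y - \<beta>\<bar> powr q) \<partial>\<nu>) \<le> ennreal X"
  shows "(INF c. weighted_Lnorm M \<Omega> (\<lambda>x. w_phi \<Omega> \<phi> x * w x) q (\<lambda>x. f x - c)) \<le> ennreal (X powr (1 / q))"
proof -
  have fm: "(\<lambda>y. \<bar>f y - \<beta>\<bar> powr q) \<in> borel_measurable (restrict_space M \<Omega>)" using f by measurable
  have "weighted_Lnorm M \<Omega> (\<lambda>x. w_phi \<Omega> \<phi> x * w x) q (\<lambda>x. f x - \<beta>) = ennreal_powr (\<integral>\<^sup>+y\<in>\<Omega>. ennreal (\<bar>f y - \<beta>\<bar> powr q) \<partial>\<nu>) (1 / q)"
    unfolding weighted_Lnorm_def by (subst nn_integral_\<nu>[OF W_eq w fm]) auto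
  also have "\<dots> \<le> ennreal_powr (ennreal X) (1 / q)" using \<beta> q by (intro ennreal_powr_mono) auto
  also have "\<dots> = ennreal (X powr (1 / q))" using X q by (intro ennreal_powr_real) auto
  finally show ?thesis by (rule INF_lower2[OF UNIV_I])
qed

text \<open>Infinite energy makes the right side infinite, so the oscillation estimate is asked for
  finite \<open>E\<close> only. Taking the root \<open>1 / q\<close> turns the power
  \<open>q / p\<close> of the energy into the \<open>1 / p\<close> of the seminorm.\<close>

lemma seminorm_conclusion:
  assumes W_eq: "W = density M (\<lambda>x. ennreal (w x))" and w: "w \<in> borel_measurable M" "\<And>x. 0 \<le> w x"
    and q: "0 < q" and p: "1 \<le> p" and K: "0 < K"
    and b: "\<And>Et. E = ennreal Et \<Longrightarrow> 0 \<le> Et \<Longrightarrow> \<exists>b. (\<integral>\<^sup>+y\<in>\<Omega>. ennreal (\<bar>f y - b\<bar> powr q) \<partial>\<nu>) \<le> ennreal (K * Et powr (q / p))"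
    and f: "f \<in> borel_measurable (restrict_space M \<Omega>)"
  shows "(INF c. weighted_Lnorm M \<Omega> (\<lambda>x. w_phi \<Omega> \<phi> x * w x) q (\<lambda>x. f x - c)) \<le> ennreal (K powr (1 / q)) * ennreal_powr E (1 / p)"
proof (cases E)
  case (real Et)
  obtain b where b': "(\<integral>\<^sup>+y\<in>\<Omega>. ennreal (\<bar>f y - b\<bar> powr q) \<partial>\<nu>) \<le> ennreal (K * Et powr (q / p))"
    using b[OF real(2,1)] by blast
  have "(INF c. weighted_Lnorm M \<Omega> (\<lambda>x. w_phi \<Omega> \<phi> x * w x) q (\<lambda>x. f x - c)) \<le> ennreal ((K * Et powr (q / p)) powr (1 / q))"
    by (rule norm_bound[OF W_eq w f q _ b']) (use K in auto)
  also have "(K * Et powr (q / p)) powr (1 / q) = K powr (1 / q) * Et powr (1 / p)"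
    using K q by (simp add: powr_mult powr_powr)
  also have "ennreal (K powr (1 / q) * Et powr (1 / p)) = ennreal (K powr (1 / q)) * ennreal_powr E (1 / p)"
    using real p K by (simp add: ennreal_powr_real ennreal_mult')
  finally show ?thesis .
next
  case top
  then have "ennreal_powr E (1 / p) = top" using p by (simp add: ennreal_powr_def)
  then show ?thesis using K by (simp add: ennreal_mult_eq_top_iff)
qed

text \<open>The energy density of a truncation at \<open>y\<close> is the inner integral of the
  kernel. The bound is for \<open>v_Phi\<close>, the stronger version, since \<open>v_Phi\<close> is
  at most \<open>w_Phi\<close> at \<open>y\<close>.\<close>

lemma fractional_estimate:
  assumes W_eq: "W = density M (\<lambda>x. ennreal (w x))"
    and w: "w \<in> borel_measurable M" "\<And>x. 0 \<le> w x" and v: "v \<in> borel_measurable M" "\<And>x. 0 \<le> v x"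
    and p: "1 \<le> p" and pq: "p \<le> q" and rr: "1 < rr" and cls: "weight_pair_class M \<Omega> (s - \<gamma>) rr q p w v"
    and \<gamma>: "0 \<le> \<gamma>" and s: "0 < s" and a4: "a \<le> \<tau> / 4" and \<Lambda>1: "1 \<le> \<Lambda>"
    and \<Phi>: "\<And>t. 0 < t \<Longrightarrow> \<Phi> t = \<phi> t powr (p / q)"
  obtains K where "0 < K" "\<And>f. f \<in> borel_measurable (restrict_space M \<Omega>) \<Longrightarrow>
      (INF c. weighted_Lnorm M \<Omega> (\<lambda>x. w_phi \<Omega> \<phi> x * w x) q (\<lambda>x. f x - c))
        \<le> ennreal K * frac_seminorm M s p \<tau> \<Omega> (\<lambda>x y. v_Phi \<Omega> \<Phi> (\<gamma> * p) x y * v y) f"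
proof -
  have q: "0 < q" using p pq by linarith
  define int where "int f x y = \<bar>f x - f y\<bar> powr p / (measure M (ball y (dist x y)) * dist x y powr (s * p)) * (v_Phi \<Omega> \<Phi> (\<gamma> * p) x y * v y)" for f x y
  define S where "S y = \<Omega> \<inter> ball y (\<tau> * bdist \<Omega> y)" for y
  define e where "e h t y = (\<integral>\<^sup>+x\<in>S y. ennreal (int (\<lambda>x. t * trunc t h x) x y) \<partial>M)" for h t y
  show thesis
  proof (rule frac_energy_ge[OF \<gamma> p q s a4 \<Phi> v(2)])
    fix C1 :: real assume C1: "0 < C1" and fe0:
      "\<And>z u h t y. z \<in> \<Omega> \<Longrightarrow> 0 < u \<Longrightarrow> u \<le> a * bdist \<Omega> z \<Longrightarrow> h \<in> borel_measurable borel \<Longrightarrow> 0 < t \<Longrightarrow> y \<in> ball z u \<Longrightarrow>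
        ennreal ((t * \<bar>trunc t h y - avg M (ball z u) (trunc t h)\<bar>) powr p * v y * (bdist \<Omega> z powr (\<gamma> * p) * \<phi> (bdist \<Omega> z) powr (p / q)))
        \<le> ennreal (C1 * u powr (s * p)) *
          (\<integral>\<^sup>+x\<in>\<Omega> \<inter> ball y (\<tau> * bdist \<Omega> y). ennreal (\<bar>t * trunc t h x - t * trunc t h y\<bar> powr p /
              (measure M (ball y (dist x y)) * dist x y powr (s * p)) * (v_Phi \<Omega> \<Phi> (\<gamma> * p) x y * v y)) \<partial>M)"
    have fe: "ennreal ((t * \<bar>trunc t h y - avg M (ball z u) (trunc t h)\<bar>) powr p * v y * (bdist \<Omega> z powr (\<gamma> * p) * \<phi> (bdist \<Omega> z) powr (p / q)))
        \<le> ennreal (C1 * u powr (s * p)) * e h t y"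
      if "z \<in> \<Omega>" "0 < u" "u \<le> a * bdist \<Omega> z" "h \<in> borel_measurable borel" "0 < t" "y \<in> ball z u" for z u h t y
      unfolding e_def int_def S_def by (rule fe0[OF that])
    have \<kappa>: "1 \<le> q / p" using p pq by simp
    have la: "1 * a \<le> c0" using a by simp
    show thesis
    proof (rule energy_bound[OF W_eq w v p q rr cls \<gamma> order.refl la C1])
      fix K1 :: real assume K1: "0 \<le> K1" and eb:
        "\<And>z u f F e. z \<in> \<Omega> \<Longrightarrow> 0 < u \<Longrightarrow> u \<le> a * bdist \<Omega> z \<Longrightarrow> f \<in> borel_measurable M \<Longrightarrow> (\<And>x. 0 \<le> f x) \<Longrightarrow> 0 \<le> F \<Longrightarrow>
          ennreal (F * measure M (ball z (1 * u))) \<le> (\<integral>\<^sup>+x\<in>ball z (1 * u). ennreal (f x) \<partial>M) \<Longrightarrow>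
          (\<And>y. y \<in> ball z (1 * u) \<Longrightarrow> ennreal (f y powr p * v y * (bdist \<Omega> z powr (\<gamma> * p) * \<phi> (bdist \<Omega> z) powr (p / q)))
              \<le> ennreal (C1 * u powr (s * p)) * e y) \<Longrightarrow>
          (\<integral>\<^sup>+y\<in>ball z (1 * u). e y \<partial>M) < \<infinity> \<Longrightarrow>
          F powr q * measure \<nu> (ball z (5 * (\<Lambda> * u))) \<le> K1 * enn2real (\<integral>\<^sup>+y\<in>ball z (1 * u). e y \<partial>M) powr (q / p)"
      show thesis
      proof (rule oscillation_to_norm[OF \<kappa> q \<Lambda>1 la K1])
        fix K :: real assume K: "0 < K" and main: "\<And>f e Et. f \<in> borel_measurable (restrict_space M \<Omega>) \<Longrightarrow> 0 \<le> Et \<Longrightarrow>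
          \<forall>h \<sigma> b t z r. h = (\<lambda>x. if x \<in> \<Omega> then \<sigma> * (f x - b) else 0) \<and> \<sigma> \<in> {- 1, 1} \<and> h \<in> borel_measurable borel \<and>
              0 < t \<and> z \<in> \<Omega> \<and> 0 < r \<and> r \<le> a * bdist \<Omega> z \<and> (\<integral>\<^sup>+y\<in>\<Omega>. e h t y \<partial>M) < \<infinity> \<longrightarrow>
            (t * osc M (trunc t h) (ball z r)) powr q * measure \<nu> (ball z (5 * (\<Lambda> * r)))
              \<le> K1 * enn2real (\<integral>\<^sup>+y\<in>ball z (1 * r). e h t y \<partial>M) powr (q / p) \<Longrightarrow>
          \<forall>h \<sigma> b t0 m. h = (\<lambda>x. if x \<in> \<Omega> then \<sigma> * (f x - b) else 0) \<and> \<sigma> \<in> {- 1, 1} \<and> 0 < t0 \<longrightarrow>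
            (\<Sum>k<m. \<integral>\<^sup>+y\<in>\<Omega>. e h (t0 * 2 ^ k) y \<partial>M) \<le> ennreal Et \<Longrightarrow>
          \<exists>b. (\<integral>\<^sup>+y\<in>\<Omega>. ennreal (\<bar>f y - b\<bar> powr q) \<partial>\<nu>) \<le> ennreal (K * Et powr (q / p))"
        show thesis
        proof (rule that[of "K powr (1 / q)"])
          show "0 < K powr (1 / q)" using K by simp
          fix f :: "'a \<Rightarrow> real" assume f: "f \<in> borel_measurable (restrict_space M \<Omega>)"
          define E where "E = (\<integral>\<^sup>+y\<in>\<Omega>. (\<integral>\<^sup>+x\<in>S y. ennreal (int f x y) \<partial>M) \<partial>M)"
          have "frac_seminorm M s p \<tau> \<Omega> (\<lambda>x y. v_Phi \<Omega> \<Phi> (\<gamma> * p) x y * v y) f = ennreal_powr E (1 / p)"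
            unfolding frac_seminorm_def E_def int_def S_def ..
          moreover have "(INF c. weighted_Lnorm M \<Omega> (\<lambda>x. w_phi \<Omega> \<phi> x * w x) q (\<lambda>x. f x - c)) \<le> ennreal (K powr (1 / q)) * ennreal_powr E (1 / p)"
          proof (rule seminorm_conclusion[OF W_eq w q p K _ f])
            fix Et assume E: "E = ennreal Et" and Et: "0 \<le> Et"
            show "\<exists>b. (\<integral>\<^sup>+y\<in>\<Omega>. ennreal (\<bar>f y - b\<bar> powr q) \<partial>\<nu>) \<le> ennreal (K * Et powr (q / p))"
            proof (rule main[where e = e, OF f Et]; intro allI impI; elim conjE)
              fix h :: "'a \<Rightarrow> real" and \<sigma> b t r :: real and z
              assume h: "h \<in> borel_measurable borel" and t: "0 < t" and z: "z \<in> \<Omega>" and r: "0 < r" "r \<le> a * bdist \<Omega> z"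
                and fin: "(\<integral>\<^sup>+y\<in>\<Omega>. e h t y \<partial>M) < \<infinity>"
              define B where "B = ball z r"
              have fm: "B \<in> fmeasurable M" "0 < measure M B" using ball_fm pos r(1) by (auto simp: B_def)
              note tt = trunc_test[OF h t]
              have "a * bdist \<Omega> z \<le> c0 * bdist \<Omega> z" using a bdist_pos[OF z] by (intro mult_right_mono) auto
              then have B\<Omega>: "B \<subseteq> \<Omega>" using c0(2)[OF z] r subset_ball[of r "c0 * bdist \<Omega> z" z] by (auto simp: B_def)
              show "(t * osc M (trunc t h) (ball z r)) powr q * measure \<nu> (ball z (5 * (\<Lambda> * r)))
                \<le> K1 * enn2real (\<integral>\<^sup>+y\<in>ball z (1 * r). e h t y \<partial>M) powr (q / p)"
              proof (rule eb[OF z r, where f = "\<lambda>y. t * \<bar>trunc t h y - avg M B (trunc t h)\<bar>"])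
                show "(\<lambda>y. t * \<bar>trunc t h y - avg M B (trunc t h)\<bar>) \<in> borel_measurable M" using tt(1) by measurable
                show "0 \<le> t * \<bar>trunc t h y - avg M B (trunc t h)\<bar>" for y using t by simp
                have "0 \<le> osc M (trunc t h) B * measure M B"
                  unfolding osc_eq[OF tt fm] set_lebesgue_integral_def by (intro integral_nonneg_AE) auto
                then show "0 \<le> t * osc M (trunc t h) (ball z r)" using fm(2) t by (simp add: zero_le_mult_iff B_def)
                show "ennreal (t * osc M (trunc t h) (ball z r) * measure M (ball z (1 * r)))
                  \<le> (\<integral>\<^sup>+y\<in>ball z (1 * r). ennreal (t * \<bar>trunc t h y - avg M B (trunc t h)\<bar>) \<partial>M)"
                  using nn_integral_osc[OF tt fm, of t] t by (simp add: B_def)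
                show "ennreal ((t * \<bar>trunc t h y - avg M B (trunc t h)\<bar>) powr p * v y * (bdist \<Omega> z powr (\<gamma> * p) * \<phi> (bdist \<Omega> z) powr (p / q)))
                  \<le> ennreal (C1 * r powr (s * p)) * e h t y" if "y \<in> ball z (1 * r)" for y
                  using fe[OF z r h t, of y] that by (simp add: B_def)
                have "(\<integral>\<^sup>+y\<in>ball z (1 * r). e h t y \<partial>M) \<le> (\<integral>\<^sup>+y\<in>\<Omega>. e h t y \<partial>M)"
                  using B\<Omega> by (intro nn_integral_mono) (auto simp: B_def split: split_indicator)
                then show "(\<integral>\<^sup>+y\<in>ball z (1 * r). e h t y \<partial>M) < \<infinity>" using fin by (rule le_less_trans)
              qed
            next
              fix h :: "'a \<Rightarrow> real" and \<sigma> b t0 :: real and m :: nat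
              assume h: "h = (\<lambda>x. if x \<in> \<Omega> then \<sigma> * (f x - b) else 0)" and \<sigma>: "\<sigma> \<in> {- 1, 1}" and t0: "0 < t0"
              have V: "0 \<le> v_Phi \<Omega> \<Phi> (\<gamma> * p) x y" if "x \<in> \<Omega>" "y \<in> \<Omega>" for x y
                using bdist_pos[OF that(1)] bdist_pos[OF that(2)] \<Phi> by (simp add: v_Phi_def w_Phi_def)
              \<comment> \<open>For fixed \<open>x\<close> and \<open>y\<close> the kernel is a
                common factor, so summing over the levels is the inequality for increments of
                truncations.\<close>
              have pt: "(\<Sum>k<m. ennreal (int (\<lambda>x. t0 * 2 ^ k * trunc (t0 * 2 ^ k) h x) x y)) \<le> ennreal (int f x y)"
                if xy: "x \<in> \<Omega>" "y \<in> \<Omega>" for x y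
              proof -
                define c where "c = v_Phi \<Omega> \<Phi> (\<gamma> * p) x y * v y / (measure M (ball y (dist x y)) * dist x y powr (s * p))"
                have c: "0 \<le> c" using V[OF xy] v(2)[of y] by (simp add: c_def)
                have int: "int g x y = \<bar>g x - g y\<bar> powr p * c" for g by (simp add: int_def c_def)
                have "(\<Sum>k<m. ennreal (int (\<lambda>x. t0 * 2 ^ k * trunc (t0 * 2 ^ k) h x) x y))
                  = ennreal ((\<Sum>k<m. \<bar>t0 * 2 ^ k * trunc (t0 * 2 ^ k) h x - t0 * 2 ^ k * trunc (t0 * 2 ^ k) h y\<bar> powr p) * c)"
                  unfolding int sum_distrib_right using c by (intro sum_ennreal) simp
                also have "\<dots> \<le> ennreal (\<bar>h x - h y\<bar> powr p * c)"
                  using c by (intro ennreal_leI mult_right_mono sum_trunc_diff_powr t0 p)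
                also have "\<bar>h x - h y\<bar> = \<bar>f x - f y\<bar>" using xy \<sigma> by (auto simp: h)
                finally show ?thesis by (simp add: int)
              qed
              \<comment> \<open>Superadditivity is applied to the outer integral here and to the
                inner one below, since the inner integral may fail to be measurable in
                \<open>y\<close>.\<close>
              have "(\<Sum>k<m. \<integral>\<^sup>+y\<in>\<Omega>. e h (t0 * 2 ^ k) y \<partial>M) \<le> (\<integral>\<^sup>+y. (\<Sum>k<m. e h (t0 * 2 ^ k) y * indicator \<Omega> y) \<partial>M)"
                by (rule nn_integral_superadd_sum) simp
              also have "\<dots> \<le> E"
                unfolding E_def
              proof (rule nn_integral_mono)
                fix y
                show "(\<Sum>k<m. e h (t0 * 2 ^ k) y * indicator \<Omega> y) \<le> (\<integral>\<^sup>+x\<in>S y. ennreal (int f x y) \<partial>M) * indicator \<Omega> y"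
                proof (cases "y \<in> \<Omega>")
                  case True
                  have "(\<Sum>k<m. e h (t0 * 2 ^ k) y) \<le> (\<integral>\<^sup>+x. (\<Sum>k<m. ennreal (int (\<lambda>x. t0 * 2 ^ k * trunc (t0 * 2 ^ k) h x) x y) * indicator (S y) x) \<partial>M)"
                    unfolding e_def by (rule nn_integral_superadd_sum) simp
                  also have "\<dots> \<le> (\<integral>\<^sup>+x\<in>S y. ennreal (int f x y) \<partial>M)"
                  proof (rule nn_integral_mono)
                    fix x
                    show "(\<Sum>k<m. ennreal (int (\<lambda>x. t0 * 2 ^ k * trunc (t0 * 2 ^ k) h x) x y) * indicator (S y) x)
                      \<le> ennreal (int f x y) * indicator (S y) x"
                      using pt[OF _ True, of x] by (cases "x \<in> S y") (simp_all add: S_def)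
                  qed
                  finally show ?thesis using True by simp
                qed simp
              qed
              finally show "(\<Sum>k<m. \<integral>\<^sup>+y\<in>\<Omega>. e h (t0 * 2 ^ k) y \<partial>M) \<le> ennreal Et" by (simp add: E)
            qed
          qed
          ultimately show "(INF c. weighted_Lnorm M \<Omega> (\<lambda>x. w_phi \<Omega> \<phi> x * w x) q (\<lambda>x. f x - c))
            \<le> ennreal (K powr (1 / q)) * frac_seminorm M s p \<tau> \<Omega> (\<lambda>x y. v_Phi \<Omega> \<Phi> (\<gamma> * p) x y * v y) f" by simp
        qed
      qed
    qed
qed assumption+
qed

text \<open>The truncated gradients of different dyadic levels live on the disjoint sets {t < h
  \<le> 2t}, so their energy densities add up to at most that of \<open>g\<close>. The Poincare
  inequality places the gradient on the \<open>lam'\<close>-dilated ball; for this reason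
  \<open>lam' * a\<close> is bounded by \<open>c0\<close> and by 1/2.\<close>

lemma gradient_estimate:
  assumes W_eq: "W = density M (\<lambda>x. ennreal (w x))"
    and w: "w \<in> borel_measurable M" "\<And>x. 0 \<le> w x" and v: "v \<in> borel_measurable M" "\<And>x. 0 \<le> v x"
    and p: "1 \<le> p" and pq: "p \<le> q" and rr: "1 < rr" and cls: "weight_pair_class M \<Omega> (1 - \<gamma>) rr q p w v"
    and \<gamma>: "0 \<le> \<gamma>" and l: "1 \<le> lam'" "lam' * a \<le> c0" "lam' * a \<le> 1/2" "lam' \<le> \<Lambda>" and C': "0 < C'"
    and \<Phi>: "\<And>t. 0 < t \<Longrightarrow> \<Phi> t = \<phi> t powr (p / q)"
  obtains K where "0 < K" "\<And>f g. f \<in> borel_measurable (restrict_space M \<Omega>) \<Longrightarrow> g \<in> borel_measurable M \<Longrightarrow> (\<And>x. 0 \<le> g x) \<Longrightarrow>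
      truncation_property M \<Omega> lam' C' f g \<Longrightarrow>
      (INF c. weighted_Lnorm M \<Omega> (\<lambda>x. w_phi \<Omega> \<phi> x * w x) q (\<lambda>x. f x - c))
        \<le> ennreal K * weighted_Lnorm M \<Omega> (\<lambda>y. w_Phi \<Omega> \<Phi> (\<gamma> * p) y * v y) p g"
proof -
  have q: "0 < q" using p pq by linarith
  define C1 where "C1 = C' powr p * (2 powr (\<gamma> * p) * D\<phi> powr (p / q))"
  have C1: "0 < C1" using C' D\<phi>_ge by (simp add: C1_def)
  have \<kappa>: "1 \<le> q / p" using p pq by simp
  show thesis
  proof (rule energy_bound[OF W_eq w v p q rr cls \<gamma> l(1,2) C1])
    fix K1 :: real assume K1: "0 \<le> K1" and eb:
      "\<And>z u f F e. z \<in> \<Omega> \<Longrightarrow> 0 < u \<Longrightarrow> u \<le> a * bdist \<Omega> z \<Longrightarrow> f \<in> borel_measurable M \<Longrightarrow> (\<And>x. 0 \<le> f x) \<Longrightarrow> 0 \<le> F \<Longrightarrow>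
        ennreal (F * measure M (ball z (lam' * u))) \<le> (\<integral>\<^sup>+x\<in>ball z (lam' * u). ennreal (f x) \<partial>M) \<Longrightarrow>
        (\<And>y. y \<in> ball z (lam' * u) \<Longrightarrow> ennreal (f y powr p * v y * (bdist \<Omega> z powr (\<gamma> * p) * \<phi> (bdist \<Omega> z) powr (p / q)))
            \<le> ennreal (C1 * u powr (1 * p)) * e y) \<Longrightarrow>
        (\<integral>\<^sup>+y\<in>ball z (lam' * u). e y \<partial>M) < \<infinity> \<Longrightarrow>
        F powr q * measure \<nu> (ball z (5 * (\<Lambda> * u))) \<le> K1 * enn2real (\<integral>\<^sup>+y\<in>ball z (lam' * u). e y \<partial>M) powr (q / p)"
    define e where "e g h t y = ennreal ((g y * indicator {x. t < h x \<and> h x \<le> 2 * t} y) powr p * (w_Phi \<Omega> \<Phi> (\<gamma> * p) y * v y))"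
      for g :: "'a \<Rightarrow> real" and h :: "'a \<Rightarrow> real" and t :: real and y
    show thesis
    proof (rule oscillation_to_norm[OF \<kappa> q l(4,2) K1])
      fix K :: real assume K: "0 < K" and main: "\<And>f e Et. f \<in> borel_measurable (restrict_space M \<Omega>) \<Longrightarrow> 0 \<le> Et \<Longrightarrow>
        \<forall>h \<sigma> b t z r. h = (\<lambda>x. if x \<in> \<Omega> then \<sigma> * (f x - b) else 0) \<and> \<sigma> \<in> {- 1, 1} \<and> h \<in> borel_measurable borel \<and>
            0 < t \<and> z \<in> \<Omega> \<and> 0 < r \<and> r \<le> a * bdist \<Omega> z \<and> (\<integral>\<^sup>+y\<in>\<Omega>. e h t y \<partial>M) < \<infinity> \<longrightarrow>
          (t * osc M (trunc t h) (ball z r)) powr q * measure \<nu> (ball z (5 * (\<Lambda> * r)))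
            \<le> K1 * enn2real (\<integral>\<^sup>+y\<in>ball z (lam' * r). e h t y \<partial>M) powr (q / p) \<Longrightarrow>
        \<forall>h \<sigma> b t0 m. h = (\<lambda>x. if x \<in> \<Omega> then \<sigma> * (f x - b) else 0) \<and> \<sigma> \<in> {- 1, 1} \<and> 0 < t0 \<longrightarrow>
          (\<Sum>k<m. \<integral>\<^sup>+y\<in>\<Omega>. e h (t0 * 2 ^ k) y \<partial>M) \<le> ennreal Et \<Longrightarrow>
        \<exists>b. (\<integral>\<^sup>+y\<in>\<Omega>. ennreal (\<bar>f y - b\<bar> powr q) \<partial>\<nu>) \<le> ennreal (K * Et powr (q / p))"
      show thesis
      proof (rule that[of "K powr (1 / q)"])
        show "0 < K powr (1 / q)" using K by simp
        fix f g :: "'a \<Rightarrow> real" assume f: "f \<in> borel_measurable (restrict_space M \<Omega>)" and g: "g \<in> borel_measurable M" "\<And>x. 0 \<le> g x"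
          and tp: "truncation_property M \<Omega> lam' C' f g"
        have wP: "0 \<le> w_Phi \<Omega> \<Phi> (\<gamma> * p) y" if "y \<in> \<Omega>" for y
          using bdist_pos[OF that] \<Phi> by (simp add: w_Phi_def)
        define E where "E = (\<integral>\<^sup>+y\<in>\<Omega>. ennreal (\<bar>g y\<bar> powr p * (w_Phi \<Omega> \<Phi> (\<gamma> * p) y * v y)) \<partial>M)"
        have "(INF c. weighted_Lnorm M \<Omega> (\<lambda>x. w_phi \<Omega> \<phi> x * w x) q (\<lambda>x. f x - c)) \<le> ennreal (K powr (1 / q)) * ennreal_powr E (1 / p)"
        proof (rule seminorm_conclusion[OF W_eq w q p K _ f])
          fix Et assume E: "E = ennreal Et" and Et: "0 \<le> Et"
          show "\<exists>b. (\<integral>\<^sup>+y\<in>\<Omega>. ennreal (\<bar>f y - b\<bar> powr q) \<partial>\<nu>) \<le> ennreal (K * Et powr (q / p))"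
          proof (rule main[where e = "e g", OF f Et]; intro allI impI; elim conjE)
            fix h :: "'a \<Rightarrow> real" and \<sigma> b t r :: real and z
            assume h: "h = (\<lambda>x. if x \<in> \<Omega> then \<sigma> * (f x - b) else 0)" "\<sigma> \<in> {- 1, 1}" "h \<in> borel_measurable borel"
              and t: "0 < t" and z: "z \<in> \<Omega>" and r: "0 < r" "r \<le> a * bdist \<Omega> z"
              and fin: "(\<integral>\<^sup>+y\<in>\<Omega>. e g h t y \<partial>M) < \<infinity>"
            define d where "d = bdist \<Omega> z"
            have d: "0 < d" unfolding d_def by (rule bdist_pos[OF z])
            have "lam' * r \<le> (lam' * a) * d" using r(2) l(1) by (simp add: d_def mult.assoc mult_left_mono)
            moreover have "(lam' * a) * d \<le> c0 * d" "(lam' * a) * d \<le> 1/2 * d" using l(2,3) d by (auto intro!: mult_right_mono)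
            ultimately have lr: "lam' * r \<le> c0 * d" "lam' * r \<le> d / 2" by auto
            have sub: "ball z (lam' * r) \<subseteq> \<Omega>" using c0(2)[OF z] subset_ball[OF lr(1), of z] by (auto simp: d_def)
            define gt where "gt y = g y * indicator {x. t < h x \<and> h x \<le> 2 * t} y" for y
            have gt0: "0 \<le> gt y" for y using g(2)[of y] by (simp add: gt_def)
            show "(t * osc M (trunc t h) (ball z r)) powr q * measure \<nu> (ball z (5 * (\<Lambda> * r)))
              \<le> K1 * enn2real (\<integral>\<^sup>+y\<in>ball z (lam' * r). e g h t y \<partial>M) powr (q / p)"
            proof (rule eb[OF z r, where f = "\<lambda>y. C' * r * gt y"])
              have hM: "h \<in> borel_measurable M" using h(3) unfolding measurable_cong_sets[OF sets_M refl] .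
              have "{x \<in> space M. t < h x \<and> h x \<le> 2 * t} \<in> sets M" using hM by measurable
              then have [measurable]: "{x. t < h x \<and> h x \<le> 2 * t} \<in> sets M" by (simp add: ball_doublingD(2)[OF M])
              show "(\<lambda>y. C' * r * gt y) \<in> borel_measurable M" unfolding gt_def using g(1) by measurable
              show "0 \<le> C' * r * gt y" for y using C' r(1) gt0[of y] by simp
              have tt: "trunc t h \<in> borel_measurable M" "\<And>x. 0 \<le> trunc t h x \<and> trunc t h x \<le> 1" by (rule trunc_test[OF h(3) t])+
              have "0 \<le> osc M (trunc t h) (ball z r) * measure M (ball z r)"
                unfolding osc_eq[OF tt ball_fm pos[OF r(1)]] set_lebesgue_integral_def by (intro integral_nonneg_AE) auto
              then show "0 \<le> t * osc M (trunc t h) (ball z r)" using pos[OF r(1), of z] t by (simp add: zero_le_mult_iff)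
              show "ennreal (t * osc M (trunc t h) (ball z r) * measure M (ball z (lam' * r)))
                \<le> (\<integral>\<^sup>+y\<in>ball z (lam' * r). ennreal (C' * r * gt y) \<partial>M)"
                unfolding gt_def by (rule gradient_oscillation[OF tp g(2,1) C' l(1) h t r(1) sub])
              show "ennreal ((C' * r * gt y) powr p * v y * (bdist \<Omega> z powr (\<gamma> * p) * \<phi> (bdist \<Omega> z) powr (p / q)))
                \<le> ennreal (C1 * r powr (1 * p)) * e g h t y" if y: "y \<in> ball z (lam' * r)" for y
              proof -
                have y\<Omega>: "y \<in> \<Omega>" using y sub by blast
                have G: "bdist \<Omega> z powr (\<gamma> * p) * \<phi> (bdist \<Omega> z) powr (p / q) \<le> 2 powr (\<gamma> * p) * D\<phi> powr (p / q) * w_Phi \<Omega> \<Phi> (\<gamma> * p) y"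
                  using y lr(2) by (intro improving_weight_ge[OF \<gamma> p q z y\<Omega> _ _ \<Phi>, of "lam' * r"]) (auto simp: d_def)
                have "(C' * r * gt y) powr p * v y * (bdist \<Omega> z powr (\<gamma> * p) * \<phi> (bdist \<Omega> z) powr (p / q))
                  \<le> (C' * r * gt y) powr p * v y * (2 powr (\<gamma> * p) * D\<phi> powr (p / q) * w_Phi \<Omega> \<Phi> (\<gamma> * p) y)"
                  using G v(2)[of y] by (intro mult_left_mono) auto
                also have "\<dots> = (C1 * r powr (1 * p)) * (gt y powr p * (w_Phi \<Omega> \<Phi> (\<gamma> * p) y * v y))"
                  using C' r(1) gt0[of y] by (simp add: C1_def powr_mult mult_ac)
                finally have "ennreal ((C' * r * gt y) powr p * v y * (bdist \<Omega> z powr (\<gamma> * p) * \<phi> (bdist \<Omega> z) powr (p / q)))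
                  \<le> ennreal ((C1 * r powr (1 * p)) * (gt y powr p * (w_Phi \<Omega> \<Phi> (\<gamma> * p) y * v y)))" by (rule ennreal_leI)
                also have "\<dots> = ennreal (C1 * r powr (1 * p)) * e g h t y"
                  using C1 by (simp only: e_def gt_def ennreal_mult' mult_nonneg_nonneg less_imp_le powr_ge_zero)
                finally show ?thesis .
              qed
              have "(\<integral>\<^sup>+y\<in>ball z (lam' * r). e g h t y \<partial>M) \<le> (\<integral>\<^sup>+y\<in>\<Omega>. e g h t y \<partial>M)"
                using sub by (intro nn_integral_mono) (auto split: split_indicator)
              then show "(\<integral>\<^sup>+y\<in>ball z (lam' * r). e g h t y \<partial>M) < \<infinity>" using fin by (rule le_less_trans)
            qed
          next
            fix h :: "'a \<Rightarrow> real" and \<sigma> b t0 :: real and m :: nat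
            assume t0: "0 < t0"
            have pt: "(\<Sum>k<m. e g h (t0 * 2 ^ k) y) \<le> ennreal (\<bar>g y\<bar> powr p * (w_Phi \<Omega> \<Phi> (\<gamma> * p) y * v y))" if y: "y \<in> \<Omega>" for y
            proof -
              define A where "A k = {x. t0 * 2 ^ k < h x \<and> h x \<le> 2 * (t0 * 2 ^ k)}" for k :: nat
              define c where "c = w_Phi \<Omega> \<Phi> (\<gamma> * p) y * v y"
              have c: "0 \<le> c" using wP[OF y] v(2)[of y] by (simp add: c_def)
              have "disjoint_family_on A {..<m}"
                unfolding disjoint_family_on_def
              proof (intro ballI impI)
                fix i j :: nat assume "i \<noteq> j"
                have "A i \<inter> A j = {}" if "i < j" for i j
                proof -
                  have "(2 :: real) ^ Suc i \<le> 2 ^ j" using that by (intro power_increasing) auto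
                  then have "2 * (t0 * 2 ^ i) \<le> t0 * 2 ^ j" using t0 by simp
                  then show ?thesis unfolding A_def by fastforce
                qed
                then show "A i \<inter> A j = {}" using \<open>i \<noteq> j\<close> by (metis Int_commute nat_neq_iff)
              qed
              then have ind: "(\<Sum>k<m. indicator (A k) y :: real) = indicator (\<Union>k<m. A k) y"
                by (intro indicator_UN_disjoint[symmetric]) auto
              have "(g y * indicator (A k) y) powr p = \<bar>g y\<bar> powr p * indicator (A k) y" for k
                using g(2)[of y] by (simp add: indicator_def)
              then have "(\<Sum>k<m. e g h (t0 * 2 ^ k) y) = (\<Sum>k<m. ennreal (\<bar>g y\<bar> powr p * indicator (A k) y * c))"
                by (simp only: e_def A_def c_def)
              also have "\<dots> = ennreal (\<Sum>k<m. \<bar>g y\<bar> powr p * indicator (A k) y * c)"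
                using c by (intro sum_ennreal) simp
              also have "(\<Sum>k<m. \<bar>g y\<bar> powr p * indicator (A k) y * c) = \<bar>g y\<bar> powr p * c * (\<Sum>k<m. indicator (A k) y)"
                by (simp add: sum_distrib_left mult_ac)
              also have "\<dots> \<le> \<bar>g y\<bar> powr p * c * 1"
                unfolding ind using c by (intro mult_left_mono) (auto simp: indicator_def)
              finally show ?thesis by (simp add: c_def ennreal_leI)
            qed
            have "(\<Sum>k<m. \<integral>\<^sup>+y\<in>\<Omega>. e g h (t0 * 2 ^ k) y \<partial>M) \<le> (\<integral>\<^sup>+y. (\<Sum>k<m. e g h (t0 * 2 ^ k) y * indicator \<Omega> y) \<partial>M)"
              by (rule nn_integral_superadd_sum) simp
            also have "\<dots> \<le> E"
              unfolding E_def
            proof (rule nn_integral_mono)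
              fix y
              show "(\<Sum>k<m. e g h (t0 * 2 ^ k) y * indicator \<Omega> y) \<le> ennreal (\<bar>g y\<bar> powr p * (w_Phi \<Omega> \<Phi> (\<gamma> * p) y * v y)) * indicator \<Omega> y"
                using pt[of y] by (cases "y \<in> \<Omega>") simp_all
            qed
            finally show "(\<Sum>k<m. \<integral>\<^sup>+y\<in>\<Omega>. e g h (t0 * 2 ^ k) y \<partial>M) \<le> ennreal Et" by (simp add: E)
          qed
        qed
        then show "(INF c. weighted_Lnorm M \<Omega> (\<lambda>x. w_phi \<Omega> \<phi> x * w x) q (\<lambda>x. f x - c))
          \<le> ennreal (K powr (1 / q)) * weighted_Lnorm M \<Omega> (\<lambda>y. w_Phi \<Omega> \<Phi> (\<gamma> * p) y * v y) p g"
          by (simp add: E_def weighted_Lnorm_def)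
      qed
    qed
  qed
qed

end

theorem theorem4:
  fixes M :: "'a::metric_space measure"
    and \<Omega> :: "'a set"
    and s \<gamma> n p q \<tau> r lam C lam' C' :: real
    and \<phi> \<Phi> :: "real \<Rightarrow> real"
    and w v :: "'a \<Rightarrow> real"
  assumes "0 < s" "s \<le> 1" "0 \<le> \<gamma>" "\<gamma> \<le> s"
    and "doubling_measure M" "doubling_dimension M n"
    and "1 \<le> p" "p \<le> q" "(s - \<gamma>) * p < n" "q \<le> n * p / (n - (s - \<gamma>) * p)"
    and "bounded_john_domain \<Omega>"
    and "frontier \<Omega> \<noteq> {}"
    and "\<exists>c>0. \<forall>x\<in>\<Omega>. ball x (c * bdist \<Omega> x) \<subseteq> \<Omega>"
    and "\<forall>t>0. 0 < \<phi> t" "mono_on {0<..} \<phi>" "\<exists>D. \<forall>t>0. \<phi> (2 * t) \<le> D * \<phi> t"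
    and "locally_integrable M \<Omega> (w_phi \<Omega> \<phi>)"
    and "\<forall>t>0. \<Phi> t = \<phi> t powr (p / q)"
    and "doubling_weight M w" "muckenhoupt_infinity M w"
    and "weight M v"
    and "0 < \<tau>" "\<tau> < 1"
    and "1 < r" "weight_pair_class M \<Omega> (s - \<gamma>) r q p w v"
    and "1 \<le> lam" "0 < C" "1 \<le> lam'" "0 < C'"
  shows "(\<exists>K>0. \<forall>f g. sobolev_space M s p \<tau> \<Omega> f g \<and>
              (s = 1 \<longrightarrow> is_gradient M \<Omega> lam C lam' C' f g) \<longrightarrow>
            (INF c::real. weighted_Lnorm M \<Omega> (\<lambda>x. w_phi \<Omega> \<phi> x * w x) q (\<lambda>x. f x - c))
              \<le> ennreal K * sobolev_seminorm M s p \<tau> \<Omega> (\<lambda>y. w_Phi \<Omega> \<Phi> (\<gamma> * p) y * v y) f g)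
       \<and> (s < 1 \<longrightarrow>
          (\<exists>K>0. \<forall>f g. sobolev_space M s p \<tau> \<Omega> f g \<longrightarrow>
            (INF c::real. weighted_Lnorm M \<Omega> (\<lambda>x. w_phi \<Omega> \<phi> x * w x) q (\<lambda>x. f x - c))
              \<le> ennreal K * frac_seminorm M s p \<tau> \<Omega> (\<lambda>x y. v_Phi \<Omega> \<Phi> (\<gamma> * p) x y * v y) f))"
proof -
  have sM: "sets M = sets borel" using assms(5) by (simp add: doubling_measure_def)
  obtain D where D: "ball_doubling M D" using doubling_measureD(1)[OF assms(5)] by blast
  note pos = doubling_measureD(2)[OF assms(5)]
  define W where "W = density M (\<lambda>x. ennreal (w x))"
  obtain D' where D': "ball_doubling W D'" unfolding W_def using doubling_weightD[OF assms(5,19)] by blast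
  have w: "w \<in> borel_measurable M" "\<And>x. 0 \<le> w x" using assms(19) by (auto simp: doubling_weight_def weight_def)
  have v: "v \<in> borel_measurable M" "\<And>x. 0 \<le> v x" using assms(21) by (auto simp: weight_def)
  have null: "null_sets M \<subseteq> null_sets W"
  proof -
    have "absolutely_continuous M W" unfolding W_def using w(1) by (intro absolutely_continuousI_density) simp
    then show ?thesis by (simp add: absolutely_continuous_def)
  qed
  obtain t where t: "1 \<le> t" "muckenhoupt M t w" using assms(20) by (auto simp: muckenhoupt_infinity_def)
  obtain c where c: "0 < c" and half0: "\<And>x r F. F \<in> sets borel \<Longrightarrow> F \<subseteq> ball x r \<Longrightarrow> 0 < r \<Longrightarrow> measure M (ball x r) \<le> 2 * measure M F \<Longrightarrow>
       c * measure (density M (\<lambda>x. ennreal (w x))) (ball x r) \<le> measure (density M (\<lambda>x. ennreal (w x))) F"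
    by (rule muckenhoupt_half[OF assms(5,19) t(2,1)]) (rule that)
  note half = half0[folded W_def]
  obtain x0 CJ where x0: "x0 \<in> \<Omega>" and CJ: "1 \<le> CJ" and cur:
    "\<And>y. y \<in> \<Omega> \<Longrightarrow> \<exists>\<kappa>. \<kappa> 0 = y \<and> \<kappa> (CJ * bdist \<Omega> x0) = x0 \<and>
          (\<forall>t. 0 \<le> t \<and> t \<le> CJ * bdist \<Omega> x0 \<longrightarrow> \<kappa> t \<in> \<Omega> \<and> t / CJ \<le> bdist \<Omega> (\<kappa> t)) \<and>
          (\<forall>s t. 0 \<le> s \<and> s \<le> t \<and> t \<le> CJ * bdist \<Omega> x0 \<longrightarrow> dist (\<kappa> s) (\<kappa> t) \<le> t - s)"
    by (rule john_curve_exists[OF assms(11)]) (rule that)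
  obtain c0 where c0: "0 < c0" "\<And>x. x \<in> \<Omega> \<Longrightarrow> ball x (c0 * bdist \<Omega> x) \<subseteq> \<Omega>" using assms(13) by blast
  obtain D\<phi> where D\<phi>: "\<And>t. 0 < t \<Longrightarrow> \<phi> (2 * t) \<le> D\<phi> * \<phi> t" using assms(16) by blast
  define k where "k = min (min c0 (1/2)) (\<tau> / 4)"
  have k: "0 < k" "k \<le> c0" "k \<le> 1/2" "k \<le> \<tau> / 4" using c0(1) assms(22) by (auto simp: k_def)
  \<comment> \<open>\<open>k\<close> meets all bounds on the Whitney parameter, including
    \<open>\<tau> / 4\<close> for the fractional kernel; division by \<open>lam'\<close> keeps the
    dilated balls of the Poincare inequality admissible as well.\<close>
  define a where "a = k / lam'"
  have l: "1 \<le> lam'" by (rule assms(28))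
  have "0 < a" "a \<le> k" using l k(1) by (simp_all add: a_def field_simps)
  then have a_le: "0 < a" "a \<le> c0" "a \<le> 1/2" "a \<le> \<tau> / 4" using k by linarith+
  have la: "lam' * a \<le> c0" "lam' * a \<le> 1/2" using k l by (auto simp: a_def)
  \<comment> \<open>Large enough for the chains and for the energies on balls dilated by
    \<open>lam'\<close>.\<close>
  define \<Lambda> where "\<Lambda> = max (2 * CJ / a) lam'"
  have \<Lambda>_ge: "2 * CJ / a \<le> \<Lambda>" "lam' \<le> \<Lambda>" "1 \<le> \<Lambda>" using l by (auto simp: \<Lambda>_def)
  interpret john_chain M W \<Omega> x0 D D' c CJ c0 D\<phi> \<phi> a \<Lambda>
  proof unfold_locales
    show "open \<Omega>" "bounded \<Omega>" using assms(11) by (auto simp: bounded_john_domain_def)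
  qed (fact D pos D' null c half assms(12) x0 CJ cur c0 assms(14)[rule_format] assms(15) D\<phi> a_le(1-3) \<Lambda>_ge(1))+
  have W_eq: "W = density M (\<lambda>x. ennreal (w x))" by (rule W_def)
  have \<Phi>: "\<And>t. 0 < t \<Longrightarrow> \<Phi> t = \<phi> t powr (p / q)" using assms(18) by blast
  have fm: "f \<in> borel_measurable (restrict_space M \<Omega>)" if "sobolev_space M s p \<tau> \<Omega> f g" for f g
    using that by (simp add: sobolev_space_def)
  have frac: "\<exists>K>0. \<forall>f. f \<in> borel_measurable (restrict_space M \<Omega>) \<longrightarrow>
      (INF c. weighted_Lnorm M \<Omega> (\<lambda>x. w_phi \<Omega> \<phi> x * w x) q (\<lambda>x. f x - c))
        \<le> ennreal K * frac_seminorm M s p \<tau> \<Omega> (\<lambda>x y. v_Phi \<Omega> \<Phi> (\<gamma> * p) x y * v y) f"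
  proof (rule fractional_estimate[OF W_eq w v assms(7,8,24,25,3,1) a_le(4) \<Lambda>_ge(3) \<Phi>])
    fix K :: real assume "0 < K" and K: "\<And>f. f \<in> borel_measurable (restrict_space M \<Omega>) \<Longrightarrow>
      (INF c. weighted_Lnorm M \<Omega> (\<lambda>x. w_phi \<Omega> \<phi> x * w x) q (\<lambda>x. f x - c))
        \<le> ennreal K * frac_seminorm M s p \<tau> \<Omega> (\<lambda>x y. v_Phi \<Omega> \<Phi> (\<gamma> * p) x y * v y) f"
    show ?thesis by (intro exI[of _ K] conjI allI impI K) fact
  qed assumption
  \<comment> \<open>The minimum in \<open>v_Phi\<close> is at most the value at \<open>y\<close>, so
    for \<open>s < 1\<close> one estimate gives both assertions.\<close>
  have vw: "frac_seminorm M s p \<tau> \<Omega> (\<lambda>x y. v_Phi \<Omega> \<Phi> (\<gamma> * p) x y * v y) f \<le> frac_seminorm M s p \<tau> \<Omega> (\<lambda>x y. w_Phi \<Omega> \<Phi> (\<gamma> * p) y * v y) f" for f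
    unfolding frac_seminorm_def
  proof (intro ennreal_powr_mono nn_integral_mono mult_right_mono ennreal_leI mult_left_mono)
    show "v_Phi \<Omega> \<Phi> (\<gamma> * p) x y \<le> w_Phi \<Omega> \<Phi> (\<gamma> * p) y" for x y by (simp add: v_Phi_def)
    show "0 \<le> v y" for y by (rule v(2))
  qed (use assms(7) in auto)
  have grad: "\<exists>K>0. \<forall>f g. sobolev_space M s p \<tau> \<Omega> f g \<and> is_gradient M \<Omega> lam C lam' C' f g \<longrightarrow>
      (INF c. weighted_Lnorm M \<Omega> (\<lambda>x. w_phi \<Omega> \<phi> x * w x) q (\<lambda>x. f x - c))
        \<le> ennreal K * weighted_Lnorm M \<Omega> (\<lambda>y. w_Phi \<Omega> \<Phi> (\<gamma> * p) y * v y) p g" if s1: "s = 1"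
  proof (rule gradient_estimate[OF W_eq w v assms(7,8,24) assms(25)[unfolded s1] assms(3) l la \<Lambda>_ge(2) assms(29) \<Phi>])
    fix K :: real assume "0 < K" and K: "\<And>f g. f \<in> borel_measurable (restrict_space M \<Omega>) \<Longrightarrow> g \<in> borel_measurable M \<Longrightarrow> (\<And>x. 0 \<le> g x) \<Longrightarrow>
      truncation_property M \<Omega> lam' C' f g \<Longrightarrow>
      (INF c. weighted_Lnorm M \<Omega> (\<lambda>x. w_phi \<Omega> \<phi> x * w x) q (\<lambda>x. f x - c))
        \<le> ennreal K * weighted_Lnorm M \<Omega> (\<lambda>y. w_Phi \<Omega> \<Phi> (\<gamma> * p) y * v y) p g"
    show ?thesis
    proof (intro exI[of _ K] conjI allI impI)
      fix f g assume fg: "sobolev_space M s p \<tau> \<Omega> f g \<and> is_gradient M \<Omega> lam C lam' C' f g"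
      then have g: "g \<in> borel_measurable M" "\<And>x. 0 \<le> g x" "truncation_property M \<Omega> lam' C' f g"
        by (auto simp: is_gradient_def)
      show "(INF c. weighted_Lnorm M \<Omega> (\<lambda>x. w_phi \<Omega> \<phi> x * w x) q (\<lambda>x. f x - c))
        \<le> ennreal K * weighted_Lnorm M \<Omega> (\<lambda>y. w_Phi \<Omega> \<Phi> (\<gamma> * p) y * v y) p g"
        by (rule K[OF fm[OF conjunct1[OF fg]] g])
    qed fact
  qed assumption
  obtain K where K: "0 < K" "\<forall>f. f \<in> borel_measurable (restrict_space M \<Omega>) \<longrightarrow>
      (INF c. weighted_Lnorm M \<Omega> (\<lambda>x. w_phi \<Omega> \<phi> x * w x) q (\<lambda>x. f x - c))
        \<le> ennreal K * frac_seminorm M s p \<tau> \<Omega> (\<lambda>x y. v_Phi \<Omega> \<Phi> (\<gamma> * p) x y * v y) f"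
    using frac by (elim exE conjE) (rule that)
  show ?thesis
  proof (cases "s = 1")
    case True
    then show ?thesis using grad[OF True] by (simp add: sobolev_seminorm_def)
  next
    case False
    show ?thesis
    proof (intro conjI impI exI[of _ K] allI K(1))
      fix f g assume "sobolev_space M s p \<tau> \<Omega> f g \<and> (s = 1 \<longrightarrow> is_gradient M \<Omega> lam C lam' C' f g)"
      then have "(INF c. weighted_Lnorm M \<Omega> (\<lambda>x. w_phi \<Omega> \<phi> x * w x) q (\<lambda>x. f x - c))
        \<le> ennreal K * frac_seminorm M s p \<tau> \<Omega> (\<lambda>x y. v_Phi \<Omega> \<Phi> (\<gamma> * p) x y * v y) f"
        by (intro K(2)[rule_format] fm[of f g]) blast
      also have "\<dots> \<le> ennreal K * frac_seminorm M s p \<tau> \<Omega> (\<lambda>x y. w_Phi \<Omega> \<Phi> (\<gamma> * p) y * v y) f"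
        by (intro mult_left_mono vw) simp
      finally show "(INF c. weighted_Lnorm M \<Omega> (\<lambda>x. w_phi \<Omega> \<phi> x * w x) q (\<lambda>x. f x - c))
        \<le> ennreal K * sobolev_seminorm M s p \<tau> \<Omega> (\<lambda>y. w_Phi \<Omega> \<Phi> (\<gamma> * p) y * v y) f g"
        using False by (simp add: sobolev_seminorm_def)
    next
      fix f g assume "sobolev_space M s p \<tau> \<Omega> f g"
      then show "(INF c. weighted_Lnorm M \<Omega> (\<lambda>x. w_phi \<Omega> \<phi> x * w x) q (\<lambda>x. f x - c))
        \<le> ennreal K * frac_seminorm M s p \<tau> \<Omega> (\<lambda>x y. v_Phi \<Omega> \<Phi> (\<gamma> * p) x y * v y) f"
        by (intro K(2)[rule_format] fm)
    qed
  qed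
qed

end
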